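(* Let $\mathcal O_K$ be a Dedekind domain of characteristic zero with finite residue fields, $\mathfrak p$ a nonzero prime ideal of $\mathcal O_K$ whose residue field $k_{\mathfrak p}$ has odd characteristic, $\mathcal O_{\mathfrak p}$ the completion of $\mathcal O_K$ at $\mathfrak p$ and $K_{\mathfrak p}$ its fraction field. Let $\psi$ be a non-trivial additive character of $K_{\mathfrak p}$ with conductor $\mathfrak p^{c_\psi}$, $c_\psi\in\mathbb Z$. Let $F_{\mathfrak p}=\mathrm{Frac}\,\mathcal O_{\mathfrak p}[[t]]$ and let $\omega\in\Omega^{\mathrm{cts}}_{F_{\mathfrak p}/K_{\mathfrak p}}$ be a nonzero continuous relative differential. Assume that for each irreducible distinguished polynomial $P$, $\omega$ has the expansion $$\sum_{i=0}^\infty c_{i,P}\,t_P^{\mathrm{ord}_{y_P}\omega+i}\,dt_P$$ at $y_P$, and that $\omega=c_{\mathfrak p}(t)\,dt$ at $y_{\mathfrak p}$, where $c_{\mathfrak p}\in K_{\mathfrak p}\{\{t\}\}$; write $\mathrm{ord}_{y_{\mathfrak p}}\omega:=\mathrm{ord}_{y_{\mathfrak p}}c_{\mathfrak p}$. Define $$\gamma_P(\omega)=\begin{cases}1&\text{if }\mathrm{ord}_{y_P}\omega\text{ is even},\\ \gamma\big(\psi_P(\tfrac12c_{0,P}a^2)\big)&\text{otherwise,}\end{cases}\qquad \gamma_{\mathfrak p}(\omega)=\begin{cases}1&\text{if }\mathrm{ord}_{y_{\mathfrak p}}\omega-c_\psi\text{ is even},\\ \gamma\big(\psi_{\mathfrak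 p}(\tfrac12\bar c_{\mathfrak p}a^2)\big)&\text{otherwise,}\end{cases}$$ where the Weil indices $\gamma$ are those of the quadratic characters $a\mapsto\psi_P(\tfrac12c_{0,P}a^2)$ of $K_P$ and $a\mapsto\psi_{\mathfrak p}(\tfrac12\bar c_{\mathfrak p}a^2)$ of $k_{\mathfrak p}((t))$. Then $\gamma_P(\omega)=1$ for almost all $P$ (all but finitely many), and $$\gamma_{\mathfrak p}(\omega)\prod_P\gamma_P(\omega)=1,$$ where the product is taken over all irreducible distinguished polynomials $P$ in $\mathcal O_{\mathfrak p}[t]$.
   Context: A distinguished polynomial is one of the form $P(t)=t^l+a_1t^{l-1}+\cdots+a_l$ with $l\ge1$ and all $a_i$ in the maximal ideal of $\mathcal O_{\mathfrak p}$ (also denoted $\mathfrak p$). The height one primes of $\mathcal O_{\mathfrak p}[[t]]$ are $y_{\mathfrak p}$, generated by $\mathfrak p$, and $y_P$, generated by an irreducible distinguished polynomial $P$. $\Omega^{\mathrm{cts}}_{F_{\mathfrak p}/K_{\mathfrak p}}=F_{\mathfrak p}\,dt$. The completion of $F_{\mathfrak p}$ at $y_P$ is $K_P((t_P))$, where $K_P=K_{\mathfrak p}[t]/(P(t))$ is a finite extension of $K_{\mathfrak p}$ (embedded as the unique coefficient field containing $K_{\mathfrak p}$) and $t_P$ is the local parameter of $y_P$ given by $P(t)$; $\mathrm{ord}_{y_P}\omega$ is the order in $t_P$, so $c_{0,P}\ne0$, $c_{i,P}\in K_P$. The completion of $F_{\mathfrak p}$ at $y_{\mathfrak p}$ is $$K_{\mathfrak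 p}\{\{t\}\}=\Big\{\sum_{i\in\mathbb Z}a_it^i\ \Big|\ a_i\in K_{\mathfrak p}\text{ bounded},\ \lim_{i\to\infty}a_{-i}=0\Big\},$$ with discrete valuation $\mathrm{ord}_{y_{\mathfrak p}}(\sum a_it^i)=\min_i\mathrm{ord}_{\mathfrak p}(a_i)$ and residue field $k_{\mathfrak p}((t))$. Fix a local parameter $\varpi_{\mathfrak p}$ of $\mathfrak p$. For $f\in K_{\mathfrak p}\{\{t\}\}^\times$, $\bar f:=\varpi_{\mathfrak p}^{-\mathrm{ord}_{y_{\mathfrak p}}f}f\bmod y_{\mathfrak p}\in k_{\mathfrak p}((t))^\times$. Characters: $\psi_P=\psi\circ\mathrm{Tr}_{K_P/K_{\mathfrak p}}$. Conductor $\mathfrak p^{c_\psi}$ means $\psi$ is trivial on $\mathfrak p^{c_\psi}$ but not on $\mathfrak p^{c_\psi-1}$. $\psi_0$ is the additive character of $k_{\mathfrak p}$ given by $\psi_0(a)=\psi(\tilde a)$, where $\tilde a\in\mathfrak p^{c_\psi-1}$ is any element with $\varpi_{\mathfrak p}^{1-c_\psi}\tilde a\equiv a\bmod\mathfrak p$. $\psi_{\mathfrak p}$ is the character of $k_{\mathfrak p}((t))$ given by $\psi_{\mathfrak p}(\sum_ia_it^i)=\psi_0(-a_{-1})$. **Weil index.** Let $\mathbb T$ be the circle group. For a locally compact Hausdorff abelian group $A$ with Pontryagin dual $A^*$ and pairing $(x,x^* )\in\mathbb T$, and a continuous $h:A\to\mathbb T$ with $h(-x)=h(x)$ and $h(x+y)h(x)^{-1}h(y)^{-1}=(x,y\rho)$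 for a topological isomorphism $\rho:A\to A^*$ (written on the right), $\gamma(h)\in\mathbb T$ is the unique number such that for all Bruhat–Schwartz $g\in\mathcal S(A^* )$, $$\int_A h(y)\,Fg(y)\,dy=\gamma(h)|\rho|^{-1/2}\int_{A^*}h(x^*\rho^{-1})^{-1}g(x^* )\,dx^*,\quad Fg(y)=\int_{A^*}g(x^* )(y,x^* )\,dx^*,$$ with dual Haar measures and $|\rho|>0$ defined by $\int_A f(x\rho)\,dx=|\rho|^{-1}\int_{A^*}f(x^* )\,dx^*$. *)

theory Defs
  imports
    "HOL-Analysis.Analysis"
    "HOL-Computational_Algebra.Computational_Algebra"
    "HOL-Algebra.Product_Groups"
begin

section \<open>Pontryagin duality\<close>

text \<open>Topological groups are pairs of a group (a record with carrier) and a topology on that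
  carrier.  The notions of this section are meant for locally compact Hausdorff abelian groups.\<close>

definition circle_group :: "complex monoid" where
  "circle_group = \<lparr>carrier = sphere 0 1, monoid.mult = (*), one = 1\<rparr>"

definition dual_group :: "'a monoid \<Rightarrow> 'a topology \<Rightarrow> ('a \<Rightarrow> complex) monoid" where
  "dual_group G T =
     \<lparr>carrier = {\<xi> \<in> extensional (carrier G).
                  \<xi> \<in> hom G circle_group \<and> continuous_map T euclidean \<xi>},
      monoid.mult = (\<lambda>\<xi> \<eta>. restrict (\<lambda>x. \<xi> x * \<eta> x) (carrier G)),
      one = restrict (\<lambda>_. 1) (carrier G)\<rparr>"

text \<open>The compact-open topology.\<close>

definition dual_topology :: "'a monoid \<Rightarrow> 'a topology \<Rightarrow> ('a \<Rightarrow> complex) topology" where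
  "dual_topology G T =
     topology_generated_by
       {{\<xi> \<in> carrier (dual_group G T). \<xi> ` C \<subseteq> U} | C U. compactin T C \<and> open U}"


section \<open>Bruhat--Schwartz functions\<close>

text \<open>The elementary groups are the finite products of copies of the real line, the integers, the
  circle and finite cyclic groups, the latter as groups of roots of unity.\<close>

datatype factor = Real_Line | Integers | Circle | Cyclic nat

fun factor_group :: "factor \<Rightarrow> complex monoid" where
  "factor_group Real_Line = \<lparr>carrier = \<real>, monoid.mult = (+), one = 0\<rparr>"
| "factor_group Integers = \<lparr>carrier = \<int>, monoid.mult = (+), one = 0\<rparr>"
| "factor_group Circle = circle_group"
| "factor_group (Cyclic d) = \<lparr>carrier = {z. z ^ Suc d = 1}, monoid.mult = (*), one = 1\<rparr>"

definition elementary_group :: "factor list \<Rightarrow> (nat \<Rightarrow> complex) monoid" where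
  "elementary_group ks = product_group {..<length ks} (\<lambda>i. factor_group (ks ! i))"

definition elementary_topology :: "factor list \<Rightarrow> (nat \<Rightarrow> complex) topology" where
  "elementary_topology ks =
     product_topology (\<lambda>i. top_of_set (carrier (factor_group (ks ! i)))) {..<length ks}"

text \<open>Translation by \<open>s\<close> along the \<open>i\<close>-th coordinate.  It is trivial on a discrete factor, so that
  the corresponding derivative vanishes.\<close>

definition shift :: "factor list \<Rightarrow> nat \<Rightarrow> real \<Rightarrow> (nat \<Rightarrow> complex) \<Rightarrow> (nat \<Rightarrow> complex)" where
  "shift ks i s x =
     (case ks ! i of
        Real_Line \<Rightarrow> x(i := x i + of_real s)
      | Circle \<Rightarrow> x(i := x i * cis s)
      | _ \<Rightarrow> x)"

definition partial_deriv ::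
  "factor list \<Rightarrow> nat \<Rightarrow> ((nat \<Rightarrow> complex) \<Rightarrow> complex) \<Rightarrow> (nat \<Rightarrow> complex) \<Rightarrow> complex" where
  "partial_deriv ks i \<phi> x = vector_derivative (\<lambda>s. \<phi> (shift ks i s x)) (at 0)"

text \<open>All iterated partial derivatives exist and stay bounded after multiplication by any monomial
  in the coordinates.  Coordinates on compact factors have absolute value 1 and do not matter here.
  Boundedness of all derivatives makes them Lipschitz, so such functions are smooth.\<close>

definition schwartz_elementary :: "factor list \<Rightarrow> ((nat \<Rightarrow> complex) \<Rightarrow> complex) \<Rightarrow> bool" where
  "schwartz_elementary ks \<phi> \<longleftrightarrow>
     (\<forall>is. set is \<subseteq> {..<length ks} \<longrightarrow>
        (\<forall>i<length ks. \<forall>x\<in>carrier (elementary_group ks).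
           (\<lambda>s. foldr (partial_deriv ks) is \<phi> (shift ks i s x)) differentiable (at 0)) \<and>
        (\<forall>js. set js \<subseteq> {..<length ks} \<longrightarrow>
           bounded ((\<lambda>x. (\<Prod>j\<leftarrow>js. x j) * foldr (partial_deriv ks) is \<phi> x)
                      ` carrier (elementary_group ks))))"

text \<open>Bruhat's definition: \<open>f\<close> vanishes outside an open compactly generated subgroup \<open>H\<close>, and on \<open>H\<close>
  it is the pullback of a Schwartz function on an elementary quotient of \<open>H\<close> by a compact subgroup
  (the kernel of \<open>\<pi>\<close>).\<close>

definition bruhat_schwartz :: "'a monoid \<Rightarrow> 'a topology \<Rightarrow> ('a \<Rightarrow> complex) \<Rightarrow> bool" where
  "bruhat_schwartz G T f \<longleftrightarrow>
     (\<exists>H ks \<pi> \<phi>.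
        subgroup H G \<and> openin T H \<and>
        (\<exists>C. compactin T C \<and> C \<subseteq> H \<and> generate G C = H) \<and>
        \<pi> \<in> hom (G\<lparr>carrier := H\<rparr>) (elementary_group ks) \<and>
        \<pi> ` H = carrier (elementary_group ks) \<and>
        continuous_map (subtopology T H) (elementary_topology ks) \<pi> \<and>
        open_map (subtopology T H) (elementary_topology ks) \<pi> \<and>
        compactin T {x \<in> H. \<pi> x = one (elementary_group ks)} \<and>
        schwartz_elementary ks \<phi> \<and>
        (\<forall>x\<in>H. f x = \<phi> (\<pi> x)) \<and> (\<forall>x\<in>carrier G - H. f x = 0))"


section \<open>Dual Haar measures and the Weil index\<close>

definition haar_measure :: "'a monoid \<Rightarrow> 'a topology \<Rightarrow> 'a measure \<Rightarrow> bool" where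
  "haar_measure G T M \<longleftrightarrow>
     sets M = sets (sigma (topspace T) {U. openin T U}) \<and>
     emeasure M (topspace T) \<noteq> 0 \<and>
     (\<forall>C. compactin T C \<longrightarrow> emeasure M C < \<infinity>) \<and>
     (\<forall>A\<in>sets M. emeasure M A = (INF U\<in>{U. openin T U \<and> A \<subseteq> U}. emeasure M U)) \<and>
     (\<forall>U. openin T U \<longrightarrow> emeasure M U = (SUP C\<in>{C. compactin T C \<and> C \<subseteq> U}. emeasure M C)) \<and>
     (\<forall>x\<in>carrier G. \<forall>A\<in>sets M. emeasure M ((\<lambda>y. x \<otimes>\<^bsub>G\<^esub> y) ` A) = emeasure M A)"

text \<open>\<open>M\<close> and \<open>N\<close> are dual to each other if Fourier inversion holds without a constant.\<close>

definition dual_haar_measures ::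
  "'a monoid \<Rightarrow> 'a topology \<Rightarrow> 'a measure \<Rightarrow> ('a \<Rightarrow> complex) measure \<Rightarrow> bool" where
  "dual_haar_measures G T M N \<longleftrightarrow>
     haar_measure G T M \<and> haar_measure (dual_group G T) (dual_topology G T) N \<and>
     (\<forall>f. bruhat_schwartz G T f \<longrightarrow>
        (\<forall>x\<in>carrier G. f x = (\<integral>\<xi>. (\<integral>y. f y * cnj (\<xi> y) \<partial>M) * \<xi> x \<partial>N)))"

text \<open>Here \<open>m\<close> is the modulus \<open>|\<rho>|\<close> with respect to the chosen dual measures; the pairing of \<open>x\<close> with
  a character \<open>\<xi>\<close> is \<open>\<xi> x\<close>.\<close>

definition is_weil_index ::
  "'a monoid \<Rightarrow> 'a topology \<Rightarrow> ('a \<Rightarrow> complex) \<Rightarrow> complex \<Rightarrow> bool" where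
  "is_weil_index G T h c \<longleftrightarrow>
     continuous_map T euclidean h \<and> h ` carrier G \<subseteq> sphere 0 1 \<and>
     (\<forall>x\<in>carrier G. h (inv\<^bsub>G\<^esub> x) = h x) \<and>
     c \<in> sphere 0 1 \<and>
     (\<exists>\<rho> M N m.
        \<rho> \<in> iso G (dual_group G T) \<and> homeomorphic_map T (dual_topology G T) \<rho> \<and>
        (\<forall>x\<in>carrier G. \<forall>y\<in>carrier G. h (x \<otimes>\<^bsub>G\<^esub> y) * inverse (h x) * inverse (h y) = \<rho> y x) \<and>
        dual_haar_measures G T M N \<and>
        m > 0 \<and>
        (\<forall>f :: ('a \<Rightarrow> complex) \<Rightarrow> complex. integrable N f \<longrightarrow>
           (\<integral>x. f (\<rho> x) \<partial>M) = of_real (inverse m) * (\<integral>\<xi>. f \<xi> \<partial>N)) \<and>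
        (\<forall>g. bruhat_schwartz (dual_group G T) (dual_topology G T) g \<longrightarrow>
           (\<integral>y. h y * (\<integral>\<xi>. g \<xi> * \<xi> y \<partial>N) \<partial>M) =
           c * of_real (m powr (-1/2)) *
             (\<integral>\<xi>. inverse (h (inv_into (carrier G) \<rho> \<xi>)) * g \<xi> \<partial>N)))"

definition weil_index :: "'a monoid \<Rightarrow> 'a topology \<Rightarrow> ('a \<Rightarrow> complex) \<Rightarrow> complex" where
  "weil_index G T h = (THE c. is_weil_index G T h c)"


section \<open>Dedekind domains and completions\<close>

definition is_ideal :: "'a::comm_ring_1 set \<Rightarrow> bool" where
  "is_ideal I \<longleftrightarrow> module.subspace (*) I"

definition is_prime_ideal :: "'a::comm_ring_1 set \<Rightarrow> bool" where
  "is_prime_ideal q \<longleftrightarrow> is_ideal q \<and> q \<noteq> UNIV \<and> (\<forall>a b. a * b \<in> q \<longrightarrow> a \<in> q \<or> b \<in> q)"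

definition is_maximal_ideal :: "'a::comm_ring_1 set \<Rightarrow> bool" where
  "is_maximal_ideal q \<longleftrightarrow> is_ideal q \<and> q \<noteq> UNIV \<and> (\<forall>I. is_ideal I \<and> q \<subseteq> I \<longrightarrow> I = q \<or> I = UNIV)"

primrec ideal_power :: "'a::comm_ring_1 set \<Rightarrow> nat \<Rightarrow> 'a set" where
  "ideal_power I 0 = UNIV"
| "ideal_power I (Suc n) = module.span (*) {a * b | a b. a \<in> I \<and> b \<in> ideal_power I n}"

definition residue_classes :: "'a::comm_ring_1 set \<Rightarrow> 'a set set" where
  "residue_classes q = UNIV // {(a, b). a - b \<in> q}"

definition dedekind_domain :: "'a::idom itself \<Rightarrow> bool" where
  "dedekind_domain _ \<longleftrightarrow>
     (\<forall>I :: 'a set. is_ideal I \<longrightarrow> (\<exists>B. finite B \<and> module.span (*) B = I)) \<and>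
     (\<forall>x :: 'a fract. (\<exists>r :: 'a poly. lead_coeff r = 1 \<and> poly (map_poly to_fract r) x = 0)
        \<longrightarrow> x \<in> range to_fract) \<and>
     (\<forall>q :: 'a set. is_prime_ideal q \<and> q \<noteq> {0} \<longrightarrow> is_maximal_ideal q)"

text \<open>A valuation is given by its values on nonzero elements; its value at 0 is never used.\<close>

definition discrete_valuation :: "('k::field \<Rightarrow> int) \<Rightarrow> bool" where
  "discrete_valuation v \<longleftrightarrow>
     (\<forall>x y. x \<noteq> 0 \<and> y \<noteq> 0 \<longrightarrow> v (x * y) = v x + v y) \<and>
     (\<forall>x y. x \<noteq> 0 \<and> y \<noteq> 0 \<and> x + y \<noteq> 0 \<longrightarrow> min (v x) (v y) \<le> v (x + y)) \<and>
     (\<exists>x. x \<noteq> 0 \<and> v x = 1)"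

text \<open>The fractional ideal \<open>\<pp>\<^sup>n\<close>; in particular \<open>max_power v 0\<close> is the valuation ring.\<close>

definition max_power :: "('k::field \<Rightarrow> int) \<Rightarrow> int \<Rightarrow> 'k set" where
  "max_power v n = {x. x = 0 \<or> n \<le> v x}"

definition valuation_topology :: "('k::field \<Rightarrow> int) \<Rightarrow> 'k topology" where
  "valuation_topology v = topology_generated_by {{y. y - x \<in> max_power v n} | x n. True}"

text \<open>The completion is characterised up to unique isomorphism: \<open>\<iota>\<close> embeds the Dedekind domain as a
  dense subring of the ring of integers of the complete discretely valued field \<open>'k\<close>, and \<open>v\<close>
  restricts to the \<open>p\<close>-adic valuation.\<close>

definition is_completion_at ::
  "'o::idom set \<Rightarrow> ('o \<Rightarrow> 'k::field) \<Rightarrow> ('k \<Rightarrow> int) \<Rightarrow> bool" where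
  "is_completion_at p \<iota> v \<longleftrightarrow>
     \<iota> 1 = 1 \<and> (\<forall>a b. \<iota> (a + b) = \<iota> a + \<iota> b) \<and> (\<forall>a b. \<iota> (a * b) = \<iota> a * \<iota> b) \<and>
     discrete_valuation v \<and>
     (\<forall>a n. a \<in> ideal_power p n \<longleftrightarrow> \<iota> a \<in> max_power v (int n)) \<and>
     (\<forall>x\<in>max_power v 0. \<forall>n. \<exists>a. x - \<iota> a \<in> max_power v n) \<and>
     (\<forall>X. (\<forall>n. \<exists>N. \<forall>i\<ge>N. \<forall>j\<ge>N. X i - X j \<in> max_power v n) \<longrightarrow>
        (\<exists>L. limitin (valuation_topology v) X L sequentially))"

text \<open>\<open>res\<close> identifies \<open>'f\<close> with the residue field; only its values on the valuation ring matter.\<close>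

definition is_residue_map :: "('k::field \<Rightarrow> int) \<Rightarrow> ('k \<Rightarrow> 'f::field) \<Rightarrow> bool" where
  "is_residue_map v res \<longleftrightarrow>
     res 1 = 1 \<and>
     (\<forall>x\<in>max_power v 0. \<forall>y\<in>max_power v 0. res (x + y) = res x + res y \<and> res (x * y) = res x * res y) \<and>
     res ` max_power v 0 = UNIV \<and>
     (\<forall>x\<in>max_power v 0. res x = 0 \<longleftrightarrow> x \<in> max_power v 1)"

definition additive_group :: "'a::ab_group_add set \<Rightarrow> 'a monoid" where
  "additive_group S = \<lparr>carrier = S, monoid.mult = (+), one = 0\<rparr>"

definition additive_character :: "('k::field \<Rightarrow> int) \<Rightarrow> ('k \<Rightarrow> complex) \<Rightarrow> bool" where
  "additive_character v \<psi> \<longleftrightarrow>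
     \<psi> \<in> carrier (dual_group (additive_group UNIV) (valuation_topology v))"

definition has_conductor :: "('k::field \<Rightarrow> int) \<Rightarrow> ('k \<Rightarrow> complex) \<Rightarrow> int \<Rightarrow> bool" where
  "has_conductor v \<psi> c \<longleftrightarrow>
     (\<forall>x\<in>max_power v c. \<psi> x = 1) \<and> \<not> (\<forall>x\<in>max_power v (c - 1). \<psi> x = 1)"


section \<open>The field \<open>Frac O[[t]]\<close> and distinguished polynomials\<close>

definition integral_fps :: "('k::field \<Rightarrow> int) \<Rightarrow> 'k fps set" where
  "integral_fps v = {g. \<forall>n. fps_nth g n \<in> max_power v 0}"

text \<open>The fraction field \<open>F\<close> is realised inside the field of all Laurent series over \<open>'k\<close>.  The
  continuous relative differentials are \<open>F dt\<close>, and \<open>f dt\<close> is represented by \<open>f\<close>.\<close>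

definition frac_integral_fps :: "('k::field \<Rightarrow> int) \<Rightarrow> 'k fls set" where
  "frac_integral_fps v =
     {fps_to_fls g / fps_to_fls h | g h. g \<in> integral_fps v \<and> h \<in> integral_fps v \<and> h \<noteq> 0}"

definition integral_poly :: "('k::field \<Rightarrow> int) \<Rightarrow> 'k poly set" where
  "integral_poly v = {A. \<forall>i. coeff A i \<in> max_power v 0}"

definition distinguished :: "('k::field \<Rightarrow> int) \<Rightarrow> 'k poly \<Rightarrow> bool" where
  "distinguished v P \<longleftrightarrow>
     degree P \<ge> 1 \<and> lead_coeff P = 1 \<and>
     (\<forall>i<degree P. coeff P i \<in> max_power v 1)"

text \<open>Irreducibility is meant in the polynomial ring over the valuation ring.\<close>

definition irreducible_distinguished :: "('k::field \<Rightarrow> int) \<Rightarrow> 'k poly \<Rightarrow> bool" where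
  "irreducible_distinguished v P \<longleftrightarrow>
     distinguished v P \<and>
     (\<forall>A\<in>integral_poly v. \<forall>B\<in>integral_poly v. P = A * B \<longrightarrow>
        (\<exists>C\<in>integral_poly v. A * C = 1) \<or> (\<exists>C\<in>integral_poly v. B * C = 1))"

definition poly_to_fls :: "'k::field poly \<Rightarrow> 'k fls" where
  "poly_to_fls A = fps_to_fls (fps_of_poly A)"

text \<open>The localisation of \<open>O[[t]]\<close> at the prime generated by \<open>P\<close>.\<close>

definition localization_at :: "('k::field \<Rightarrow> int) \<Rightarrow> 'k poly \<Rightarrow> 'k fls set" where
  "localization_at v P =
     {fps_to_fls g / fps_to_fls h | g h.
        g \<in> integral_fps v \<and> h \<in> integral_fps v \<and>
        \<not> (\<exists>k\<in>integral_fps v. h = fps_of_poly P * k)}"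


section \<open>The completion at \<open>y\<^sub>P\<close>\<close>

text \<open>An element of \<open>K\<^sub>P = K[t]/(P)\<close> is represented by its remainder modulo \<open>P\<close>, and an element of
  \<open>K\<^sub>P((t\<^sub>P))\<close> by a Laurent series over \<open>K[t]\<close> with such coefficients; products are reduced modulo \<open>P\<close>
  coefficientwise.  The topology on \<open>K\<^sub>P\<close> is that of a finite-dimensional vector space over \<open>K\<close>.\<close>

definition residue_polys :: "'k::field poly \<Rightarrow> 'k poly set" where
  "residue_polys P = {q. degree q < degree P}"

definition residue_poly_topology :: "('k::field \<Rightarrow> int) \<Rightarrow> 'k poly \<Rightarrow> 'k poly topology" where
  "residue_poly_topology v P =
     pullback_topology (residue_polys P) coeff
       (product_topology (\<lambda>_. valuation_topology v) UNIV)"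

text \<open>The trace of multiplication by \<open>a\<close> on \<open>K[t]/(P)\<close>, in the basis of powers of \<open>t\<close>.\<close>

definition residue_trace :: "'k::field poly \<Rightarrow> 'k poly \<Rightarrow> 'k" where
  "residue_trace P a =
     (\<Sum>i<degree P. coeff ((a * monom 1 i) mod P) i)"

text \<open>\<open>e\<close> is the embedding of \<open>F = Frac O[[t]]\<close> into its completion \<open>K\<^sub>P((t\<^sub>P))\<close> at \<open>y\<^sub>P\<close>: a homomorphism
  of \<open>K\<close>-algebras that sends \<open>P\<close> to \<open>t\<^sub>P\<close>, is compatible with the \<open>y\<^sub>P\<close>-adic filtrations, and induces
  the identification \<open>t \<mapsto> t mod P\<close> of the residue field with \<open>K[t]/(P)\<close>.  These conditions determine
  \<open>e\<close> on \<open>F\<close>.\<close>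

definition completion_embedding ::
  "('k::field \<Rightarrow> int) \<Rightarrow> 'k poly \<Rightarrow> ('k fls \<Rightarrow> 'k poly fls) \<Rightarrow> bool" where
  "completion_embedding v P e \<longleftrightarrow>
     (\<forall>f\<in>frac_integral_fps v. \<forall>n. fls_nth (e f) n \<in> residue_polys P) \<and>
     (\<forall>f\<in>frac_integral_fps v. \<forall>g\<in>frac_integral_fps v.
        e (f + g) = e f + e g \<and> (\<forall>n. fls_nth (e (f * g)) n = fls_nth (e f * e g) n mod P)) \<and>
     (\<forall>a. e (fls_const a) = fls_const [:a:]) \<and>
     e (poly_to_fls P) = fls_X \<and>
     (\<forall>f\<in>frac_integral_fps v. \<forall>n::int.
        (\<exists>g\<in>localization_at v P. f = (poly_to_fls P) powi n * g) \<longleftrightarrow>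
        (\<forall>i<n. fls_nth (e f) i = 0)) \<and>
     fls_nth (e fls_X) 0 = [:0, 1:] mod P"

text \<open>The differential \<open>f dt\<close> equals \<open>e(f) (de(t)/dt\<^sub>P) dt\<^sub>P\<close> at \<open>y\<^sub>P\<close>.  The predicate says that this is
  \<open>\<Sum>\<^sub>i c\<^sub>i t\<^sub>P\<^bsup>n + i\<^esup> dt\<^sub>P\<close> with \<open>c\<^sub>0 \<noteq> 0\<close>, so \<open>n\<close> is its order at \<open>y\<^sub>P\<close>.\<close>

definition has_expansion_at ::
  "('k::field \<Rightarrow> int) \<Rightarrow> 'k poly \<Rightarrow> 'k fls \<Rightarrow> int \<Rightarrow> (nat \<Rightarrow> 'k poly) \<Rightarrow> bool" where
  "has_expansion_at v P f n c \<longleftrightarrow>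
     c 0 \<noteq> 0 \<and>
     (\<exists>e. completion_embedding v P e \<and>
        (\<forall>j. fls_nth (e f * fls_deriv (e fls_X)) j mod P = (if j < n then 0 else c (nat (j - n)))))"

definition gamma_P ::
  "('k::field \<Rightarrow> int) \<Rightarrow> ('k \<Rightarrow> complex) \<Rightarrow> 'k poly \<Rightarrow> int \<Rightarrow> 'k poly \<Rightarrow> complex" where
  "gamma_P v \<psi> P n c\<^sub>0 =
     (if even n then 1
      else weil_index (additive_group (residue_polys P)) (residue_poly_topology v P)
             (\<lambda>a. \<psi> (residue_trace P (smult (1/2) (c\<^sub>0 * a\<^sup>2)))))"


section \<open>The completion at \<open>y\<^sub>\<pp>\<close>\<close>

definition double_series :: "('k::field \<Rightarrow> int) \<Rightarrow> (int \<Rightarrow> 'k) set" where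
  "double_series v =
     {a. (\<exists>n. \<forall>i. a i \<in> max_power v n) \<and>
         limitin (valuation_topology v) (\<lambda>i. a (- int i)) 0 sequentially}"

definition double_series_product ::
  "('k::field \<Rightarrow> int) \<Rightarrow> (int \<Rightarrow> 'k) \<Rightarrow> (int \<Rightarrow> 'k) \<Rightarrow> (int \<Rightarrow> 'k) \<Rightarrow> bool" where
  "double_series_product v a b c \<longleftrightarrow>
     (\<forall>n. limitin (valuation_topology v) (\<lambda>m. \<Sum>i = - int m..int m. a i * b (n - i)) (c n) sequentially)"

text \<open>\<open>c\<close> is the image of \<open>f = g / h\<close> in \<open>K{{t}}\<close>, i.e. \<open>h c = g\<close> there.\<close>

definition image_in_double_series ::
  "('k::field \<Rightarrow> int) \<Rightarrow> 'k fls \<Rightarrow> (int \<Rightarrow> 'k) \<Rightarrow> bool" where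
  "image_in_double_series v f c \<longleftrightarrow>
     c \<in> double_series v \<and>
     (\<exists>g\<in>integral_fps v. \<exists>h\<in>integral_fps v. h \<noteq> 0 \<and> f = fps_to_fls g / fps_to_fls h \<and>
        double_series_product v (fls_nth (fps_to_fls h)) c (fls_nth (fps_to_fls g)))"

text \<open>The infimum is attained for nonzero elements of \<open>double_series v\<close>.\<close>

definition double_series_ord :: "('k::field \<Rightarrow> int) \<Rightarrow> (int \<Rightarrow> 'k) \<Rightarrow> int" where
  "double_series_ord v c = Inf {v (c i) | i. c i \<noteq> 0}"

definition double_series_bar ::
  "('k::field \<Rightarrow> int) \<Rightarrow> ('k \<Rightarrow> 'f::field) \<Rightarrow> 'k \<Rightarrow> (int \<Rightarrow> 'k) \<Rightarrow> 'f fls" where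
  "double_series_bar v res \<pi> c = Abs_fls (\<lambda>i. res (\<pi> powi (- double_series_ord v c) * c i))"

definition psi_0 ::
  "('k::field \<Rightarrow> int) \<Rightarrow> ('k \<Rightarrow> 'f::field) \<Rightarrow> 'k \<Rightarrow> ('k \<Rightarrow> complex) \<Rightarrow> int \<Rightarrow> 'f \<Rightarrow> complex" where
  "psi_0 v res \<pi> \<psi> c\<^sub>\<psi> a = \<psi> (SOME x. x \<in> max_power v (c\<^sub>\<psi> - 1) \<and> res (\<pi> powi (1 - c\<^sub>\<psi>) * x) = a)"

definition psi_p ::
  "('k::field \<Rightarrow> int) \<Rightarrow> ('k \<Rightarrow> 'f::field) \<Rightarrow> 'k \<Rightarrow> ('k \<Rightarrow> complex) \<Rightarrow> int \<Rightarrow> 'f fls \<Rightarrow> complex" where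
  "psi_p v res \<pi> \<psi> c\<^sub>\<psi> s = psi_0 v res \<pi> \<psi> c\<^sub>\<psi> (- fls_nth s (-1))"

text \<open>The type \<open>'f fls\<close> carries its \<open>t\<close>-adic metric.\<close>

definition gamma_p ::
  "('k::field \<Rightarrow> int) \<Rightarrow> ('k \<Rightarrow> 'f::field) \<Rightarrow> 'k \<Rightarrow> ('k \<Rightarrow> complex) \<Rightarrow> int \<Rightarrow> (int \<Rightarrow> 'k) \<Rightarrow> complex" where
  "gamma_p v res \<pi> \<psi> c\<^sub>\<psi> c =
     (if even (double_series_ord v c - c\<^sub>\<psi>) then 1
      else weil_index (additive_group (UNIV :: 'f fls set)) euclidean
             (\<lambda>a. psi_p v res \<pi> \<psi> c\<^sub>\<psi> (fls_const (1/2) * double_series_bar v res \<pi> c * a\<^sup>2)))"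

end

theory Submission
  imports Defs
begin

text \<open>All Weil indices are compared with finite Gauss sums: up to a positive factor, the Weil index of
  a quadratic character of a self-dual filtered group is the sum of the character over a large lattice
  modulo a small one, and averaging over an isotropic lattice \<open>L\<close> reduces that sum to \<open>L\<^sup>\<bottom> / L\<close>.  Since
  Weil indices have absolute value 1, positive factors may be ignored.

  Let \<open>f = g / h\<close>.  By Weierstrass preparation \<open>f h\<^sup>2 = g h = \<pi>\<^sup>m A\<^sup>2 R u\<close> with \<open>u\<close> a unit and \<open>R\<close> a squarefree
  product of irreducible distinguished polynomials, so \<open>ord\<^sub>P\<close> is odd precisely at the divisors \<open>P\<close> of
  \<open>R\<close>.  By Euler's formula the trace form of \<open>K[t]/(P)\<close> twisted by \<open>1 / P'\<close> reads off the top coefficient,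
  and the Chinese remainder theorem turns \<open>\<Prod>\<^sub>P \<gamma>\<^sub>P\<close> into a Gauss sum over lattices of \<open>K[t]/(R)\<close> for the
  form \<open>\<psi>(\<pi>\<^sup>m r x\<^sup>2 / 2)\<close> composed with the top coefficient, \<open>r\<close> being the remainder of \<open>u\<close> modulo \<open>R\<close>.  As \<open>R\<close> is
  congruent to a power of \<open>t\<close>, the lattice of integral polynomials divisible by \<open>t\<^sup>e\<close> modulo \<open>\<pi>\<close> has the
  one with exponent \<open>deg R - e\<close> as its orthogonal.  The sum thus becomes 1, or
  \<open>\<Sum>\<^sub>a \<psi>\<^sub>0 (u(0) a\<^sup>2 / 2)\<close> if \<open>deg R\<close> and \<open>c\<^sub>\<psi> - m\<close> are odd.  The sum for \<open>\<gamma>\<^sub>p\<close> reduces in the same way to 1 or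
  the complex conjugate, the sign coming from the sign in \<open>\<psi>\<^sub>p\<close>.\<close>


section \<open>Transversals\<close>

text \<open>A Weil index is characterised by an identity over all Bruhat--Schwartz functions, for
  some choice of dual Haar measures, so it can be used only once existence and uniqueness are known.
  This is proved for groups filtered by subgroups of constant finite index and applied to K[t]/(P)
  and k((t)). Analysis there is finite: such a group has arbitrarily small subgroups and elementary
  groups have none, so Bruhat--Schwartz functions are constant on cosets of a small subgroup and
  integrals become finite sums. No single \<open>gamma_P\<close> is ever evaluated. Products of
  lattices of the K[t]/(P) are not adapted to the reduction of R modulo \<pi>, while K[t]/(R) has
  lattices that are; the two kinds are commensurable, and passing between them costs a positive
  factor. Odd residue characteristic enters as integrality of 1/2, so that on the lattices used the
  half form is as integral as the form. The factor P' of Euler's formula is cancelled by dt/dt_P,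
  which is 1/P' modulo P, in the expansion of the differential; factors that are squares modulo P
  are absorbed by rescaling the variable.\<close>

definition add_subgroup :: "'a::ab_group_add set \<Rightarrow> bool" where
  "add_subgroup L \<longleftrightarrow> 0 \<in> L \<and> (\<forall>x\<in>L. \<forall>y\<in>L. x - y \<in> L)"

lemma add_subgroup_zero: "add_subgroup L \<Longrightarrow> 0 \<in> L"
  and add_subgroup_diff: "add_subgroup L \<Longrightarrow> x \<in> L \<Longrightarrow> y \<in> L \<Longrightarrow> x - y \<in> L"
  by (auto simp: add_subgroup_def)

lemma add_subgroup_minus: "add_subgroup L \<Longrightarrow> x \<in> L \<Longrightarrow> - x \<in> L"
  using add_subgroup_diff[of L 0 x] by (simp add: add_subgroup_zero)

lemma add_subgroup_add: "add_subgroup L \<Longrightarrow> x \<in> L \<Longrightarrow> y \<in> L \<Longrightarrow> x + y \<in> L"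
  using add_subgroup_diff[of L x "- y"] by (simp add: add_subgroup_minus)

lemmas add_subgroup_intros = add_subgroup_zero add_subgroup_diff add_subgroup_minus add_subgroup_add

lemma add_subgroup_diff_commute: "add_subgroup L \<Longrightarrow> x - y \<in> L \<longleftrightarrow> y - x \<in> L"
  using add_subgroup_minus[of L "x - y"] add_subgroup_minus[of L "y - x"] by auto

lemma add_subgroup_add_cancel: "add_subgroup L \<Longrightarrow> b \<in> L \<Longrightarrow> x + b \<in> L \<longleftrightarrow> x \<in> L"
  using add_subgroup_diff[of L "x + b" b] add_subgroup_add[of L x b] by auto

definition coset_stable :: "'a::ab_group_add set \<Rightarrow> 'a set \<Rightarrow> bool" where
  "coset_stable E L \<longleftrightarrow> (\<forall>x\<in>E. \<forall>b\<in>L. x + b \<in> E)"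

text \<open>Finite index is part of the notion, and \<open>E\<close> need not be a group: the same
  definition counts cosets in quotients of lattices and in arbitrary unions of cosets.\<close>

definition transversal :: "'a::ab_group_add set \<Rightarrow> 'a set \<Rightarrow> 'a set \<Rightarrow> bool" where
  "transversal R E L \<longleftrightarrow> finite R \<and> R \<subseteq> E \<and> (\<forall>x\<in>E. \<exists>!r. r \<in> R \<and> x - r \<in> L)"

lemma transversal_finite: "transversal R E L \<Longrightarrow> finite R"
  by (auto simp: transversal_def)

lemma transversal_subset: "transversal R E L \<Longrightarrow> R \<subseteq> E"
  by (auto simp: transversal_def)

lemma transversal_ex: "transversal R E L \<Longrightarrow> x \<in> E \<Longrightarrow> \<exists>r\<in>R. x - r \<in> L"
  by (fastforce simp: transversal_def)

lemma transversal_unique: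
  assumes "transversal R E L" "x \<in> E" "r \<in> R" "s \<in> R" "x - r \<in> L" "x - s \<in> L"
  shows "r = s"
  using assms unfolding transversal_def by blast

lemma transversal_eq:
  assumes "transversal R E L" "add_subgroup L" "r \<in> R" "s \<in> R" "r - s \<in> L"
  shows "r = s"
  using transversal_unique[of R E L r r s] assms
  by (auto simp: add_subgroup_zero dest: transversal_subset)

lemma transversalI:
  assumes "add_subgroup L" "finite R" "R \<subseteq> E" "\<And>x. x \<in> E \<Longrightarrow> \<exists>r\<in>R. x - r \<in> L"
    and "\<And>r s. r \<in> R \<Longrightarrow> s \<in> R \<Longrightarrow> r - s \<in> L \<Longrightarrow> r = s"
  shows "transversal R E L"
  unfolding transversal_def
proof (intro conjI ballI)
  fix x assume "x \<in> E"
  then obtain r where r: "r \<in> R" "x - r \<in> L" using assms(4) by blast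
  show "\<exists>!r. r \<in> R \<and> x - r \<in> L"
  proof (rule ex1I[of _ r])
    fix s assume s: "s \<in> R \<and> x - s \<in> L"
    have "(x - r) - (x - s) \<in> L" using r s assms(1) by (blast intro: add_subgroup_diff)
    then show "s = r" using assms(5)[of s r] r s by (simp add: algebra_simps)
  qed (use r in auto)
qed (use assms in auto)

lemma transversal_bij:
  assumes R: "transversal R E L" and R': "transversal R' E L" and L: "add_subgroup L"
  obtains \<phi> where "bij_betw \<phi> R R'" "\<And>r. r \<in> R \<Longrightarrow> \<phi> r - r \<in> L"
proof -
  define \<phi> where "\<phi> r = (SOME s. s \<in> R' \<and> r - s \<in> L)" for r
  have \<phi>: "\<phi> r \<in> R' \<and> r - \<phi> r \<in> L" if "r \<in> R" for r
    unfolding \<phi>_def by (rule someI_ex) (use that R R' transversal_ex transversal_subset in blast)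
  have "inj_on \<phi> R"
  proof (rule inj_onI)
    fix x y assume *: "x \<in> R" "y \<in> R" "\<phi> x = \<phi> y"
    have "(x - \<phi> x) - (y - \<phi> y) \<in> L" using \<phi> * L by (blast intro: add_subgroup_diff)
    then show "x = y" using transversal_eq[OF R L] * by simp
  qed
  moreover have "\<phi> ` R = R'"
  proof safe
    fix s assume s: "s \<in> R'"
    then obtain r where r: "r \<in> R" "s - r \<in> L" using R R' transversal_ex transversal_subset by blast
    have "s - \<phi> r \<in> L" using add_subgroup_add[OF L r(2) conjunct2[OF \<phi>[OF r(1)]]] by simp
    then have "s = \<phi> r" using transversal_eq[OF R' L s] \<phi>[OF r(1)] by blast
    then show "s \<in> \<phi> ` R" using r by blast
  qed (use \<phi> in blast)
  ultimately have "bij_betw \<phi> R R'" by (simp add: bij_betw_def)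
  then show ?thesis using that[of \<phi>] \<phi> L by (simp add: add_subgroup_diff_commute)
qed

lemma transversal_card:
  assumes "transversal R E L" "transversal R' E L" "add_subgroup L"
  shows "card R = card R'"
  using transversal_bij[OF assms] bij_betw_same_card by metis

text \<open>Invariance is asked for only when both points lie in \<open>E\<close>, so the lemma
  applies to functions that are periodic on a lattice but not on the whole group.\<close>

lemma transversal_sum:
  fixes f :: "'a::ab_group_add \<Rightarrow> 'b::comm_monoid_add"
  assumes R: "transversal R E L" and R': "transversal R' E L" and L: "add_subgroup L"
    and f: "\<And>x b. x \<in> E \<Longrightarrow> b \<in> L \<Longrightarrow> x + b \<in> E \<Longrightarrow> f (x + b) = f x"
  shows "sum f R = sum f R'"
proof -
  obtain \<phi> where \<phi>: "bij_betw \<phi> R R'" "\<And>r. r \<in> R \<Longrightarrow> \<phi> r - r \<in> L"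
    using transversal_bij[OF R R' L] by blast
  have "f (\<phi> r) = f r" if "r \<in> R" for r
    using f[of r "\<phi> r - r"] \<phi>(2)[OF that] that bij_betwE[OF \<phi>(1)] transversal_subset[OF R]
      transversal_subset[OF R'] by (auto simp: subset_iff)
  then show ?thesis using sum.reindex_bij_betw[OF \<phi>(1), of f] by (metis (no_types, lifting) sum.cong)
qed

lemma transversal_translate:
  assumes R: "transversal R E L" and L: "add_subgroup L" and E: "add_subgroup E" and a: "a \<in> E"
  shows "transversal ((\<lambda>r. r + a) ` R) E L"
proof (rule transversalI[OF L])
  show "\<exists>r\<in>(\<lambda>r. r + a) ` R. x - r \<in> L" if "x \<in> E" for x
    using transversal_ex[OF R, of "x - a"] add_subgroup_diff[OF E that a] by (auto simp: algebra_simps)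
  show "(\<lambda>r. r + a) ` R \<subseteq> E" using transversal_subset[OF R] add_subgroup_add[OF E _ a] by auto
qed (use transversal_finite[OF R] transversal_eq[OF R L] in auto)

lemma transversal_refine:
  assumes R: "transversal R E M" and R': "transversal R' M L"
    and M: "add_subgroup M" and L: "add_subgroup L" and LM: "L \<subseteq> M" and E: "coset_stable E M"
  shows "transversal ((\<lambda>(r, s). r + s) ` (R \<times> R')) E L"
    and "card ((\<lambda>(r, s). r + s) ` (R \<times> R')) = card R * card R'"
    and "inj_on (\<lambda>(r, s). r + s) (R \<times> R')"
proof -
  have inj: "r = r' \<and> s = s'"
    if "r \<in> R" "r' \<in> R" "s \<in> R'" "s' \<in> R'" "(r + s) - (r' + s') \<in> L" for r r' s s'
  proof -
    have s: "s \<in> M" "s' \<in> M" using that transversal_subset[OF R'] by auto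
    have "((r + s) - (r' + s')) + (s' - s) \<in> M"
      using that LM s M by (blast intro: add_subgroup_add add_subgroup_diff)
    then have "r - r' \<in> M" by (simp add: algebra_simps)
    then have "r = r'" using transversal_eq[OF R M] that by blast
    then show ?thesis using transversal_eq[OF R' L, of s s'] that by simp
  qed
  show "transversal ((\<lambda>(r, s). r + s) ` (R \<times> R')) E L"
  proof (rule transversalI[OF L])
    fix x assume "x \<in> E"
    then obtain r where r: "r \<in> R" "x - r \<in> M" using transversal_ex[OF R] by blast
    then obtain s where s: "s \<in> R'" "x - r - s \<in> L" using transversal_ex[OF R'] by blast
    show "\<exists>t\<in>(\<lambda>(r, s). r + s) ` (R \<times> R'). x - t \<in> L"
      by (rule bexI[of _ "r + s"]) (use r s in \<open>auto simp: algebra_simps\<close>)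
  next
    show "(\<lambda>(r, s). r + s) ` (R \<times> R') \<subseteq> E"
      using transversal_subset[OF R] transversal_subset[OF R'] E by (auto simp: coset_stable_def)
  qed (use transversal_finite[OF R] transversal_finite[OF R'] inj in auto)
  show inj_on: "inj_on (\<lambda>(r, s). r + s) (R \<times> R')"
    by (rule inj_onI) (use inj add_subgroup_zero[OF L] in auto)
  show "card ((\<lambda>(r, s). r + s) ` (R \<times> R')) = card R * card R'"
    using card_image[OF inj_on] by (simp add: card_cartesian_product)
qed

text \<open>Averaging over translations by \<open>L\<^sub>0\<close> kills every coset outside \<open>D\<close>.\<close>

lemma gauss_sum_reduce:
  fixes h :: "'a::ab_group_add \<Rightarrow> complex"
  assumes groups: "add_subgroup L" "add_subgroup L0" "add_subgroup D" "add_subgroup \<Lambda>"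
    and incl: "L \<subseteq> L0" "L0 \<subseteq> D" "D \<subseteq> \<Lambda>"
    and R: "transversal R \<Lambda> L" and R0: "transversal R0 D L0"
    and D: "\<And>x. x \<in> \<Lambda> \<Longrightarrow> x \<in> D \<longleftrightarrow> (\<forall>y\<in>L0. \<beta> y x = 1)"
    and h: "\<And>x y. x \<in> \<Lambda> \<Longrightarrow> y \<in> \<Lambda> \<Longrightarrow> h (x + y) = h x * h y * \<beta> x y"
    and h1: "\<And>x. x \<in> L0 \<Longrightarrow> h x = 1"
    and sym: "\<And>x y. x \<in> \<Lambda> \<Longrightarrow> y \<in> \<Lambda> \<Longrightarrow> \<beta> x y = \<beta> y x"
    and \<beta>: "\<And>x y z. x \<in> \<Lambda> \<Longrightarrow> y \<in> \<Lambda> \<Longrightarrow> z \<in> \<Lambda> \<Longrightarrow> \<beta> (x + y) z = \<beta> x z * \<beta> y z"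
    and per: "\<And>x b. x \<in> \<Lambda> \<Longrightarrow> b \<in> L \<Longrightarrow> h (x + b) = h x"
  shows "\<exists>\<kappa>::real. \<kappa> > 0 \<and> sum h R = of_real \<kappa> * sum h R0"
proof -
  define R1 where "R1 = R \<inter> D"
  have L0\<Lambda>: "L0 \<subseteq> \<Lambda>" and LD: "L \<subseteq> D" and L\<Lambda>: "L \<subseteq> \<Lambda>" using incl by auto
  \<comment> \<open>The representatives in \<open>R\<close> need not lie in \<open>L0\<close>; each
    \<open>r\<close> whose coset meets \<open>L0\<close> is replaced by a point of that
    intersection.\<close>
  obtain R2 where R2: "transversal R2 L0 L"
  proof
    show "transversal ((\<lambda>r. SOME x. x \<in> L0 \<and> x - r \<in> L) ` {r \<in> R. \<exists>x\<in>L0. x - r \<in> L}) L0 L"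
      (is "transversal (?\<phi> ` ?A) L0 L")
    proof (rule transversalI[OF groups(1)])
      have \<phi>: "?\<phi> r \<in> L0 \<and> ?\<phi> r - r \<in> L" if "r \<in> ?A" for r
        by (rule someI_ex) (use that in auto)
      show "?\<phi> ` ?A \<subseteq> L0" using \<phi> by auto
      show "\<exists>s\<in>?\<phi> ` ?A. x - s \<in> L" if x: "x \<in> L0" for x
      proof -
        obtain r where r: "r \<in> R" "x - r \<in> L" using transversal_ex[OF R, of x] x L0\<Lambda> by blast
        then have "r \<in> ?A" using x by blast
        moreover from \<phi>[OF this] have "(x - r) - (?\<phi> r - r) \<in> L"
          using r groups(1) by (blast intro: add_subgroup_diff)
        ultimately show ?thesis by auto
      qed
      fix s s' assume s: "s \<in> ?\<phi> ` ?A" "s' \<in> ?\<phi> ` ?A" and ss: "s - s' \<in> L"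
      obtain r r' where r: "r \<in> ?A" "r' \<in> ?A" "s = ?\<phi> r" "s' = ?\<phi> r'" using s by blast
      have "(s - s') + (s' - r') - (s - r) \<in> L"
        using \<phi>[OF r(1)] \<phi>[OF r(2)] ss groups(1) unfolding r(3)[symmetric] r(4)[symmetric]
        by (blast intro: add_subgroup_diff add_subgroup_add)
      then have "r - r' \<in> L" by (simp add: algebra_simps)
      then have "r = r'" using transversal_eq[OF R groups(1), of r r'] r by simp
      then show "s = s'" using r by simp
    qed (use transversal_finite[OF R] in auto)
  qed
  have fin: "finite R2" "finite R" "finite R0" "R2 \<subseteq> L0"
    using R R2 R0 transversal_finite transversal_subset[OF R2] by auto
  have card2: "card R2 > 0"
    using transversal_ex[OF R2 add_subgroup_zero[OF groups(2)]] fin card_gt_0_iff by blast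
  \<comment> \<open>Orthogonality of characters on \<open>L0 / L\<close>. The case
    \<open>h x = 0\<close> is split off because triviality of \<beta> on \<open>L\<close> is
    obtained by cancelling \<open>h x\<close>.\<close>
  have perp: "(\<Sum>b\<in>R2. \<beta> x b) * h x = (if x \<in> D then of_nat (card R2) * h x else 0)" if x: "x \<in> \<Lambda>" for x
  proof (cases "x \<in> D \<or> h x = 0")
    case True
    then show ?thesis using D[OF x] fin(4) sym[OF x] L0\<Lambda> by (auto simp: subset_iff)
  next
    case False
    then obtain y where y: "y \<in> L0" "\<beta> y x \<noteq> 1" and hx: "h x \<noteq> 0" using D[OF x] by blast
    have \<beta>L: "\<beta> b x = 1" if "b \<in> L" for b
      using h[OF x, of b] per[OF x that] h1[of b] hx sym[of x b] x
        subsetD[OF L\<Lambda> that] subsetD[OF incl(1) that] by simp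
    have "(\<Sum>b\<in>R2. \<beta> b x) = (\<Sum>b\<in>(\<lambda>r. r + y) ` R2. \<beta> b x)"
      by (rule transversal_sum[OF R2 transversal_translate[OF R2 groups(1,2) y(1)] groups(1)])
         (use \<beta> x \<beta>L L0\<Lambda> L\<Lambda> in \<open>simp add: subset_iff\<close>)
    also have "\<dots> = (\<Sum>b\<in>R2. \<beta> (b + y) x)" by (subst sum.reindex) (auto simp: inj_on_def)
    also have "\<dots> = (\<Sum>b\<in>R2. \<beta> b x) * \<beta> y x"
    proof -
      have "\<beta> (b + y) x = \<beta> b x * \<beta> y x" if "b \<in> R2" for b
        using \<beta>[of b y x] x subsetD[OF fin(4) that] y(1) L0\<Lambda> by blast
      then show ?thesis by (simp add: sum_distrib_right)
    qed
    finally have "(\<Sum>b\<in>R2. \<beta> b x) = 0" using y by simp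
    moreover have "(\<Sum>b\<in>R2. \<beta> b x) = (\<Sum>b\<in>R2. \<beta> x b)"
      by (rule sum.cong) (use sym x fin(4) L0\<Lambda> in auto)
    ultimately show ?thesis using False by simp
  qed
  \<comment> \<open>Translation by \<open>b\<close> in \<open>L0\<close> permutes the cosets of
    \<open>L\<close> and, since \<open>h b = 1\<close>, multiplies \<open>h x\<close> by
    \<open>\<beta> x b\<close>.\<close>
  have "of_nat (card R2) * sum h R = (\<Sum>b\<in>R2. \<Sum>x\<in>R. h (x + b))"
  proof -
    have "(\<Sum>x\<in>R. h (x + b)) = sum h R" if "b \<in> R2" for b
    proof -
      have b: "b \<in> \<Lambda>" using that fin L0\<Lambda> by auto
      have "sum h R = sum h ((\<lambda>r. r + b) ` R)"
        by (rule transversal_sum[OF R transversal_translate[OF R groups(1,4) b] groups(1)])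
           (use per in auto)
      also have "\<dots> = (\<Sum>x\<in>R. h (x + b))" by (subst sum.reindex) (auto simp: inj_on_def)
      finally show ?thesis by simp
    qed
    then show ?thesis by simp
  qed
  also have "\<dots> = (\<Sum>x\<in>R. \<Sum>b\<in>R2. h (x + b))" by (rule sum.swap)
  also have "\<dots> = (\<Sum>x\<in>R. (\<Sum>b\<in>R2. \<beta> x b) * h x)"
    unfolding sum_distrib_right
    by (intro sum.cong refl) (use h h1 fin(4) transversal_subset[OF R] L0\<Lambda> in \<open>auto simp: subset_iff\<close>)
  also have "\<dots> = (\<Sum>x\<in>R. if x \<in> D then of_nat (card R2) * h x else 0)"
    by (intro sum.cong refl perp) (use transversal_subset[OF R] in auto)
  also have "\<dots> = of_nat (card R2) * sum h R1"
    unfolding R1_def using fin by (simp add: sum.If_cases sum_distrib_left Int_def)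
  finally have 1: "sum h R = sum h R1" using card2 by simp
  have R1: "transversal R1 D L"
  proof (rule transversalI[OF groups(1)])
    fix x assume x: "x \<in> D"
    then obtain r where r: "r \<in> R" "x - r \<in> L" using transversal_ex[OF R, of x] incl by blast
    have "x - (x - r) \<in> D" using x r LD groups(3) by (blast intro: add_subgroup_diff)
    then show "\<exists>r\<in>R1. x - r \<in> L" using r by (auto simp: R1_def)
  qed (use fin transversal_eq[OF R groups(1)] in \<open>auto simp: R1_def\<close>)
  have stab: "coset_stable D L0"
    using groups incl by (auto simp: coset_stable_def intro: add_subgroup_add)
  \<comment> \<open>On \<open>D\<close> the function \<open>h\<close> is constant on cosets of
    \<open>L0\<close>, and each of these contains \<open>card R2\<close> cosets of \<open>L\<close>;
    this number is the positive factor.\<close>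
  note ref = transversal_refine[OF R0 R2 groups(2,1) incl(1) stab]
  have "sum h R1 = sum h ((\<lambda>(r, s). r + s) ` (R0 \<times> R2))"
    by (rule transversal_sum[OF R1 ref(1) groups(1)]) (use per incl in auto)
  also have "\<dots> = (\<Sum>(r, s)\<in>R0 \<times> R2. h (r + s))"
    by (subst sum.reindex[OF ref(3)]) (simp add: case_prod_unfold)
  also have "\<dots> = (\<Sum>r\<in>R0. \<Sum>s\<in>R2. h (r + s))" by (rule sum.cartesian_product[symmetric])
  also have "\<dots> = (\<Sum>r\<in>R0. of_nat (card R2) * h r)"
  proof (rule sum.cong[OF refl])
    fix r assume r: "r \<in> R0"
    then have rD: "r \<in> D" "r \<in> \<Lambda>" using transversal_subset[OF R0] incl by auto
    have "h (r + s) = h r" if "s \<in> R2" for s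
      using h[of r s] h1[of s] rD D[of r] sym[of r s] subsetD[OF fin(4) that] L0\<Lambda>
      by (auto simp: subset_iff)
    then show "(\<Sum>s\<in>R2. h (r + s)) = of_nat (card R2) * h r" by simp
  qed
  also have "\<dots> = of_nat (card R2) * sum h R0" by (simp add: sum_distrib_left)
  finally have "sum h R = of_real (real (card R2)) * sum h R0" using 1 by simp
  then show ?thesis using card2 by (intro exI[of _ "real (card R2)"]) simp
qed

section \<open>Filtered groups and their Haar measures\<close>

lemma carrier_additive_group [simp]: "carrier (additive_group S) = S"
  and mult_additive_group [simp]: "x \<otimes>\<^bsub>additive_group S\<^esub> y = x + y"
  and one_additive_group [simp]: "\<one>\<^bsub>additive_group S\<^esub> = 0"
  by (simp_all add: additive_group_def)

lemma comm_group_additive_group: "add_subgroup S \<Longrightarrow> comm_group (additive_group S)"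
  by (rule comm_groupI)
     (auto simp: add_subgroup_intros algebra_simps intro: bexI[of _ "- x" for x])

lemma inv_additive_group [simp]:
  assumes "add_subgroup S" "x \<in> S"
  shows "inv\<^bsub>additive_group S\<^esub> x = - x"
proof -
  interpret comm_group "additive_group S" by (rule comm_group_additive_group[OF assms(1)])
  show ?thesis by (rule inv_equality) (use assms in \<open>auto simp: add_subgroup_minus\<close>)
qed

text \<open>The common frame for K[t]/(P), filtered by multiples of an integral lattice, and k((t)),
  filtered by powers of t. The constant index \<open>Q\<close> makes \<open>Q\<close> to the power
  \<open>- n\<close> a volume for \<open>B n\<close>. Completeness is asked for sequences of
  prescribed speed, the form in which the compactness argument and the surjectivity of the duality
  map use it.\<close>

locale filtered_group =
  fixes S :: "'a::ab_group_add set" and T :: "'a topology" and B :: "int \<Rightarrow> 'a set" and Q :: nat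
  assumes B_group: "add_subgroup (B n)"
    and B_antimono: "m \<le> n \<Longrightarrow> B n \<subseteq> B m"
    and B_Union: "(\<Union>n. B n) = S"
    and B_Inter: "(\<And>n. x \<in> B n) \<Longrightarrow> x = 0"
    and B_index: "\<exists>R. transversal R (B n) (B (n + 1)) \<and> card R = Q"
    and openin_iff: "openin T U \<longleftrightarrow> U \<subseteq> S \<and> (\<forall>x\<in>U. \<exists>n. \<forall>b\<in>B n. x + b \<in> U)"
    and complete: "\<lbrakk>\<And>i. X i \<in> S; \<And>i. X (Suc i) - X i \<in> B (m + int i)\<rbrakk>
      \<Longrightarrow> \<exists>y\<in>S. \<forall>i. y - X i \<in> B (m + int i)"
begin

lemmas B_intros = add_subgroup_intros[OF B_group]

lemma B_sub_S: "B n \<subseteq> S"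
  using B_Union by auto

lemma B_in_S: "x \<in> B n \<Longrightarrow> x \<in> S"
  using B_sub_S by auto

lemma S_in_B: "x \<in> S \<Longrightarrow> \<exists>n. x \<in> B n"
  using B_Union by auto

lemma S_group: "add_subgroup S"
  unfolding add_subgroup_def
proof (intro conjI ballI)
  fix x y assume "x \<in> S" "y \<in> S"
  then obtain m n where "x \<in> B m" "y \<in> B n" using S_in_B by blast
  then have "x \<in> B (min m n)" "y \<in> B (min m n)"
    using B_antimono[of "min m n" m] B_antimono[of "min m n" n] by auto
  then show "x - y \<in> S" using B_intros(2) B_in_S by blast
qed (use B_intros(1) B_in_S in blast)

lemmas S_intros = add_subgroup_intros[OF S_group]

lemma Q_pos: "Q > 0"
proof -
  obtain R where R: "transversal R (B 0) (B (0 + 1))" "card R = Q" using B_index by blast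
  then have "R \<noteq> {}" using transversal_ex[OF R(1) B_intros(1)] by blast
  then show ?thesis using R transversal_finite[OF R(1)] by (metis card_gt_0_iff)
qed

lemma coset_stable_mono: "coset_stable E (B m) \<Longrightarrow> m \<le> n \<Longrightarrow> coset_stable E (B n)"
  using B_antimono by (fastforce simp: coset_stable_def)

lemma coset_stable_B: "m \<le> n \<Longrightarrow> coset_stable (B m) (B n)"
  using B_antimono B_intros(4) by (fastforce simp: coset_stable_def)

lemma transversal_stable_refine:
  assumes R: "transversal R E (B m)" and E: "coset_stable E (B m)" and mn: "m \<le> n"
  shows "\<exists>R'. transversal R' E (B n) \<and> card R' = card R * Q ^ nat (n - m)"
  using mn
proof (induction n rule: int_ge_induct)
  case base
  then show ?case using R by auto
next
  case (step n)
  then obtain R' where R': "transversal R' E (B n)" "card R' = card R * Q ^ nat (n - m)" by blast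
  obtain R2 where R2: "transversal R2 (B n) (B (n + 1))" "card R2 = Q" using B_index by blast
  have stab: "coset_stable E (B n)" using E step coset_stable_mono by blast
  have "nat (n + 1 - m) = Suc (nat (n - m))" using step by simp
  then show ?case
    using transversal_refine[OF R'(1) R2(1) B_group B_group B_antimono stab] R' R2 by auto
qed

lemma transversal_B:
  assumes "m \<le> n"
  shows "\<exists>R. transversal R (B m) (B n) \<and> card R = Q ^ nat (n - m)"
proof -
  have "transversal {0} (B m) (B m)"
    by (rule transversalI[OF B_group]) (auto simp: B_intros)
  then show ?thesis
    using transversal_stable_refine[of "{0}" "B m" m n] assms coset_stable_B[of m m] by auto
qed

lemma transversal_restrict:
  assumes R: "transversal R E L" and E': "E' \<subseteq> E" "coset_stable E' L" and L: "add_subgroup L"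
  shows "transversal (R \<inter> E') E' L"
proof (rule transversalI[OF L])
  fix x assume x: "x \<in> E'"
  then obtain r where r: "r \<in> R" "x - r \<in> L" using transversal_ex[OF R] E' by blast
  then have "r - x \<in> L" using add_subgroup_diff_commute[OF L] by blast
  then have "x + (r - x) \<in> E'" using x E'(2) unfolding coset_stable_def by blast
  then show "\<exists>r\<in>R \<inter> E'. x - r \<in> L" using r by auto
qed (use transversal_finite[OF R] transversal_eq[OF R L] in auto)

section \<open>Compact open sets and their volume\<close>

definition compact_open :: "'a set \<Rightarrow> bool" where
  "compact_open E \<longleftrightarrow> (\<exists>m n. E \<subseteq> B m \<and> coset_stable E (B n))"

lemma compact_open_subset: "compact_open E \<Longrightarrow> E \<subseteq> S"
  using B_sub_S by (auto simp: compact_open_def)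

lemma transversal_compact_open:
  assumes "E \<subseteq> B m" "coset_stable E (B n)"
  shows "\<exists>R. transversal R E (B n)"
proof -
  obtain R where R: "transversal R (B (min m n)) (B n)" using transversal_B[of "min m n" n] by auto
  have "E \<subseteq> B (min m n)" using assms B_antimono[of "min m n" m] by auto
  then show ?thesis using transversal_restrict[OF R _ assms(2) B_group] by blast
qed

text \<open>Bounding by \<open>B (- n)\<close> makes both conditions weaker as \<open>n\<close>
  grows, so finitely many sets have a common level.\<close>

lemma compact_open_level:
  assumes "compact_open E"
  obtains n0 where "\<And>n. n \<ge> n0 \<Longrightarrow> coset_stable E (B n) \<and> E \<subseteq> B (- n)"
proof -
  obtain m n where mn: "E \<subseteq> B m" "coset_stable E (B n)" using assms by (auto simp: compact_open_def)
  show ?thesis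
  proof (rule that[of "max n (- m)"])
    fix k assume k: "k \<ge> max n (- m)"
    then show "coset_stable E (B k) \<and> E \<subseteq> B (- k)"
      using coset_stable_mono[OF mn(2), of k] mn(1) B_antimono[of "- k" m] by auto
  qed
qed

lemma compact_open_common_level:
  assumes "compact_open E" "compact_open F"
  obtains n where "coset_stable E (B n)" "E \<subseteq> B (- n)" "coset_stable F (B n)" "F \<subseteq> B (- n)"
proof -
  obtain n1 n2 where "\<And>n. n \<ge> n1 \<Longrightarrow> coset_stable E (B n) \<and> E \<subseteq> B (- n)"
    "\<And>n. n \<ge> n2 \<Longrightarrow> coset_stable F (B n) \<and> F \<subseteq> B (- n)"
    using compact_open_level assms by metis
  then show ?thesis using that[of "max n1 n2"] by auto
qed

lemma compact_open_empty: "compact_open {}"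
  by (auto simp: compact_open_def coset_stable_def)

lemma compact_open_B: "compact_open (B n)"
  using coset_stable_B[of n n] by (auto simp: compact_open_def)

lemma compact_open_Un:
  assumes "compact_open E" "compact_open F" shows "compact_open (E \<union> F)"
  using assms compact_open_common_level[OF assms] unfolding compact_open_def coset_stable_def
  by (metis Un_iff Un_subset_iff)

lemma compact_open_Int:
  assumes "compact_open E" "compact_open F" shows "compact_open (E \<inter> F)"
proof -
  obtain n where "coset_stable E (B n)" "E \<subseteq> B (- n)" "coset_stable F (B n)"
    using compact_open_common_level[OF assms] by metis
  then show ?thesis unfolding compact_open_def coset_stable_def by blast
qed

lemma compact_open_Diff:
  assumes "compact_open E" "compact_open F" shows "compact_open (E - F)"
proof -
  obtain n where n: "coset_stable E (B n)" "E \<subseteq> B (- n)" "coset_stable F (B n)"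
    using compact_open_common_level[OF assms] by metis
  have "x + b \<in> E - F" if "x \<in> E - F" "b \<in> B n" for x b
  proof -
    have "x + b + (- b) \<in> F" if "x + b \<in> F"
      using n(3) that \<open>b \<in> B n\<close> B_intros(3) unfolding coset_stable_def by blast
    then show ?thesis using that n by (auto simp: coset_stable_def)
  qed
  then show ?thesis using n unfolding compact_open_def coset_stable_def by blast
qed

lemma compact_open_coset:
  assumes "x \<in> S" shows "compact_open ((+) x ` B n)"
proof -
  obtain m where m: "x \<in> B m" using S_in_B[OF assms] by blast
  have "(+) x ` B n \<subseteq> B (min m n)"
    using m B_antimono[of "min m n" m] B_antimono[of "min m n" n] by (auto intro!: B_intros(4))
  moreover have "coset_stable ((+) x ` B n) (B n)"
    unfolding coset_stable_def by (auto simp: add.assoc B_intros(4))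
  ultimately show ?thesis unfolding compact_open_def by blast
qed

text \<open>The Haar volume normalised by 1 on \<open>B 0\<close>. The description ranges over all
  levels and transversals at once; \<open>vol_eq\<close> is the proof that they agree.\<close>

definition vol :: "'a set \<Rightarrow> real" where
  "vol E = (THE c. \<forall>n R. coset_stable E (B n) \<and> transversal R E (B n) \<longrightarrow>
     c = real (card R) * real Q powi (- n))"

text \<open>One level deeper there are \<open>Q\<close> times as many cosets, each weighing
  \<open>1 / Q\<close>.\<close>

lemma vol_eq:
  assumes E: "coset_stable E (B n)" and R: "transversal R E (B n)"
  shows "vol E = real (card R) * real Q powi (- n)"
proof -
  have le: "real (card R1) * real Q powi (- m) = real (card R2) * real Q powi (- n)"
    if le_hyps: "coset_stable E (B m)" "transversal R1 E (B m)" "coset_stable E (B n)" "transversal R2 E (B n)" "m \<le> n"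
    for R1 R2 m n
  proof -
    obtain R' where R': "transversal R' E (B n)" "card R' = card R1 * Q ^ nat (n - m)"
      using transversal_stable_refine[OF le_hyps(2,1,5)] by blast
    have "card R2 = card R1 * Q ^ nat (n - m)" using transversal_card[OF that(4) R'(1) B_group] R' by simp
    moreover have "real Q powi (- m) = real Q powi (n - m) * real Q powi (- n)"
      using Q_pos power_int_add[of "real Q" "n - m" "- n"] by simp
    moreover have "real Q powi (n - m) = real Q ^ nat (n - m)"
      using that(5) by (simp add: power_int_def)
    ultimately show ?thesis by simp
  qed
  have eq: "real (card R1) * real Q powi (- m) = real (card R) * real Q powi (- n)"
    if "coset_stable E (B m)" "transversal R1 E (B m)" for R1 m
    using le[OF that E R] le[OF E R that] linear[of m n] by metis
  show ?thesis
    unfolding vol_def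
  proof (rule the_equality)
    show "\<forall>m R'. coset_stable E (B m) \<and> transversal R' E (B m) \<longrightarrow>
        real (card R) * real Q powi (- n) = real (card R') * real Q powi (- m)"
      using eq by simp
  qed (use E R in blast)
qed

lemma vol_nonneg: "compact_open E \<Longrightarrow> vol E \<ge> 0"
proof -
  assume "compact_open E"
  then obtain m n R where "coset_stable E (B n)" "transversal R E (B n)"
    unfolding compact_open_def using transversal_compact_open by blast
  then show ?thesis using vol_eq by simp
qed

lemma vol_empty: "vol {} = 0"
  using vol_eq[of "{}" 0 "{}"] by (auto simp: coset_stable_def transversal_def)

lemma vol_Un:
  assumes "compact_open E" "compact_open F" "E \<inter> F = {}"
  shows "vol (E \<union> F) = vol E + vol F"
proof -
  obtain n where n: "coset_stable E (B n)" "E \<subseteq> B (- n)" "coset_stable F (B n)" "F \<subseteq> B (- n)"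
    using compact_open_common_level[OF assms(1,2)] by metis
  obtain R1 R2 where R: "transversal R1 E (B n)" "transversal R2 F (B n)"
    using transversal_compact_open[OF n(2,1)] transversal_compact_open[OF n(4,3)] by blast
  have cross: False if "r \<in> E" "s \<in> F" "r - s \<in> B n" for r s
  proof -
    have "s + (r - s) \<in> F" using n(3) that unfolding coset_stable_def by blast
    then show False using that assms by auto
  qed
  have "transversal (R1 \<union> R2) (E \<union> F) (B n)"
  proof (rule transversalI[OF B_group])
    fix r s assume rs: "r \<in> R1 \<union> R2" "s \<in> R1 \<union> R2" "r - s \<in> B n"
    have sr: "s - r \<in> B n" using rs(3) add_subgroup_diff_commute[OF B_group] by blast
    consider "r \<in> R1" "s \<in> R1" | "r \<in> R2" "s \<in> R2" | "r \<in> R1" "s \<in> R2" | "r \<in> R2" "s \<in> R1"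
      using rs by blast
    then show "r = s"
    proof cases
      case 1
      then show ?thesis using transversal_eq[OF R(1) B_group _ _ rs(3)] by blast
    next
      case 2
      then show ?thesis using transversal_eq[OF R(2) B_group _ _ rs(3)] by blast
    next
      case 3
      then show ?thesis using cross[of r s] rs(3) R[THEN transversal_subset] by auto
    next
      case 4
      then show ?thesis using cross[of s r] sr R[THEN transversal_subset] by auto
    qed
  next
    show "finite (R1 \<union> R2)" using R[THEN transversal_finite] by simp
    show "R1 \<union> R2 \<subseteq> E \<union> F" using R[THEN transversal_subset] by auto
    fix x assume "x \<in> E \<union> F"
    then consider "x \<in> E" | "x \<in> F" by blast
    then show "\<exists>r\<in>R1 \<union> R2. x - r \<in> B n"
    proof cases
      case 1
      from transversal_ex[OF R(1) this] show ?thesis by blast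
    next
      case 2
      from transversal_ex[OF R(2) this] show ?thesis by blast
    qed
  qed
  moreover have "coset_stable (E \<union> F) (B n)" using n by (auto simp: coset_stable_def)
  moreover have "card (R1 \<union> R2) = card R1 + card R2"
  proof (rule card_Un_disjoint)
    show "R1 \<inter> R2 = {}"
      using assms(3) transversal_subset[OF R(1)] transversal_subset[OF R(2)] by blast
  qed (use R[THEN transversal_finite] in auto)
  ultimately show ?thesis
    using vol_eq[OF n(1) R(1)] vol_eq[OF n(3) R(2)] vol_eq[of "E \<union> F" n "R1 \<union> R2"]
    by (simp add: distrib_right)
qed

lemma vol_B: "vol (B n) = real Q powi (- n)"
proof -
  have "transversal {0} (B n) (B n)"
    by (rule transversalI[OF B_group]) (auto simp: B_intros(1))
  then show ?thesis using vol_eq[OF coset_stable_B[of n n]] by simp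
qed

lemma openin_S: "openin T S"
  unfolding openin_iff
proof (intro conjI ballI exI[of _ 0])
  show "x + b \<in> S" if "x \<in> S" "b \<in> B 0" for x b
    using that B_in_S S_intros(4) by blast
qed auto

lemma topspace_T: "topspace T = S"
proof
  show "topspace T \<subseteq> S" using openin_iff[of "topspace T"] openin_topspace by blast
  show "S \<subseteq> topspace T" using openin_S by (rule openin_subset)
qed

lemma openin_compact_open:
  assumes "compact_open E" shows "openin T E"
  using assms B_sub_S unfolding openin_iff compact_open_def coset_stable_def by (meson subset_trans)

text \<open>Koenig's lemma: a cover without finite subcover yields a chain of bad cosets, whose limit
  point lies in some open set of the cover.\<close>

lemma compactin_B: "compactin T (B m)"
  unfolding compactin_def
proof (intro conjI allI impI)
  show "B m \<subseteq> topspace T" using B_sub_S topspace_T by simp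
  fix \<U> assume \<U>: "Ball \<U> (openin T) \<and> B m \<subseteq> \<Union>\<U>"
  define good where "good x n \<longleftrightarrow> (\<exists>\<F>. finite \<F> \<and> \<F> \<subseteq> \<U> \<and> (\<forall>b\<in>B n. x + b \<in> \<Union>\<F>))" for x n
  have step: "\<exists>b\<in>B n. \<not> good (x + b) (n + 1)" if "\<not> good x n" for x n
  proof (rule ccontr)
    assume "\<not> ?thesis"
    then have all: "\<forall>b\<in>B n. good (x + b) (n + 1)" by blast
    obtain R where R: "transversal R (B n) (B (n + 1))" using B_index by blast
    have "\<forall>r\<in>R. \<exists>\<F>. finite \<F> \<and> \<F> \<subseteq> \<U> \<and> (\<forall>b\<in>B (n + 1). x + r + b \<in> \<Union>\<F>)"
      using all transversal_subset[OF R] unfolding good_def by blast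
    then obtain \<F> where \<F>: "\<And>r. r \<in> R \<Longrightarrow> finite (\<F> r) \<and> \<F> r \<subseteq> \<U> \<and> (\<forall>b\<in>B (n + 1). x + r + b \<in> \<Union>(\<F> r))"
      by metis
    have "x + b \<in> \<Union>(\<Union>(\<F> ` R))" if b: "b \<in> B n" for b
    proof -
      obtain r where r: "r \<in> R" "b - r \<in> B (n + 1)" using transversal_ex[OF R b] by blast
      have "x + r + (b - r) \<in> \<Union>(\<F> r)" using \<F>[OF r(1)] r(2) by blast
      then show ?thesis using r by auto
    qed
    moreover have "finite (\<Union>(\<F> ` R))" "\<Union>(\<F> ` R) \<subseteq> \<U>" using \<F> transversal_finite[OF R] by auto
    ultimately have "good x n" unfolding good_def by blast
    then show False using that by blast
  qed
  show "\<exists>\<F>. finite \<F> \<and> \<F> \<subseteq> \<U> \<and> B m \<subseteq> \<Union>\<F>"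
  proof (rule ccontr)
    assume no_cover: "\<not> ?thesis"
    have "\<not> good 0 m"
    proof
      assume "good 0 m"
      then obtain \<F> where "finite \<F>" "\<F> \<subseteq> \<U>" "\<forall>b\<in>B m. b \<in> \<Union>\<F>"
        unfolding good_def add_0 by blast
      then show False using no_cover by blast
    qed
    have "\<exists>x. \<forall>i. (x i \<in> B m \<and> \<not> good (x i) (m + int i)) \<and> x (Suc i) - x i \<in> B (m + int i)"
    proof (rule dependent_nat_choice)
      show "\<exists>x. x \<in> B m \<and> \<not> good x (m + int 0)" using \<open>\<not> good 0 m\<close> B_intros(1) by auto
      fix x i assume x: "x \<in> B m \<and> \<not> good x (m + int i)"
      obtain b where b: "b \<in> B (m + int i)" "\<not> good (x + b) (m + int i + 1)" using step x by blast
      have "b \<in> B m" using b(1) B_antimono[of m "m + int i"] by auto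
      then show "\<exists>y. (y \<in> B m \<and> \<not> good y (m + int (Suc i))) \<and> y - x \<in> B (m + int i)"
        using b x by (intro exI[of _ "x + b"]) (auto simp: B_intros(4) algebra_simps)
    qed
    then obtain x where x: "\<And>i. x i \<in> B m" "\<And>i. \<not> good (x i) (m + int i)"
      "\<And>i. x (Suc i) - x i \<in> B (m + int i)" by blast
    obtain y where y: "\<And>i. y - x i \<in> B (m + int i)" using complete[of x m] x B_in_S by blast
    have "(y - x 0) + x 0 \<in> B m" using y[of 0] x(1)[of 0] by (intro B_intros(4)) auto
    then obtain U where U: "U \<in> \<U>" "y \<in> U" using \<U> by auto
    then obtain k where k: "\<forall>b\<in>B k. y + b \<in> U" using \<U> openin_iff by blast
    define i where "i = nat (k - m)"
    have "x i + b \<in> U" if b: "b \<in> B (m + int i)" for b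
    proof -
      have "b - (y - x i) \<in> B (m + int i)" using y b by (rule B_intros(2)[rotated])
      moreover have "B (m + int i) \<subseteq> B k" by (rule B_antimono) (simp add: i_def)
      ultimately have "y + (b - (y - x i)) \<in> U" using k by blast
      then show ?thesis by (simp add: algebra_simps)
    qed
    then have "good (x i) (m + int i)" unfolding good_def using U by (intro exI[of _ "{U}"]) auto
    then show False using x by blast
  qed
qed

lemma compactin_compact_open:
  assumes "compact_open E" shows "compactin T E"
proof -
  obtain m n where mn: "E \<subseteq> B m" "coset_stable E (B n)" using assms by (auto simp: compact_open_def)
  have "openin T (S - E)"
    unfolding openin_iff
  proof (intro conjI ballI exI[of _ n])
    fix x b assume x: "x \<in> S - E" "b \<in> B n"
    have "x + b \<notin> E"
    proof
      assume "x + b \<in> E"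
      then have "x + b + (- b) \<in> E" using mn x B_intros(3) unfolding coset_stable_def by blast
      then show False using x by simp
    qed
    then show "x + b \<in> S - E" using x B_in_S S_intros(4) by blast
  qed auto
  then have "closedin T E" using compact_open_subset[OF assms] by (simp add: closedin_def topspace_T)
  then show ?thesis using closed_compactin[OF compactin_B mn(1)] by blast
qed

lemma compactin_bounded:
  assumes "compactin T C" shows "\<exists>m. C \<subseteq> B m"
proof -
  have "\<exists>\<F>. finite \<F> \<and> \<F> \<subseteq> range B \<and> C \<subseteq> \<Union>\<F>"
  proof (rule compactinD[OF assms])
    show "C \<subseteq> \<Union> (range B)" using compactin_subset_topspace[OF assms] topspace_T B_Union by simp
  qed (use openin_compact_open[OF compact_open_B] in auto)
  then obtain K where K: "finite K" "C \<subseteq> (\<Union>k\<in>K. B k)" by (metis finite_subset_image)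
  show ?thesis
  proof (cases "K = {}")
    case False
    have "B k \<subseteq> B (Min K)" if "k \<in> K" for k using that K by (intro B_antimono) auto
    then show ?thesis using K by blast
  qed (use K in auto)
qed

sublocale ring: ring_of_sets S "{E. compact_open E}"
  by (unfold ring_of_sets_iff)
     (auto simp: compact_open_empty compact_open_Un compact_open_Diff dest: compact_open_subset)

lemma vol_positive: "positive {E. compact_open E} (\<lambda>E. ennreal (vol E))"
  by (simp add: positive_def vol_empty)

lemma vol_finite_UN:
  assumes "finite I" "disjoint_family_on A I" "\<And>i. i \<in> I \<Longrightarrow> compact_open (A i)"
  shows "compact_open (\<Union>i\<in>I. A i) \<and> vol (\<Union>i\<in>I. A i) = (\<Sum>i\<in>I. vol (A i))"
  using assms
proof (induction I)
  case (insert i I)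
  have "A i \<inter> (\<Union>i\<in>I. A i) = {}"
    using insert.prems(1) insert.hyps by (auto simp: disjoint_family_on_def)
  moreover have "compact_open (\<Union>i\<in>I. A i) \<and> vol (\<Union>i\<in>I. A i) = (\<Sum>i\<in>I. vol (A i))"
    using insert by (intro insert.IH) (auto simp: disjoint_family_on_def)
  ultimately show ?case using insert by (simp add: vol_Un compact_open_Un)
qed (simp add: vol_empty compact_open_empty)

text \<open>Compactness of the union leaves only finitely many nonempty \<open>A i\<close>, because
  they are open and disjoint; finite additivity then suffices.\<close>

lemma vol_countably_additive: "countably_additive {E. compact_open E} (\<lambda>E. ennreal (vol E))"
proof (rule countably_additiveI)
  fix A :: "nat \<Rightarrow> 'a set"
  assume A: "range A \<subseteq> {E. compact_open E}" and disj: "disjoint_family A"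
    and U: "(\<Union>i. A i) \<in> {E. compact_open E}"
  have co: "compact_open (A i)" for i using A by auto
  have "\<exists>\<F>. finite \<F> \<and> \<F> \<subseteq> range A \<and> (\<Union>i. A i) \<subseteq> \<Union>\<F>"
    by (rule compactinD[OF compactin_compact_open]) (use U openin_compact_open[OF co] in auto)
  then obtain I where I: "finite I" "(\<Union>i. A i) \<subseteq> (\<Union>i\<in>I. A i)" by (metis finite_subset_image)
  have empty: "A i = {}" if "i \<notin> I" for i
  proof (rule ccontr)
    assume "A i \<noteq> {}"
    then obtain x where x: "x \<in> A i" by auto
    then have "x \<in> (\<Union>i\<in>I. A i)" using I(2) by blast
    then obtain j where "j \<in> I" "x \<in> A j" by blast
    then show False
      using disjoint_family_onD[OF disj UNIV_I UNIV_I, of i j] x that by blast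
  qed
  have eq: "(\<Union>i. A i) = (\<Union>i\<in>I. A i)" using I by auto
  have "(\<Sum>i. ennreal (vol (A i))) = (\<Sum>i\<in>I. ennreal (vol (A i)))"
    by (rule suminf_finite[OF I(1)]) (simp add: empty vol_empty)
  also have "\<dots> = ennreal (\<Sum>i\<in>I. vol (A i))" by (rule sum_ennreal) (rule vol_nonneg[OF co])
  also have "(\<Sum>i\<in>I. vol (A i)) = vol (\<Union>i. A i)"
    unfolding eq using vol_finite_UN[OF I(1) disjoint_family_on_mono[OF subset_UNIV disj] co] by simp
  finally show "(\<Sum>i. ennreal (vol (A i))) = ennreal (vol (\<Union>i. A i))" .
qed

section \<open>Haar measure by Caratheodory extension\<close>

definition vol_outer :: "'a set \<Rightarrow> ennreal" where
  "vol_outer = outer_measure {E. compact_open E} (\<lambda>E. ennreal (vol E))"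

definition haar :: "'a measure" where
  "haar = measure_of S {E. compact_open E} vol_outer"

lemma compact_open_Pow: "{E. compact_open E} \<subseteq> Pow S"
  using compact_open_subset by auto

lemma space_haar: "space haar = S"
  using compact_open_Pow by (simp add: haar_def)

lemma sets_haar: "sets haar = sigma_sets S {E. compact_open E}"
  using compact_open_Pow by (simp add: haar_def)

lemma vol_increasing: "increasing {E. compact_open E} (\<lambda>E. ennreal (vol E))"
  by (rule ring.additive_increasing[OF vol_positive ring.countably_additive_additive[OF vol_positive vol_countably_additive]])

text \<open>The extension is kept equal to the outer measure itself, because outer regularity is
  later read off from the covers that define \<open>vol_outer\<close>.\<close>

lemma measure_space_vol_outer: "measure_space S (sigma_sets S {E. compact_open E}) vol_outer"
proof -
  let ?ls = "lambda_system S (Pow S) vol_outer"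
  have "algebra S (Pow S)" "sigma_algebra S (Pow S)"
    by (simp_all add: algebra_Pow sigma_algebra_Pow)
  then have ms: "measure_space S ?ls vol_outer"
    unfolding vol_outer_def
    by (intro sigma_algebra.caratheodory_lemma ring.outer_measure_space_outer_measure
        vol_positive vol_increasing)
  have sub: "{E. compact_open E} \<subseteq> ?ls"
    unfolding vol_outer_def
    by (rule ring.algebra_subset_lambda_system[OF vol_positive vol_increasing
        ring.countably_additive_additive[OF vol_positive vol_countably_additive]])
  show ?thesis
  proof (rule measure_down[OF ms sigma_algebra_sigma_sets[OF compact_open_Pow]])
    have "sigma_algebra S ?ls" using ms by (simp add: measure_space_def)
    then show "sigma_sets S {E. compact_open E} \<subseteq> ?ls"
      using sub by (rule sigma_algebra.sigma_sets_subset)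
  qed
qed

lemma emeasure_haar:
  assumes "A \<in> sets haar" shows "emeasure haar A = vol_outer A"
proof (rule emeasure_measure_of[OF haar_def compact_open_Pow])
  show "positive (sets haar) vol_outer" "countably_additive (sets haar) vol_outer"
    using measure_space_vol_outer unfolding sets_haar measure_space_def by auto
qed (fact assms)

lemma sets_haar_compact_open: "compact_open E \<Longrightarrow> E \<in> sets haar"
  by (simp add: sets_haar sigma_sets.Basic)

lemma emeasure_haar_compact_open:
  assumes "compact_open E" shows "emeasure haar E = ennreal (vol E)"
  using emeasure_haar[OF sets_haar_compact_open[OF assms]]
    ring.outer_measure_agrees[OF vol_positive vol_countably_additive, of E] assms
  by (simp add: vol_outer_def)

text \<open>\<open>E k\<close> collects the points of \<open>B (- k)\<close> whose coset modulo
  \<open>B k\<close> stays in the open set. This makes open sets measurable and yields inner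
  regularity.\<close>

lemma open_exhaustion:
  assumes U: "openin T U"
  obtains E where "\<And>k. compact_open (E k)" "incseq E" "(\<Union>k. E k) = U"
proof
  define E where "E k = {x \<in> B (- int k). \<forall>b\<in>B (int k). x + b \<in> U}" for k
  show "compact_open (E k)" for k
    unfolding compact_open_def
  proof (intro exI conjI)
    show "E k \<subseteq> B (- int k)" by (auto simp: E_def)
    show "coset_stable (E k) (B (int k))"
      unfolding coset_stable_def E_def
      using B_antimono[of "- int k" "int k"] by (auto simp: add.assoc intro!: B_intros(4))
  qed
  show "incseq E"
  proof (rule incseq_SucI)
    fix k
    have "B (- int k) \<subseteq> B (- int (Suc k))" "B (int (Suc k)) \<subseteq> B (int k)" by (auto intro!: B_antimono)
    then show "E k \<subseteq> E (Suc k)" unfolding E_def by blast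
  qed
  show "(\<Union>k. E k) = U"
  proof safe
    fix x k assume "x \<in> E k"
    then have "x + 0 \<in> U" unfolding E_def using B_intros(1) by blast
    then show "x \<in> U" by simp
  next
    fix x assume x: "x \<in> U"
    obtain m n where mn: "x \<in> B m" "\<forall>b\<in>B n. x + b \<in> U" using U x S_in_B unfolding openin_iff by blast
    define k where "k = nat (max n (- m))"
    have "B m \<subseteq> B (- int k)" "B (int k) \<subseteq> B n" by (auto intro!: B_antimono simp: k_def)
    then have "x \<in> E k" using mn unfolding E_def by blast
    then show "x \<in> (\<Union>k. E k)" by blast
  qed
qed

lemma sets_haar_open: "openin T U \<Longrightarrow> U \<in> sets haar"
  using open_exhaustion[of U] sets_haar_compact_open by (metis (no_types, lifting) UNIV_I countableI_type sets.countable_UN'' )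

lemma sets_haar_sigma: "sets haar = sets (sigma (topspace T) {U. openin T U})"
proof -
  have "{U. openin T U} \<subseteq> Pow S" using openin_iff by auto
  then have eq: "sets (sigma (topspace T) {U. openin T U}) = sigma_sets S {U. openin T U}"
    by (simp add: topspace_T)
  have "sigma_sets S {E. compact_open E} \<subseteq> sigma_sets S {U. openin T U}"
    by (rule sigma_sets_mono') (use openin_compact_open in auto)
  moreover have "sigma_sets S {U. openin T U} \<subseteq> sigma_sets S {E. compact_open E}"
    by (rule sigma_sets_mono) (use sets_haar_open sets_haar in auto)
  ultimately show ?thesis using eq sets_haar by simp
qed

end

text \<open>Stated for arbitrary \<open>f\<close>, so that it can be applied without checking
  measurability: for nonmeasurable \<open>f\<close> both integrals have the default value 0.\<close>

lemma integral_density_const: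
  fixes f :: "'a \<Rightarrow> complex"
  assumes "\<kappa> > 0"
  shows "(\<integral>x. f x \<partial>density M (\<lambda>_. ennreal \<kappa>)) = of_real \<kappa> * (\<integral>x. f x \<partial>M)"
proof (cases "f \<in> borel_measurable M")
  case True
  then show ?thesis
    using integral_density[OF True, of "\<lambda>_. \<kappa>"] assms by (simp add: scaleR_conv_of_real)
next
  case False
  then have "f \<notin> borel_measurable (density M (\<lambda>_. ennreal \<kappa>))" by simp
  with False show ?thesis
    using borel_measurable_integrable not_integrable_integral_eq by (metis mult_zero_right)
qed

section \<open>Invariance and uniqueness of Haar measure\<close>

context filtered_group
begin

text \<open>The compact open sets are closed under intersection and generate the sigma-algebra, and
  the \<open>B (- i)\<close> exhaust \<open>S\<close> with finite measure, so a measure is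
  determined by its values on them.\<close>

lemma haar_eqI:
  assumes M: "sets M = sets haar" and "\<kappa> \<ge> 0"
    and E: "\<And>E. compact_open E \<Longrightarrow> emeasure M E = ennreal \<kappa> * ennreal (vol E)"
  shows "M = density haar (\<lambda>_. ennreal \<kappa>)"
proof (rule measure_eqI_generator_eq[where E = "{E. compact_open E}" and \<Omega> = S and A = "\<lambda>i. B (- int i)"])
  show "Int_stable {E. compact_open E}" by (auto simp: Int_stable_def compact_open_Int)
  show "{E. compact_open E} \<subseteq> Pow S" by (rule compact_open_Pow)
  show "emeasure M X = emeasure (density haar (\<lambda>_. ennreal \<kappa>)) X" if "X \<in> {E. compact_open E}" for X
    using that E emeasure_density_const[OF sets_haar_compact_open[of X], of "ennreal \<kappa>"]
      emeasure_haar_compact_open[of X] by simp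
  show "sets M = sigma_sets S {E. compact_open E}" using M sets_haar by simp
  show "sets (density haar (\<lambda>_. ennreal \<kappa>)) = sigma_sets S {E. compact_open E}" by (simp add: sets_haar)
  show "range (\<lambda>i. B (- int i)) \<subseteq> {E. compact_open E}" using compact_open_B by auto
  show "(\<Union>i. B (- int i)) = S"
  proof
    show "S \<subseteq> (\<Union>i. B (- int i))"
    proof
      fix x assume "x \<in> S"
      then obtain n where "x \<in> B n" using S_in_B by blast
      moreover have "B n \<subseteq> B (- int (nat (- n)))" by (rule B_antimono) simp
      ultimately show "x \<in> (\<Union>i. B (- int i))" by blast
    qed
  qed (use B_sub_S in auto)
  show "emeasure M (B (- int i)) \<noteq> \<infinity>" for i
    using E[OF compact_open_B] by (simp add: ennreal_mult_eq_top_iff)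
qed

lemma vol_coset:
  assumes "x \<in> S" shows "vol ((+) x ` B n) = real Q powi (- n)"
proof -
  have "coset_stable ((+) x ` B n) (B n)"
    unfolding coset_stable_def by (auto simp: add.assoc B_intros(4))
  moreover have "transversal {x} ((+) x ` B n) (B n)"
    by (rule transversalI[OF B_group]) (auto simp: B_intros(1) image_iff intro: bexI[of _ 0])
  ultimately show ?thesis using vol_eq[of "(+) x ` B n" n "{x}"] by simp
qed

lemma coset_partition:
  assumes E: "coset_stable E (B n)" and R: "transversal R E (B n)"
  shows "E = (\<Union>r\<in>R. (+) r ` B n)" and "disjoint_family_on (\<lambda>r. (+) r ` B n) R"
proof -
  show "E = (\<Union>r\<in>R. (+) r ` B n)"
  proof safe
    fix x assume "x \<in> E"
    then obtain r where r: "r \<in> R" "x - r \<in> B n" using transversal_ex[OF R] by blast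
    then have "x \<in> (+) r ` B n" by (auto simp: image_iff intro!: bexI[of _ "x - r"])
    then show "x \<in> (\<Union>r\<in>R. (+) r ` B n)" using r by blast
  next
    fix r b assume "r \<in> R" "b \<in> B n"
    then show "r + b \<in> E" using E transversal_subset[OF R] unfolding coset_stable_def by blast
  qed
  show "disjoint_family_on (\<lambda>r. (+) r ` B n) R"
    unfolding disjoint_family_on_def
  proof safe
    fix r s b c assume rs: "r \<in> R" "s \<in> R" "r \<noteq> s" and b: "b \<in> B n" "c \<in> B n" "r + b = s + c"
    have "r - s = c - b" using b(3) by (simp add: algebra_simps)
    then have "r - s \<in> B n" using b B_intros(2) by simp
    then show "r + b \<in> {}" using transversal_eq[OF R B_group rs(1,2)] rs(3) by blast
  qed
qed

lemma emeasure_transversal: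
  assumes M: "sets M = sets haar" and inv: "\<And>x n. x \<in> S \<Longrightarrow> emeasure M ((+) x ` B n) = emeasure M (B n)"
    and E: "coset_stable E (B n)" "E \<subseteq> S" and R: "transversal R E (B n)"
  shows "emeasure M E = of_nat (card R) * emeasure M (B n)"
proof -
  have RS: "R \<subseteq> S" using transversal_subset[OF R] E by blast
  have "emeasure M E = emeasure M (\<Union>r\<in>R. (+) r ` B n)"
    using coset_partition(1)[OF E(1) R] by simp
  also have "\<dots> = (\<Sum>r\<in>R. emeasure M ((+) r ` B n))"
  proof (rule sum_emeasure[symmetric])
    show "(\<lambda>r. (+) r ` B n) ` R \<subseteq> sets M"
      unfolding M using RS sets_haar_compact_open[OF compact_open_coset] by blast
  qed (use coset_partition(2)[OF E(1) R] transversal_finite[OF R] in auto)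
  also have "\<dots> = (\<Sum>r\<in>R. emeasure M (B n))" by (rule sum.cong) (use RS inv in auto)
  finally show ?thesis by simp
qed

lemma coset_shift: "(+) a ` ((+) x ` B n) = (+) (a + x) ` B n"
  by (auto simp: image_image add.assoc)

text \<open>The translated measure is the image measure under \<open>z - x\<close>. It agrees with
  \<open>haar\<close> on all cosets of all \<open>B n\<close>, hence everywhere by
  \<open>haar_eqI\<close> with \<kappa> = 1.\<close>

lemma haar_invariant:
  assumes x: "x \<in> S" and A: "A \<in> sets haar"
  shows "(+) x ` A \<in> sets haar" and "emeasure haar ((+) x ` A) = emeasure haar A"
proof -
  have img: "(+) y ` A = (\<lambda>z. z - y) -` A \<inter> S" if "A \<subseteq> S" "y \<in> S" for A y
  proof (intro equalityI subsetI)
    fix z assume "z \<in> (\<lambda>z. z - y) -` A \<inter> S"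
    then show "z \<in> (+) y ` A" by (intro image_eqI[of _ _ "z - y"]) auto
  qed (use that S_intros(4) in auto)
  have co: "compact_open ((+) y ` E)" if E: "compact_open E" and y: "y \<in> S" for E y
  proof -
    obtain m n where mn: "E \<subseteq> B m" "coset_stable E (B n)" using E by (auto simp: compact_open_def)
    obtain k where k: "y \<in> B k" using S_in_B[OF y] by blast
    have "y \<in> B (min m k)" "E \<subseteq> B (min m k)"
      using k mn(1) B_antimono[of "min m k" m] B_antimono[of "min m k" k] by auto
    then have "(+) y ` E \<subseteq> B (min m k)" using B_intros(4) by blast
    moreover have "coset_stable ((+) y ` E) (B n)"
      using mn(2) unfolding coset_stable_def by (auto simp: add.assoc)
    ultimately show ?thesis unfolding compact_open_def by blast
  qed
  have "(\<lambda>z. z - x) \<in> measurable haar haar"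
  proof (rule measurable_sigma_sets[of haar S "{E. compact_open E}"])
    show "(\<lambda>z. z - x) -` E \<inter> space haar \<in> sets haar" if "E \<in> {E. compact_open E}" for E
    proof -
      have E: "compact_open E" using that by simp
      have "(+) x ` E = (\<lambda>z. z - x) -` E \<inter> S" by (rule img[OF compact_open_subset[OF E] x])
      then show ?thesis using sets_haar_compact_open[OF co[OF E x]] unfolding space_haar by metis
    qed
  qed (use sets_haar compact_open_Pow x S_intros(2) in \<open>auto simp: space_haar\<close>)
  note meas = this
  have AS: "A \<subseteq> S" using A sets.sets_into_space space_haar by blast
  show "(+) x ` A \<in> sets haar"
    using measurable_sets[OF meas A] img[OF AS x] by (simp add: space_haar)
  define N where "N = distr haar haar (\<lambda>z. z - x)"
  have N: "emeasure N E = emeasure haar ((+) x ` E)" if "E \<in> sets haar" for E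
  proof -
    have "E \<subseteq> S" using that sets.sets_into_space space_haar by blast
    then show ?thesis unfolding N_def using emeasure_distr[OF meas that] img[OF _ x] by (simp add: space_haar)
  qed
  have "N = density haar (\<lambda>_. ennreal 1)"
  proof (rule haar_eqI)
    fix E assume E: "compact_open E"
    obtain m n where mn: "E \<subseteq> B m" "coset_stable E (B n)" using E by (auto simp: compact_open_def)
    obtain R where R: "transversal R E (B n)" using transversal_compact_open mn by blast
    have cos: "emeasure N ((+) y ` B n) = ennreal (real Q powi (- n))" if "y \<in> S" for y n
      using N[OF sets_haar_compact_open[OF compact_open_coset[OF that]]] S_intros(4)[OF x that]
      by (simp add: coset_shift emeasure_haar_compact_open compact_open_coset vol_coset)
    have B0: "(+) 0 ` B n = B n" for n by auto
    have "emeasure N E = of_nat (card R) * emeasure N (B n)"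
      by (rule emeasure_transversal)
         (use mn R cos cos[OF S_intros(1), unfolded B0] compact_open_subset[OF E] in \<open>simp_all add: N_def\<close>)
    also have "\<dots> = ennreal (vol E)"
      using cos[OF S_intros(1), of n] vol_eq[OF mn(2) R]
      by (simp add: B0 ennreal_mult' flip: ennreal_of_nat_eq_real_of_nat)
    finally show "emeasure N E = ennreal 1 * ennreal (vol E)" by simp
  qed (simp_all add: N_def)
  then have "emeasure N A = emeasure haar A" using emeasure_density_const[OF A, of 1] by simp
  then show "emeasure haar ((+) x ` A) = emeasure haar A" using N[OF A] by simp
qed

lemma haar_measure_haar: "haar_measure (additive_group S) T haar"
  unfolding haar_measure_def
proof (intro conjI allI impI ballI)
  show "sets haar = sets (sigma (topspace T) {U. openin T U})" by (rule sets_haar_sigma)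
  have "emeasure haar (B 0) \<le> emeasure haar S"
    by (rule emeasure_mono) (use B_sub_S sets_haar_open[OF openin_S] in auto)
  then show "emeasure haar (topspace T) \<noteq> 0"
    using emeasure_haar_compact_open[OF compact_open_B] by (auto simp: vol_B topspace_T)
next
  fix C assume "compactin T C"
  then obtain m where "C \<subseteq> B m" using compactin_bounded by blast
  then have "emeasure haar C \<le> emeasure haar (B m)"
    by (rule emeasure_mono) (rule sets_haar_compact_open[OF compact_open_B])
  then show "emeasure haar C < \<infinity>"
    using emeasure_haar_compact_open[OF compact_open_B, of m]
    by (metis ennreal_less_top infinity_ennreal_def order_le_less_trans)
next
  fix A assume A: "A \<in> sets haar"
  show "emeasure haar A = (INF U\<in>{U. openin T U \<and> A \<subseteq> U}. emeasure haar U)"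
  proof (rule antisym)
    show "emeasure haar A \<le> (INF U\<in>{U. openin T U \<and> A \<subseteq> U}. emeasure haar U)"
      by (rule INF_greatest) (auto intro: emeasure_mono sets_haar_open)
    show "(INF U\<in>{U. openin T U \<and> A \<subseteq> U}. emeasure haar U) \<le> emeasure haar A"
      unfolding emeasure_haar[OF A] vol_outer_def outer_measure_def
    proof (rule INF_greatest)
      fix X assume X: "X \<in> {X. range X \<subseteq> {E. compact_open E} \<and> disjoint_family X \<and> A \<subseteq> (\<Union>i::nat. X i)}"
      then have co: "compact_open (X i)" for i by auto
      have op: "openin T (\<Union>i. X i)" using openin_compact_open[OF co] by blast
      have "(INF U\<in>{U. openin T U \<and> A \<subseteq> U}. emeasure haar U) \<le> emeasure haar (\<Union>i. X i)"
        by (rule INF_lower) (use X op in auto)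
      also have "\<dots> \<le> (\<Sum>i. emeasure haar (X i))"
        by (rule emeasure_subadditive_countably) (use co sets_haar_compact_open in auto)
      finally show "(INF U\<in>{U. openin T U \<and> A \<subseteq> U}. emeasure haar U) \<le> (\<Sum>i. ennreal (vol (X i)))"
        using emeasure_haar_compact_open[OF co] by simp
    qed
  qed
next
  fix U assume U: "openin T U"
  obtain E where E: "\<And>k. compact_open (E k)" "incseq E" "(\<Union>k. E k) = U"
    using open_exhaustion[OF U] by blast
  show "emeasure haar U = (SUP C\<in>{C. compactin T C \<and> C \<subseteq> U}. emeasure haar C)"
  proof (rule antisym)
    have "emeasure haar U = (SUP k. emeasure haar (E k))"
      unfolding E(3)[symmetric]
      by (rule SUP_emeasure_incseq[symmetric]) (use E(1,2) sets_haar_compact_open in auto)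
    also have "\<dots> \<le> (SUP C\<in>{C. compactin T C \<and> C \<subseteq> U}. emeasure haar C)"
    proof (rule SUP_least)
      fix k
      show "emeasure haar (E k) \<le> (SUP C\<in>{C. compactin T C \<and> C \<subseteq> U}. emeasure haar C)"
        by (rule SUP_upper) (use E compactin_compact_open in auto)
    qed
    finally show "emeasure haar U \<le> (SUP C\<in>{C. compactin T C \<and> C \<subseteq> U}. emeasure haar C)" .
    show "(SUP C\<in>{C. compactin T C \<and> C \<subseteq> U}. emeasure haar C) \<le> emeasure haar U"
      by (rule SUP_least) (auto intro: emeasure_mono sets_haar_open U)
  qed
next
  fix x A assume "x \<in> carrier (additive_group S)" "A \<in> sets haar"
  then show "emeasure haar ((\<lambda>y. x \<otimes>\<^bsub>additive_group S\<^esub> y) ` A) = emeasure haar A"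
    using haar_invariant(2)[of x A] by simp
qed

text \<open>Invariance gives equal mass to all cosets of \<open>B n\<close>, which forces the masses
  of all \<open>B n\<close> once \<kappa>, the mass of \<open>B 0\<close>, is known; \<kappa> is
  nonzero because the whole group has nonzero measure.\<close>

lemma haar_measure_unique:
  assumes M: "haar_measure (additive_group S) T M"
  obtains \<kappa> where "\<kappa> > 0" "M = density haar (\<lambda>_. ennreal \<kappa>)"
proof -
  have sets: "sets M = sets haar" using M sets_haar_sigma unfolding haar_measure_def by simp
  have inv: "emeasure M ((+) x ` A) = emeasure M A" if "x \<in> S" "A \<in> sets haar" for x A
    using M that sets unfolding haar_measure_def by simp
  have "\<forall>C. compactin T C \<longrightarrow> emeasure M C < \<infinity>"
    using M unfolding haar_measure_def by (elim conjE) assumption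
  then have fin: "emeasure M (B n) < \<infinity>" for n using compactin_B by blast
  define \<kappa> where "\<kappa> = measure M (B 0)"
  have step: "measure M (B m) = real Q ^ nat (n - m) * measure M (B n)" if mn: "m \<le> n" for m n
  proof -
    obtain R where R: "transversal R (B m) (B n)" "card R = Q ^ nat (n - m)" using transversal_B[OF mn] by blast
    have "emeasure M (B m) = of_nat (card R) * emeasure M (B n)"
      by (rule emeasure_transversal[OF sets _ coset_stable_B[OF mn] B_sub_S R(1)])
         (rule inv[OF _ sets_haar_compact_open[OF compact_open_B]])
    then have "measure M (B m) = real (card R) * measure M (B n)"
      by (simp add: measure_def enn2real_mult)
    then show ?thesis using R(2) by simp
  qed
  have B: "measure M (B n) = \<kappa> * real Q powi (- n)" for n
  proof (cases "n \<ge> 0")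
    case True
    have "\<kappa> = real Q ^ nat n * measure M (B n)"
      using step[OF True] unfolding \<kappa>_def[symmetric] by simp
    moreover have "real Q powi (- n) = inverse (real Q ^ nat n)"
      using True by (simp add: power_int_def power_inverse)
    ultimately show ?thesis using Q_pos by simp
  next
    case False
    then have "measure M (B n) = real Q ^ nat (- n) * \<kappa>"
      using step[of n 0] unfolding \<kappa>_def[symmetric] by simp
    moreover have "real Q powi (- n) = real Q ^ nat (- n)" using False by (simp add: power_int_def)
    ultimately show ?thesis by simp
  qed
  have dens: "M = density haar (\<lambda>_. ennreal \<kappa>)"
  proof (rule haar_eqI[OF sets])
    fix E assume E: "compact_open E"
    obtain m n where mn: "E \<subseteq> B m" "coset_stable E (B n)" using E by (auto simp: compact_open_def)
    obtain R where R: "transversal R E (B n)" using transversal_compact_open mn by blast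
    have "emeasure M E = of_nat (card R) * emeasure M (B n)"
      by (rule emeasure_transversal[OF sets _ mn(2) compact_open_subset[OF E] R])
         (rule inv[OF _ sets_haar_compact_open[OF compact_open_B]])
    also have "emeasure M (B n) = ennreal (\<kappa> * real Q powi (- n))"
      using fin[of n] B[of n] emeasure_eq_ennreal_measure[of M "B n"] by simp
    also have "of_nat (card R) * \<dots> = ennreal (\<kappa> * vol E)"
      using vol_eq[OF mn(2) R]
      by (simp add: ennreal_of_nat_eq_real_of_nat \<kappa>_def mult.left_commute flip: ennreal_mult)
    finally show "emeasure M E = ennreal \<kappa> * ennreal (vol E)"
      using vol_nonneg[OF E] by (simp add: ennreal_mult \<kappa>_def)
  qed (simp add: \<kappa>_def)
  have "\<kappa> \<noteq> 0"
  proof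
    assume "\<kappa> = 0"
    then have "emeasure M S = 0"
      using dens emeasure_density_const[OF sets_haar_open[OF openin_S], of 0] by simp
    moreover have "emeasure M (topspace T) \<noteq> 0"
      using M unfolding haar_measure_def by (elim conjE) assumption
    ultimately show False by (simp add: topspace_T)
  qed
  then have "\<kappa> > 0" using measure_nonneg[of M "B 0"] by (simp add: \<kappa>_def order_less_le)
  then show ?thesis using dens by (rule that)
qed

subsection \<open>Integrals of locally constant functions\<close>

abbreviation int_over :: "'a set \<Rightarrow> ('a \<Rightarrow> complex) \<Rightarrow> complex" where
  "int_over E f \<equiv> set_lebesgue_integral haar E f"

text \<open>The integrands to which Fourier analysis reduces here: over a compact open set their
  integrals are finite sums over representatives.\<close>

definition const_on_cosets :: "int \<Rightarrow> 'a set \<Rightarrow> ('a \<Rightarrow> complex) \<Rightarrow> bool" where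
  "const_on_cosets n E f \<longleftrightarrow> coset_stable E (B n) \<and> (\<forall>x\<in>E. \<forall>b\<in>B n. f (x + b) = f x)"

lemma has_integral_cosets:
  assumes f: "const_on_cosets n E f" and ES: "E \<subseteq> S" and R: "transversal R E (B n)"
  shows "has_bochner_integral haar (\<lambda>x. indicator E x *\<^sub>R f x) (of_real (real Q powi (- n)) * sum f R)"
proof -
  have E: "coset_stable E (B n)" and inv: "\<And>x b. x \<in> E \<Longrightarrow> b \<in> B n \<Longrightarrow> f (x + b) = f x"
    using f by (auto simp: const_on_cosets_def)
  have RS: "r \<in> S" "r \<in> E" if "r \<in> R" for r using transversal_subset[OF R] ES that by auto
  have "has_bochner_integral haar (\<lambda>x. \<Sum>r\<in>R. indicator ((+) r ` B n) x *\<^sub>R f r)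
          (\<Sum>r\<in>R. measure haar ((+) r ` B n) *\<^sub>R f r)"
  proof (rule has_bochner_integral_sum, rule has_bochner_integral_indicator)
    fix r assume r: "r \<in> R"
    show "(+) r ` B n \<in> sets haar" using sets_haar_compact_open compact_open_coset RS[OF r] by blast
    show "emeasure haar ((+) r ` B n) < \<infinity>"
      using emeasure_haar_compact_open[OF compact_open_coset[OF RS(1)[OF r]]] by simp
  qed
  moreover have "(\<Sum>r\<in>R. indicator ((+) r ` B n) x *\<^sub>R f r) = indicator E x *\<^sub>R f x" for x
  proof (cases "x \<in> E")
    case True
    then obtain s where s: "s \<in> R" "x - s \<in> B n" using transversal_ex[OF R] by blast
    have ind: "indicator ((+) r ` B n) x = (if r = s then 1 else 0 :: real)" if r: "r \<in> R" for r
    proof (cases "r = s")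
      case True
      then show ?thesis using s by (auto simp: indicator_def image_iff intro!: bexI[of _ "x - s"])
    next
      case False
      have "x \<notin> (+) r ` B n"
      proof
        assume "x \<in> (+) r ` B n"
        then have "x - r \<in> B n" by auto
        then have "r = s" using transversal_unique[OF R \<open>x \<in> E\<close> r s(1) _ s(2)] by blast
        then show False using False by simp
      qed
      then show ?thesis using False by simp
    qed
    have "(\<Sum>r\<in>R. indicator ((+) r ` B n) x *\<^sub>R f r) = (\<Sum>r\<in>R. if r = s then f s else 0)"
      by (rule sum.cong) (auto simp: ind)
    also have "\<dots> = f s" using s transversal_finite[OF R] by simp
    also have "f s = f x" using inv[OF RS(2)[OF s(1)] s(2)] by simp
    finally show ?thesis using True by simp
  next
    case False
    have "indicator ((+) r ` B n) x = (0::real)" if "r \<in> R" for r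
      using False coset_partition(1)[OF E R] that by (auto simp: indicator_def)
    then show ?thesis using False by simp
  qed
  moreover have "measure haar ((+) r ` B n) = real Q powi (- n)" if "r \<in> R" for r
    using emeasure_haar_compact_open[OF compact_open_coset[OF RS(1)[OF that]], of n]
      vol_coset[OF RS(1)[OF that], of n] by (simp add: measure_def)
  then have "(\<Sum>r\<in>R. measure haar ((+) r ` B n) *\<^sub>R f r) = of_real (real Q powi (- n)) * sum f R"
    by (simp add: scaleR_conv_of_real sum_distrib_left cong: sum.cong)
  ultimately show ?thesis by simp
qed

lemma integral_cosets:
  assumes "const_on_cosets n E f" "E \<subseteq> S" "transversal R E (B n)"
  shows "int_over E f = of_real (real Q powi (- n)) * sum f R"
  using has_integral_cosets[OF assms] unfolding set_lebesgue_integral_def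
  by (rule has_bochner_integral_integral_eq)

lemma integral_const:
  assumes "compact_open E" shows "int_over E (\<lambda>_. c) = of_real (vol E) * c"
proof -
  obtain m n where mn: "E \<subseteq> B m" "coset_stable E (B n)" using assms by (auto simp: compact_open_def)
  obtain R where R: "transversal R E (B n)" using transversal_compact_open mn by blast
  have "const_on_cosets n E (\<lambda>_. c)" using mn by (simp add: const_on_cosets_def)
  then show ?thesis
    using integral_cosets[OF _ compact_open_subset[OF assms] R] vol_eq[OF mn(2) R] by simp
qed

lemma integral_shift:
  assumes "const_on_cosets n E f" and co: "compact_open E" and E: "add_subgroup E" and a: "a \<in> E"
  shows "int_over E (\<lambda>x. f (x + a)) = int_over E f"
proof -
  have stab: "coset_stable E (B n)" and inv: "\<And>x b. x \<in> E \<Longrightarrow> b \<in> B n \<Longrightarrow> f (x + b) = f x"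
    using assms(1) by (auto simp: const_on_cosets_def)
  obtain R where R: "transversal R E (B n)"
    using co stab transversal_compact_open unfolding compact_open_def by blast
  have "const_on_cosets n E (\<lambda>x. f (x + a))"
    unfolding const_on_cosets_def
  proof (intro conjI ballI stab)
    fix x b assume x: "x \<in> E" "b \<in> B n"
    have "f (x + a + b) = f (x + a)" using inv[OF add_subgroup_add[OF E x(1) a] x(2)] .
    then show "f (x + b + a) = f (x + a)" by (simp add: algebra_simps)
  qed
  then have "int_over E (\<lambda>x. f (x + a)) = of_real (real Q powi (- n)) * (\<Sum>r\<in>R. f (r + a))"
    by (rule integral_cosets[OF _ compact_open_subset[OF co] R])
  also have "(\<Sum>r\<in>R. f (r + a)) = sum f ((\<lambda>r. r + a) ` R)" by (subst sum.reindex) (auto simp: inj_on_def)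
  also have "\<dots> = sum f R"
    by (rule transversal_sum[OF transversal_translate[OF R B_group E a] R B_group]) (rule inv)
  also have "of_real (real Q powi (- n)) * \<dots> = int_over E f"
    by (rule integral_cosets[OF assms(1) compact_open_subset[OF co] R, symmetric])
  finally show ?thesis .
qed

text \<open>Fubini as an interchange of two finite sums over representatives.\<close>

lemma integral_swap:
  assumes co: "compact_open E" "compact_open F"
    and stab: "coset_stable E (B n)" "coset_stable F (B n)"
    and inv: "\<And>x y b. x \<in> E \<Longrightarrow> y \<in> F \<Longrightarrow> b \<in> B n \<Longrightarrow> f (x + b) y = f x y"
      "\<And>x y b. x \<in> E \<Longrightarrow> y \<in> F \<Longrightarrow> b \<in> B n \<Longrightarrow> f x (y + b) = f x y"
  shows "int_over E (\<lambda>x. int_over F (f x)) = int_over F (\<lambda>y. int_over E (\<lambda>x. f x y))"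
proof -
  obtain R R' where R: "transversal R E (B n)" and R': "transversal R' F (B n)"
    using co stab transversal_compact_open unfolding compact_open_def by metis
  note sub = compact_open_subset[OF co(1)] compact_open_subset[OF co(2)]
  have 1: "int_over F (f x) = of_real (real Q powi (- n)) * sum (f x) R'" if "x \<in> E" for x
    by (rule integral_cosets[OF _ sub(2) R']) (use that stab inv in \<open>auto simp: const_on_cosets_def\<close>)
  have 2: "int_over E (\<lambda>x. f x y) = of_real (real Q powi (- n)) * (\<Sum>x\<in>R. f x y)" if "y \<in> F" for y
    by (rule integral_cosets[OF _ sub(1) R]) (use that stab inv in \<open>auto simp: const_on_cosets_def\<close>)
  have st: "x + b \<in> E" if "x \<in> E" "b \<in> B n" for x b using stab(1) that unfolding coset_stable_def by blast
  have st': "x + b \<in> F" if "x \<in> F" "b \<in> B n" for x b using stab(2) that unfolding coset_stable_def by blast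
  have R'F: "r \<in> F" if "r \<in> R'" for r using transversal_subset[OF R'] that by blast
  have RE: "r \<in> E" if "r \<in> R" for r using transversal_subset[OF R] that by blast
  have "int_over E (\<lambda>x. int_over F (f x)) = of_real (real Q powi (- n)) * (\<Sum>x\<in>R. int_over F (f x))"
  proof (rule integral_cosets[OF _ sub(1) R])
    have "int_over F (f (x + b)) = int_over F (f x)" if "x \<in> E" "b \<in> B n" for x b
      using 1[OF that(1)] 1[OF st[OF that]] inv(1)[OF that(1) R'F that(2)] by simp
    then show "const_on_cosets n E (\<lambda>x. int_over F (f x))" using stab(1) by (simp add: const_on_cosets_def)
  qed
  also have "\<dots> = of_real (real Q powi (- n)) * (\<Sum>x\<in>R. of_real (real Q powi (- n)) * sum (f x) R')"
    using 1[OF RE] by simp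
  also have "\<dots> = of_real (real Q powi (- n)) * (\<Sum>y\<in>R'. of_real (real Q powi (- n)) * (\<Sum>x\<in>R. f x y))"
    by (simp flip: sum_distrib_left) (rule disjI2, rule sum.swap)
  also have "\<dots> = of_real (real Q powi (- n)) * (\<Sum>y\<in>R'. int_over E (\<lambda>x. f x y))"
    using 2[OF R'F] by simp
  also have "\<dots> = int_over F (\<lambda>y. int_over E (\<lambda>x. f x y))"
  proof (rule integral_cosets[OF _ sub(2) R', symmetric])
    have "int_over E (\<lambda>x. f x (y + b)) = int_over E (\<lambda>x. f x y)" if "y \<in> F" "b \<in> B n" for y b
      using 2[OF that(1)] 2[OF st'[OF that]] inv(2)[OF RE that] by simp
    then show "const_on_cosets n F (\<lambda>y. int_over E (\<lambda>x. f x y))" using stab(2) by (simp add: const_on_cosets_def)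
  qed
  finally show ?thesis .
qed

text \<open>Translation by an \<open>a\<close> with \<open>\<xi> a\<close> different from 1 leaves
  the integral unchanged and also multiplies it by \<open>\<xi> a\<close>.\<close>

lemma integral_character:
  assumes co: "compact_open E" and E: "add_subgroup E"
    and \<xi>: "\<And>x y. x \<in> E \<Longrightarrow> y \<in> E \<Longrightarrow> \<xi> (x + y) = \<xi> x * \<xi> y"
    and n: "\<And>b. b \<in> B n \<Longrightarrow> \<xi> b = 1" "B n \<subseteq> E"
  shows "int_over E \<xi> = (if \<forall>x\<in>E. \<xi> x = 1 then of_real (vol E) else 0)"
proof (cases "\<forall>x\<in>E. \<xi> x = 1")
  case True
  then have "int_over E \<xi> = int_over E (\<lambda>_. 1)"
    unfolding set_lebesgue_integral_def by (intro Bochner_Integration.integral_cong) (auto simp: indicator_def)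
  then show ?thesis using True integral_const[OF co, of 1] by simp
next
  case False
  then obtain a where a: "a \<in> E" "\<xi> a \<noteq> 1" by blast
  have lc: "const_on_cosets n E \<xi>"
    unfolding const_on_cosets_def coset_stable_def
    using \<xi> n add_subgroup_add[OF E] by (simp add: subset_iff)
  have "int_over E \<xi> = int_over E (\<lambda>x. \<xi> (x + a))" by (rule integral_shift[OF lc co E a(1), symmetric])
  also have "\<dots> = int_over E (\<lambda>x. \<xi> x * \<xi> a)"
    unfolding set_lebesgue_integral_def
    by (intro Bochner_Integration.integral_cong) (auto simp: indicator_def \<xi> a)
  also have "\<dots> = int_over E \<xi> * \<xi> a" by simp
  finally have "int_over E \<xi> = 0" using a by simp
  then show ?thesis by (simp only: if_not_P[OF False])
qed

lemma integral_cong_on: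
  assumes "\<And>x. x \<in> E \<Longrightarrow> f x = g x" shows "int_over E f = int_over E g"
  unfolding set_lebesgue_integral_def
  by (intro Bochner_Integration.integral_cong) (use assms in \<open>auto simp: indicator_def\<close>)

lemma integral_support:
  assumes "E \<subseteq> F" "\<And>x. x \<in> F - E \<Longrightarrow> f x = 0" shows "int_over F f = int_over E f"
  unfolding set_lebesgue_integral_def
  by (intro Bochner_Integration.integral_cong) (use assms in \<open>auto simp: indicator_def\<close>)

lemma integral_haar_support:
  assumes "\<And>x. x \<in> S - E \<Longrightarrow> f x = 0" shows "(\<integral>x. f x \<partial>haar) = int_over E f"
  unfolding set_lebesgue_integral_def
  by (intro Bochner_Integration.integral_cong) (use assms in \<open>auto simp: indicator_def space_haar\<close>)

end

section \<open>Transport along isomorphisms of topological groups\<close>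

text \<open>Used in both directions: along the self-duality to build a Haar measure on the dual, and
  along its inverse to identify an arbitrary one. The integral formula covers all \<open>F\<close>,
  since for a homeomorphism the measurability of \<open>F\<close> is equivalent to that of its
  composite with \<rho>.\<close>

lemma haar_measure_transport:
  assumes G: "monoid G" and iso: "\<rho> \<in> iso G G'" and homeo: "homeomorphic_map T T' \<rho>"
    and top: "topspace T = carrier G"
    and M: "haar_measure G T M"
  shows "haar_measure G' T' (distr M (sigma (topspace T') {U. openin T' U}) \<rho>)"
    and "(\<integral>\<xi>. F \<xi> \<partial>distr M (sigma (topspace T') {U. openin T' U}) \<rho>) = (\<integral>x. (F (\<rho> x) :: complex) \<partial>M)"
proof -
  define \<Sigma> where "\<Sigma> = sigma (topspace T') {U. openin T' U}"
  define N where "N = distr M \<Sigma> \<rho>"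
  obtain g where g: "homeomorphic_maps T T' \<rho> g" using homeo homeomorphic_map_maps by blast
  have conts: "continuous_map T T' \<rho>" "continuous_map T' T g"
    and inv: "\<And>x. x \<in> topspace T \<Longrightarrow> g (\<rho> x) = x" "\<And>y. y \<in> topspace T' \<Longrightarrow> \<rho> (g y) = y"
    using g unfolding homeomorphic_maps_def by auto
  have maps: "\<rho> x \<in> topspace T'" if "x \<in> topspace T" for x
    using conts(1) that unfolding continuous_map_def by blast
  have maps': "g y \<in> topspace T" if "y \<in> topspace T'" for y
    using conts(2) that unfolding continuous_map_def by blast
  have Pow: "{U. openin T U} \<subseteq> Pow (topspace T)" "{U. openin T' U} \<subseteq> Pow (topspace T')"
    using openin_subset by blast+
  have setsM: "sets M = sets (sigma (topspace T) {U. openin T U})"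
    using M unfolding haar_measure_def by (elim conjE) assumption
  have spM: "space M = topspace T" using sets_eq_imp_space_eq[OF setsM] Pow by simp
  have sp\<Sigma>: "space \<Sigma> = topspace T'" using Pow by (simp add: \<Sigma>_def)
  have sM: "sets M = sigma_sets (topspace T) {U. openin T U}" using setsM Pow by simp
  have s\<Sigma>: "sets \<Sigma> = sigma_sets (topspace T') {U. openin T' U}" using Pow by (simp add: \<Sigma>_def)
  have \<rho>_meas: "\<rho> \<in> measurable M \<Sigma>"
  proof (rule measurable_sigma_sets[OF s\<Sigma> Pow(2)])
    show "\<rho> -` U \<inter> space M \<in> sets M" if "U \<in> {U. openin T' U}" for U
    proof -
      have "openin T {x \<in> topspace T. \<rho> x \<in> U}" using openin_continuous_map_preimage[OF conts(1)] that by blast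
      moreover have "\<rho> -` U \<inter> space M = {x \<in> topspace T. \<rho> x \<in> U}" by (auto simp: spM)
      ultimately show ?thesis by (simp add: sM sigma_sets.Basic)
    qed
  qed (use maps spM in auto)
  have g_meas: "g \<in> measurable \<Sigma> M"
  proof (rule measurable_sigma_sets[OF sM Pow(1)])
    show "g -` U \<inter> space \<Sigma> \<in> sets \<Sigma>" if "U \<in> {U. openin T U}" for U
    proof -
      have "openin T' {x \<in> topspace T'. g x \<in> U}" using openin_continuous_map_preimage[OF conts(2)] that by blast
      moreover have "g -` U \<inter> space \<Sigma> = {x \<in> topspace T'. g x \<in> U}" by (auto simp: sp\<Sigma>)
      ultimately show ?thesis by (simp add: s\<Sigma> sigma_sets.Basic)
    qed
  qed (use maps' sp\<Sigma> in auto)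
  have pre: "\<rho> -` (\<rho> ` X) \<inter> topspace T = X" if "X \<subseteq> topspace T" for X
    using that inv(1) by (auto simp: subset_iff) (metis)
  have pre': "g -` X \<inter> topspace T' = \<rho> ` X" if "X \<subseteq> topspace T" for X
    using that inv maps by (auto simp: subset_iff image_iff) metis
  have img: "\<rho> ` (\<rho> -` Y \<inter> topspace T) = Y" if "Y \<subseteq> topspace T'" for Y
  proof (intro equalityI subsetI)
    fix y assume y: "y \<in> Y"
    then have "y \<in> topspace T'" using that by blast
    then show "y \<in> \<rho> ` (\<rho> -` Y \<inter> topspace T)" using inv(2) maps' y by (intro image_eqI[of _ _ "g y"]) auto
  qed auto
  have sets_iff: "\<rho> ` X \<in> sets \<Sigma> \<longleftrightarrow> X \<in> sets M" if X: "X \<subseteq> topspace T" for X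
  proof
    assume "\<rho> ` X \<in> sets \<Sigma>"
    from measurable_sets[OF \<rho>_meas this] show "X \<in> sets M" using pre[OF X] by (simp add: spM)
  next
    assume "X \<in> sets M"
    from measurable_sets[OF g_meas this] show "\<rho> ` X \<in> sets \<Sigma>" using pre'[OF X] by (simp add: sp\<Sigma>)
  qed
  have N: "emeasure N (\<rho> ` X) = emeasure M X" if X: "X \<subseteq> topspace T" for X
  proof (cases "X \<in> sets M")
    case True
    then show ?thesis
      unfolding N_def using emeasure_distr[OF \<rho>_meas] sets_iff[OF X] pre[OF X] by (simp add: spM)
  next
    case False
    then show ?thesis using sets_iff[OF X] by (simp add: N_def emeasure_notin_sets)
  qed
  have Mtop: "emeasure M (topspace T) \<noteq> 0"
    and Mfin: "\<And>C. compactin T C \<Longrightarrow> emeasure M C < \<infinity>"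
    and Mout: "\<And>A. A \<in> sets M \<Longrightarrow> emeasure M A = (INF U\<in>{U. openin T U \<and> A \<subseteq> U}. emeasure M U)"
    and Minn: "\<And>U. openin T U \<Longrightarrow> emeasure M U = (SUP C\<in>{C. compactin T C \<and> C \<subseteq> U}. emeasure M C)"
    and Minv: "\<And>x A. x \<in> carrier G \<Longrightarrow> A \<in> sets M \<Longrightarrow> emeasure M ((\<lambda>y. x \<otimes>\<^bsub>G\<^esub> y) ` A) = emeasure M A"
    using M unfolding haar_measure_def by blast+
  have top': "carrier G' = topspace T'"
    using iso homeomorphic_imp_surjective_map[OF homeo] top
    by (auto simp: iso_def bij_betw_def)
  have hom: "\<rho> (x \<otimes>\<^bsub>G\<^esub> y) = \<rho> x \<otimes>\<^bsub>G'\<^esub> \<rho> y" if "x \<in> carrier G" "y \<in> carrier G" for x y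
    using iso that by (auto simp: iso_def hom_def)
  have ex: "\<exists>X. X \<subseteq> topspace T \<and> Y = \<rho> ` X" if "Y \<subseteq> topspace T'" for Y
    using img[OF that] by (intro exI[of _ "\<rho> -` Y \<inter> topspace T"]) auto
  have inj: "\<rho> ` X \<subseteq> \<rho> ` Y \<longleftrightarrow> X \<subseteq> Y" if "X \<subseteq> topspace T" "Y \<subseteq> topspace T" for X Y
    using that inv(1) by (auto simp: subset_iff image_iff) metis
  have "haar_measure G' T' N"
    unfolding haar_measure_def
  proof (intro conjI allI impI ballI)
    show "sets N = sets (sigma (topspace T') {U. openin T' U})" by (simp add: N_def \<Sigma>_def)
    show "emeasure N (topspace T') \<noteq> 0"
      using Mtop N[OF subset_refl] homeomorphic_imp_surjective_map[OF homeo] by simp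
  next
    fix C assume C: "compactin T' C"
    then obtain X where X: "X \<subseteq> topspace T" "C = \<rho> ` X" using ex compactin_subset_topspace by metis
    then show "emeasure N C < \<infinity>"
      using N[OF X(1)] Mfin[of X] C homeomorphic_map_compactness[OF homeo X(1)] by simp
  next
    fix A assume A: "A \<in> sets N"
    then have "A \<subseteq> topspace T'" using sets.sets_into_space[of A \<Sigma>] sp\<Sigma> by (simp add: N_def)
    then obtain X where X: "X \<subseteq> topspace T" "A = \<rho> ` X" using ex by blast
    have eq: "{U. openin T' U \<and> A \<subseteq> U} = (\<lambda>V. \<rho> ` V) ` {V. openin T V \<and> X \<subseteq> V}"
    proof (intro equalityI subsetI)
      fix U assume U: "U \<in> {U. openin T' U \<and> A \<subseteq> U}"
      then obtain V where V: "V \<subseteq> topspace T" "U = \<rho> ` V" using ex openin_subset by (metis mem_Collect_eq)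
      then show "U \<in> (\<lambda>V. \<rho> ` V) ` {V. openin T V \<and> X \<subseteq> V}"
        using U homeomorphic_map_openness[OF homeo V(1)] inj[OF X(1) V(1)] X(2) by blast
    next
      fix U assume "U \<in> (\<lambda>V. \<rho> ` V) ` {V. openin T V \<and> X \<subseteq> V}"
      then obtain V where V: "openin T V" "X \<subseteq> V" "U = \<rho> ` V" by blast
      have "openin T' (\<rho> ` V)" using homeomorphic_map_openness[OF homeo openin_subset[OF V(1)]] V(1) by blast
      then show "U \<in> {U. openin T' U \<and> A \<subseteq> U}" using V X by blast
    qed
    have "emeasure N A = emeasure M X" using N X by simp
    also have "\<dots> = (INF U\<in>{U. openin T U \<and> X \<subseteq> U}. emeasure M U)"
      using A X sets_iff[OF X(1)] Mout by (simp add: N_def)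
    also have "\<dots> = (INF U\<in>{U. openin T U \<and> X \<subseteq> U}. emeasure N (\<rho> ` U))"
      by (rule INF_cong) (simp_all add: N openin_subset)
    finally show "emeasure N A = (INF U\<in>{U. openin T' U \<and> A \<subseteq> U}. emeasure N U)"
      unfolding eq by (simp add: image_image)
  next
    fix U' assume U': "openin T' U'"
    then obtain U where U: "U \<subseteq> topspace T" "U' = \<rho> ` U" using ex openin_subset by metis
    then have opU: "openin T U" using U' homeomorphic_map_openness[OF homeo U(1)] by blast
    have eq: "{C. compactin T' C \<and> C \<subseteq> U'} = (\<lambda>V. \<rho> ` V) ` {C. compactin T C \<and> C \<subseteq> U}"
    proof (intro equalityI subsetI)
      fix C assume C: "C \<in> {C. compactin T' C \<and> C \<subseteq> U'}"
      then obtain V where V: "V \<subseteq> topspace T" "C = \<rho> ` V" using ex compactin_subset_topspace by (metis mem_Collect_eq)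
      then show "C \<in> (\<lambda>V. \<rho> ` V) ` {C. compactin T C \<and> C \<subseteq> U}"
        using C homeomorphic_map_compactness[OF homeo V(1)] inj[OF V(1) U(1)] U(2) by blast
    next
      fix C assume "C \<in> (\<lambda>V. \<rho> ` V) ` {C. compactin T C \<and> C \<subseteq> U}"
      then obtain V where V: "compactin T V" "V \<subseteq> U" "C = \<rho> ` V" by blast
      have "compactin T' (\<rho> ` V)"
        using homeomorphic_map_compactness[OF homeo compactin_subset_topspace[OF V(1)]] V(1) by blast
      then show "C \<in> {C. compactin T' C \<and> C \<subseteq> U'}" using V U by blast
    qed
    have "emeasure N U' = emeasure M U" using N U by simp
    also have "\<dots> = (SUP C\<in>{C. compactin T C \<and> C \<subseteq> U}. emeasure M C)" by (rule Minn[OF opU])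
    also have "\<dots> = (SUP C\<in>{C. compactin T C \<and> C \<subseteq> U}. emeasure N (\<rho> ` C))"
      by (rule SUP_cong) (simp_all add: N compactin_subset_topspace)
    finally show "emeasure N U' = (SUP C\<in>{C. compactin T' C \<and> C \<subseteq> U'}. emeasure N C)"
      unfolding eq by (simp add: image_image)
  next
    fix y A assume y: "y \<in> carrier G'" and A: "A \<in> sets N"
    then have "A \<subseteq> topspace T'" using sets.sets_into_space[of A \<Sigma>] sp\<Sigma> by (simp add: N_def)
    then obtain X where X: "X \<subseteq> topspace T" "A = \<rho> ` X" using ex by blast
    obtain x where x: "x \<in> carrier G" "y = \<rho> x" using y top' top inv(2) maps' by metis
    have XM: "X \<in> sets M" using A X sets_iff[OF X(1)] by (simp add: N_def)
    have eq: "(\<lambda>z. y \<otimes>\<^bsub>G'\<^esub> z) ` A = \<rho> ` ((\<lambda>z. x \<otimes>\<^bsub>G\<^esub> z) ` X)"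
    proof -
      have "\<rho> (x \<otimes>\<^bsub>G\<^esub> z) = y \<otimes>\<^bsub>G'\<^esub> \<rho> z" if "z \<in> X" for z
        using hom[OF x(1), of z] that X(1) x(2) top by auto
      then show ?thesis unfolding X(2) image_image by simp
    qed
    have "(\<lambda>z. x \<otimes>\<^bsub>G\<^esub> z) ` X \<subseteq> topspace T"
      using x(1) X(1) monoid.m_closed[OF G] unfolding top by blast
    then show "emeasure N ((\<lambda>z. y \<otimes>\<^bsub>G'\<^esub> z) ` A) = emeasure N A"
      using N Minv[OF x(1) XM] X eq by simp
  qed
  then show "haar_measure G' T' (distr M (sigma (topspace T') {U. openin T' U}) \<rho>)"
    by (simp add: N_def \<Sigma>_def)
  have "(\<integral>\<xi>. F \<xi> \<partial>N) = (\<integral>x. F (\<rho> x) \<partial>M)"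
  proof (cases "F \<in> borel_measurable \<Sigma>")
    case True
    then show ?thesis unfolding N_def by (rule integral_distr[OF \<rho>_meas])
  next
    case False
    have "(\<lambda>x. F (\<rho> x)) \<notin> borel_measurable M"
    proof
      assume "(\<lambda>x. F (\<rho> x)) \<in> borel_measurable M"
      from measurable_compose[OF g_meas this] have "(\<lambda>y. F (\<rho> (g y))) \<in> borel_measurable \<Sigma>" .
      moreover have "(\<lambda>y. F (\<rho> (g y))) \<in> borel_measurable \<Sigma> \<longleftrightarrow> F \<in> borel_measurable \<Sigma>"
        by (rule measurable_cong) (simp add: inv(2) sp\<Sigma>)
      ultimately show False using False by blast
    qed
    moreover have "F \<notin> borel_measurable N" using False by (simp add: N_def)
    ultimately show ?thesis
      using borel_measurable_integrable not_integrable_integral_eq by metis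
  qed
  then show "(\<integral>\<xi>. F \<xi> \<partial>distr M (sigma (topspace T') {U. openin T' U}) \<rho>) = (\<integral>x. F (\<rho> x) \<partial>M)"
    by (simp add: N_def \<Sigma>_def)
qed

text \<open>The open subgroup, its compact generating set and the quotient map are pulled back along
  \<rho>, while the Schwartz function on the elementary group stays the same.\<close>

lemma bruhat_schwartz_transport:
  assumes G: "group G" "group G'" and iso: "\<rho> \<in> iso G G'" and homeo: "homeomorphic_map T T' \<rho>"
    and top: "topspace T = carrier G"
    and g: "bruhat_schwartz G' T' g"
  shows "bruhat_schwartz G T (g \<circ> \<rho>)"
proof -
  obtain H C ks \<pi> \<phi> where H: "subgroup H G'" "openin T' H"
    and C: "compactin T' C" "C \<subseteq> H" "generate G' C = H"
    and \<pi>: "\<pi> \<in> hom (G'\<lparr>carrier := H\<rparr>) (elementary_group ks)" "\<pi> ` H = carrier (elementary_group ks)"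
    "continuous_map (subtopology T' H) (elementary_topology ks) \<pi>"
    "open_map (subtopology T' H) (elementary_topology ks) \<pi>"
    "compactin T' {x \<in> H. \<pi> x = one (elementary_group ks)}"
    and \<phi>: "schwartz_elementary ks \<phi>" "\<forall>x\<in>H. g x = \<phi> (\<pi> x)" "\<forall>x\<in>carrier G' - H. g x = 0"
    using g unfolding bruhat_schwartz_def by (elim exE conjE) (rule that; assumption)
  interpret hom: group_hom G G' \<rho>
    using G iso by (simp add: group_hom_def group_hom_axioms_def iso_def)
  have bij: "bij_betw \<rho> (carrier G) (carrier G')" using iso by (simp add: iso_def)
  have HG': "H \<subseteq> carrier G'" by (rule subgroup.subset[OF H(1)])
  define H1 where "H1 = {x \<in> carrier G. \<rho> x \<in> H}"
  have pre_image: "\<rho> ` {x \<in> carrier G. \<rho> x \<in> Y} = Y" if "Y \<subseteq> carrier G'" for Y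
    using that bij by (auto simp: bij_betw_def)
  have inj: "inj_on \<rho> (carrier G)" using bij by (simp add: bij_betw_def)
  have comp: "compactin T {x \<in> carrier G. \<rho> x \<in> Y}" if "compactin T' Y" "Y \<subseteq> carrier G'" for Y
    using homeomorphic_map_compactness[OF homeo, of "{x \<in> carrier G. \<rho> x \<in> Y}"] pre_image[OF that(2)] that(1)
    by (auto simp: top)
  have sub: "homeomorphic_map (subtopology T H1) (subtopology T' H) \<rho>"
    by (rule homeomorphic_map_subtopologies[OF homeo])
       (use pre_image[OF HG'] homeomorphic_imp_surjective_map[OF homeo] bij top HG' in
         \<open>auto simp: H1_def bij_betw_def\<close>)
  show ?thesis
    unfolding bruhat_schwartz_def
  proof (rule exI[of _ H1], rule exI[of _ ks], rule exI[of _ "\<pi> \<circ> \<rho>"], rule exI[of _ \<phi>], intro conjI)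
    show "subgroup H1 G"
    proof
      show "H1 \<subseteq> carrier G" by (auto simp: H1_def)
      show "\<one>\<^bsub>G\<^esub> \<in> H1" using subgroup.one_closed[OF H(1)] by (simp add: H1_def)
      show "x \<otimes>\<^bsub>G\<^esub> y \<in> H1" if "x \<in> H1" "y \<in> H1" for x y
        using that subgroup.m_closed[OF H(1)] by (simp add: H1_def)
      show "inv\<^bsub>G\<^esub> x \<in> H1" if "x \<in> H1" for x
        using that subgroup.m_inv_closed[OF H(1)] by (simp add: H1_def)
    qed
    show "openin T H1"
      using openin_continuous_map_preimage[OF homeomorphic_imp_continuous_map[OF homeo] H(2)]
      by (simp add: H1_def top)
    define C1 where "C1 = {x \<in> carrier G. \<rho> x \<in> C}"
    have CG': "C \<subseteq> carrier G'" using C(2) HG' by blast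
    have "\<rho> ` generate G C1 = \<rho> ` H1"
      using hom.generate_img[of C1] pre_image[OF CG'] pre_image[OF HG'] C(3)
      by (simp add: C1_def H1_def)
    moreover have "generate G C1 \<subseteq> carrier G"
      by (rule hom.G.generate_incl) (auto simp: C1_def)
    ultimately have "generate G C1 = H1"
      using inj_on_image_eq_iff[OF inj] by (auto simp: H1_def)
    then show "\<exists>C. compactin T C \<and> C \<subseteq> H1 \<and> generate G C = H1"
      using comp[OF C(1) CG'] C(2) by (intro exI[of _ C1]) (auto simp: C1_def H1_def)
    show "\<pi> \<circ> \<rho> \<in> hom (G\<lparr>carrier := H1\<rparr>) (elementary_group ks)"
      using \<pi>(1) by (auto simp: hom_def H1_def)
    show "(\<pi> \<circ> \<rho>) ` H1 = carrier (elementary_group ks)"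
      using \<pi>(2) pre_image[OF HG'] by (simp only: H1_def flip: image_comp)
    show "continuous_map (subtopology T H1) (elementary_topology ks) (\<pi> \<circ> \<rho>)"
      by (rule continuous_map_compose[OF homeomorphic_imp_continuous_map[OF sub] \<pi>(3)])
    show "open_map (subtopology T H1) (elementary_topology ks) (\<pi> \<circ> \<rho>)"
      by (rule open_map_compose[OF homeomorphic_imp_open_map[OF sub] \<pi>(4)])
    have "{x \<in> H1. (\<pi> \<circ> \<rho>) x = one (elementary_group ks)} =
        {x \<in> carrier G. \<rho> x \<in> {x \<in> H. \<pi> x = one (elementary_group ks)}}"
      by (auto simp: H1_def)
    then show "compactin T {x \<in> H1. (\<pi> \<circ> \<rho>) x = one (elementary_group ks)}"
      using comp[OF \<pi>(5)] HG' by auto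
    show "schwartz_elementary ks \<phi>" by (rule \<phi>(1))
    show "\<forall>x\<in>H1. (g \<circ> \<rho>) x = \<phi> ((\<pi> \<circ> \<rho>) x)" using \<phi>(2) by (simp add: H1_def)
    show "\<forall>x\<in>carrier G - H1. (g \<circ> \<rho>) x = 0" using \<phi>(3) by (simp add: H1_def)
  qed
qed

section \<open>Characters and Bruhat--Schwartz functions of filtered groups\<close>

text \<open>Chosen so that the only element whose iterated doubles (squares, in multiplicative
  notation) all stay inside is the identity.\<close>

definition factor_nbhd :: "factor \<Rightarrow> complex set" where
  "factor_nbhd k = (case k of Real_Line \<Rightarrow> ball 0 1 | Integers \<Rightarrow> ball 0 1 | _ \<Rightarrow> {z. Re z > 0})"

text \<open>|y^2 - 1| = |y + 1| |y - 1|, and on the unit circle with positive real part |y + 1|^2 =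
  2 + 2 Re y is at least 2. A nonzero squared distance to 1 would at least double at each step, but
  it is bounded by 4.\<close>

lemma squares_in_halfplane:
  assumes unit: "\<And>j::nat. norm (y j) = 1" and step: "\<And>j. y (Suc j) = y j * y j"
    and pos: "\<And>j. Re (y j) > 0"
  shows "y 0 = (1::complex)"
proof (rule ccontr)
  assume "y 0 \<noteq> 1"
  then have d: "(norm (y 0 - 1))\<^sup>2 > 0" by simp
  have grow: "(norm (y j - 1))\<^sup>2 \<ge> 2 ^ j * (norm (y 0 - 1))\<^sup>2" for j
  proof (induction j)
    case (Suc j)
    have "(norm (y j + 1))\<^sup>2 = (norm (y j))\<^sup>2 + 2 * Re (y j) + 1"
      unfolding cmod_power2 by (simp add: power2_eq_square algebra_simps)
    then have "(norm (y j + 1))\<^sup>2 \<ge> 2" using unit[of j] pos[of j] by simp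
    moreover have "(norm (y (Suc j) - 1))\<^sup>2 = (norm (y j + 1))\<^sup>2 * (norm (y j - 1))\<^sup>2"
      by (simp add: step flip: norm_mult power_mult_distrib) (simp add: algebra_simps)
    ultimately have "(norm (y (Suc j) - 1))\<^sup>2 \<ge> 2 * (norm (y j - 1))\<^sup>2"
      by (simp add: mult_right_mono)
    then show ?case using Suc by simp
  qed simp
  have bound: "(norm (y j - 1))\<^sup>2 \<le> 4" for j
  proof -
    have "norm (y j - 1) \<le> 2" using norm_triangle_ineq4[of "y j" 1] unit[of j] by simp
    then show ?thesis using power_mono[of "norm (y j - 1)" 2 2] by simp
  qed
  obtain j where "4 / (norm (y 0 - 1))\<^sup>2 < 2 ^ j" using real_arch_pow[of 2 "4 / (norm (y 0 - 1))\<^sup>2"] by auto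
  then have "4 < 2 ^ j * (norm (y 0 - 1))\<^sup>2" using d by (simp add: field_simps)
  then show False using grow[of j] bound[of j] by simp
qed

lemma doubles_in_ball:
  assumes step: "\<And>j::nat. y (Suc j) = y j + y j" and ball: "\<And>j. norm (y j) < 1"
  shows "y 0 = (0::complex)"
proof (rule ccontr)
  assume "y 0 \<noteq> 0"
  have y: "y j = 2 ^ j * y 0" for j by (induction j) (simp_all add: step)
  obtain j where "1 / norm (y 0) < 2 ^ j" using real_arch_pow[of 2 "1 / norm (y 0)"] by auto
  then have "1 < norm (y j)" unfolding y[of j] using \<open>y 0 \<noteq> 0\<close> by (simp add: norm_mult norm_power field_simps)
  then show False using ball[of j] by simp
qed

lemma factor_no_small_subgroups:
  assumes "\<And>j::nat. y j \<in> carrier (factor_group k)"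
    and "\<And>j. y (Suc j) = y j \<otimes>\<^bsub>factor_group k\<^esub> y j"
    and "\<And>j. y j \<in> factor_nbhd k"
  shows "y 0 = one (factor_group k)"
proof (cases k)
  case Real_Line
  then show ?thesis using doubles_in_ball[of y] assms by (simp add: factor_nbhd_def)
next
  case Integers
  then show ?thesis using doubles_in_ball[of y] assms by (simp add: factor_nbhd_def)
next
  case Circle
  then show ?thesis using squares_in_halfplane[of y] assms by (simp add: factor_nbhd_def circle_group_def)
next
  case (Cyclic d)
  have "norm z = 1" if "z ^ Suc d = 1" for z :: complex
    using that norm_power[of z "Suc d"] power_eq_1_iff[of "norm z" "Suc d"] by simp
  then show ?thesis using squares_in_halfplane[of y] assms Cyclic by (simp add: factor_nbhd_def)
qed

text \<open>Absence of small subgroups, stated for doubling orbits: the orbit of a point of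
  \<open>B n\<close> stays in \<open>B n\<close>, and this is how the neighbourhood is
  applied.\<close>

lemma elementary_nbhd:
  obtains U where "openin (elementary_topology ks) U" "one (elementary_group ks) \<in> U"
    "\<And>y. \<lbrakk>\<And>j::nat. y j \<in> carrier (elementary_group ks);
      \<And>j. y (Suc j) = y j \<otimes>\<^bsub>elementary_group ks\<^esub> y j; \<And>j. y j \<in> U\<rbrakk> \<Longrightarrow> y 0 = one (elementary_group ks)"
proof
  let ?U = "PiE {..<length ks} (\<lambda>i. carrier (factor_group (ks ! i)) \<inter> factor_nbhd (ks ! i))"
  have "open (factor_nbhd k)" for k
    by (cases k) (simp_all add: factor_nbhd_def open_halfspace_Re_gt)
  then show "openin (elementary_topology ks) ?U"
    unfolding elementary_topology_def
    by (subst openin_PiE) (auto simp: openin_open)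
  have "one (factor_group k) \<in> carrier (factor_group k) \<inter> factor_nbhd k" for k
    by (cases k) (simp_all add: factor_nbhd_def circle_group_def)
  then show "one (elementary_group ks) \<in> ?U"
    by (auto simp: elementary_group_def)
  fix y :: "nat \<Rightarrow> nat \<Rightarrow> complex"
  assume y: "\<And>j. y j \<in> carrier (elementary_group ks)"
    "\<And>j. y (Suc j) = y j \<otimes>\<^bsub>elementary_group ks\<^esub> y j" "\<And>j. y j \<in> ?U"
  have "y 0 i = one (elementary_group ks) i" for i
  proof (cases "i < length ks")
    case True
    have "y 0 i = one (factor_group (ks ! i))"
      by (rule factor_no_small_subgroups[of "\<lambda>j. y j i"])
         (use y True in \<open>auto simp: elementary_group_def PiE_iff\<close>)
    then show ?thesis using True by (simp add: elementary_group_def)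
  next
    case False
    then show ?thesis using y(1)[of 0] by (auto simp: elementary_group_def PiE_iff extensional_def)
  qed
  then show "y 0 = one (elementary_group ks)" by blast
qed

context filtered_group
begin

lemma doubling_in_B: "x \<in> B n \<Longrightarrow> ((\<lambda>z. z + z) ^^ j) x \<in> B n"
  by (induction j) (simp_all add: B_intros(4))

lemma subgroup_B: "subgroup (B n) (additive_group S)"
proof -
  interpret comm_group "additive_group S" by (rule comm_group_additive_group[OF S_group])
  show ?thesis
  proof (rule subgroupI)
    show "B n \<noteq> {}" using B_intros(1) by blast
    show "inv\<^bsub>additive_group S\<^esub> a \<in> B n" if "a \<in> B n" for a
      using that B_intros(3) B_in_S S_group by simp
  qed (use B_sub_S B_intros(4) in simp_all)
qed

text \<open>The support lies in \<open>H\<close>, which is generated by a compact set and hence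
  contained in one \<open>B m\<close>. A small \<open>B n\<close> is mapped by \<open>\<pi>\<close>
  into a neighbourhood without small subgroups, so \<open>\<pi>\<close> is trivial on it and
  \<open>f\<close> is constant on its cosets.\<close>

lemma bruhat_schwartz_locally_constant:
  assumes "bruhat_schwartz (additive_group S) T f"
  shows "\<exists>m n. (\<forall>x\<in>S. \<forall>b\<in>B n. f (x + b) = f x) \<and> (\<forall>x\<in>S - B m. f x = 0)"
proof -
  obtain H C ks \<pi> \<phi> where H: "subgroup H (additive_group S)" "openin T H"
    and C: "compactin T C" "C \<subseteq> H" "generate (additive_group S) C = H"
    and \<pi>: "\<pi> \<in> hom ((additive_group S)\<lparr>carrier := H\<rparr>) (elementary_group ks)"
    "continuous_map (subtopology T H) (elementary_topology ks) \<pi>"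
    and \<phi>: "\<forall>x\<in>H. f x = \<phi> (\<pi> x)" "\<forall>x\<in>carrier (additive_group S) - H. f x = 0"
    using assms unfolding bruhat_schwartz_def by (elim exE conjE) (rule that; assumption)
  interpret comm_group "additive_group S" by (rule comm_group_additive_group[OF S_group])
  obtain m where m: "C \<subseteq> B m" using compactin_bounded[OF C(1)] by blast
  have HB: "H \<subseteq> B m" using generate_subgroup_incl[OF m subgroup_B] C(3) by simp
  have HS: "H \<subseteq> S" using HB B_sub_S by blast
  have H0: "0 \<in> H" using subgroup.one_closed[OF H(1)] by simp
  have Hadd: "x + y \<in> H" if "x \<in> H" "y \<in> H" for x y using subgroup.m_closed[OF H(1) that] by simp
  have Hdiff: "x - y \<in> H" if "x \<in> H" "y \<in> H" for x y
    using Hadd[OF that(1) subgroup.m_inv_closed[OF H(1) that(2)]] that HS S_group by auto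
  have \<pi>_add: "\<pi> (x + y) = \<pi> x \<otimes>\<^bsub>elementary_group ks\<^esub> \<pi> y" if "x \<in> H" "y \<in> H" for x y
    using \<pi>(1) that by (simp add: hom_def)
  have \<pi>_car: "\<pi> x \<in> carrier (elementary_group ks)" if "x \<in> H" for x
    using \<pi>(1) that by (auto simp: hom_def)
  obtain U where U: "openin (elementary_topology ks) U" "one (elementary_group ks) \<in> U"
    "\<And>y. \<lbrakk>\<And>j::nat. y j \<in> carrier (elementary_group ks);
      \<And>j. y (Suc j) = y j \<otimes>\<^bsub>elementary_group ks\<^esub> y j; \<And>j. y j \<in> U\<rbrakk> \<Longrightarrow> y 0 = one (elementary_group ks)"
    using elementary_nbhd by blast
  \<comment> \<open>An idempotent in a product of groups is the identity; this is checked in each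
    factor.\<close>
  have \<pi>0: "\<pi> 0 = one (elementary_group ks)"
  proof -
    have eq: "\<pi> 0 = \<pi> 0 \<otimes>\<^bsub>elementary_group ks\<^esub> \<pi> 0" using \<pi>_add[OF H0 H0] by simp
    have "\<pi> 0 i = one (elementary_group ks) i" for i
    proof (cases "i < length ks")
      case True
      have "\<pi> 0 i \<in> carrier (factor_group (ks ! i))"
        using \<pi>_car[OF H0] True by (auto simp: elementary_group_def)
      moreover have "\<pi> 0 i = \<pi> 0 i \<otimes>\<^bsub>factor_group (ks ! i)\<^esub> \<pi> 0 i"
        using fun_cong[OF eq, of i] True by (simp add: elementary_group_def)
      ultimately have "\<pi> 0 i = one (factor_group (ks ! i))"
        by (cases "ks ! i") (auto simp: circle_group_def)
      then show ?thesis using True by (simp add: elementary_group_def)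
    next
      case False
      then show ?thesis using \<pi>_car[OF H0] by (auto simp: elementary_group_def PiE_iff extensional_def)
    qed
    then show ?thesis by blast
  qed
  have "openin (subtopology T H) {x \<in> topspace (subtopology T H). \<pi> x \<in> U}"
    by (rule openin_continuous_map_preimage[OF \<pi>(2) U(1)])
  then have op: "openin T {x \<in> topspace (subtopology T H). \<pi> x \<in> U}"
    using openin_trans_full[OF _ H(2)] by blast
  have "topspace (subtopology T H) = H" using HS topspace_T by auto
  with op have "openin T {x \<in> H. \<pi> x \<in> U}" by (simp only:)
  moreover have "0 \<in> {x \<in> H. \<pi> x \<in> U}" using H0 U(2) \<pi>0 by simp
  ultimately obtain n where "\<forall>b\<in>B n. 0 + b \<in> {x \<in> H. \<pi> x \<in> U}" unfolding openin_iff by blast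
  then have n: "b \<in> H" "\<pi> b \<in> U" if "b \<in> B n" for b using that by auto
  have triv: "\<pi> b = one (elementary_group ks)" if b: "b \<in> B n" for b
    using U(3)[of "\<lambda>j. \<pi> (((\<lambda>z. z + z) ^^ j) b)"] doubling_in_B[OF b] n \<pi>_car \<pi>_add by simp
  show ?thesis
  proof (intro exI conjI ballI)
    fix x b assume x: "x \<in> S" and b: "b \<in> B n"
    show "f (x + b) = f x"
    proof (cases "x \<in> H")
      case True
      have "\<pi> (x + b) = \<pi> x" using \<pi>_add[OF True n(1)[OF b]] \<pi>_add[OF True H0] triv[OF b] \<pi>0 by simp
      then show ?thesis using \<phi>(1) True Hadd[OF True n(1)[OF b]] by simp
    next
      case False
      then have "x + b \<notin> H" using Hdiff[of "x + b" b] n(1)[OF b] by auto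
      then show ?thesis using False \<phi>(2) x S_intros(4)[OF x B_in_S[OF b]] by simp
    qed
  next
    fix x assume "x \<in> S - B m"
    then show "f x = 0" using HB \<phi>(2) by auto
  qed
qed

text \<open>\<open>H = B n\<close> with the trivial elementary quotient: the empty product, whose
  only element is the everywhere \<open>undefined\<close> function. This indicator is the test
  function that pins down the Weil index.\<close>

lemma bruhat_schwartz_indicator_B:
  "bruhat_schwartz (additive_group S) T (\<lambda>x. indicator (B n) x)"
  unfolding bruhat_schwartz_def
proof (rule exI[of _ "B n"], rule exI[of _ "[]"], rule exI[of _ "\<lambda>_ _. undefined"], rule exI[of _ "\<lambda>_. 1"], intro conjI)
  interpret comm_group "additive_group S" by (rule comm_group_additive_group[OF S_group])
  show sub: "subgroup (B n) (additive_group S)" by (rule subgroup_B)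
  have "generate (additive_group S) (B n) = B n"
  proof (rule antisym)
    show "generate (additive_group S) (B n) \<subseteq> B n"
      by (rule generate_subgroup_incl[OF subset_refl sub])
  qed (rule subsetI, rule generate.incl)
  then show "\<exists>C. compactin T C \<and> C \<subseteq> B n \<and> generate (additive_group S) C = B n"
    by (intro exI[of _ "B n"] conjI compactin_B subset_refl)
  have one: "carrier (elementary_group []) = {\<lambda>_. undefined}"
    by (simp add: elementary_group_def)
  show "(\<lambda>_ _. undefined) \<in> hom ((additive_group S)\<lparr>carrier := B n\<rparr>) (elementary_group [])"
    by (simp add: hom_def elementary_group_def fun_eq_iff)
  show "(\<lambda>_ _. undefined) ` B n = carrier (elementary_group [])"
    using B_intros(1)[of n] by (auto simp: one)
  have top: "topspace (elementary_topology []) = {\<lambda>_. undefined}"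
    by (simp add: elementary_topology_def)
  then show "continuous_map (subtopology T (B n)) (elementary_topology []) (\<lambda>_ _. undefined)"
    by simp
  show "open_map (subtopology T (B n)) (elementary_topology []) (\<lambda>_ _. undefined)"
    unfolding open_map_def
  proof (intro allI impI)
    fix U
    have "(\<lambda>_ _. undefined) ` U = {} \<or> (\<lambda>_ _. undefined) ` U = topspace (elementary_topology [])"
      by (auto simp: top)
    then show "openin (elementary_topology []) ((\<lambda>_ _. undefined) ` U)" by auto
  qed
  show "compactin T {x \<in> B n. (\<lambda>_. undefined) = one (elementary_group [])}"
    using compactin_B by (simp add: elementary_group_def restrict_def)
  show "schwartz_elementary [] (\<lambda>_. 1)"
    by (simp add: schwartz_elementary_def one)
  show "openin T (B n)" by (rule openin_compact_open[OF compact_open_B])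
qed auto

text \<open>Continuity sends some \<open>B n\<close> into the right half plane; the values along a
  doubling orbit are successive squares, so \<open>squares_in_halfplane\<close> applies.\<close>

lemma character_locally_trivial:
  assumes add: "\<And>x y. x \<in> S \<Longrightarrow> y \<in> S \<Longrightarrow> \<xi> (x + y) = \<xi> x * \<xi> y"
    and unit: "\<And>x. x \<in> S \<Longrightarrow> norm (\<xi> x) = 1" and cont: "continuous_map T euclidean \<xi>"
  obtains n where "\<And>b. b \<in> B n \<Longrightarrow> \<xi> b = (1::complex)"
proof -
  have "\<xi> 0 * \<xi> 0 = \<xi> 0" using add[of 0 0] S_intros(1) by simp
  then have \<xi>0: "\<xi> 0 = 1" using unit[OF S_intros(1)] by auto
  have "open {z. Re z > 0}" by (rule open_halfspace_Re_gt)
  then have "openin T {x \<in> topspace T. \<xi> x \<in> {z. Re z > 0}}"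
    by (intro openin_continuous_map_preimage[OF cont]) simp
  moreover have "0 \<in> {x \<in> topspace T. \<xi> x \<in> {z. Re z > 0}}" using \<xi>0 S_intros(1) topspace_T by simp
  ultimately obtain n where "\<forall>b\<in>B n. 0 + b \<in> {x \<in> topspace T. \<xi> x \<in> {z. Re z > 0}}"
    unfolding openin_iff by blast
  then have n: "Re (\<xi> b) > 0" if "b \<in> B n" for b using that by auto
  show ?thesis
  proof
    fix b assume b: "b \<in> B n"
    show "\<xi> b = 1"
    proof -
      let ?y = "\<lambda>j. ((\<lambda>z. z + z) ^^ j) b"
      have y: "?y j \<in> S" "?y j \<in> B n" for j using doubling_in_B[OF b] B_in_S by blast+
      have "\<xi> (?y 0) = 1"
        by (rule squares_in_halfplane[of "\<lambda>j. \<xi> (?y j)"]) (use y unit add n in simp_all)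
      then show ?thesis by simp
    qed
  qed
qed

end

lemma haar_measure_density:
  assumes M: "haar_measure G T M" and \<kappa>: "\<kappa> > 0"
  shows "haar_measure G T (density M (\<lambda>_. ennreal \<kappa>))"
proof -
  define N where "N = density M (\<lambda>_. ennreal \<kappa>)"
  have N: "emeasure N A = ennreal \<kappa> * emeasure M A" for A
  proof (cases "A \<in> sets M")
    case True
    then show ?thesis unfolding N_def by (rule emeasure_density_const)
  qed (simp add: N_def emeasure_notin_sets)
  have setsM: "sets M = sets (sigma (topspace T) {U. openin T U})"
    and Mtop: "emeasure M (topspace T) \<noteq> 0"
    and Mfin: "\<And>C. compactin T C \<Longrightarrow> emeasure M C < \<infinity>"
    and Mout: "\<And>A. A \<in> sets M \<Longrightarrow> emeasure M A = (INF U\<in>{U. openin T U \<and> A \<subseteq> U}. emeasure M U)"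
    and Minn: "\<And>U. openin T U \<Longrightarrow> emeasure M U = (SUP C\<in>{C. compactin T C \<and> C \<subseteq> U}. emeasure M C)"
    and Minv: "\<And>x A. x \<in> carrier G \<Longrightarrow> A \<in> sets M \<Longrightarrow> emeasure M ((\<lambda>y. x \<otimes>\<^bsub>G\<^esub> y) ` A) = emeasure M A"
    using M unfolding haar_measure_def by blast+
  \<comment> \<open>\<kappa> is positive and finite, so multiplication by it has an inverse on the
    extended nonnegative reals and commutes with infima.\<close>
  have INF_mult: "(INF i\<in>I. c * f i) = c * (INF i\<in>I. f i)"
    if c: "c = ennreal \<kappa>" for I :: "'a set set" and f and c :: ennreal
  proof (rule antisym)
    have inv: "ennreal (1 / \<kappa>) * (c * x) = x" "c * (ennreal (1 / \<kappa>) * x) = x" for x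
      using \<kappa> by (simp_all add: c flip: mult.assoc ennreal_mult)
    have "ennreal (1 / \<kappa>) * (INF i\<in>I. c * f i) \<le> (INF i\<in>I. f i)"
    proof (rule INF_greatest)
      fix i assume "i \<in> I"
      then have "ennreal (1 / \<kappa>) * (INF i\<in>I. c * f i) \<le> ennreal (1 / \<kappa>) * (c * f i)"
        by (intro mult_left_mono INF_lower) auto
      then show "ennreal (1 / \<kappa>) * (INF i\<in>I. c * f i) \<le> f i" by (simp add: inv)
    qed
    then have "c * (ennreal (1 / \<kappa>) * (INF i\<in>I. c * f i)) \<le> c * (INF i\<in>I. f i)"
      by (rule mult_left_mono) simp
    then show "(INF i\<in>I. c * f i) \<le> c * (INF i\<in>I. f i)" by (simp add: inv)
    show "c * (INF i\<in>I. f i) \<le> (INF i\<in>I. c * f i)"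
      by (intro INF_greatest mult_left_mono INF_lower) auto
  qed
  have "haar_measure G T N"
    unfolding haar_measure_def
  proof (intro conjI allI impI ballI)
    show "sets N = sets (sigma (topspace T) {U. openin T U})" using setsM by (simp add: N_def)
    show "emeasure N (topspace T) \<noteq> 0" using Mtop \<kappa> by (simp add: N)
    show "emeasure N C < \<infinity>" if "compactin T C" for C
      using Mfin[OF that] by (simp add: N ennreal_mult_less_top)
    show "emeasure N A = (INF U\<in>{U. openin T U \<and> A \<subseteq> U}. emeasure N U)" if "A \<in> sets N" for A
      using Mout[of A] that by (simp add: N INF_mult) (simp add: N_def)
    show "emeasure N U = (SUP C\<in>{C. compactin T C \<and> C \<subseteq> U}. emeasure N C)" if "openin T U" for U
      using Minn[OF that] by (simp add: N SUP_mult_left_ennreal)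
    show "emeasure N ((\<lambda>y. x \<otimes>\<^bsub>G\<^esub> y) ` A) = emeasure N A" if "x \<in> carrier G" "A \<in> sets N" for x A
      using Minv[of x A] that by (simp add: N) (simp add: N_def)
  qed
  then show ?thesis by (simp add: N_def)
qed

section \<open>Quadratic characters of self-dual filtered groups\<close>

text \<open>\<beta>0 is a fixed pairing for which \<open>B n\<close> and \<open>B (a - n)\<close>
  are exact orthogonals, \<tau> stands for multiplication by the coefficient of the form, and
  \<open>h\<close> is quadratic with bilinear form \<open>\<beta>0 x (\<tau> y)\<close>. Keeping
  \<tau> apart preserves the exact duality of the filtration, which \<tau> respects only up to a
  bounded shift.\<close>

locale quadratic_character = filtered_group S T B Q
  for S :: "'a::ab_group_add set" and T B Q +
  fixes \<beta>0 :: "'a \<Rightarrow> 'a \<Rightarrow> complex" and a :: int and \<tau> :: "'a \<Rightarrow> 'a" and h :: "'a \<Rightarrow> complex"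
  assumes \<beta>0_add: "\<lbrakk>x \<in> S; y \<in> S; z \<in> S\<rbrakk> \<Longrightarrow> \<beta>0 (x + y) z = \<beta>0 x z * \<beta>0 y z"
    and \<beta>0_sym: "\<lbrakk>x \<in> S; y \<in> S\<rbrakk> \<Longrightarrow> \<beta>0 x y = \<beta>0 y x"
    and \<beta>0_norm: "\<lbrakk>x \<in> S; y \<in> S\<rbrakk> \<Longrightarrow> norm (\<beta>0 x y) = 1"
    and \<beta>0_perp: "y \<in> S \<Longrightarrow> (\<forall>x\<in>B n. \<beta>0 x y = 1) \<longleftrightarrow> y \<in> B (a - n)"
    and \<tau>_bij: "bij_betw \<tau> S S"
    and \<tau>_add: "\<lbrakk>x \<in> S; y \<in> S\<rbrakk> \<Longrightarrow> \<tau> (x + y) = \<tau> x + \<tau> y"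
    and \<tau>_bounded: "\<exists>k. \<forall>n. \<forall>x\<in>S. (x \<in> B n \<longrightarrow> \<tau> x \<in> B (n - k)) \<and> (\<tau> x \<in> B n \<longrightarrow> x \<in> B (n - k))"
    and h_norm: "x \<in> S \<Longrightarrow> norm (h x) = 1"
    and h_minus: "x \<in> S \<Longrightarrow> h (- x) = h x"
    and h_add: "\<lbrakk>x \<in> S; y \<in> S\<rbrakk> \<Longrightarrow> h (x + y) = h x * h y * \<beta>0 x (\<tau> y)"
    and h_trivial: "\<exists>n. \<forall>x\<in>B n. h x = 1"
begin

definition \<beta> :: "'a \<Rightarrow> 'a \<Rightarrow> complex" where "\<beta> x y = \<beta>0 x (\<tau> y)"

text \<open>The orthogonal of \<open>B n\<close> under \<beta> (\<open>D_iff\<close>), written as a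
  preimage under \<tau> so that indices can be transported.\<close>

definition D :: "int \<Rightarrow> 'a set" where "D n = {y \<in> S. \<tau> y \<in> B (a - n)}"

lemma \<tau>_in_S: "x \<in> S \<Longrightarrow> \<tau> x \<in> S"
  using \<tau>_bij by (auto simp: bij_betw_def)

lemma h_nonzero: "x \<in> S \<Longrightarrow> h x \<noteq> 0"
  using h_norm by fastforce

lemma h_inverse: "x \<in> S \<Longrightarrow> inverse (h x) = cnj (h x)"
  using complex_norm_square[of "h x"] h_norm[of x] by (intro inverse_unique) simp

lemma \<tau>_diff: "x \<in> S \<Longrightarrow> y \<in> S \<Longrightarrow> \<tau> (x - y) = \<tau> x - \<tau> y"
  using \<tau>_add[of "x - y" y] S_intros(2)[of x y] by simp

lemma \<beta>_add_left: "\<lbrakk>x \<in> S; y \<in> S; z \<in> S\<rbrakk> \<Longrightarrow> \<beta> (x + y) z = \<beta> x z * \<beta> y z"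
  by (simp add: \<beta>_def \<beta>0_add \<tau>_in_S)

lemma h_add_\<beta>: "\<lbrakk>x \<in> S; y \<in> S\<rbrakk> \<Longrightarrow> h (x + y) = h x * h y * \<beta> x y"
  by (simp add: \<beta>_def h_add)

lemma \<beta>_sym: "\<lbrakk>x \<in> S; y \<in> S\<rbrakk> \<Longrightarrow> \<beta> x y = \<beta> y x"
  using h_add_\<beta>[of x y] h_add_\<beta>[of y x] h_nonzero by (simp add: add.commute)

lemma \<beta>_add_right: "\<lbrakk>x \<in> S; y \<in> S; z \<in> S\<rbrakk> \<Longrightarrow> \<beta> z (x + y) = \<beta> z x * \<beta> z y"
  using \<beta>_add_left[of x y z] \<beta>_sym S_intros(4) by metis

lemma \<beta>_norm: "\<lbrakk>x \<in> S; y \<in> S\<rbrakk> \<Longrightarrow> norm (\<beta> x y) = 1"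
  by (simp add: \<beta>_def \<beta>0_norm \<tau>_in_S)

lemma \<beta>_zero: "x \<in> S \<Longrightarrow> \<beta> 0 x = 1"
  using \<beta>_add_left[of 0 0 x] \<beta>_norm[of 0 x] S_intros(1) by auto

lemma \<beta>_zero_right: "x \<in> S \<Longrightarrow> \<beta> x 0 = 1"
  using \<beta>_zero \<beta>_sym S_intros(1) by metis

lemma \<beta>_minus_right: "\<lbrakk>x \<in> S; y \<in> S\<rbrakk> \<Longrightarrow> \<beta> x (- y) = cnj (\<beta> x y)"
proof -
  assume xy: "x \<in> S" "y \<in> S"
  have "\<beta> x (- y) * \<beta> x y = 1"
    using \<beta>_add_right[of "- y" y x] xy S_intros(3) \<beta>_zero_right by simp
  moreover have "cnj (\<beta> x y) * \<beta> x y = 1"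
    using \<beta>_norm[OF xy] complex_norm_square[of "\<beta> x y"] by (simp add: mult.commute)
  moreover have "\<beta> x y \<noteq> 0" using \<beta>_norm[OF xy] by auto
  ultimately show ?thesis by (metis mult_right_cancel)
qed

lemma D_in_S: "x \<in> D n \<Longrightarrow> x \<in> S"
  by (simp add: D_def)

lemma D_iff: "y \<in> S \<Longrightarrow> y \<in> D n \<longleftrightarrow> (\<forall>x\<in>B n. \<beta> x y = 1)"
  using \<beta>0_perp[OF \<tau>_in_S] by (simp add: D_def \<beta>_def)

lemma \<beta>_B_D: "x \<in> B n \<Longrightarrow> y \<in> D n \<Longrightarrow> \<beta> x y = 1"
  using D_iff D_in_S by blast

lemma \<beta>_D_B: "x \<in> B n \<Longrightarrow> y \<in> D n \<Longrightarrow> \<beta> y x = 1"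
  using \<beta>_B_D \<beta>_sym D_in_S B_in_S by metis

text \<open>Biduality: \<tau> is onto, so it maps \<open>D n\<close> onto \<open>B (a - n)\<close>,
  whose orthogonal under \<beta>0 is \<open>B n\<close>.\<close>

lemma B_iff: "x \<in> S \<Longrightarrow> x \<in> B n \<longleftrightarrow> (\<forall>y\<in>D n. \<beta> x y = 1)"
proof
  assume x: "x \<in> S" and all: "\<forall>y\<in>D n. \<beta> x y = 1"
  have "\<beta>0 z x = 1" if z: "z \<in> B (a - n)" for z
  proof -
    have "z \<in> \<tau> ` S" using \<tau>_bij B_in_S[OF z] by (simp add: bij_betw_def)
    then obtain y where y: "y \<in> S" "\<tau> y = z" by blast
    then have "\<beta> x y = 1" using all z by (simp add: D_def)
    then show ?thesis using \<beta>0_sym[OF x B_in_S[OF z]] y by (simp add: \<beta>_def)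
  qed
  then show "x \<in> B n" using \<beta>0_perp[OF x, of "a - n"] by simp
qed (use \<beta>_B_D in blast)

lemma D_group: "add_subgroup (D n)"
  unfolding add_subgroup_def
proof (intro conjI ballI)
  show "0 \<in> D n" using D_iff[OF S_intros(1)] \<beta>_zero_right B_in_S by blast
  show "x - y \<in> D n" if "x \<in> D n" "y \<in> D n" for x y
    using that \<tau>_diff S_intros(2) B_intros(2) by (simp add: D_def)
qed

lemma D_mono: "m \<le> n \<Longrightarrow> D m \<subseteq> D n"
  using B_antimono[of "a - n" "a - m"] by (auto simp: D_def)

lemma D_B_sandwich: "\<exists>k. \<forall>n. B (a - n + k) \<subseteq> D n \<and> D n \<subseteq> B (a - n - k)"
proof -
  obtain k where k: "\<And>n x. x \<in> S \<Longrightarrow> (x \<in> B n \<longrightarrow> \<tau> x \<in> B (n - k)) \<and> (\<tau> x \<in> B n \<longrightarrow> x \<in> B (n - k))"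
    using \<tau>_bounded by blast
  have "B (a - n + k) \<subseteq> D n" for n
  proof
    fix x assume x: "x \<in> B (a - n + k)"
    then show "x \<in> D n" using k[OF B_in_S[OF x], of "a - n + k"] B_in_S[OF x] by (simp add: D_def)
  qed
  moreover have "D n \<subseteq> B (a - n - k)" for n using k by (auto simp: D_def)
  ultimately show ?thesis by blast
qed

lemma compact_open_D: "compact_open (D n)"
proof -
  obtain k where k: "B (a - n + k) \<subseteq> D n" "D n \<subseteq> B (a - n - k)" using D_B_sandwich by blast
  have "coset_stable (D n) (B (a - n + k))"
    using k(1) add_subgroup_add[OF D_group] unfolding coset_stable_def by blast
  then show ?thesis using k(2) unfolding compact_open_def by blast
qed

lemma D_absorbs_B: "\<exists>n0. \<forall>n\<ge>n0. B m \<subseteq> D n"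
proof -
  obtain k where k: "\<And>n. B (a - n + k) \<subseteq> D n" using D_B_sandwich by blast
  have "B m \<subseteq> D n" if "n \<ge> a + k - m" for n
    using k[of n] B_antimono[of "a - n + k" m] that by auto
  then show ?thesis by blast
qed

lemma B_absorbs_D: "\<exists>n0. \<forall>n\<ge>n0. D m \<subseteq> B (- n)"
proof -
  obtain k where k: "\<And>n. D n \<subseteq> B (a - n - k)" using D_B_sandwich by blast
  have "D m \<subseteq> B (- n)" if "n \<ge> - (a - m - k)" for n
    using k[of m] B_antimono[of "- n" "a - m - k"] that by auto
  then show ?thesis by blast
qed

lemma D_small_in_B: "\<exists>n0. \<forall>n\<le>n0. D n \<subseteq> B m"
proof -
  obtain k where k: "\<And>n. D n \<subseteq> B (a - n - k)" using D_B_sandwich by blast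
  have "D n \<subseteq> B m" if "n \<le> a - k - m" for n
    using k[of n] B_antimono[of m "a - n - k"] that by auto
  then show ?thesis by blast
qed

text \<open>The product of the volumes of any \<open>B n\<close> and its orthogonal
  (\<open>vol_D\<close>). It is the constant by which Fourier inversion on \<open>S\<close> through
  \<beta> misses the identity.\<close>

definition \<delta> :: real where "\<delta> = vol (D 0)"

text \<open>For \<open>m \<le> n\<close> the inverse of \<tau> carries representatives of
  \<open>B (a - n)\<close> modulo \<open>B (a - m)\<close> to representatives of \<open>D n\<close>
  modulo \<open>D m\<close>; so the volume of \<open>D n\<close> grows by the factor by which that
  of \<open>B n\<close> shrinks.\<close>

lemma vol_D: "vol (D n) * vol (B n) = \<delta>"
proof -
  have eq: "vol (D n) = real Q ^ nat (n - m) * vol (D m)" if mn: "m \<le> n" for m n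
  proof -
    obtain R where R: "transversal R (B (a - n)) (B (a - m))" "card R = Q ^ nat (n - m)"
      using transversal_B[of "a - n" "a - m"] mn by auto
    define R' where "R' = inv_into S \<tau> ` R"
    have inv: "inv_into S \<tau> z \<in> S" "\<tau> (inv_into S \<tau> z) = z" if "z \<in> S" for z
      using \<tau>_bij that by (auto simp: bij_betw_def inv_into_into f_inv_into_f)
    have RS: "r \<in> S" "r \<in> B (a - n)" if "r \<in> R" for r using transversal_subset[OF R(1)] that B_in_S by auto
    have R': "transversal R' (D n) (D m)"
    proof (rule transversalI[OF D_group])
      show "finite R'" using transversal_finite[OF R(1)] by (simp add: R'_def)
      show "R' \<subseteq> D n" using inv RS by (auto simp: R'_def D_def)
      show "\<exists>r\<in>R'. x - r \<in> D m" if x: "x \<in> D n" for x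
      proof -
        obtain r where r: "r \<in> R" "\<tau> x - r \<in> B (a - m)" using x transversal_ex[OF R(1)] by (auto simp: D_def)
        have "x - inv_into S \<tau> r \<in> D m"
          using inv[OF RS(1)[OF r(1)]] r(2) D_in_S[OF x] \<tau>_diff S_intros(2) by (simp add: D_def)
        then show ?thesis using r(1) by (auto simp: R'_def)
      qed
      fix r s assume rs: "r \<in> R'" "s \<in> R'" "r - s \<in> D m"
      obtain u w where u: "u \<in> R" "w \<in> R" "r = inv_into S \<tau> u" "s = inv_into S \<tau> w"
        using rs by (auto simp: R'_def)
      have "\<tau> (r - s) = u - w" using u inv RS(1) \<tau>_diff by simp
      then have "u - w \<in> B (a - m)" using rs(3) by (simp add: D_def)
      then have "u = w" using transversal_eq[OF R(1) B_group u(1,2)] by blast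
      then show "r = s" using u by simp
    qed
    have card': "card R' = card R"
      unfolding R'_def by (rule card_image) (metis inj_onI inv(2) RS(1))
    obtain l where l: "coset_stable (D m) (B l)" "coset_stable (D n) (B l)"
      using compact_open_common_level[OF compact_open_D compact_open_D] by metis
    obtain R2 where R2: "transversal R2 (D m) (B l)"
      using l(1) compact_open_D[of m] transversal_compact_open unfolding compact_open_def by metis
    have lD: "B l \<subseteq> D m"
      using l(1) add_subgroup_zero[OF D_group] unfolding coset_stable_def by (metis add_0 subsetI)
    have stab: "coset_stable (D n) (D m)"
      using D_mono[OF mn] add_subgroup_add[OF D_group] unfolding coset_stable_def by blast
    note ref = transversal_refine[OF R' R2 D_group B_group lD stab]
    show ?thesis
      using vol_eq[OF l(2) ref(1)] vol_eq[OF l(1) R2] ref(2) card' R(2) by simp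
  qed
  have pw: "real Q ^ nat k * real Q powi (- k) = 1" if "k \<ge> 0" for k
    using that Q_pos by (simp add: power_int_def power_inverse flip: power_mult_distrib)
  show ?thesis
  proof (cases "n \<ge> 0")
    case True
    then show ?thesis using eq[of 0 n] pw[of n] by (simp add: \<delta>_def vol_B)
  next
    case False
    then have "\<delta> = real Q ^ nat (- n) * vol (D n)" using eq[of n 0] by (simp add: \<delta>_def)
    moreover have "real Q powi (- n) = real Q ^ nat (- n)" using False by (simp add: power_int_def)
    ultimately show ?thesis by (simp add: vol_B)
  qed
qed

lemma vol_B_pos: "vol (B n) > 0"
  using Q_pos by (simp add: vol_B zero_less_power_int)

lemma \<delta>_pos: "\<delta> > 0"
proof -
  obtain m n where mn: "D 0 \<subseteq> B m" "coset_stable (D 0) (B n)" using compact_open_D[of 0] unfolding compact_open_def by blast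
  obtain R where R: "transversal R (D 0) (B n)" using transversal_compact_open mn by blast
  have "R \<noteq> {}" using transversal_ex[OF R add_subgroup_zero[OF D_group]] by blast
  then have "card R > 0" using transversal_finite[OF R] by (simp add: card_gt_0_iff)
  then show ?thesis
    using vol_eq[OF mn(2) R] Q_pos by (simp add: \<delta>_def zero_less_power_int)
qed

lemma vol_D_pos: "vol (D n) > 0"
  using vol_D[of n] vol_B_pos[of n] \<delta>_pos by (metis zero_less_mult_pos2)

lemma exists_D_level: "x \<in> S \<Longrightarrow> \<exists>n0. \<forall>n\<ge>n0. x \<in> D n"
  using S_in_B D_absorbs_B by (meson subsetD)

lemma common_level:
  obtains l where "l \<ge> l0" "coset_stable (D n) (B l)" "coset_stable (B m) (B l)" "B l \<subseteq> D k"
proof -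
  obtain l1 where l1: "\<And>l. l \<ge> l1 \<Longrightarrow> coset_stable (D n) (B l) \<and> D n \<subseteq> B (- l)"
    using compact_open_level[OF compact_open_D] by metis
  obtain k' where k': "\<And>n. B (a - n + k') \<subseteq> D n" using D_B_sandwich by blast
  define l where "l = max (max l0 l1) (max m (a - k + k'))"
  show ?thesis
  proof (rule that[of l])
    show "l \<ge> l0" by (simp add: l_def)
    show "coset_stable (D n) (B l)" using l1[of l] by (simp add: l_def)
    show "coset_stable (B m) (B l)" using coset_stable_B[of m l] by (simp add: l_def)
    have "a - k + k' \<le> l" by (simp add: l_def)
    then show "B l \<subseteq> D k" using k'[of k] B_antimono by blast
  qed
qed

lemma integral_\<beta>_D: "x \<in> S \<Longrightarrow> int_over (D n) (\<lambda>y. \<beta> x y) = (if x \<in> B n then of_real (vol (D n)) else 0)"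
proof -
  assume x: "x \<in> S"
  obtain m where m: "x \<in> B m" using S_in_B[OF x] by blast
  obtain l where l: "coset_stable (D n) (B l)" "B l \<subseteq> D m" using common_level by metis
  have "B l \<subseteq> D n"
    using l(1) add_subgroup_zero[OF D_group] unfolding coset_stable_def by (metis add_0 subsetI)
  then have "int_over (D n) (\<lambda>y. \<beta> x y) = (if \<forall>y\<in>D n. \<beta> x y = 1 then of_real (vol (D n)) else 0)"
    using l(2) m by (intro integral_character[OF compact_open_D D_group])
      (auto simp: \<beta>_add_right x D_in_S \<beta>_B_D)
  then show ?thesis using B_iff[OF x] by simp
qed

lemma integral_\<beta>_B: "y \<in> S \<Longrightarrow> int_over (B n) (\<lambda>x. \<beta> x y) = (if y \<in> D n then of_real (vol (B n)) else 0)"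
proof -
  assume y: "y \<in> S"
  obtain l where l: "\<forall>n\<ge>l. y \<in> D n" using exists_D_level[OF y] by blast
  have "B (max l n) \<subseteq> B n" by (rule B_antimono) simp
  then have "int_over (B n) (\<lambda>x. \<beta> x y) = (if \<forall>x\<in>B n. \<beta> x y = 1 then of_real (vol (B n)) else 0)"
    using l by (intro integral_character[OF compact_open_B B_group, where n = "max l n"])
      (auto simp: \<beta>_add_left y B_in_S intro: \<beta>_B_D)
  then show ?thesis using D_iff[OF y] by simp
qed

end

section \<open>Fourier inversion through the pairing\<close>

context quadratic_character
begin

definition FT :: "('a \<Rightarrow> complex) \<Rightarrow> 'a \<Rightarrow> complex" where
  "FT f y = (\<integral>z. f z * \<beta> y z \<partial>haar)"

lemma FT_eq:
  assumes "\<And>x. x \<in> S - B m \<Longrightarrow> f x = 0"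
  shows "FT f y = int_over (B m) (\<lambda>z. f z * \<beta> y z)"
  unfolding FT_def by (rule integral_haar_support) (simp add: assms)

text \<open>\<open>f\<close> is invariant under \<open>B n\<close>, so substituting
  \<open>z + b\<close> multiplies the transform at \<open>y\<close> by \<open>\<beta> y b\<close>;
  outside \<open>D n\<close> some \<open>b\<close> in \<open>B n\<close> makes this factor different
  from 1.\<close>

lemma FT_support:
  assumes inv: "\<And>x b. x \<in> S \<Longrightarrow> b \<in> B n \<Longrightarrow> f (x + b) = f x" and supp: "\<And>x. x \<in> S - B m \<Longrightarrow> f x = 0"
    and mn: "m \<le> n" and y: "y \<in> S - D n"
  shows "FT f y = 0"
proof -
  have yS: "y \<in> S" using y by simp
  have FTf: "FT f y = int_over (B m) (\<lambda>z. f z * \<beta> y z)" by (rule FT_eq) (rule supp)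
  obtain b where b: "b \<in> B n" "\<beta> b y \<noteq> 1" using y D_iff[OF yS, of n] by blast
  then have b': "\<beta> y b \<noteq> 1" "b \<in> S" "b \<in> B m" using \<beta>_sym[OF yS B_in_S[OF b(1)]] B_in_S B_antimono[OF mn] by auto
  obtain l where l: "\<forall>n\<ge>l. y \<in> D n" using exists_D_level[OF yS] by blast
  have lc: "const_on_cosets (max l n) (B m) (\<lambda>z. f z * \<beta> y z)"
    unfolding const_on_cosets_def
  proof (intro conjI ballI)
    show "coset_stable (B m) (B (max l n))" using mn by (intro coset_stable_B) simp
    fix x c assume x: "x \<in> B m" and c: "c \<in> B (max l n)"
    have "c \<in> B n" using c B_antimono[of n "max l n"] by auto
    moreover have "\<beta> y c = 1" using l \<beta>_D_B[OF c] by simp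
    ultimately show "f (x + c) * \<beta> y (x + c) = f x * \<beta> y x"
      using inv[OF B_in_S[OF x]] \<beta>_add_right[OF B_in_S[OF x] B_in_S[OF c] yS] by simp
  qed
  have "FT f y = int_over (B m) (\<lambda>z. f (z + b) * \<beta> y (z + b))"
    unfolding FTf by (rule integral_shift[OF lc compact_open_B B_group b'(3), symmetric])
  also have "\<dots> = int_over (B m) (\<lambda>z. f z * \<beta> y z * \<beta> y b)"
    by (rule integral_cong_on) (simp add: inv[OF B_in_S b(1)] \<beta>_add_right[OF B_in_S b'(2) yS])
  also have "\<dots> = FT f y * \<beta> y b" unfolding FTf by simp
  finally show ?thesis using b'(1) by simp
qed

text \<open>After interchanging the integrals, the inner one over \<open>z\<close> in
  \<open>D n'\<close> is the volume of \<open>D n'\<close> if \<open>x - y\<close> lies in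
  \<open>B n'\<close> and 0 otherwise. The outer integral then sees only the coset of
  \<open>x\<close>, and the two volumes multiply to \<delta>.\<close>

lemma FT_inversion:
  assumes inv: "\<And>x b. x \<in> S \<Longrightarrow> b \<in> B n \<Longrightarrow> f (x + b) = f x" and supp: "\<And>x. x \<in> S - B m \<Longrightarrow> f x = 0"
    and x: "x \<in> S"
  shows "(\<integral>z. FT f (- z) * \<beta> x z \<partial>haar) = of_real \<delta> * f x"
proof -
  obtain k where k: "x \<in> B k" using S_in_B[OF x] by blast
  \<comment> \<open>The support lattice is enlarged to contain \<open>x\<close>, and
    \<open>n'\<close> is taken at least \<open>m'\<close> so that the coset of \<open>x\<close>
    modulo \<open>B n'\<close> lies inside it.\<close>
  define m' where "m' = min m k"
  define n' where "n' = max n m'"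
  have supp': "f y = 0" if "y \<in> S - B m'" for y
    using supp[of y] that B_antimono[of m' m] by (auto simp: m'_def)
  have inv': "f (y + b) = f y" if "y \<in> S" "b \<in> B n'" for y b
    using inv[OF that(1), of b] that(2) B_antimono[of n n'] by (auto simp: n'_def)
  have FTf: "FT f y = int_over (B m') (\<lambda>z. f z * \<beta> y z)" for y by (rule FT_eq) (rule supp')
  have xm: "x \<in> B m'" using k B_antimono[of m' k] by (auto simp: m'_def)
  obtain l where l: "l \<ge> n'" "coset_stable (D n') (B l)" "coset_stable (B m') (B l)" "B l \<subseteq> D m'"
    using common_level by metis
  have Bl: "b \<in> B n'" "b \<in> D m'" "b \<in> S" if "b \<in> B l" for b
    using that l(4) B_antimono[OF l(1)] B_in_S by auto
  have "(\<integral>z. FT f (- z) * \<beta> x z \<partial>haar) = int_over (D n') (\<lambda>z. FT f (- z) * \<beta> x z)"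
  proof (rule integral_haar_support)
    fix z assume z: "z \<in> S - D n'"
    then have "- z \<in> S - D n'" using S_intros(3) add_subgroup_minus[OF D_group, of "- z"] by auto
    then show "FT f (- z) * \<beta> x z = 0"
      using FT_support[of n' f m' "- z", OF inv' supp'] by (simp add: n'_def)
  qed
  also have "\<dots> = int_over (D n') (\<lambda>z. int_over (B m') (\<lambda>y. f y * \<beta> (- z) y * \<beta> x z))"
    unfolding FTf by simp
  also have "\<dots> = int_over (D n') (\<lambda>z. int_over (B m') (\<lambda>y. f y * \<beta> (x - y) z))"
  proof (intro integral_cong_on)
    fix z y assume z: "z \<in> D n'" and y: "y \<in> B m'"
    have S: "z \<in> S" "y \<in> S" "- z \<in> S" "- y \<in> S" using z y D_in_S B_in_S S_intros(3) by auto
    have "\<beta> (- z) y = \<beta> (- y) z"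
      using \<beta>_sym[OF S(3,2)] \<beta>_sym[OF S(4,1)] \<beta>_minus_right[OF S(2,1)] \<beta>_minus_right[OF S(1,2)] \<beta>_sym[OF S(1,2)]
      by simp
    then show "f y * \<beta> (- z) y * \<beta> x z = f y * \<beta> (x - y) z"
      using \<beta>_add_left[OF x S(4,1)] by simp
  qed
  also have "\<dots> = int_over (B m') (\<lambda>y. int_over (D n') (\<lambda>z. f y * \<beta> (x - y) z))"
  proof (rule integral_swap[OF compact_open_D compact_open_B l(2,3)])
    fix z y b assume z: "z \<in> D n'" and y: "y \<in> B m'" and b: "b \<in> B l"
    have S: "z \<in> S" "y \<in> S" "x - y \<in> S" "- b \<in> S" using z y D_in_S B_in_S S_intros(2,3) x Bl(3)[OF b] by auto
    have "\<beta> (x - y) b = 1" using \<beta>_B_D[of "x - y" m' b] Bl[OF b] xm y B_intros(2) by blast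
    then show "f y * \<beta> (x - y) (z + b) = f y * \<beta> (x - y) z"
      using \<beta>_add_right[OF S(1) Bl(3)[OF b] S(3)] by simp
    have "\<beta> (- b) z = 1" using \<beta>_B_D[OF B_intros(3)[OF Bl(1)[OF b]] z] .
    moreover have "x - (y + b) = (x - y) + (- b)" by simp
    ultimately show "f (y + b) * \<beta> (x - (y + b)) z = f y * \<beta> (x - y) z"
      using \<beta>_add_left[OF S(3,4,1)] inv'[OF S(2) Bl(1)[OF b]] by (simp only: mult_1_right)
  qed
  also have "\<dots> = int_over (B m') (\<lambda>y. f y * (if x - y \<in> B n' then of_real (vol (D n')) else 0))"
    by (rule integral_cong_on) (simp add: integral_\<beta>_D S_intros(2) x B_in_S)
  also have "\<dots> = int_over ((+) x ` B n') (\<lambda>y. f y * (if x - y \<in> B n' then of_real (vol (D n')) else 0))"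
  proof (rule integral_support)
    have "B n' \<subseteq> B m'" by (rule B_antimono) (simp add: n'_def)
    then show "(+) x ` B n' \<subseteq> B m'" using xm B_intros(4) by blast
    fix y assume "y \<in> B m' - (+) x ` B n'"
    then have "y - x \<notin> B n'" by (auto simp: image_iff intro: bexI[of _ "y - x"])
    then show "f y * (if x - y \<in> B n' then of_real (vol (D n')) else 0) = 0"
      using add_subgroup_diff_commute[OF B_group, of x y n'] by simp
  qed
  also have "\<dots> = int_over ((+) x ` B n') (\<lambda>_. f x * of_real (vol (D n')))"
  proof (rule integral_cong_on)
    fix y assume "y \<in> (+) x ` B n'"
    then obtain b where b: "b \<in> B n'" "y = x + b" by blast
    then show "f y * (if x - y \<in> B n' then of_real (vol (D n')) else 0) = f x * of_real (vol (D n'))"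
      using inv'[OF x b(1)] B_intros(3)[OF b(1)] by simp
  qed
  also have "\<dots> = of_real (vol (B n')) * (f x * of_real (vol (D n')))"
    by (simp add: integral_const[OF compact_open_coset[OF x]] vol_coset[OF x] vol_B)
  also have "\<dots> = of_real (vol (D n') * vol (B n')) * f x" by (simp add: mult_ac)
  finally show ?thesis by (simp only: vol_D)
qed

section \<open>Gauss integrals\<close>

definition isotropic_level :: "int \<Rightarrow> bool" where
  "isotropic_level n \<longleftrightarrow> (\<forall>x\<in>B n. h x = 1)"

lemma isotropic_level_mono: "isotropic_level m \<Longrightarrow> m \<le> n \<Longrightarrow> isotropic_level n"
  using B_antimono unfolding isotropic_level_def by blast

lemma isotropic_B_D: "isotropic_level n \<Longrightarrow> B n \<subseteq> D n"
proof
  fix y assume n: "isotropic_level n" and y: "y \<in> B n"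
  have "\<beta> x y = 1" if x: "x \<in> B n" for x
    using h_add_\<beta>[OF B_in_S[OF x] B_in_S[OF y]] n x y B_intros(4)[OF x y] by (simp add: isotropic_level_def)
  then show "y \<in> D n" using D_iff[OF B_in_S[OF y]] by blast
qed

lemma h_periodic:
  assumes n: "isotropic_level n" and x: "x \<in> D n" and b: "b \<in> B n"
  shows "h (x + b) = h x"
  using h_add_\<beta>[OF D_in_S[OF x] B_in_S[OF b]] \<beta>_D_B[OF b x] n b by (simp add: isotropic_level_def)

text \<open>At an isotropic level this is the improper integral of \<open>h\<close> over the whole
  group: by \<open>integral_h\<close> every larger compact open subgroup gives the same
  value.\<close>

definition gauss :: "int \<Rightarrow> complex" where "gauss n = int_over (D n) h"

text \<open>The integral is averaged over translations by \<open>B n\<close>, where \<open>h\<close>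
  is 1. A point \<open>x\<close> then carries the integral of \<open>\<beta> x b\<close> over
  \<open>b\<close> as its weight, and this vanishes outside \<open>D n\<close>.\<close>

lemma integral_h:
  assumes n: "isotropic_level n" and \<Lambda>: "compact_open \<Lambda>" "add_subgroup \<Lambda>" "D n \<subseteq> \<Lambda>"
  shows "int_over \<Lambda> h = gauss n"
proof -
  have \<Lambda>S: "\<Lambda> \<subseteq> S" using compact_open_subset[OF \<Lambda>(1)] .
  have BL: "B n \<subseteq> \<Lambda>" using isotropic_B_D[OF n] \<Lambda>(3) by blast
  obtain k where k: "\<Lambda> \<subseteq> B k" using \<Lambda>(1) by (auto simp: compact_open_def)
  obtain n1 where n1: "\<And>l. l \<ge> n1 \<Longrightarrow> B k \<subseteq> D l" using D_absorbs_B by blast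
  obtain n2 where n2: "\<And>l. l \<ge> n2 \<Longrightarrow> coset_stable \<Lambda> (B l) \<and> \<Lambda> \<subseteq> B (- l)"
    using compact_open_level[OF \<Lambda>(1)] by metis
  define l where "l = max n (max n1 n2)"
  have l: "\<Lambda> \<subseteq> D l" "coset_stable \<Lambda> (B l)" "isotropic_level l" "B l \<subseteq> B n"
  proof -
    have "n1 \<le> l" "n2 \<le> l" "n \<le> l" by (simp_all add: l_def)
    then show "\<Lambda> \<subseteq> D l" "coset_stable \<Lambda> (B l)" "isotropic_level l" "B l \<subseteq> B n"
      using k n1[of l] n2[of l] isotropic_level_mono[OF n, of l] B_antimono[of n l] by auto
  qed
  have per: "h (x + b) = h x" if "x \<in> \<Lambda>" "b \<in> B l" for x b using h_periodic[OF l(3)] that l(1) by blast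
  have lc: "const_on_cosets l \<Lambda> h" using l(2) per by (simp add: const_on_cosets_def)
  have \<beta>l: "\<beta> x b = 1" if "x \<in> \<Lambda>" "b \<in> B l" for x b using \<beta>_D_B[OF that(2)] that(1) l(1) by blast
  have "of_real (vol (B n)) * int_over \<Lambda> h = int_over (B n) (\<lambda>b. int_over \<Lambda> h)"
    by (simp add: integral_const[OF compact_open_B])
  also have "\<dots> = int_over (B n) (\<lambda>b. int_over \<Lambda> (\<lambda>x. h x * \<beta> x b))"
  proof (rule integral_cong_on)
    fix b assume b: "b \<in> B n"
    have "int_over \<Lambda> h = int_over \<Lambda> (\<lambda>x. h (x + b))"
      by (rule integral_shift[OF lc \<Lambda>(1,2), symmetric]) (use b BL in blast)
    also have "\<dots> = int_over \<Lambda> (\<lambda>x. h x * \<beta> x b)"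
      by (rule integral_cong_on) (use h_add_\<beta> b \<Lambda>S B_in_S n in \<open>auto simp: isotropic_level_def subset_iff\<close>)
    finally show "int_over \<Lambda> h = int_over \<Lambda> (\<lambda>x. h x * \<beta> x b)" .
  qed
  also have "\<dots> = int_over \<Lambda> (\<lambda>x. int_over (B n) (\<lambda>b. h x * \<beta> x b))"
  proof (rule integral_swap[OF compact_open_B \<Lambda>(1) _ l(2)])
    show "coset_stable (B n) (B l)" by (rule coset_stable_B) (simp add: l_def)
    fix b x c assume b: "b \<in> B n" and x: "x \<in> \<Lambda>" and c: "c \<in> B l"
    have S: "x \<in> S" "b \<in> S" "c \<in> S" using b x c \<Lambda>S B_in_S by auto
    show "h x * \<beta> x (b + c) = h x * \<beta> x b" using \<beta>_add_right[OF S(2,3,1)] \<beta>l[OF x c] by simp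
    have "\<beta> c b = 1" using \<beta>_sym[OF S(3,2)] \<beta>l[of b c] b BL c by auto
    then show "h (x + c) * \<beta> (x + c) b = h x * \<beta> x b" using \<beta>_add_left[OF S(1,3,2)] per[OF x c] by simp
  qed
  also have "\<dots> = int_over \<Lambda> (\<lambda>x. h x * (if x \<in> D n then of_real (vol (B n)) else 0))"
  proof (rule integral_cong_on)
    fix x assume x: "x \<in> \<Lambda>"
    have xS: "x \<in> S" using x \<Lambda>S by blast
    have "int_over (B n) (\<lambda>b. \<beta> x b) = int_over (B n) (\<lambda>b. \<beta> b x)"
      by (rule integral_cong_on) (simp add: \<beta>_sym[OF xS] B_in_S)
    then show "int_over (B n) (\<lambda>b. h x * \<beta> x b) = h x * (if x \<in> D n then of_real (vol (B n)) else 0)"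
      using integral_\<beta>_B[OF xS] by simp
  qed
  also have "\<dots> = int_over (D n) (\<lambda>x. h x * (if x \<in> D n then of_real (vol (B n)) else 0))"
    by (rule integral_support[OF \<Lambda>(3)]) simp
  also have "\<dots> = int_over (D n) (\<lambda>x. of_real (vol (B n)) * h x)"
    by (rule integral_cong_on) simp
  also have "\<dots> = of_real (vol (B n)) * gauss n" by (simp add: gauss_def)
  finally show ?thesis using vol_B_pos[of n] by simp
qed

lemma gauss_eq:
  assumes "isotropic_level m" "isotropic_level n"
  shows "gauss m = gauss n"
proof -
  have "gauss i = gauss j" if "isotropic_level i" "i \<le> j" for i j
    using integral_h[OF that(1) compact_open_D D_group D_mono[OF that(2)]] by (simp add: gauss_def)
  then show ?thesis using assms by (metis linear)
qed

text \<open>After the shift by \<open>y\<close>, the squared absolute value is the double integral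
  of \<open>h x * \<beta> x y\<close>; integrating over \<open>y\<close> leaves \<open>x\<close> in
  \<open>B n\<close>, where \<open>h\<close> is 1.\<close>

lemma norm_gauss:
  assumes n: "isotropic_level n" shows "(norm (gauss n))\<^sup>2 = \<delta>"
proof -
  obtain l where l: "l \<ge> n" "coset_stable (D n) (B l)" using common_level by metis
  have Bl: "b \<in> B n" if "b \<in> B l" for b using that B_antimono[OF l(1)] by blast
  have lc: "const_on_cosets l (D n) h"
    using l(2) h_periodic[OF n] Bl by (simp add: const_on_cosets_def)
  have cnj_h: "h x * cnj (h x) = 1" if "x \<in> S" for x
    using complex_norm_square[of "h x"] h_norm[OF that] by simp
  have gnj: "cnj (gauss n) = int_over (D n) (\<lambda>y. cnj (h y))"
    unfolding gauss_def set_lebesgue_integral_def by (subst Bochner_Integration.integral_cnj[symmetric]) simp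
  have "gauss n * cnj (gauss n) = int_over (D n) (\<lambda>y. gauss n * cnj (h y))" by (simp add: gnj)
  also have "\<dots> = int_over (D n) (\<lambda>y. int_over (D n) (\<lambda>x. h x * \<beta> x y))"
  proof (rule integral_cong_on)
    fix y assume y: "y \<in> D n"
    have "gauss n = int_over (D n) (\<lambda>x. h (x + y))"
      unfolding gauss_def by (rule integral_shift[OF lc compact_open_D D_group y, symmetric])
    also have "\<dots> = int_over (D n) (\<lambda>x. h x * \<beta> x y * h y)"
      by (rule integral_cong_on) (simp add: h_add_\<beta>[OF D_in_S D_in_S[OF y]])
    also have "\<dots> = int_over (D n) (\<lambda>x. h x * \<beta> x y) * h y" by simp
    finally show "gauss n * cnj (h y) = int_over (D n) (\<lambda>x. h x * \<beta> x y)"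
      using cnj_h[OF D_in_S[OF y]] by (simp add: mult.assoc)
  qed
  also have "\<dots> = int_over (D n) (\<lambda>x. int_over (D n) (\<lambda>y. h x * \<beta> x y))"
  proof (rule integral_swap[OF compact_open_D compact_open_D l(2,2)])
    fix y x b assume y: "y \<in> D n" and x: "x \<in> D n" and b: "b \<in> B l"
    note S = D_in_S[OF x] D_in_S[OF y] B_in_S[OF b]
    show "h x * \<beta> x (y + b) = h x * \<beta> x y"
      using \<beta>_add_right[OF S(2,3,1)] \<beta>_D_B[OF Bl[OF b] x] by simp
    show "h (x + b) * \<beta> (x + b) y = h x * \<beta> x y"
      using \<beta>_add_left[OF S(1,3,2)] \<beta>_B_D[OF Bl[OF b] y] h_periodic[OF n x Bl[OF b]] by simp
  qed
  also have "\<dots> = int_over (D n) (\<lambda>x. h x * (if x \<in> B n then of_real (vol (D n)) else 0))"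
    by (rule integral_cong_on) (simp add: integral_\<beta>_D D_in_S)
  also have "\<dots> = int_over (B n) (\<lambda>x. h x * (if x \<in> B n then of_real (vol (D n)) else 0))"
    by (rule integral_support[OF isotropic_B_D[OF n]]) simp
  also have "\<dots> = int_over (B n) (\<lambda>x. of_real (vol (D n)))"
    by (rule integral_cong_on) (use n in \<open>simp add: isotropic_level_def\<close>)
  also have "\<dots> = of_real (vol (D n) * vol (B n))" by (simp add: integral_const[OF compact_open_B] mult.commute)
  finally have "gauss n * cnj (gauss n) = of_real \<delta>" by (simp only: vol_D)
  then show ?thesis using complex_norm_square[of "gauss n"] by (metis of_real_eq_iff of_real_power)
qed

text \<open>Completing the square: \<open>h y * \<beta> y z = cnj (h z) * h (y + z)\<close>, and the
  shift by \<open>z\<close> turns the inner integral into the Gauss integral.\<close>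

lemma weil_identity:
  assumes n: "isotropic_level n"
    and inv: "\<And>x b. x \<in> S \<Longrightarrow> b \<in> B i \<Longrightarrow> g (x + b) = g x" and supp: "\<And>x. x \<in> S - B m \<Longrightarrow> g x = 0"
  shows "(\<integral>y. h y * FT g y \<partial>haar) = gauss n * (\<integral>z. cnj (h z) * g z \<partial>haar)"
proof -
  obtain k where k: "\<And>j. j \<ge> k \<Longrightarrow> B m \<subseteq> D j" using D_absorbs_B by blast
  define j where "j = max (max n m) (max i k)"
  have j: "isotropic_level j" "B m \<subseteq> D j" "m \<le> j" "i \<le> j"
    using isotropic_level_mono[OF n, of j] k[of j] by (auto simp: j_def)
  have inv': "g (x + b) = g x" if "x \<in> S" "b \<in> B j" for x b
    using inv[OF that(1), of b] that(2) B_antimono[OF j(4)] by blast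
  obtain l where l: "l \<ge> j" "coset_stable (D j) (B l)" "coset_stable (B m) (B l)" using common_level by metis
  have Bl: "b \<in> B j" if "b \<in> B l" for b using that B_antimono[OF l(1)] by blast
  have lc: "const_on_cosets l (D j) h"
    using l(2) h_periodic[OF j(1)] Bl by (simp add: const_on_cosets_def)
  have cnj_h: "h x * cnj (h x) = 1" if "x \<in> S" for x
    using complex_norm_square[of "h x"] h_norm[OF that] by simp
  have FTg: "FT g y = int_over (B m) (\<lambda>z. g z * \<beta> y z)" for y by (rule FT_eq) (rule supp)
  have "FT g y = 0" if "y \<in> S - D j" for y by (rule FT_support[OF inv' supp j(3) that])
  then have "(\<integral>y. h y * FT g y \<partial>haar) = int_over (D j) (\<lambda>y. h y * FT g y)"
    by (intro integral_haar_support) simp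
  also have "\<dots> = int_over (D j) (\<lambda>y. int_over (B m) (\<lambda>z. h y * (g z * \<beta> y z)))"
    unfolding FTg by simp
  also have "\<dots> = int_over (B m) (\<lambda>z. int_over (D j) (\<lambda>y. h y * (g z * \<beta> y z)))"
  proof (rule integral_swap[OF compact_open_D compact_open_B l(2,3)])
    fix y z b assume y: "y \<in> D j" and z: "z \<in> B m" and b: "b \<in> B l"
    note S = D_in_S[OF y] B_in_S[OF z] B_in_S[OF b]
    have zD: "z \<in> D j" using z j(2) by blast
    show "h (y + b) * (g z * \<beta> (y + b) z) = h y * (g z * \<beta> y z)"
      using \<beta>_add_left[OF S(1,3,2)] \<beta>_B_D[OF Bl[OF b] zD] h_periodic[OF j(1) y Bl[OF b]] by simp
    show "h y * (g (z + b) * \<beta> y (z + b)) = h y * (g z * \<beta> y z)"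
      using \<beta>_add_right[OF S(2,3,1)] \<beta>_D_B[OF Bl[OF b] y] inv'[OF S(2) Bl[OF b]] by simp
  qed
  also have "\<dots> = int_over (B m) (\<lambda>z. gauss n * (cnj (h z) * g z))"
  proof (rule integral_cong_on)
    fix z assume z: "z \<in> B m"
    have zD: "z \<in> D j" using z j(2) by blast
    have "int_over (D j) (\<lambda>y. h y * (g z * \<beta> y z)) = int_over (D j) (\<lambda>y. cnj (h z) * g z * h (y + z))"
    proof (rule integral_cong_on)
      fix y assume y: "y \<in> D j"
      have "cnj (h z) * g z * h (y + z) = (h z * cnj (h z)) * (h y * (g z * \<beta> y z))"
        using h_add_\<beta>[OF D_in_S[OF y] D_in_S[OF zD]] by (simp add: mult_ac)
      then show "h y * (g z * \<beta> y z) = cnj (h z) * g z * h (y + z)"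
        by (simp only: cnj_h[OF D_in_S[OF zD]] mult_1_left)
    qed
    also have "\<dots> = cnj (h z) * g z * int_over (D j) (\<lambda>y. h (y + z))" by simp
    also have "int_over (D j) (\<lambda>y. h (y + z)) = gauss j"
      unfolding gauss_def by (rule integral_shift[OF lc compact_open_D D_group zD])
    also have "gauss j = gauss n" by (rule gauss_eq[OF j(1) n])
    finally show "int_over (D j) (\<lambda>y. h y * (g z * \<beta> y z)) = gauss n * (cnj (h z) * g z)" by (simp add: mult_ac)
  qed
  also have "\<dots> = gauss n * int_over (B m) (\<lambda>z. cnj (h z) * g z)" by simp
  also have "int_over (B m) (\<lambda>z. cnj (h z) * g z) = (\<integral>z. cnj (h z) * g z \<partial>haar)"
    by (rule integral_haar_support[symmetric]) (simp add: supp)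
  finally show ?thesis .
qed

subsection \<open>Self-duality\<close>

abbreviation "dualG \<equiv> dual_group (additive_group S) T"
abbreviation "dualT \<equiv> dual_topology (additive_group S) T"

definition \<rho> :: "'a \<Rightarrow> 'a \<Rightarrow> complex" where "\<rho> y = restrict (\<lambda>x. \<beta> x y) S"

lemma carrier_dual: "carrier dualG = {\<xi> \<in> extensional S. (\<forall>x\<in>S. norm (\<xi> x) = 1) \<and>
    (\<forall>x\<in>S. \<forall>y\<in>S. \<xi> (x + y) = \<xi> x * \<xi> y) \<and> continuous_map T euclidean \<xi>}"
  by (auto simp: dual_group_def hom_def circle_group_def)

lemma continuous_map_locally_const:
  assumes "\<And>x. x \<in> S \<Longrightarrow> \<exists>n. \<forall>b\<in>B n. f (x + b) = f x"
  shows "continuous_map T euclidean f"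
  unfolding continuous_map
proof (intro conjI allI impI)
  fix U
  show "openin T {x \<in> topspace T. f x \<in> U}"
    unfolding openin_iff topspace_T
  proof (intro conjI ballI)
    fix x assume x: "x \<in> {x \<in> S. f x \<in> U}"
    then obtain n where n: "\<forall>b\<in>B n. f (x + b) = f x" using assms by blast
    have "x + b \<in> {x \<in> S. f x \<in> U}" if "b \<in> B n" for b using n that x S_intros(4) B_in_S by auto
    then show "\<exists>n. \<forall>b\<in>B n. x + b \<in> {x \<in> S. f x \<in> U}" by blast
  qed auto
qed simp

lemma \<rho>_in_dual: "y \<in> S \<Longrightarrow> \<rho> y \<in> carrier dualG"
proof -
  assume y: "y \<in> S"
  obtain n where n: "y \<in> D n" using exists_D_level[OF y] by blast
  have "continuous_map T euclidean (\<rho> y)"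
  proof (rule continuous_map_locally_const)
    fix x assume x: "x \<in> S"
    have "\<rho> y (x + b) = \<rho> y x" if b: "b \<in> B n" for b
      using \<beta>_add_left[OF x B_in_S[OF b] y] \<beta>_B_D[OF b n] x S_intros(4)[OF x B_in_S[OF b]] by (simp add: \<rho>_def)
    then show "\<exists>n. \<forall>b\<in>B n. \<rho> y (x + b) = \<rho> y x" by blast
  qed
  then show ?thesis
    using y by (simp add: carrier_dual \<rho>_def \<beta>_norm \<beta>_add_left S_intros(4))
qed

lemma h_continuous: "continuous_map T euclidean h"
proof (rule continuous_map_locally_const)
  fix x assume x: "x \<in> S"
  obtain n0 where n0: "\<forall>n\<ge>n0. x \<in> D n" using exists_D_level[OF x] by blast
  obtain n1 where n1: "isotropic_level n1" using h_trivial by (auto simp: isotropic_level_def)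
  show "\<exists>n. \<forall>b\<in>B n. h (x + b) = h x"
    using h_periodic[of "max n0 n1" x] isotropic_level_mono[OF n1, of "max n0 n1"] n0 by auto
qed

text \<open>The difference of two elements with the same image is orthogonal to all of
  \<open>S\<close>, hence lies in every \<open>D n\<close>, and these shrink to 0 as
  \<open>n\<close> tends to minus infinity.\<close>

lemma \<rho>_inj: "inj_on \<rho> S"
proof (rule inj_onI)
  fix y z assume y: "y \<in> S" and z: "z \<in> S" and eq: "\<rho> y = \<rho> z"
  have yz: "y - z \<in> S" by (rule S_intros(2)[OF y z])
  have "\<beta> x (y - z) = 1" if x: "x \<in> S" for x
  proof -
    have e: "\<beta> x y = \<beta> x z" using fun_cong[OF eq, of x] x by (simp add: \<rho>_def)
    have "\<beta> x y = \<beta> x (y - z) * \<beta> x z" using \<beta>_add_right[OF yz z x] by simp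
    moreover have "\<beta> x z \<noteq> 0" using \<beta>_norm[OF x z] by auto
    ultimately show ?thesis using e by simp
  qed
  then have "y - z \<in> D n" for n using D_iff[OF yz] B_in_S by blast
  then have "y - z \<in> B n" for n using D_small_in_B[of n] by blast
  then have "y - z = 0" by (rule B_Inter)
  then show "y = z" by simp
qed

text \<open>Fourier analysis on \<open>B m\<close> represents a character on \<open>B m\<close>; the representing elements for
  \<open>m \<rightarrow> -\<infinity>\<close> converge.\<close>

lemma \<rho>_surj:
  assumes \<xi>: "\<xi> \<in> carrier dualG" shows "\<xi> \<in> \<rho> ` S"
proof -
  have add: "\<And>x y. x \<in> S \<Longrightarrow> y \<in> S \<Longrightarrow> \<xi> (x + y) = \<xi> x * \<xi> y" and unit: "\<And>x. x \<in> S \<Longrightarrow> norm (\<xi> x) = 1"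
    and cont: "continuous_map T euclidean \<xi>" and ext: "\<xi> \<in> extensional S"
    using \<xi> by (auto simp: carrier_dual)
  obtain n where n: "\<And>b. b \<in> B n \<Longrightarrow> \<xi> b = 1" using character_locally_trivial[OF add unit cont] by blast
  \<comment> \<open>If all coefficients of \<xi> on \<open>B m\<close> against the characters given
    by \<open>y\<close> in \<open>D n\<close> were 0, integrating them over \<open>y\<close> would
    make the product of the volumes of \<open>B n\<close> and \<open>D n\<close> vanish.\<close>
  have local: "\<exists>y\<in>D n. \<forall>x\<in>B m. \<xi> x = \<beta> x y" if mn: "m \<le> n" for m
  proof -
    define ch where "ch y x = \<xi> x * \<beta> x (- y)" for y x
    obtain l where l: "l \<ge> n" "coset_stable (D n) (B l)" "coset_stable (B m) (B l)" "B l \<subseteq> D m"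
      using common_level by metis
    have Bl: "b \<in> B n" "b \<in> D m" "b \<in> S" if "b \<in> B l" for b using that B_antimono[OF l(1)] l(4) B_in_S by auto
    have ch_add: "ch y (x + x') = ch y x * ch y x'" if "x \<in> S" "x' \<in> S" "y \<in> S" for y x x'
      using add[OF that(1,2)] \<beta>_add_left[OF that(1,2) S_intros(3)[OF that(3)]] by (simp add: ch_def)
    have ch_l: "ch y b = 1" if "y \<in> D n" "b \<in> B l" for y b
      using n Bl(1)[OF that(2)] \<beta>_B_D[OF Bl(1)[OF that(2)] add_subgroup_minus[OF D_group that(1)]]
      by (simp add: ch_def)
    have Bnm: "B n \<subseteq> B m" by (rule B_antimono[OF mn])
    have J: "int_over (B m) (ch y) = (if \<forall>x\<in>B m. ch y x = 1 then of_real (vol (B m)) else 0)" if y: "y \<in> D n" for y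
    proof (rule integral_character[OF compact_open_B B_group])
      show "ch y b = 1" if "b \<in> B l" for b by (rule ch_l[OF y that])
      show "B l \<subseteq> B m" using Bl(1) Bnm by blast
    qed (simp add: ch_add B_in_S D_in_S[OF y])
    have "\<exists>y\<in>D n. int_over (B m) (ch y) \<noteq> 0"
    proof (rule ccontr)
      assume "\<not> ?thesis"
      then have "0 = int_over (D n) (\<lambda>y. int_over (B m) (ch y))"
        using integral_cong_on[of "D n" "\<lambda>y. int_over (B m) (ch y)" "\<lambda>_. 0"]
          integral_const[OF compact_open_D, of n 0] by simp
      also have "\<dots> = int_over (B m) (\<lambda>x. int_over (D n) (\<lambda>y. ch y x))"
      proof (rule integral_swap[OF compact_open_D compact_open_B l(2,3)])
        fix y x b assume y: "y \<in> D n" and x: "x \<in> B m" and b: "b \<in> B l"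
        note S = D_in_S[OF y] B_in_S[OF x] Bl(3)[OF b]
        have "\<beta> x (- b) = 1" using \<beta>_B_D[OF x add_subgroup_minus[OF D_group Bl(2)[OF b]]] .
        then show "ch (y + b) x = ch y x"
          using \<beta>_add_right[OF S_intros(3)[OF S(1)] S_intros(3)[OF S(3)] S(2)] by (simp add: ch_def algebra_simps)
        show "ch y (x + b) = ch y x" using ch_add[OF S(2,3,1)] ch_l[OF y b] by simp
      qed
      also have "\<dots> = int_over (B m) (\<lambda>x. \<xi> x * (if x \<in> B n then of_real (vol (D n)) else 0))"
      proof (rule integral_cong_on)
        fix x assume x: "x \<in> B m"
        have xS: "x \<in> S" "- x \<in> S" using B_in_S[OF x] S_intros(3) by auto
        have "int_over (D n) (\<lambda>y. ch y x) = int_over (D n) (\<lambda>y. \<xi> x * \<beta> (- x) y)"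
        proof (rule integral_cong_on)
          fix y assume y: "y \<in> D n"
          note yS = D_in_S[OF y]
          have "\<beta> (- x) y = \<beta> x (- y)"
            using \<beta>_sym[OF xS(2) yS] \<beta>_minus_right[OF yS xS(1)] \<beta>_sym[OF yS xS(1)] \<beta>_minus_right[OF xS(1) yS]
            by simp
          then show "ch y x = \<xi> x * \<beta> (- x) y" by (simp add: ch_def)
        qed
        also have "\<dots> = \<xi> x * (if - x \<in> B n then of_real (vol (D n)) else 0)"
          using integral_\<beta>_D[OF xS(2)] by simp
        also have "- x \<in> B n \<longleftrightarrow> x \<in> B n" using B_intros(3)[of x n] B_intros(3)[of "- x" n] by auto
        finally show "int_over (D n) (\<lambda>y. ch y x) = \<xi> x * (if x \<in> B n then of_real (vol (D n)) else 0)" .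
      qed
      also have "\<dots> = int_over (B n) (\<lambda>x. \<xi> x * (if x \<in> B n then of_real (vol (D n)) else 0))"
        by (rule integral_support[OF Bnm]) simp
      also have "\<dots> = int_over (B n) (\<lambda>x. of_real (vol (D n)))"
        by (rule integral_cong_on) (simp add: n)
      also have "\<dots> = of_real (vol (B n) * vol (D n))" by (simp add: integral_const[OF compact_open_B])
      finally show False using vol_B_pos[of n] vol_D_pos[of n] by simp
    qed
    then obtain y where y: "y \<in> D n" "int_over (B m) (ch y) \<noteq> 0" by blast
    have yS: "y \<in> S" by (rule D_in_S[OF y(1)])
    have "\<forall>x\<in>B m. ch y x = 1"
      using J[OF y(1)] y(2) by presburger
    then have "\<forall>x\<in>B m. \<xi> x = \<beta> x y"
    proof (intro ballI)
      fix x assume x: "x \<in> B m" and all: "\<forall>x\<in>B m. ch y x = 1"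
      have xS: "x \<in> S" by (rule B_in_S[OF x])
      have 1: "\<xi> x * \<beta> x (- y) = 1" using all x by (simp add: ch_def)
      have "\<beta> x (- y) * \<beta> x y = 1"
        using \<beta>_add_right[OF S_intros(3)[OF yS] yS xS] \<beta>_zero_right[OF xS] by simp
      then have "\<xi> x * (\<beta> x (- y) * \<beta> x y) = \<xi> x" by simp
      then show "\<xi> x = \<beta> x y" using 1 by (simp flip: mult.assoc)
    qed
    then show ?thesis using y(1) by blast
  qed
  obtain k where k: "\<And>n. D n \<subseteq> B (a - n - k)" using D_B_sandwich by blast
  have "\<exists>Y. \<forall>i::nat. Y i \<in> D n \<and> (\<forall>x\<in>B (n - int i). \<xi> x = \<beta> x (Y i))"
  proof (rule choice, intro allI)
    show "\<exists>y. y \<in> D n \<and> (\<forall>x\<in>B (n - int i). \<xi> x = \<beta> x y)" for i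
      using local[of "n - int i"] by auto
  qed
  then obtain Y where Y: "\<And>i::nat. Y i \<in> D n" "\<And>i x. x \<in> B (n - int i) \<Longrightarrow> \<xi> x = \<beta> x (Y i)" by blast
  have YS: "Y i \<in> S" for i using Y(1) D_in_S by blast
  \<comment> \<open>Two elements representing \<xi> on \<open>B (n - i)\<close> differ by an element
    of \<open>D (n - i)\<close>, and \<open>D_B_sandwich\<close> turns this into the rate required
    by \<open>complete\<close>.\<close>
  have diff: "Y (Suc i) - Y i \<in> B (a - n - k + int i)" for i
  proof -
    have "\<beta> x (Y (Suc i) - Y i) = 1" if x: "x \<in> B (n - int i)" for x
    proof -
      have xS: "x \<in> S" by (rule B_in_S[OF x])
      have "x \<in> B (n - int (Suc i))" using x B_antimono[of "n - int (Suc i)" "n - int i"] by auto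
      then have "\<beta> x (Y (Suc i)) = \<beta> x (Y i)" using Y(2)[OF x] Y(2)[of x "Suc i"] by simp
      moreover have "\<beta> x (Y (Suc i)) = \<beta> x (Y (Suc i) - Y i) * \<beta> x (Y i)"
        using \<beta>_add_right[OF S_intros(2)[OF YS YS] YS xS, of "Suc i" i i] by simp
      moreover have "\<beta> x (Y i) \<noteq> 0" using \<beta>_norm[OF xS YS, of i] by auto
      ultimately show ?thesis by simp
    qed
    then have "Y (Suc i) - Y i \<in> D (n - int i)" using D_iff[OF S_intros(2)[OF YS YS]] by blast
    then show ?thesis using k[of "n - int i"] by (auto simp: algebra_simps)
  qed
  obtain y where y: "y \<in> S" "\<And>i. y - Y i \<in> B (a - n - k + int i)" using complete[OF YS diff] by blast
  have "\<rho> y = \<xi>"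
  proof (rule extensionalityI[of _ S])
    show "\<rho> y \<in> extensional S" by (simp add: \<rho>_def)
    fix x assume x: "x \<in> S"
    obtain m where m: "x \<in> B m" using S_in_B[OF x] by blast
    obtain k' where k': "\<And>j. B (a - j + k') \<subseteq> D j" using D_B_sandwich by blast
    define i where "i = nat (\<bar>n - m\<bar> + \<bar>n + k + k' - m\<bar>)"
    have i: "n - int i \<le> m" "a - m + k' \<le> a - n - k + int i" unfolding i_def by arith+
    have "x \<in> B (n - int i)" using m B_antimono[OF i(1)] by blast
    then have 1: "\<xi> x = \<beta> x (Y i)" by (rule Y(2))
    have "B (a - n - k + int i) \<subseteq> B (a - m + k')" by (rule B_antimono[OF i(2)])
    then have "y - Y i \<in> D m" using y(2)[of i] k'[of m] by blast
    then have "\<beta> x (y - Y i) = 1" by (rule \<beta>_B_D[OF m])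
    moreover have "\<beta> x y = \<beta> x (y - Y i) * \<beta> x (Y i)"
      using \<beta>_add_right[OF S_intros(2)[OF y(1) YS] YS x, of i i] by simp
    ultimately show "\<rho> y x = \<xi> x" using 1 x by (simp add: \<rho>_def)
  qed (rule ext)
  then show ?thesis using y(1) by blast
qed

end

section \<open>The self-duality as an isomorphism of topological groups\<close>

context quadratic_character
begin

lemma topspace_dual: "topspace dualT = carrier dualG"
proof -
  let ?\<S> = "{{\<xi> \<in> carrier dualG. \<xi> ` C \<subseteq> U} | C U. compactin T C \<and> open U}"
  \<comment> \<open>The empty compact set makes the whole dual a subbasic open set.\<close>
  have "carrier dualG = {\<xi> \<in> carrier dualG. \<xi> ` {} \<subseteq> (UNIV :: complex set)}" by simp
  then have "carrier dualG \<in> ?\<S>" using compactin_empty[of T] open_UNIV by blast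
  then have "\<Union>?\<S> = carrier dualG" by blast
  then show ?thesis unfolding dual_topology_def by (simp add: topology_generated_by_topspace)
qed

lemma openin_dual_basis:
  assumes "compactin T C" "open U" shows "openin dualT {\<xi> \<in> carrier dualG. \<xi> ` C \<subseteq> U}"
  unfolding dual_topology_def by (rule topology_generated_by_Basis) (use assms in blast)

lemma \<rho>_image: "\<rho> ` S = carrier dualG"
  using \<rho>_in_dual \<rho>_surj by blast

text \<open>A compact set lies in some \<open>B m\<close>, and adding an element of
  \<open>D m\<close> to \<open>y\<close> does not change \<open>\<rho> y\<close> on
  \<open>B m\<close>.\<close>

lemma \<rho>_continuous: "continuous_map T dualT \<rho>"
  unfolding dual_topology_def
proof (rule continuous_on_generated_topo)
  fix V assume "V \<in> {{\<xi> \<in> carrier dualG. \<xi> ` C \<subseteq> U} | C U. compactin T C \<and> open U}"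
  then obtain C U where V: "V = {\<xi> \<in> carrier dualG. \<xi> ` C \<subseteq> U}" "compactin T C" by blast
  obtain m where m: "C \<subseteq> B m" using compactin_bounded[OF V(2)] by blast
  obtain k where k: "\<And>n. B (a - n + k) \<subseteq> D n" using D_B_sandwich by blast
  show "openin T (\<rho> -` V \<inter> topspace T)"
    unfolding openin_iff topspace_T
  proof (intro conjI ballI exI[of _ "a - m + k"])
    fix y b assume y: "y \<in> \<rho> -` V \<inter> S" and b: "b \<in> B (a - m + k)"
    have yS: "y \<in> S" and bS: "b \<in> S" using y B_in_S[OF b] by auto
    have bD: "b \<in> D m" using b k by blast
    have "\<rho> (y + b) x = \<rho> y x" if x: "x \<in> C" for x
      using \<beta>_add_right[OF yS bS B_in_S, of x m] \<beta>_B_D[OF _ bD, of x] m x B_in_S[of x m]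
      by (auto simp: \<rho>_def subset_iff)
    moreover have "\<rho> y ` C \<subseteq> U" using y V(1) by auto
    ultimately have "\<rho> (y + b) ` C \<subseteq> U" by auto
    then show "y + b \<in> \<rho> -` V \<inter> S" using V(1) \<rho>_in_dual S_intros(4)[OF yS bS] by auto
  qed auto
next
  show "\<rho> ` topspace T \<subseteq> \<Union> {{\<xi> \<in> carrier dualG. \<xi> ` C \<subseteq> U} | C U. compactin T C \<and> open U}"
    using topspace_dual \<rho>_image topspace_T unfolding dual_topology_def topology_generated_by_topspace by simp
qed

text \<open>A neighbourhood of \<open>\<rho> y\<close> is cut out by closeness on the finitely many
  cosets of \<open>B n\<close> in \<open>B m\<close>. If \<open>\<rho> z\<close> lies in it,
  \<open>\<beta> x (z - y)\<close> has positive real part for all \<open>x\<close> in the group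
  \<open>B m\<close>, hence equals 1 there, and \<open>z - y\<close> lies in the small set
  \<open>D m\<close>.\<close>

lemma \<rho>_open: "open_map T dualT \<rho>"
  unfolding open_map_def
proof (intro allI impI)
  fix U assume U: "openin T U"
  have "\<exists>V. openin dualT V \<and> \<rho> y \<in> V \<and> V \<subseteq> \<rho> ` U" if y: "y \<in> U" for y
  proof -
    have yS: "y \<in> S" using U y unfolding openin_iff by blast
    obtain k where k: "\<And>b. b \<in> B k \<Longrightarrow> y + b \<in> U" using U y unfolding openin_iff by blast
    obtain m where m: "D m \<subseteq> B k" using D_small_in_B by blast
    obtain n0 where n0: "\<forall>n\<ge>n0. y \<in> D n" using exists_D_level[OF yS] by blast
    define n where "n = max n0 m"
    have yD: "y \<in> D n" and mn: "m \<le> n" using n0 by (auto simp: n_def)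
    obtain R where R: "transversal R (B m) (B n)" using transversal_B[OF mn] by blast
    have RS: "r \<in> S" "r \<in> B m" if "r \<in> R" for r using transversal_subset[OF R] that B_in_S by auto
    define W where "W r = {\<xi> \<in> carrier dualG. \<xi> ` ((+) r ` B n) \<subseteq> ball (\<beta> r y) 1}" for r
    have Rne: "R \<noteq> {}" using transversal_ex[OF R B_intros(1)] by blast
    have "openin dualT (\<Inter>r\<in>R. W r)"
    proof (rule openin_INT2[OF transversal_finite[OF R] Rne])
      fix r assume r: "r \<in> R"
      show "openin dualT (W r)"
        unfolding W_def
        by (rule openin_dual_basis[OF compactin_compact_open[OF compact_open_coset[OF RS(1)[OF r]]]]) simp
    qed
    moreover have "\<rho> y \<in> (\<Inter>r\<in>R. W r)"
    proof
      fix r assume r: "r \<in> R"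
      have "\<rho> y (r + b) = \<beta> r y" if b: "b \<in> B n" for b
        using \<beta>_add_left[OF RS(1)[OF r] B_in_S[OF b] yS] \<beta>_B_D[OF b yD] S_intros(4)[OF RS(1)[OF r] B_in_S[OF b]]
        by (simp add: \<rho>_def)
      then show "\<rho> y \<in> W r" using \<rho>_in_dual[OF yS] by (auto simp: W_def)
    qed
    moreover have "(\<Inter>r\<in>R. W r) \<subseteq> \<rho> ` U"
    proof
      fix \<xi> assume \<xi>: "\<xi> \<in> (\<Inter>r\<in>R. W r)"
      then have "\<xi> \<in> carrier dualG" using Rne by (auto simp: W_def)
      then obtain z where z: "z \<in> S" "\<xi> = \<rho> z" using \<rho>_surj by blast
      have zy: "z - y \<in> S" by (rule S_intros(2)[OF z(1) yS])
      have re: "Re (\<beta> x (z - y)) > 0" if x: "x \<in> B m" for x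
      proof -
        have xS: "x \<in> S" by (rule B_in_S[OF x])
        obtain r where r: "r \<in> R" "x - r \<in> B n" using transversal_ex[OF R x] by blast
        have "x = r + (x - r)" by simp
        then have "\<xi> x \<in> ball (\<beta> r y) 1" using \<xi> r unfolding W_def by blast
        moreover have "\<beta> x y = \<beta> r y"
          using \<beta>_add_left[OF RS(1)[OF r(1)] B_in_S[OF r(2)] yS] \<beta>_B_D[OF r(2) yD] by simp
        moreover have "\<xi> x = \<beta> x z" using z xS by (simp add: \<rho>_def)
        ultimately have lt: "norm (\<beta> x y - \<beta> x z) < 1" by (simp add: dist_norm)
        have "\<beta> x z = \<beta> x (z - y) * \<beta> x y" using \<beta>_add_right[OF zy yS xS] by simp
        then have "norm (\<beta> x y * (1 - \<beta> x (z - y))) < 1" using lt by (simp add: algebra_simps)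
        then have "norm (1 - \<beta> x (z - y)) < 1" using \<beta>_norm[OF xS yS] by (simp add: norm_mult)
        then show ?thesis using complex_Re_le_cmod[of "1 - \<beta> x (z - y)"] by simp
      qed
      have "\<beta> x (z - y) = 1" if x: "x \<in> B m" for x
      proof -
        let ?y = "\<lambda>j. ((\<lambda>z. z + z) ^^ j) x"
        have y: "?y j \<in> S" "?y j \<in> B m" for j using doubling_in_B[OF x] B_in_S by blast+
        have "\<beta> (?y 0) (z - y) = 1"
          by (rule squares_in_halfplane[of "\<lambda>j. \<beta> (?y j) (z - y)"])
             (simp_all add: \<beta>_norm[OF y(1) zy] \<beta>_add_left[OF y(1) y(1) zy] re[OF y(2)])
        then show ?thesis by simp
      qed
      then have "z - y \<in> D m" using D_iff[OF zy] by blast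
      then have "y + (z - y) \<in> U" using k m by blast
      then show "\<xi> \<in> \<rho> ` U" using z by simp
    qed
    ultimately show ?thesis by blast
  qed
  then show "openin dualT (\<rho> ` U)" by (subst openin_subopen) blast
qed

lemma \<rho>_homeomorphic: "homeomorphic_map T dualT \<rho>"
  by (rule bijective_open_imp_homeomorphic_map[OF \<rho>_continuous \<rho>_open])
     (simp_all add: topspace_T topspace_dual \<rho>_image \<rho>_inj)

lemma mult_dual: "y \<in> S \<Longrightarrow> z \<in> S \<Longrightarrow> \<rho> y \<otimes>\<^bsub>dualG\<^esub> \<rho> z = \<rho> (y + z)"
  by (auto simp: dual_group_def \<rho>_def \<beta>_add_right)

lemma group_dual: "group dualG"
proof (rule groupI)
  have one: "\<one>\<^bsub>dualG\<^esub> = \<rho> 0"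
    by (auto simp: dual_group_def \<rho>_def \<beta>_zero_right)
  show "\<one>\<^bsub>dualG\<^esub> \<in> carrier dualG" unfolding one by (rule \<rho>_in_dual[OF S_intros(1)])
  fix x assume "x \<in> carrier dualG"
  then obtain x' where x: "x' \<in> S" "x = \<rho> x'" using \<rho>_surj by blast
  show "\<one>\<^bsub>dualG\<^esub> \<otimes>\<^bsub>dualG\<^esub> x = x" unfolding one x(2) mult_dual[OF S_intros(1) x(1)] by simp
  show "\<exists>y\<in>carrier dualG. y \<otimes>\<^bsub>dualG\<^esub> x = \<one>\<^bsub>dualG\<^esub>"
    using mult_dual[OF S_intros(3)[OF x(1)] x(1)] \<rho>_in_dual[OF S_intros(3)[OF x(1)]] x(2) one
    by (intro bexI[of _ "\<rho> (- x')"]) simp_all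
  fix y assume "y \<in> carrier dualG"
  then obtain y' where y: "y' \<in> S" "y = \<rho> y'" using \<rho>_surj by blast
  show "x \<otimes>\<^bsub>dualG\<^esub> y \<in> carrier dualG"
    unfolding x(2) y(2) mult_dual[OF x(1) y(1)] by (rule \<rho>_in_dual[OF S_intros(4)[OF x(1) y(1)]])
  fix z assume "z \<in> carrier dualG"
  then obtain z' where z: "z' \<in> S" "z = \<rho> z'" using \<rho>_surj by blast
  show "x \<otimes>\<^bsub>dualG\<^esub> y \<otimes>\<^bsub>dualG\<^esub> z = x \<otimes>\<^bsub>dualG\<^esub> (y \<otimes>\<^bsub>dualG\<^esub> z)"
    unfolding x(2) y(2) z(2)
    by (simp add: mult_dual x(1) y(1) z(1) S_intros(4) add.assoc)
qed

lemma \<rho>_iso: "\<rho> \<in> iso (additive_group S) dualG"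
  unfolding iso_def bij_betw_def hom_def
  using \<rho>_in_dual mult_dual \<rho>_inj \<rho>_image by auto

lemma group_S: "group (additive_group S)"
  by (rule comm_group.axioms(2)[OF comm_group_additive_group[OF S_group]])

section \<open>Dual Haar measures and the value of the Weil index\<close>

abbreviation "dual_algebra \<equiv> sigma (topspace dualT) {U. openin dualT U}"

text \<open>The factor \<open>1 / \<delta>\<close> compensates the \<delta> of
  \<open>FT_inversion\<close> and makes the two measures dual to each other.\<close>

definition dual_haar :: "('a \<Rightarrow> complex) measure" where
  "dual_haar = density (distr haar dual_algebra \<rho>) (\<lambda>_. ennreal (1 / \<delta>))"

lemma haar_measure_dual_haar: "haar_measure dualG dualT dual_haar"
  unfolding dual_haar_def
  by (rule haar_measure_density[OF haar_measure_transport(1)[OF group.is_monoid[OF group_S] \<rho>_iso \<rho>_homeomorphic _ haar_measure_haar]])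
     (simp_all add: topspace_T \<delta>_pos)

lemma integral_dual_haar:
  fixes F :: "('a \<Rightarrow> complex) \<Rightarrow> complex"
  shows "(\<integral>\<xi>. F \<xi> \<partial>dual_haar) = of_real (1 / \<delta>) * (\<integral>z. F (\<rho> z) \<partial>haar)"
  using integral_density_const[of "1 / \<delta>" "distr haar dual_algebra \<rho>" F] \<delta>_pos
    haar_measure_transport(2)[OF group.is_monoid[OF group_S] \<rho>_iso \<rho>_homeomorphic _ haar_measure_haar, where F = F]
  by (simp add: dual_haar_def topspace_T)

lemma integral_haar_cong:
  assumes "\<And>x. x \<in> S \<Longrightarrow> f x = g x" shows "(\<integral>x. f x \<partial>haar) = (\<integral>x. g x \<partial>haar)"
  by (rule Bochner_Integration.integral_cong) (simp_all add: space_haar assms)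

lemma dual_haar_measures_haar: "dual_haar_measures (additive_group S) T haar dual_haar"
  unfolding dual_haar_measures_def
proof (intro conjI haar_measure_haar haar_measure_dual_haar allI impI ballI)
  fix f x assume f: "bruhat_schwartz (additive_group S) T f" and "x \<in> carrier (additive_group S)"
  then have x: "x \<in> S" by simp
  obtain m n where mn: "\<And>x b. x \<in> S \<Longrightarrow> b \<in> B n \<Longrightarrow> f (x + b) = f x" "\<And>x. x \<in> S - B m \<Longrightarrow> f x = 0"
    using bruhat_schwartz_locally_constant[OF f] by blast
  have "(\<integral>\<xi>. (\<integral>y. f y * cnj (\<xi> y) \<partial>haar) * \<xi> x \<partial>dual_haar) =
      of_real (1 / \<delta>) * (\<integral>z. (\<integral>y. f y * cnj (\<rho> z y) \<partial>haar) * \<rho> z x \<partial>haar)"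
    by (rule integral_dual_haar)
  also have "(\<integral>z. (\<integral>y. f y * cnj (\<rho> z y) \<partial>haar) * \<rho> z x \<partial>haar) = (\<integral>z. FT f (- z) * \<beta> x z \<partial>haar)"
  proof (rule integral_haar_cong)
    fix z assume z: "z \<in> S"
    have "(\<integral>y. f y * cnj (\<rho> z y) \<partial>haar) = FT f (- z)"
      unfolding FT_def
    proof (rule integral_haar_cong)
      fix y assume y: "y \<in> S"
      show "f y * cnj (\<rho> z y) = f y * \<beta> (- z) y"
        using \<beta>_minus_right[OF y z] \<beta>_sym[OF y S_intros(3)[OF z]] y by (simp add: \<rho>_def)
    qed
    then show "(\<integral>y. f y * cnj (\<rho> z y) \<partial>haar) * \<rho> z x = FT f (- z) * \<beta> x z" using x by (simp add: \<rho>_def)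
  qed
  also have "\<dots> = of_real \<delta> * f x" by (rule FT_inversion[OF mn x])
  finally show "f x = (\<integral>\<xi>. (\<integral>y. f y * cnj (\<xi> y) \<partial>haar) * \<xi> x \<partial>dual_haar)" using \<delta>_pos by simp
qed

lemma norm_gauss_sqrt: "isotropic_level n \<Longrightarrow> norm (gauss n) = sqrt \<delta>"
  using norm_gauss[of n] real_sqrt_abs[of "norm (gauss n)"] by simp

lemma h_quotient: "x \<in> S \<Longrightarrow> y \<in> S \<Longrightarrow> h (x + y) * inverse (h x) * inverse (h y) = \<beta> x y"
  using h_add_\<beta>[of x y] h_nonzero[of x] h_nonzero[of y] by (simp add: field_simps)

text \<open>With these measures the modulus is \<open>1 / \<delta>\<close>, whose power with
  exponent -1/2 is \<open>sqrt \<delta>\<close>; this is the origin of the denominator, and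
  \<open>norm_gauss\<close> puts the quotient on the unit circle.\<close>

lemma is_weil_index_gauss:
  assumes n: "isotropic_level n"
  shows "is_weil_index (additive_group S) T h (gauss n / of_real (sqrt \<delta>))"
  unfolding is_weil_index_def
proof (intro conjI exI[of _ \<rho>] exI[of _ haar] exI[of _ dual_haar] exI[of _ "1 / \<delta>"] allI impI ballI)
  show "continuous_map T euclidean h" by (rule h_continuous)
  show "h ` carrier (additive_group S) \<subseteq> sphere 0 1" using h_norm by auto
  show "h (inv\<^bsub>additive_group S\<^esub> x) = h x" if "x \<in> carrier (additive_group S)" for x
    using that h_minus S_group by simp
  show "gauss n / of_real (sqrt \<delta>) \<in> sphere 0 1"
    using norm_gauss_sqrt[OF n] \<delta>_pos by (simp add: norm_divide)
  show "\<rho> \<in> iso (additive_group S) dualG" by (rule \<rho>_iso)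
  show "homeomorphic_map T dualT \<rho>" by (rule \<rho>_homeomorphic)
  show "h (x \<otimes>\<^bsub>additive_group S\<^esub> y) * inverse (h x) * inverse (h y) = \<rho> y x"
    if "x \<in> carrier (additive_group S)" "y \<in> carrier (additive_group S)" for x y
    using that h_quotient by (simp add: \<rho>_def)
  show "dual_haar_measures (additive_group S) T haar dual_haar" by (rule dual_haar_measures_haar)
  show "1 / \<delta> > 0" using \<delta>_pos by simp
  show "(\<integral>x. f (\<rho> x) \<partial>haar) = of_real (inverse (1 / \<delta>)) * (\<integral>\<xi>. f \<xi> \<partial>dual_haar)" for f :: "('a \<Rightarrow> complex) \<Rightarrow> complex"
    using integral_dual_haar[of f] \<delta>_pos by simp
next
  fix g assume g: "bruhat_schwartz dualG dualT g"
  have "bruhat_schwartz (additive_group S) T (g \<circ> \<rho>)"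
    by (rule bruhat_schwartz_transport[OF group_S group_dual \<rho>_iso \<rho>_homeomorphic _ g]) (simp add: topspace_T)
  then obtain m i where mi: "\<And>x b. x \<in> S \<Longrightarrow> b \<in> B i \<Longrightarrow> (g \<circ> \<rho>) (x + b) = (g \<circ> \<rho>) x"
    "\<And>x. x \<in> S - B m \<Longrightarrow> (g \<circ> \<rho>) x = 0"
    using bruhat_schwartz_locally_constant by blast
  have "(\<integral>y. h y * (\<integral>\<xi>. g \<xi> * \<xi> y \<partial>dual_haar) \<partial>haar) = (\<integral>y. of_real (1 / \<delta>) * (h y * FT (g \<circ> \<rho>) y) \<partial>haar)"
  proof (rule integral_haar_cong)
    fix y assume y: "y \<in> S"
    have "(\<integral>z. g (\<rho> z) * \<rho> z y \<partial>haar) = FT (g \<circ> \<rho>) y"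
      unfolding FT_def by (rule integral_haar_cong) (simp add: \<rho>_def y \<beta>_sym)
    then show "h y * (\<integral>\<xi>. g \<xi> * \<xi> y \<partial>dual_haar) = of_real (1 / \<delta>) * (h y * FT (g \<circ> \<rho>) y)"
      using integral_dual_haar[of "\<lambda>\<xi>. g \<xi> * \<xi> y"] by simp
  qed
  also have "\<dots> = of_real (1 / \<delta>) * (gauss n * (\<integral>z. cnj (h z) * (g \<circ> \<rho>) z \<partial>haar))"
    by (simp only: integral_mult_right_zero weil_identity[OF n mi])
  also have "(\<integral>z. cnj (h z) * (g \<circ> \<rho>) z \<partial>haar) = (\<integral>z. inverse (h (inv_into S \<rho> (\<rho> z))) * g (\<rho> z) \<partial>haar)"
    by (rule integral_haar_cong) (simp add: h_inverse inv_into_f_f[OF \<rho>_inj])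
  also have "of_real (1 / \<delta>) * (gauss n * \<dots>) = gauss n * (\<integral>\<xi>. inverse (h (inv_into S \<rho> \<xi>)) * g \<xi> \<partial>dual_haar)"
    unfolding integral_dual_haar by simp
  also have "gauss n = gauss n / of_real (sqrt \<delta>) * of_real ((1 / \<delta>) powr (- 1 / 2))"
  proof -
    have "(1 / \<delta>) powr (- 1 / 2) = sqrt \<delta>"
      using \<delta>_pos powr_minus[of "1 / \<delta>" "1 / 2"] by (simp add: powr_half_sqrt real_sqrt_divide)
    then show ?thesis using \<delta>_pos by simp
  qed
  finally show "(\<integral>y. h y * (\<integral>\<xi>. g \<xi> * \<xi> y \<partial>dual_haar) \<partial>haar) =
      gauss n / of_real (sqrt \<delta>) * of_real ((1 / \<delta>) powr (- 1 / 2)) *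
        (\<integral>\<xi>. inverse (h (inv_into (carrier (additive_group S)) \<rho> \<xi>)) * g \<xi> \<partial>dual_haar)"
    by simp
qed

text \<open>\<open>h\<close> determines \<rho>', and both measures are positive multiples of the
  standard ones. Testing with the indicator of \<open>B n\<close> gives
  \<open>c = \<theta> * gauss n\<close> with \<theta> positive, and \<open>norm c = 1\<close> fixes
  \<theta> whatever the multiples and the modulus are.\<close>

lemma weil_index_unique:
  assumes n: "isotropic_level n" and c: "is_weil_index (additive_group S) T h c"
  shows "c = gauss n / of_real (sqrt \<delta>)"
proof -
  obtain \<rho>' M N m where c1: "c \<in> sphere 0 1"
    and iso': "\<rho>' \<in> iso (additive_group S) dualG"
    and \<rho>': "\<forall>x\<in>carrier (additive_group S). \<forall>y\<in>carrier (additive_group S).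
        h (x \<otimes>\<^bsub>additive_group S\<^esub> y) * inverse (h x) * inverse (h y) = \<rho>' y x"
    and MN: "dual_haar_measures (additive_group S) T M N" and m: "m > 0"
    and weil: "\<forall>g. bruhat_schwartz dualG dualT g \<longrightarrow>
           (\<integral>y. h y * (\<integral>\<xi>. g \<xi> * \<xi> y \<partial>N) \<partial>M) =
           c * of_real (m powr (-1/2)) *
             (\<integral>\<xi>. inverse (h (inv_into (carrier (additive_group S)) \<rho>' \<xi>)) * g \<xi> \<partial>N)"
    using c unfolding is_weil_index_def by (elim conjE exE) (rule that)
  have eq: "\<rho>' y = \<rho> y" if y: "y \<in> S" for y
  proof (rule extensionalityI[of _ S])
    have "\<rho>' y \<in> carrier dualG" using iso' y by (auto simp: iso_def hom_def)
    then show "\<rho>' y \<in> extensional S" by (simp add: carrier_dual)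
    show "\<rho> y \<in> extensional S" by (simp add: \<rho>_def)
    show "\<rho>' y x = \<rho> y x" if "x \<in> S" for x
      using \<rho>' h_quotient[OF that y] y that by (auto simp: \<rho>_def)
  qed
  define \<sigma> where "\<sigma> = inv_into S \<rho>"
  have \<sigma>: "\<sigma> (\<rho> z) = z" if "z \<in> S" for z unfolding \<sigma>_def by (rule inv_into_f_f[OF \<rho>_inj that])
  have inv': "inv_into S \<rho>' \<xi> = \<sigma> \<xi>" if "\<xi> \<in> carrier dualG" for \<xi>
  proof -
    obtain z where z: "z \<in> S" "\<xi> = \<rho> z" using \<rho>_surj \<open>\<xi> \<in> carrier dualG\<close> by blast
    have "inj_on \<rho>' S" using iso' by (simp add: iso_def bij_betw_def)
    then have "inv_into S \<rho>' (\<rho>' z) = z" using z(1) by (rule inv_into_f_f)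
    then show ?thesis using z eq \<sigma> by simp
  qed
  obtain \<kappa> where \<kappa>: "\<kappa> > 0" "M = density haar (\<lambda>_. ennreal \<kappa>)"
    using MN haar_measure_unique unfolding dual_haar_measures_def by blast
  have hN: "haar_measure dualG dualT N" using MN unfolding dual_haar_measures_def by blast
  have \<sigma>_iso: "\<sigma> \<in> iso dualG (additive_group S)"
    using group.iso_set_sym[OF group_S \<rho>_iso] by (simp add: \<sigma>_def)
  have \<sigma>_homeo: "homeomorphic_map dualT T \<sigma>"
  proof -
    obtain g where g: "homeomorphic_maps T dualT \<rho> g" using \<rho>_homeomorphic homeomorphic_map_maps by blast
    then have hg: "homeomorphic_map dualT T g" and inv: "\<And>x. x \<in> S \<Longrightarrow> g (\<rho> x) = x"
      by (auto simp: homeomorphic_maps_map topspace_T)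
    have "g \<xi> = \<sigma> \<xi>" if "\<xi> \<in> topspace dualT" for \<xi>
      using that inv \<sigma> \<rho>_surj[of \<xi>] by (auto simp: topspace_dual)
    then show ?thesis by (rule homeomorphic_map_eq[OF hg])
  qed
  note tr = haar_measure_transport[OF group.is_monoid[OF group_dual] \<sigma>_iso \<sigma>_homeo topspace_dual hN]
  obtain \<kappa>' where \<kappa>': "\<kappa>' > 0" "distr N (sigma (topspace T) {U. openin T U}) \<sigma> = density haar (\<lambda>_. ennreal \<kappa>')"
    using haar_measure_unique[OF tr(1)] by blast
  have spN: "space N = carrier dualG"
  proof -
    have "sets N = sets dual_algebra" using hN unfolding haar_measure_def by (elim conjE) assumption
    moreover have "{U. openin dualT U} \<subseteq> Pow (topspace dualT)" using openin_subset by blast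
    ultimately show ?thesis using sets_eq_imp_space_eq[of N dual_algebra] by (simp add: topspace_dual)
  qed
  have intN: "(\<integral>\<xi>. F \<xi> \<partial>N) = of_real \<kappa>' * (\<integral>z. F (\<rho> z) \<partial>haar)" for F :: "('a \<Rightarrow> complex) \<Rightarrow> complex"
  proof -
    have "(\<integral>\<xi>. F \<xi> \<partial>N) = (\<integral>\<xi>. F (\<rho> (\<sigma> \<xi>)) \<partial>N)"
    proof (rule Bochner_Integration.integral_cong[OF refl])
      fix \<xi> assume "\<xi> \<in> space N"
      then obtain z where z: "z \<in> S" "\<xi> = \<rho> z" using \<rho>_surj[of \<xi>] unfolding spN by blast
      show "F \<xi> = F (\<rho> (\<sigma> \<xi>))" unfolding z(2) \<sigma>[OF z(1)] ..
    qed
    also have "\<dots> = (\<integral>z. F (\<rho> z) \<partial>density haar (\<lambda>_. ennreal \<kappa>'))"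
      using tr(2)[of "\<lambda>z. F (\<rho> z)"] \<kappa>'(2) by simp
    finally show ?thesis by (simp add: integral_density_const[OF \<kappa>'(1)])
  qed
  define g where "g = (\<lambda>x. indicator (B n) x :: complex) \<circ> \<sigma>"
  have "bruhat_schwartz dualG dualT g"
    unfolding g_def
    by (rule bruhat_schwartz_transport[OF group_dual group_S \<sigma>_iso \<sigma>_homeo topspace_dual bruhat_schwartz_indicator_B])
  then have W: "(\<integral>y. h y * (\<integral>\<xi>. g \<xi> * \<xi> y \<partial>N) \<partial>M) = c * of_real (m powr (-1/2)) *
             (\<integral>\<xi>. inverse (h (inv_into S \<rho>' \<xi>)) * g \<xi> \<partial>N)"
    using weil by simp
  let ?f = "\<lambda>x. indicator (B n) x :: complex"
  have g\<rho>: "g (\<rho> z) = ?f z" if "z \<in> S" for z using \<sigma>[OF that] by (simp add: g_def)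
  have "(\<integral>y. h y * (\<integral>\<xi>. g \<xi> * \<xi> y \<partial>N) \<partial>M) = of_real \<kappa> * (\<integral>y. h y * (\<integral>\<xi>. g \<xi> * \<xi> y \<partial>N) \<partial>haar)"
    unfolding \<kappa>(2) by (rule integral_density_const[OF \<kappa>(1)])
  also have "(\<integral>y. h y * (\<integral>\<xi>. g \<xi> * \<xi> y \<partial>N) \<partial>haar) = (\<integral>y. of_real \<kappa>' * (h y * FT ?f y) \<partial>haar)"
  proof (rule integral_haar_cong)
    fix y assume y: "y \<in> S"
    have "(\<integral>z. g (\<rho> z) * \<rho> z y \<partial>haar) = FT ?f y"
      unfolding FT_def
    proof (rule integral_haar_cong)
      fix z assume z: "z \<in> S"
      have "\<rho> z y = \<beta> y z" using y by (simp add: \<rho>_def)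
      then show "g (\<rho> z) * \<rho> z y = ?f z * \<beta> y z" by (simp only: g\<rho>[OF z])
    qed
    then show "h y * (\<integral>\<xi>. g \<xi> * \<xi> y \<partial>N) = of_real \<kappa>' * (h y * FT ?f y)"
      using intN[of "\<lambda>\<xi>. g \<xi> * \<xi> y"] by simp
  qed
  also have "\<dots> = of_real \<kappa>' * (gauss n * (\<integral>z. cnj (h z) * ?f z \<partial>haar))"
  proof -
    have inv: "?f (x + b) = ?f x" if "x \<in> S" "b \<in> B n" for x b
      using add_subgroup_add_cancel[OF B_group that(2)] by (simp add: indicator_def)
    have supp: "?f x = 0" if "x \<in> S - B n" for x using that by simp
    show ?thesis by (simp only: integral_mult_right_zero weil_identity[OF n inv supp])
  qed
  also have "(\<integral>z. cnj (h z) * ?f z \<partial>haar) = of_real (vol (B n))"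
  proof -
    have "(\<integral>z. cnj (h z) * ?f z \<partial>haar) = int_over (B n) (\<lambda>z. cnj (h z) * ?f z)"
      by (rule integral_haar_support) simp
    also have "\<dots> = int_over (B n) (\<lambda>_. 1)"
      by (rule integral_cong_on) (use n in \<open>simp add: isotropic_level_def\<close>)
    finally show ?thesis by (simp add: integral_const[OF compact_open_B])
  qed
  finally have L: "(\<integral>y. h y * (\<integral>\<xi>. g \<xi> * \<xi> y \<partial>N) \<partial>M) = of_real (\<kappa> * \<kappa>' * vol (B n)) * gauss n"
    by (simp add: mult_ac)
  have "(\<integral>\<xi>. inverse (h (inv_into S \<rho>' \<xi>)) * g \<xi> \<partial>N) = of_real \<kappa>' * (\<integral>z. cnj (h z) * ?f z \<partial>haar)"
    unfolding intN
  proof (rule arg_cong[of _ _ "\<lambda>t. of_real \<kappa>' * t"], rule integral_haar_cong)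
    fix z assume z: "z \<in> S"
    show "inverse (h (inv_into S \<rho>' (\<rho> z))) * g (\<rho> z) = cnj (h z) * ?f z"
      by (simp only: inv'[OF \<rho>_in_dual[OF z]] \<sigma>[OF z] g\<rho>[OF z] h_inverse[OF z])
  qed
  also have "(\<integral>z. cnj (h z) * ?f z \<partial>haar) = of_real (vol (B n))"
  proof -
    have "(\<integral>z. cnj (h z) * ?f z \<partial>haar) = int_over (B n) (\<lambda>z. cnj (h z) * ?f z)"
      by (rule integral_haar_support) simp
    also have "\<dots> = int_over (B n) (\<lambda>_. 1)"
      by (rule integral_cong_on) (use n in \<open>simp add: isotropic_level_def\<close>)
    finally show ?thesis by (simp add: integral_const[OF compact_open_B])
  qed
  finally have Rr: "of_real (\<kappa> * \<kappa>' * vol (B n)) * gauss n = c * of_real (m powr (-1/2)) * of_real (\<kappa>' * vol (B n))"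
    using W L by simp
  define \<theta> where "\<theta> = \<kappa> / m powr (-1/2)"
  have pos: "m powr (-1/2) > 0" "\<theta> > 0" using m \<kappa>(1) by (auto simp: \<theta>_def)
  have "c * of_real (m powr (-1/2)) = of_real \<kappa> * gauss n"
    using Rr \<kappa>'(1) vol_B_pos[of n] by (simp add: mult_ac)
  then have c2: "c = of_real \<theta> * gauss n" using pos by (simp add: \<theta>_def field_simps)
  then have "norm c = \<theta> * sqrt \<delta>" using pos norm_gauss_sqrt[OF n] by (simp add: norm_mult)
  then have "\<theta> * sqrt \<delta> = 1" using c1 by simp
  then have "\<theta> = 1 / sqrt \<delta>" using \<delta>_pos by (simp add: field_simps)
  then show ?thesis using c2 by simp
qed

theorem weil_index_eq:
  assumes "isotropic_level n"
  shows "weil_index (additive_group S) T h = gauss n / of_real (sqrt \<delta>)"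
  unfolding weil_index_def
  by (rule the_equality) (use is_weil_index_gauss weil_index_unique assms in blast)+

lemma norm_weil_index: "norm (weil_index (additive_group S) T h) = 1"
proof -
  obtain n where n: "isotropic_level n" using h_trivial by (auto simp: isotropic_level_def)
  then show ?thesis using weil_index_eq[OF n] norm_gauss_sqrt[OF n] \<delta>_pos by (simp add: norm_divide)
qed

text \<open>The order of quantifiers matters: \<open>k\<close> is taken so large that
  \<open>D n1\<close> lies in \<open>B (- k)\<close>, and \<open>n\<close> afterwards so large that
  \<open>h\<close> is periodic on \<open>B (- k)\<close>. Thresholds of this form can be met
  simultaneously for finitely many groups.\<close>

theorem weil_index_gauss_sum:
  "\<exists>k0. \<forall>k\<ge>k0. \<exists>n0. \<forall>n\<ge>n0. (\<forall>x\<in>B (- k). \<forall>b\<in>B n. h (x + b) = h x) \<and>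
     (\<forall>R. transversal R (B (- k)) (B n) \<longrightarrow>
       (\<exists>\<kappa>::real. \<kappa> > 0 \<and> sum h R = of_real \<kappa> * weil_index (additive_group S) T h))"
proof -
  obtain n1 where n1: "isotropic_level n1" using h_trivial by (auto simp: isotropic_level_def)
  obtain k0 where k0: "\<And>k. k \<ge> k0 \<Longrightarrow> D n1 \<subseteq> B (- k)" using B_absorbs_D by blast
  show ?thesis
  proof (rule exI[of _ k0], intro allI impI)
    fix k assume k: "k \<ge> k0"
    obtain n0 where n0: "\<And>n. n \<ge> n0 \<Longrightarrow> B (- k) \<subseteq> D n" using D_absorbs_B by blast
    show "\<exists>n0. \<forall>n\<ge>n0. (\<forall>x\<in>B (- k). \<forall>b\<in>B n. h (x + b) = h x) \<and>
     (\<forall>R. transversal R (B (- k)) (B n) \<longrightarrow>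
       (\<exists>\<kappa>::real. \<kappa> > 0 \<and> sum h R = of_real \<kappa> * weil_index (additive_group S) T h))"
    proof (rule exI[of _ "max (max n0 n1) (- k)"], intro allI impI conjI)
      fix n assume n: "n \<ge> max (max n0 n1) (- k)"
      then have iso: "isotropic_level n" using isotropic_level_mono[OF n1] by simp
      show per: "\<forall>x\<in>B (- k). \<forall>b\<in>B n. h (x + b) = h x"
        using h_periodic[OF iso] n0[of n] n by auto
      fix R assume R: "transversal R (B (- k)) (B n)"
      have "coset_stable (B (- k)) (B n)" using n by (intro coset_stable_B) simp
      then have "int_over (B (- k)) h = of_real (real Q powi (- n)) * sum h R"
        using per by (intro integral_cosets[OF _ B_sub_S R]) (simp add: const_on_cosets_def)
      moreover have "int_over (B (- k)) h = of_real (sqrt \<delta>) * weil_index (additive_group S) T h"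
        using integral_h[OF n1 compact_open_B B_group k0[OF k]] weil_index_eq[OF n1] \<delta>_pos by simp
      ultimately have "sum h R = of_real (sqrt \<delta> / real Q powi (- n)) * weil_index (additive_group S) T h"
        using Q_pos by (simp add: field_simps)
      moreover have "sqrt \<delta> / real Q powi (- n) > 0"
        using \<delta>_pos Q_pos by (simp add: zero_less_power_int)
      ultimately show "\<exists>\<kappa>::real. \<kappa> > 0 \<and> sum h R = of_real \<kappa> * weil_index (additive_group S) T h" by blast
    qed
  qed
qed

end

section \<open>Complete discretely valued fields with finite residue field\<close>

text \<open>The Dedekind domain is no longer visible, and the continuity of \<psi> is contained in
  the existence of the conductor.\<close>

locale local_field =
  fixes v :: "'k::field_char_0 \<Rightarrow> int" and res :: "'k \<Rightarrow> 'f::field" and \<pi> :: 'k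
    and \<psi> :: "'k \<Rightarrow> complex" and c :: int
  assumes discrete: "discrete_valuation v"
    and cauchy_limit: "\<And>X. (\<forall>n. \<exists>N::nat. \<forall>i\<ge>N. \<forall>j\<ge>N. X i - X j \<in> max_power v n) \<Longrightarrow>
        \<exists>L. limitin (valuation_topology v) X L sequentially"
    and residue: "is_residue_map v res"
    and finite_residue: "finite (UNIV :: 'f set)"
    and odd_residue: "odd CHAR('f)"
    and \<pi>_nonzero: "\<pi> \<noteq> 0" and v_\<pi>: "v \<pi> = 1"
    and \<psi>_add: "\<psi> (x + y) = \<psi> x * \<psi> y"
    and \<psi>_norm: "norm (\<psi> x) = 1"
    and conductor: "has_conductor v \<psi> c"
begin

abbreviation mp :: "int \<Rightarrow> 'k set" where "mp \<equiv> max_power v"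

lemma v_mult: "x \<noteq> 0 \<Longrightarrow> y \<noteq> 0 \<Longrightarrow> v (x * y) = v x + v y"
  and v_add: "x \<noteq> 0 \<Longrightarrow> y \<noteq> 0 \<Longrightarrow> x + y \<noteq> 0 \<Longrightarrow> min (v x) (v y) \<le> v (x + y)"
  using discrete by (auto simp: discrete_valuation_def)

lemma v_one [simp]: "v 1 = 0"
  using v_mult[of 1 1] by simp

lemma v_minus [simp]: "x \<noteq> 0 \<Longrightarrow> v (- x) = v x"
  using v_mult[of "- 1" "- 1"] v_mult[of "- 1" x] by simp

lemma v_inverse: "x \<noteq> 0 \<Longrightarrow> v (inverse x) = - v x"
  using v_mult[of x "inverse x"] by simp

lemma v_power: "x \<noteq> 0 \<Longrightarrow> v (x ^ n) = int n * v x"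
  by (induction n) (simp_all add: v_mult algebra_simps)

lemma v_\<pi>_powi [simp]: "v (\<pi> powi n) = n"
  using \<pi>_nonzero by (simp add: power_int_def v_power v_\<pi> v_inverse)

lemma mp_iff: "x \<in> mp n \<longleftrightarrow> x = 0 \<or> n \<le> v x"
  by (simp add: max_power_def)

lemma zero_mp [simp]: "0 \<in> mp n"
  by (simp add: mp_iff)

lemma mp_add: "x \<in> mp n \<Longrightarrow> y \<in> mp n \<Longrightarrow> x + y \<in> mp n"
  using v_add[of x y] by (cases "x = 0 \<or> y = 0 \<or> x + y = 0") (auto simp: mp_iff)

lemma mp_minus: "x \<in> mp n \<Longrightarrow> - x \<in> mp n"
  by (cases "x = 0") (auto simp: mp_iff)

lemma mp_diff: "x \<in> mp n \<Longrightarrow> y \<in> mp n \<Longrightarrow> x - y \<in> mp n"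
  using mp_add[of x n "- y"] mp_minus by simp

lemma mp_mult: "x \<in> mp m \<Longrightarrow> y \<in> mp n \<Longrightarrow> x * y \<in> mp (m + n)"
  by (cases "x = 0 \<or> y = 0") (auto simp: mp_iff v_mult)

lemma mp_mult_int: "x \<in> mp 0 \<Longrightarrow> y \<in> mp n \<Longrightarrow> x * y \<in> mp n"
  using mp_mult[of x 0 y n] by simp

lemma mp_antimono: "m \<le> n \<Longrightarrow> mp n \<subseteq> mp m"
  by (auto simp: mp_iff)

lemma mp_sum: "(\<And>i. i \<in> I \<Longrightarrow> f i \<in> mp n) \<Longrightarrow> sum f I \<in> mp n"
  by (induction I rule: infinite_finite_induct) (auto intro: mp_add)

lemma one_mp [simp]: "1 \<in> mp 0"
  by (simp add: mp_iff)

lemma mp_Inter: "(\<And>n. x \<in> mp n) \<Longrightarrow> x = 0"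
proof (rule ccontr)
  assume "\<And>n. x \<in> mp n" "x \<noteq> 0"
  then have "v x + 1 \<le> v x" by (auto simp: mp_iff simp del: add_le_same_cancel1)
  then show False by simp
qed

lemma \<pi>_powi_mp [simp]: "\<pi> powi n \<in> mp n"
  by (simp add: mp_iff)

lemma \<pi>_powi_mult_mp: "\<pi> powi m * x \<in> mp n \<longleftrightarrow> x \<in> mp (n - m)"
  using \<pi>_nonzero v_mult[of "\<pi> powi m" x] by (cases "x = 0") (auto simp: mp_iff)

lemma \<pi>_powi_cancel [simp]: "\<pi> powi n * (\<pi> powi (- n) * x) = x" "\<pi> powi (- n) * (\<pi> powi n * x) = x"
  using \<pi>_nonzero by (simp_all add: power_int_minus)

lemma mp_factor: "x \<in> mp n \<Longrightarrow> \<exists>y\<in>mp 0. x = \<pi> powi n * y"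
proof -
  assume x: "x \<in> mp n"
  have "\<pi> powi (- n) * x \<in> mp 0" using x \<pi>_powi_mult_mp[of "- n" x 0] by simp
  then show ?thesis using \<pi>_powi_cancel(1)[of n x] by metis
qed

section \<open>Topology and completeness of the field\<close>

lemma openin_valuation:
  "openin (valuation_topology v) U \<longleftrightarrow> (\<forall>x\<in>U. \<exists>n. \<forall>b\<in>mp n. x + b \<in> U)"
proof
  let ?\<S> = "{{y. y - x \<in> mp n} | x n. True}"
  assume "openin (valuation_topology v) U"
  then have "generate_topology_on ?\<S> U"
    unfolding valuation_topology_def openin_topology_generated_by_iff .
  then show "\<forall>x\<in>U. \<exists>n. \<forall>b\<in>mp n. x + b \<in> U"
  proof induction
    case (Int A B)
    show ?case
    proof
      fix x assume x: "x \<in> A \<inter> B"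
      then obtain m n where "\<forall>b\<in>mp m. x + b \<in> A" "\<forall>b\<in>mp n. x + b \<in> B" using Int by blast
      then show "\<exists>n. \<forall>b\<in>mp n. x + b \<in> A \<inter> B"
        using mp_antimono[of m "max m n"] mp_antimono[of n "max m n"]
        by (intro exI[of _ "max m n"]) (auto simp: subset_iff)
    qed
  next
    case (UN K)
    then show ?case by (meson Union_iff)
  next
    case (Basis s)
    then obtain z n where s: "s = {y. y - z \<in> mp n}" by blast
    have "x + b - z \<in> mp n" if "x - z \<in> mp n" "b \<in> mp n" for x b
      using mp_add[OF that] by (simp add: algebra_simps)
    then show ?case unfolding s by blast
  qed simp
next
  assume all: "\<forall>x\<in>U. \<exists>n. \<forall>b\<in>mp n. x + b \<in> U"
  then obtain n where n: "\<And>x b. x \<in> U \<Longrightarrow> b \<in> mp (n x) \<Longrightarrow> x + b \<in> U" by metis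
  have "U = (\<Union>x\<in>U. {y. y - x \<in> mp (n x)})"
  proof (intro equalityI subsetI)
    fix y assume "y \<in> (\<Union>x\<in>U. {y. y - x \<in> mp (n x)})"
    then obtain x where "x \<in> U" "y - x \<in> mp (n x)" by blast
    then show "y \<in> U" using n[of x "y - x"] by simp
  next
    fix y assume "y \<in> U"
    then show "y \<in> (\<Union>x\<in>U. {y. y - x \<in> mp (n x)})" by (intro UN_I[of y]) simp_all
  qed
  moreover have "openin (valuation_topology v) (\<Union>x\<in>U. {y. y - x \<in> mp (n x)})"
    unfolding valuation_topology_def by (intro openin_clauses(3) ballI) (auto intro: topology_generated_by_Basis)
  ultimately show "openin (valuation_topology v) U" by simp
qed

lemma topspace_valuation [simp]: "topspace (valuation_topology v) = UNIV"
proof -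
  have "openin (valuation_topology v) UNIV" by (simp add: openin_valuation)
  then show ?thesis using openin_subset by blast
qed

lemma limitin_valuation:
  "limitin (valuation_topology v) X L sequentially \<longleftrightarrow> (\<forall>n. \<exists>N. \<forall>i\<ge>N. X i - L \<in> mp n)"
proof
  assume lim: "limitin (valuation_topology v) X L sequentially"
  show "\<forall>n. \<exists>N. \<forall>i\<ge>N. X i - L \<in> mp n"
  proof
    fix n
    have op: "openin (valuation_topology v) {y. y - L \<in> mp n}"
      unfolding valuation_topology_def by (rule topology_generated_by_Basis) blast
    from lim have "\<forall>U. openin (valuation_topology v) U \<and> L \<in> U \<longrightarrow> (\<forall>\<^sub>F i in sequentially. X i \<in> U)"
      by (simp add: limitin_def)
    from this[rule_format, of "{y. y - L \<in> mp n}"] op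
    have "\<forall>\<^sub>F i in sequentially. X i \<in> {y. y - L \<in> mp n}" by simp
    then show "\<exists>N. \<forall>i\<ge>N. X i - L \<in> mp n" by (simp add: eventually_sequentially)
  qed
next
  assume lim: "\<forall>n. \<exists>N. \<forall>i\<ge>N. X i - L \<in> mp n"
  show "limitin (valuation_topology v) X L sequentially"
    unfolding limitin_def
  proof (intro conjI allI impI)
    fix U assume U: "openin (valuation_topology v) U \<and> L \<in> U"
    then obtain n where n: "\<And>b. b \<in> mp n \<Longrightarrow> L + b \<in> U" unfolding openin_valuation by blast
    obtain N where N: "\<And>i. i \<ge> N \<Longrightarrow> X i - L \<in> mp n" using lim by blast
    have "X i \<in> U" if "i \<ge> N" for i using n[OF N[OF that]] by simp
    then show "\<forall>\<^sub>F i in sequentially. X i \<in> U" unfolding eventually_sequentially by blast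
  qed simp
qed

text \<open>Completeness with the prescribed rate that \<open>filtered_group\<close> asks for: a far
  term of the sequence is close both to the limit and, at the stated rate, to
  \<open>X i\<close>.\<close>

lemma mp_complete:
  assumes X: "\<And>i. X (Suc i) - X i \<in> mp (m + int i)"
  shows "\<exists>y. \<forall>i. y - X i \<in> mp (m + int i)"
proof -
  have step: "X j - X i \<in> mp (m + int i)" if "i \<le> j" for i j
    using that
  proof (induction j rule: dec_induct)
    case (step j)
    have "X (Suc j) - X j \<in> mp (m + int i)"
      using X[of j] mp_antimono[of "m + int i" "m + int j"] step by auto
    then show ?case using mp_add[OF _ step.IH] by fastforce
  qed simp
  have "\<forall>n. \<exists>N. \<forall>i\<ge>N. \<forall>j\<ge>N. X i - X j \<in> mp n"
  proof (rule allI, rule exI, intro allI impI)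
    fix n i j assume i: "nat (n - m) \<le> i" and j: "nat (n - m) \<le> j"
    have "(X i - X (nat (n - m))) - (X j - X (nat (n - m))) \<in> mp (m + int (nat (n - m)))"
      by (rule mp_diff[OF step[OF i] step[OF j]])
    moreover have "mp (m + int (nat (n - m))) \<subseteq> mp n" by (rule mp_antimono) simp
    ultimately show "X i - X j \<in> mp n" by auto
  qed
  then obtain L where "limitin (valuation_topology v) X L sequentially" using cauchy_limit by blast
  then have L: "\<forall>n. \<exists>N. \<forall>i\<ge>N. X i - L \<in> mp n" by (simp add: limitin_valuation)
  have "L - X i \<in> mp (m + int i)" for i
  proof -
    obtain N where N: "\<And>j. j \<ge> N \<Longrightarrow> X j - L \<in> mp (m + int i)" using L by blast
    have "(X (max i N) - X i) - (X (max i N) - L) \<in> mp (m + int i)"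
      using mp_diff[OF step[of i "max i N"] N[of "max i N"]] by simp
    then show ?thesis by simp
  qed
  then show ?thesis by blast
qed

section \<open>The residue field\<close>

lemma res_one [simp]: "res 1 = 1"
  and res_add: "x \<in> mp 0 \<Longrightarrow> y \<in> mp 0 \<Longrightarrow> res (x + y) = res x + res y"
  and res_mult: "x \<in> mp 0 \<Longrightarrow> y \<in> mp 0 \<Longrightarrow> res (x * y) = res x * res y"
  and res_surj: "\<exists>x\<in>mp 0. res x = a"
  and res_zero_iff: "x \<in> mp 0 \<Longrightarrow> res x = 0 \<longleftrightarrow> x \<in> mp 1"
proof -
  have "a \<in> res ` mp 0" using residue by (simp add: is_residue_map_def)
  then show "\<exists>x\<in>mp 0. res x = a" by blast
qed (use residue in \<open>simp_all add: is_residue_map_def\<close>)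

lemma res_zero [simp]: "res 0 = 0"
  by (simp add: res_zero_iff)

lemma res_minus: "x \<in> mp 0 \<Longrightarrow> res (- x) = - res x"
  using res_add[of x "- x"] mp_minus[of x 0] by (simp add: eq_neg_iff_add_eq_0 add.commute)

lemma res_diff: "x \<in> mp 0 \<Longrightarrow> y \<in> mp 0 \<Longrightarrow> res (x - y) = res x - res y"
  using res_add[of x "- y"] mp_minus[of y 0] res_minus[of y] by simp

lemma res_eq_iff: "x \<in> mp 0 \<Longrightarrow> y \<in> mp 0 \<Longrightarrow> res x = res y \<longleftrightarrow> x - y \<in> mp 1"
  using res_diff[of x y] res_zero_iff[of "x - y"] mp_diff[of x 0 y] by simp

lemma res_unit_iff: "x \<in> mp 0 \<Longrightarrow> res x \<noteq> 0 \<longleftrightarrow> x \<noteq> 0 \<and> v x = 0"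
  using res_zero_iff[of x] by (auto simp: mp_iff)

text \<open>An arbitrary section of the residue map, in general not additive; it supplies coset
  representatives.\<close>

definition lift :: "'f \<Rightarrow> 'k" where "lift a = (SOME x. x \<in> mp 0 \<and> res x = a)"

lemma lift_mp [simp]: "lift a \<in> mp 0" and res_lift [simp]: "res (lift a) = a"
  using someI_ex[of "\<lambda>x. x \<in> mp 0 \<and> res x = a"] res_surj[of a] by (auto simp: lift_def)

lemma two_residue: "(2::'f) \<noteq> 0"
proof
  assume "(2::'f) = 0"
  then have "CHAR('f) dvd 2" using of_nat_eq_0_iff_char_dvd[of 2, where 'a = 'f] by simp
  then have "CHAR('f) \<le> 2" by (rule dvd_imp_le) simp
  then have "CHAR('f) = 1" using odd_residue by (cases "CHAR('f)") (auto simp: le_Suc_eq numeral_2_eq_2)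
  then show False using CHAR_not_1'[where 'a = 'f] by simp
qed

text \<open>In odd residue characteristic 2 has nonzero residue and is therefore a unit.\<close>

lemma half_mp [simp]: "1 / 2 \<in> mp 0" and res_half: "res (1 / 2) = 1 / 2"
proof -
  have 2: "(2::'k) \<in> mp 0" using mp_add[of 1 0 1] by simp
  have r2: "res 2 = 2" using res_add[of 1 1] by simp
  then have "v 2 = 0" using res_unit_iff[OF 2] two_residue by simp
  then show h: "1 / 2 \<in> mp 0" using v_inverse[of 2] by (simp add: mp_iff inverse_eq_divide)
  have "res (2 * (1 / 2)) = 2 * res (1 / 2)" using res_mult[OF 2 h] r2 by simp
  then show "res (1 / 2) = 1 / 2" using two_residue by (simp add: field_simps)
qed

section \<open>Duality for the additive character and its residual character\<close>

lemma \<psi>_trivial: "x \<in> mp c \<Longrightarrow> \<psi> x = 1"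
  using conductor by (simp add: has_conductor_def)

lemma \<psi>_zero [simp]: "\<psi> 0 = 1"
  by (rule \<psi>_trivial) simp

lemma \<psi>_cong: "x - y \<in> mp c \<Longrightarrow> \<psi> x = \<psi> y"
  using \<psi>_add[of "x - y" y] \<psi>_trivial[of "x - y"] by simp

text \<open>If v(y) < c - n, the multiples of \<open>y\<close> by \<open>mp n\<close> exhaust
  \<open>mp (c - 1)\<close>, where \<psi> is nontrivial.\<close>

lemma \<psi>_perp:
  assumes "\<And>x. x \<in> mp n \<Longrightarrow> \<psi> (x * y) = 1" shows "y \<in> mp (c - n)"
proof (rule ccontr)
  assume y: "y \<notin> mp (c - n)"
  then have y0: "y \<noteq> 0" "v y \<le> c - n - 1" by (auto simp: mp_iff)
  have "\<psi> z = 1" if z: "z \<in> mp (c - 1)" for z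
  proof -
    have "z * inverse y \<in> mp n"
      using z y0 v_mult[of z "inverse y"] v_inverse[of y] by (cases "z = 0") (auto simp: mp_iff)
    then show ?thesis using assms[of "z * inverse y"] y0(1) by (simp add: mult.assoc)
  qed
  then show False using conductor by (simp add: has_conductor_def)
qed

lemma exists_nontrivial: "\<exists>x\<in>mp (c - 1). \<psi> x \<noteq> 1"
  using conductor by (auto simp: has_conductor_def)

abbreviation \<psi>0 :: "'f \<Rightarrow> complex" where "\<psi>0 \<equiv> psi_0 v res \<pi> \<psi> c"

text \<open>The choice made in \<open>psi_0\<close> is harmless: two admissible elements differ by
  an element of \<open>mp c\<close>, on which \<psi> is trivial.\<close>

lemma psi_0_eq:
  assumes "y \<in> mp 0" shows "\<psi> (\<pi> powi (c - 1) * y) = \<psi>0 (res y)"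
proof -
  have eq: "\<pi> powi (1 - c) * (\<pi> powi (c - 1) * y) = y" for y
    using \<pi>_powi_cancel(2)[of "c - 1" y] by simp
  let ?P = "\<lambda>x. x \<in> mp (c - 1) \<and> res (\<pi> powi (1 - c) * x) = res y"
  have "?P (\<pi> powi (c - 1) * y)" using assms by (simp only: eq \<pi>_powi_mult_mp) simp
  then have P: "?P (SOME x. ?P x)" by (rule someI)
  then obtain z where z: "z \<in> mp 0" "(SOME x. ?P x) = \<pi> powi (c - 1) * z" using mp_factor by blast
  then have "res z = res y" using P by (simp only: eq)
  then have "\<pi> powi (c - 1) * (y - z) \<in> mp c" using res_eq_iff[OF assms z(1)] by (simp add: \<pi>_powi_mult_mp)
  then have "\<psi> (\<pi> powi (c - 1) * y) = \<psi> (\<pi> powi (c - 1) * z)" by (intro \<psi>_cong) (simp add: right_diff_distrib)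
  then show ?thesis unfolding psi_0_def z(2)[symmetric] .
qed

lemma \<psi>0_lift: "\<psi>0 a = \<psi> (\<pi> powi (c - 1) * lift a)"
  using psi_0_eq[of "lift a"] by simp

lemma \<psi>0_add: "\<psi>0 (a + b) = \<psi>0 a * \<psi>0 b"
  using psi_0_eq[of "lift a + lift b"] mp_add[of "lift a" 0 "lift b"] res_add[of "lift a" "lift b"]
    \<psi>_add[of "\<pi> powi (c - 1) * lift a" "\<pi> powi (c - 1) * lift b"]
  by (simp add: \<psi>0_lift distrib_left)

lemma \<psi>0_norm: "norm (\<psi>0 a) = 1"
  by (simp add: \<psi>0_lift \<psi>_norm)

lemma \<psi>0_zero [simp]: "\<psi>0 0 = 1"
  using psi_0_eq[of 0] by simp

lemma \<psi>0_minus: "\<psi>0 (- a) = cnj (\<psi>0 a)"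
proof -
  have "\<psi>0 (- a) * \<psi>0 a = 1" using \<psi>0_add[of "- a" a] by simp
  moreover have "cnj (\<psi>0 a) * \<psi>0 a = 1"
    using complex_norm_square[of "\<psi>0 a"] \<psi>0_norm[of a] by (simp add: mult.commute)
  moreover have "\<psi>0 a \<noteq> 0" using \<psi>0_norm[of a] by auto
  ultimately show ?thesis by (metis mult_right_cancel)
qed

lemma \<psi>0_nontrivial: "(\<And>b. \<psi>0 (a * b) = 1) \<Longrightarrow> a = 0"
proof (rule ccontr)
  assume all: "\<And>b. \<psi>0 (a * b) = 1" and a: "a \<noteq> 0"
  obtain x where x: "x \<in> mp (c - 1)" "\<psi> x \<noteq> 1" using exists_nontrivial by blast
  obtain y where y: "y \<in> mp 0" "x = \<pi> powi (c - 1) * y" using mp_factor[OF x(1)] by blast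
  have "\<psi>0 (res y) = 1" using all[of "res y / a"] a by simp
  then show False using psi_0_eq[OF y(1)] x y by simp
qed

end

section \<open>Residue algebras of monic polynomials\<close>

text \<open>When P is separable this is the functional sending x to Tr(x / P');
  \<open>residue_trace_eq\<close> is Euler's formula in the form free of division.\<close>

definition top_coeff :: "'k::field poly \<Rightarrow> 'k poly \<Rightarrow> 'k" where
  "top_coeff P x = coeff (x mod P) (degree P - 1)"

lemma top_coeff_add: "top_coeff P (x + y) = top_coeff P x + top_coeff P y"
  by (simp add: top_coeff_def poly_mod_add_left)

lemma top_coeff_smult: "top_coeff P (smult a x) = a * top_coeff P x"
  by (simp add: top_coeff_def mod_smult_left)

lemma top_coeff_zero [simp]: "top_coeff P 0 = 0"
  by (simp add: top_coeff_def)

lemma top_coeff_sum: "top_coeff P (sum f I) = (\<Sum>i\<in>I. top_coeff P (f i))"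
  by (induction I rule: infinite_finite_induct) (simp_all add: top_coeff_add)

lemma top_coeff_cong: "x mod P = y mod P \<Longrightarrow> top_coeff P x = top_coeff P y"
  by (simp add: top_coeff_def)

lemma top_coeff_mult_mod: "top_coeff P (x * (y mod P)) = top_coeff P (x * y)"
  by (rule top_coeff_cong) (simp add: mod_mult_right_eq)

text \<open>The polynomials \<open>poly_shift (j + 1) P\<close> are the dual basis of the powers of \<open>t\<close> for the
  pairing \<open>top_coeff P (x y)\<close>.\<close>

lemma top_coeff_dual_monom:
  fixes P :: "'k::field poly"
  assumes P: "lead_coeff P = 1" and ij: "i < degree P" "j < degree P"
  shows "top_coeff P (monom 1 i * poly_shift (Suc j) P) = (if i = j then 1 else 0)"
proof (cases "i \<le> j")
  case True
  have "degree (monom 1 i * poly_shift (Suc j) P) < degree P"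
  proof -
    have "coeff (monom 1 i * poly_shift (Suc j) P) n = 0" if "n > degree P - 1" for n
      using that True ij by (auto simp: coeff_monom_mult coeff_poly_shift intro!: coeff_eq_0)
    then have "degree (monom 1 i * poly_shift (Suc j) P) \<le> degree P - 1" by (intro degree_le) auto
    then show ?thesis using ij by simp
  qed
  moreover have "degree P - 1 - i + Suc j = degree P + (j - i)" using True ij by simp
  ultimately show ?thesis
    using True ij P by (auto simp: top_coeff_def mod_poly_less coeff_monom_mult coeff_poly_shift intro!: coeff_eq_0)
next
  case False
  define k where "k = i - Suc j"
  have i: "i = k + Suc j" using False by (simp add: k_def)
  \<comment> \<open>With k = i - j - 1 the product is t^k P minus t^k times the part of P below
    t^(j+1); the latter has degree less than deg P - 1.\<close>
  let ?r = "- (monom 1 k * poly_cutoff (Suc j) P)"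
  have "monom 1 i * poly_shift (Suc j) P = monom 1 k * P + ?r"
  proof (rule poly_eqI)
    fix n
    have "coeff (monom 1 i * poly_shift (Suc j) P) n = (if n < i then 0 else coeff P (n - k))"
    proof (cases "n < i")
      case False
      then have "n - i + Suc j = n - k" using i by linarith
      then show ?thesis using False by (simp only: coeff_monom_mult coeff_poly_shift) simp
    qed (simp add: coeff_monom_mult)
    then show "coeff (monom 1 i * poly_shift (Suc j) P) n = coeff (monom 1 k * P + ?r) n"
      using i by (auto simp: coeff_monom_mult coeff_poly_cutoff)
  qed
  moreover have r: "coeff ?r n = 0" if "n \<ge> degree P - 1" for n
    using that ij i by (auto simp: coeff_monom_mult coeff_poly_cutoff)
  moreover have "?r mod P = ?r"
  proof (rule mod_poly_less)
    have "degree ?r \<le> degree P - 1" by (rule degree_le) (use r in auto)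
    then show "degree ?r < degree P" using ij by simp
  qed
  ultimately have "(monom 1 i * poly_shift (Suc j) P) mod P = ?r" by (metis mod_mult_self3)
  then show ?thesis using False r[of "degree P - 1"] by (simp add: top_coeff_def)
qed

lemma top_coeff_dual:
  fixes P :: "'k::field poly"
  assumes P: "lead_coeff P = 1" and j: "j < degree P"
  shows "top_coeff P (z * poly_shift (Suc j) P) = coeff (z mod P) j"
proof -
  define y where "y = z mod P"
  have "P \<noteq> 0" using P by auto
  then have dy: "degree y < degree P"
    unfolding y_def using degree_mod_less[of P z] j by (metis degree_0 less_nat_zero_code gr_zeroI)
  have y: "y = (\<Sum>i\<le>degree P - 1. smult (coeff y i) (monom 1 i))"
    using poly_as_sum_of_monoms'[of y "degree P - 1"] dy by (simp add: smult_monom)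
  have "top_coeff P (z * poly_shift (Suc j) P) = top_coeff P (y * poly_shift (Suc j) P)"
    by (rule top_coeff_cong) (simp add: y_def mod_mult_left_eq)
  also have "y * poly_shift (Suc j) P = (\<Sum>i\<le>degree P - 1. smult (coeff y i) (monom 1 i * poly_shift (Suc j) P))"
    by (subst y) (simp add: sum_distrib_right)
  also have "top_coeff P \<dots> = (\<Sum>i\<le>degree P - 1. coeff y i * (if i = j then 1 else 0))"
    unfolding top_coeff_sum top_coeff_smult
    by (rule sum.cong) (use P j in \<open>auto simp: top_coeff_dual_monom\<close>)
  also have "\<dots> = coeff y j" using j by (simp add: if_distrib sum.delta cong: if_cong)
  finally show ?thesis by (simp add: y_def)
qed

text \<open>The dual basis reads off the diagonal entries of multiplication by x. Summing t^i times
  the i-th dual vector gives P', since the coefficient of t^(n+1) in P occurs once for each i \<le>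
  n.\<close>

lemma residue_trace_eq:
  fixes P :: "'k::field poly"
  assumes P: "lead_coeff P = 1"
  shows "residue_trace P x = top_coeff P (x * pderiv P)"
proof -
  have "residue_trace P x = (\<Sum>i<degree P. top_coeff P (x * monom 1 i * poly_shift (Suc i) P))"
    unfolding residue_trace_def by (rule sum.cong) (use P in \<open>auto simp: top_coeff_dual\<close>)
  also have "\<dots> = top_coeff P (x * (\<Sum>i<degree P. monom 1 i * poly_shift (Suc i) P))"
    by (simp add: top_coeff_sum sum_distrib_left mult.assoc)
  also have "(\<Sum>i<degree P. monom 1 i * poly_shift (Suc i) P) = pderiv P"
  proof (rule poly_eqI)
    fix n
    have "coeff (\<Sum>i<degree P. monom 1 i * poly_shift (Suc i) P) n = (\<Sum>i<degree P. if n < i then 0 else coeff P (Suc n))"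
      unfolding coeff_sum by (rule sum.cong) (auto simp: coeff_monom_mult coeff_poly_shift)
    also have "\<dots> = (\<Sum>i\<in>{..<degree P} \<inter> {i. i \<le> n}. coeff P (Suc n))"
      by (subst sum.inter_restrict) (auto intro!: sum.cong)
    also have "\<dots> = of_nat (card ({..<degree P} \<inter> {i. i \<le> n})) * coeff P (Suc n)" by simp
    also have "\<dots> = of_nat (Suc n) * coeff P (Suc n)"
    proof (cases "Suc n \<le> degree P")
      case True
      then have "{..<degree P} \<inter> {i. i \<le> n} = {..n}" by auto
      then show ?thesis by simp
    qed (simp add: coeff_eq_0)
    finally show "coeff (\<Sum>i<degree P. monom 1 i * poly_shift (Suc i) P) n = coeff (pderiv P) n"
      by (simp add: coeff_pderiv)
  qed
  finally show ?thesis .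
qed

section \<open>Integral lattices in the residue algebra\<close>

context local_field
begin

definition pint :: "int \<Rightarrow> 'k poly set" where "pint n = {q. \<forall>i. coeff q i \<in> mp n}"

lemma pint_coeff: "q \<in> pint n \<Longrightarrow> coeff q i \<in> mp n"
  by (simp add: pint_def)

lemma pint_group: "add_subgroup (pint n)"
  by (auto simp: add_subgroup_def pint_def mp_diff)

lemmas pint_intros = add_subgroup_intros[OF pint_group]

lemma pint_antimono: "m \<le> n \<Longrightarrow> pint n \<subseteq> pint m"
  using mp_antimono[of m n] by (auto simp: pint_def)

lemma pint_mult: "p \<in> pint m \<Longrightarrow> q \<in> pint n \<Longrightarrow> p * q \<in> pint (m + n)"
  by (auto simp: pint_def coeff_mult intro!: mp_sum mp_mult)

lemma pint_smult: "a \<in> mp m \<Longrightarrow> q \<in> pint n \<Longrightarrow> smult a q \<in> pint (m + n)"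
  by (auto simp: pint_def intro!: mp_mult)

lemma pint_monom: "a \<in> mp n \<Longrightarrow> monom a i \<in> pint n"
  by (simp add: pint_def)

lemma pint_exists: "\<exists>n. q \<in> pint n"
proof -
  define n where "n = Min ((\<lambda>i. v (coeff q i)) ` {..degree q})"
  have "coeff q i \<in> mp n" for i
  proof (cases "i \<le> degree q")
    case True
    then have "n \<le> v (coeff q i)" unfolding n_def by (intro Min_le) auto
    then show ?thesis by (simp add: mp_iff)
  qed (simp add: coeff_eq_0)
  then show ?thesis by (auto simp: pint_def)
qed

lemma integral_poly_pint: "integral_poly v = pint 0"
  by (simp add: integral_poly_def pint_def)

text \<open>P is monic and integral, so each elimination step subtracts a multiple of P by a
  monomial with coefficient in \<open>mp n\<close>.\<close>

lemma pint_division: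
  assumes P: "lead_coeff P = 1" "P \<in> pint 0" and x: "x \<in> pint n"
  shows "\<exists>q r. x = q * P + r \<and> q \<in> pint n \<and> r \<in> pint n \<and> (r = 0 \<or> degree r < degree P)"
  using x
proof (induction "degree x" arbitrary: x rule: less_induct)
  case (less x)
  show ?case
  proof (cases "x = 0 \<or> degree x < degree P")
    case True
    then show ?thesis using less.prems by (intro exI[of _ 0] exI[of _ x]) (auto simp: pint_intros(1))
  next
    case False
    define m where "m = monom (lead_coeff x) (degree x - degree P)"
    define y where "y = x - m * P"
    have m: "m \<in> pint n" unfolding m_def by (rule pint_monom[OF pint_coeff[OF less.prems]])
    have y: "y \<in> pint n" unfolding y_def using less.prems pint_mult[OF m P(2)] by (intro pint_intros(2)) simp_all
    have lead: "coeff y (degree x) = 0"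
      using False P by (simp add: y_def m_def coeff_monom_mult)
    have le: "degree y \<le> degree x"
    proof (rule degree_le, intro allI impI)
      fix i assume i: "degree x < i"
      have "degree P < i - (degree x - degree P)" using i False by simp
      then show "coeff y i = 0" using i False by (simp add: y_def m_def coeff_monom_mult coeff_eq_0)
    qed
    show ?thesis
    proof (cases "y = 0")
      case True
      then show ?thesis using m by (intro exI[of _ m] exI[of _ 0]) (simp add: y_def pint_intros(1))
    next
      case False
      then have "degree y < degree x" using le lead by (metis leading_coeff_0_iff order_le_imp_less_or_eq)
      from less.hyps[OF this y] obtain q r where qr: "y = q * P + r" "q \<in> pint n" "r \<in> pint n"
        "r = 0 \<or> degree r < degree P" by blast
      then show ?thesis using m pint_intros(4)[OF qr(2) m]
        by (intro exI[of _ "q + m"] exI[of _ r]) (simp add: y_def algebra_simps)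
    qed
  qed
qed

lemma pint_mod:
  assumes P: "lead_coeff P = 1" "P \<in> pint 0" and x: "x \<in> pint n"
  shows "x mod P \<in> pint n"
proof -
  obtain q r where qr: "x = q * P + r" "r \<in> pint n" "r = 0 \<or> degree r < degree P"
    using pint_division[OF assms] by blast
  have "x mod P = r" using qr by (auto simp: mod_poly_less)
  then show ?thesis using qr by simp
qed

lemma top_coeff_pint: "lead_coeff P = 1 \<Longrightarrow> P \<in> pint 0 \<Longrightarrow> x \<in> pint n \<Longrightarrow> top_coeff P x \<in> mp n"
  unfolding top_coeff_def by (rule pint_coeff[OF pint_mod])

text \<open>Multiples of the order O[t]/(P), which may be smaller than the ring of integers of
  K[t]/(P). For every monic integral P, irreducible or not, this order is self-dual for
  \<open>top_coeff\<close> up to the conductor.\<close>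

definition rlattice :: "'k poly \<Rightarrow> int \<Rightarrow> 'k poly set" where
  "rlattice P n = residue_polys P \<inter> pint n"

lemma residue_polys_group: "degree P \<ge> 1 \<Longrightarrow> add_subgroup (residue_polys P)"
  by (auto simp: add_subgroup_def residue_polys_def degree_diff_less)

lemma rlattice_group: "degree P \<ge> 1 \<Longrightarrow> add_subgroup (rlattice P n)"
  using residue_polys_group[of P] pint_group[of n] by (auto simp: add_subgroup_def rlattice_def)

lemma residue_polys_mod: "degree P \<ge> 1 \<Longrightarrow> x mod P \<in> residue_polys P"
  using degree_mod_less'[of P x] by (cases "P = 0"; cases "x mod P = 0") (auto simp: residue_polys_def)

lemma mod_residue_polys: "x \<in> residue_polys P \<Longrightarrow> x mod P = x"
  by (simp add: residue_polys_def mod_poly_less)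

lemma residue_polys_coeff: "x \<in> residue_polys P \<Longrightarrow> degree P \<le> i \<Longrightarrow> coeff x i = 0"
  by (simp add: residue_polys_def coeff_eq_0)

lemma residue_polysI: "degree P \<ge> 1 \<Longrightarrow> (\<And>i. degree P \<le> i \<Longrightarrow> coeff x i = 0) \<Longrightarrow> x \<in> residue_polys P"
  using degree_le[of "degree P - 1" x] by (simp add: residue_polys_def less_eq_Suc_le)

definition coeff_poly :: "nat \<Rightarrow> (nat \<Rightarrow> 'k) \<Rightarrow> 'k poly" where
  "coeff_poly d g = (\<Sum>i<d. monom (g i) i)"

lemma coeff_coeff_poly: "coeff (coeff_poly d g) i = (if i < d then g i else 0)"
  by (simp add: coeff_poly_def coeff_sum)

lemma coeff_poly_residue: "degree P \<ge> 1 \<Longrightarrow> coeff_poly (degree P) g \<in> residue_polys P"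
  by (rule residue_polysI) (simp_all add: coeff_coeff_poly)

lemma coeff_poly_rlattice:
  "degree P \<ge> 1 \<Longrightarrow> (\<And>i. g i \<in> mp n) \<Longrightarrow> coeff_poly (degree P) g \<in> rlattice P n"
  by (simp add: rlattice_def coeff_poly_residue pint_def coeff_coeff_poly)

lemma transversal_rlattice:
  assumes d: "degree P \<ge> 1"
  shows "\<exists>R. transversal R (rlattice P n) (rlattice P (n + 1)) \<and> card R = CARD('f) ^ degree P"
proof -
  let ?d = "degree P"
  let ?E = "PiE {..<?d} (\<lambda>_. UNIV :: 'f set)"
  let ?\<phi> = "\<lambda>g. coeff_poly ?d (\<lambda>i. \<pi> powi n * lift (g i))"
  have inj_lift: "a = b" if "\<pi> powi n * lift a - \<pi> powi n * lift b \<in> mp (n + 1)" for a b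
  proof -
    have "\<pi> powi n * (lift a - lift b) \<in> mp (n + 1)" using that by (simp add: right_diff_distrib)
    then show ?thesis using res_eq_iff[of "lift a" "lift b"] by (simp add: \<pi>_powi_mult_mp)
  qed
  have key: "g = g'" if g: "g \<in> ?E" "g' \<in> ?E" and "?\<phi> g - ?\<phi> g' \<in> pint (n + 1)" for g g'
  proof
    fix i
    show "g i = g' i"
    proof (cases "i < ?d")
      case True
      have "coeff (?\<phi> g - ?\<phi> g') i \<in> mp (n + 1)" using that pint_coeff by blast
      then show ?thesis using inj_lift True by (simp add: coeff_coeff_poly)
    qed (use g in \<open>auto simp: PiE_iff extensional_def\<close>)
  qed
  have fin: "finite ?E" using finite_residue by (intro finite_PiE) auto
  have inj: "inj_on ?\<phi> ?E" by (rule inj_onI) (use key pint_intros(1) in auto)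
  have "transversal (?\<phi> ` ?E) (rlattice P n) (rlattice P (n + 1))"
  proof (rule transversalI[OF rlattice_group[OF d]])
    show "finite (?\<phi> ` ?E)" using fin by simp
    show "?\<phi> ` ?E \<subseteq> rlattice P n"
      by (rule image_subsetI, rule coeff_poly_rlattice[OF d]) (simp add: \<pi>_powi_mult_mp)
    show "\<exists>r\<in>?\<phi> ` ?E. x - r \<in> rlattice P (n + 1)" if x: "x \<in> rlattice P n" for x
    proof -
      define g where "g = restrict (\<lambda>i. res (\<pi> powi (- n) * coeff x i)) {..<?d}"
      have "x - ?\<phi> g \<in> pint (n + 1)"
        unfolding pint_def
      proof (intro CollectI allI)
        fix i
        show "coeff (x - ?\<phi> g) i \<in> mp (n + 1)"
        proof (cases "i < ?d")
          case True
          let ?y = "\<pi> powi (- n) * coeff x i"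
          have y: "?y \<in> mp 0" using x pint_coeff[of x n i] by (simp add: rlattice_def \<pi>_powi_mult_mp)
          have "?y - lift (res ?y) \<in> mp 1" using res_eq_iff[OF y, of "lift (res ?y)"] by simp
          then have "\<pi> powi n * (?y - lift (res ?y)) \<in> mp (n + 1)" by (simp add: \<pi>_powi_mult_mp)
          then show ?thesis using True by (simp add: coeff_coeff_poly g_def right_diff_distrib)
        next
          case False
          then show ?thesis using x residue_polys_coeff[of x P i] by (simp add: coeff_coeff_poly rlattice_def)
        qed
      qed
      moreover have "x - ?\<phi> g \<in> residue_polys P"
        using x coeff_poly_residue[OF d] add_subgroup_diff[OF residue_polys_group[OF d]]
        by (simp add: rlattice_def)
      moreover have "g \<in> ?E" by (auto simp: g_def)
      ultimately show ?thesis by (auto simp: rlattice_def)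
    qed
    show "r = s" if "r \<in> ?\<phi> ` ?E" "s \<in> ?\<phi> ` ?E" "r - s \<in> rlattice P (n + 1)" for r s
      using that key by (auto simp: rlattice_def)
  qed
  moreover have "card (?\<phi> ` ?E) = CARD('f) ^ ?d"
    using card_image[OF inj] by (simp add: card_PiE)
  ultimately show ?thesis by blast
qed

lemma openin_residue_poly_topology:
  assumes d: "degree P \<ge> 1"
  shows "openin (residue_poly_topology v P) U \<longleftrightarrow>
    U \<subseteq> residue_polys P \<and> (\<forall>x\<in>U. \<exists>n. \<forall>b\<in>rlattice P n. x + b \<in> U)"
proof
  assume "openin (residue_poly_topology v P) U"
  then obtain W where W: "openin (product_topology (\<lambda>_. valuation_topology v) UNIV) W"
    "U = coeff -` W \<inter> residue_polys P"
    unfolding residue_poly_topology_def openin_pullback_topology by blast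
  have "\<exists>n. \<forall>b\<in>rlattice P n. x + b \<in> U" if x: "x \<in> U" for x
  proof -
    have "coeff x \<in> W" using x W by blast
    then obtain V where V: "\<And>i. openin (valuation_topology v) (V i)" "coeff x \<in> PiE UNIV V" "PiE UNIV V \<subseteq> W"
      using W(1) unfolding openin_product_topology_alt by (metis UNIV_I)
    then have "\<forall>i. \<exists>n. \<forall>b\<in>mp n. coeff x i + b \<in> V i" unfolding openin_valuation by (auto simp: PiE_iff)
    then obtain n where n: "\<And>i b. b \<in> mp (n i) \<Longrightarrow> coeff x i + b \<in> V i" by metis
    \<comment> \<open>Elements of \<open>rlattice P N\<close> have no coefficients from
      \<open>degree P\<close> on, so only finitely many of the \<open>n i\<close> have to be
      respected.\<close>
    define N where "N = Max (n ` {..degree P})"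
    have "x + b \<in> U" if b: "b \<in> rlattice P N" for b
    proof -
      have "coeff (x + b) i \<in> V i" for i
      proof (cases "i \<le> degree P")
        case True
        then have "n i \<le> N" unfolding N_def by (intro Max_ge) auto
        then have "coeff b i \<in> mp (n i)" using b mp_antimono pint_coeff[of b N i] by (auto simp: rlattice_def)
        then show ?thesis using n by simp
      next
        case False
        then have "coeff b i = 0" using b residue_polys_coeff[of b P i] by (simp add: rlattice_def)
        then show ?thesis using n[of 0 i] by simp
      qed
      then have "coeff (x + b) \<in> PiE UNIV V" by (auto simp: PiE_iff)
      then have "coeff (x + b) \<in> W" using V(3) by blast
      moreover have "x + b \<in> residue_polys P"
        using x b W(2) add_subgroup_add[OF residue_polys_group[OF d]] by (auto simp: rlattice_def)
      ultimately show ?thesis using W(2) by blast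
    qed
    then show ?thesis by blast
  qed
  then show "U \<subseteq> residue_polys P \<and> (\<forall>x\<in>U. \<exists>n. \<forall>b\<in>rlattice P n. x + b \<in> U)" using W(2) by blast
next
  assume U: "U \<subseteq> residue_polys P \<and> (\<forall>x\<in>U. \<exists>n. \<forall>b\<in>rlattice P n. x + b \<in> U)"
  then obtain n where n: "\<And>x b. x \<in> U \<Longrightarrow> b \<in> rlattice P (n x) \<Longrightarrow> x + b \<in> U" by metis
  define box where "box x = PiE UNIV (\<lambda>i. if i < degree P then {z. z - coeff x i \<in> mp (n x)} else UNIV)" for x
  have op: "openin (product_topology (\<lambda>_. valuation_topology v) UNIV) (box x)" for x
  proof -
    have "openin (valuation_topology v) {z. z - coeff x i \<in> mp (n x)}" for i
      unfolding valuation_topology_def by (rule topology_generated_by_Basis) blast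
    moreover have "finite {i. (if i < degree P then {z. z - coeff x i \<in> mp (n x)} else UNIV) \<noteq> UNIV}"
      by (rule finite_subset[of _ "{..<degree P}"]) auto
    ultimately show ?thesis
      unfolding box_def openin_PiE_gen by (auto simp: openin_valuation[of UNIV])
  qed
  have "U = coeff -` (\<Union>x\<in>U. box x) \<inter> residue_polys P"
  proof (intro equalityI subsetI)
    fix x assume x: "x \<in> U"
    have "coeff x \<in> box x" by (simp add: box_def PiE_iff)
    then show "x \<in> coeff -` (\<Union>x\<in>U. box x) \<inter> residue_polys P" using U x by blast
  next
    fix y assume y: "y \<in> coeff -` (\<Union>x\<in>U. box x) \<inter> residue_polys P"
    then obtain x where x: "x \<in> U" "coeff y \<in> box x" by blast
    have res: "y - x \<in> residue_polys P"
      using y x U add_subgroup_diff[OF residue_polys_group[OF d], of y x] by blast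
    have "coeff (y - x) i \<in> mp (n x)" for i
    proof (cases "i < degree P")
      case True
      have "coeff y i \<in> (if i < degree P then {z. z - coeff x i \<in> mp (n x)} else UNIV)"
        using x(2) unfolding box_def by (rule PiE_mem) simp
      then show ?thesis using True by simp
    qed (use residue_polys_coeff[OF res, of i] in simp)
    then have "y - x \<in> rlattice P (n x)" using res by (auto simp: rlattice_def pint_def)
    then show "y \<in> U" using n[OF x(1), of "y - x"] by simp
  qed
  moreover have "openin (product_topology (\<lambda>_. valuation_topology v) UNIV) (\<Union>x\<in>U. box x)"
    using op by blast
  ultimately show "openin (residue_poly_topology v P) U"
    unfolding residue_poly_topology_def openin_pullback_topology by blast
qed

lemma filtered_group_residue:
  assumes d: "degree P \<ge> 1"
  shows "filtered_group (residue_polys P) (residue_poly_topology v P) (rlattice P) (CARD('f) ^ degree P)"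
proof
  show "add_subgroup (rlattice P n)" for n by (rule rlattice_group[OF d])
  show "rlattice P n \<subseteq> rlattice P m" if "m \<le> n" for m n using pint_antimono[OF that] by (auto simp: rlattice_def)
  show "(\<Union>n. rlattice P n) = residue_polys P" using pint_exists by (auto simp: rlattice_def)
  show "x = 0" if "\<And>n. x \<in> rlattice P n" for x
    using that mp_Inter[of "coeff x _"] by (intro poly_eqI) (auto simp: rlattice_def pint_def)
  show "\<exists>R. transversal R (rlattice P n) (rlattice P (n + 1)) \<and> card R = CARD('f) ^ degree P" for n
    by (rule transversal_rlattice[OF d])
  show "openin (residue_poly_topology v P) U \<longleftrightarrow> U \<subseteq> residue_polys P \<and> (\<forall>x\<in>U. \<exists>n. \<forall>b\<in>rlattice P n. x + b \<in> U)" for U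
    by (rule openin_residue_poly_topology[OF d])
  fix X :: "nat \<Rightarrow> 'k poly" and m
  assume X: "\<And>i. X i \<in> residue_polys P" "\<And>i. X (Suc i) - X i \<in> rlattice P (m + int i)"
  have "\<forall>j. \<exists>y. \<forall>i. y - coeff (X i) j \<in> mp (m + int i)"
  proof
    fix j
    have "coeff (X (Suc i)) j - coeff (X i) j \<in> mp (m + int i)" for i
      using X(2)[of i] pint_coeff[of "X (Suc i) - X i" "m + int i" j] by (simp add: rlattice_def)
    then show "\<exists>y. \<forall>i. y - coeff (X i) j \<in> mp (m + int i)" by (rule mp_complete)
  qed
  then obtain y where y: "\<And>j i. y j - coeff (X i) j \<in> mp (m + int i)" by metis
  let ?y = "coeff_poly (degree P) y"
  have yP: "?y \<in> residue_polys P" by (rule coeff_poly_residue[OF d])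
  have "?y - X i \<in> rlattice P (m + int i)" for i
  proof -
    have "?y - X i \<in> pint (m + int i)"
      using y residue_polys_coeff[OF X(1)] by (auto simp: pint_def coeff_coeff_poly)
    then show ?thesis using add_subgroup_diff[OF residue_polys_group[OF d] yP X(1)] by (simp add: rlattice_def)
  qed
  then show "\<exists>y\<in>residue_polys P. \<forall>i. y - X i \<in> rlattice P (m + int i)" using yP by blast
qed

text \<open>The dual basis vectors \<open>poly_shift (Suc j) P\<close> are integral because P is;
  pairing with their multiples by scalars in \<open>mp n\<close> tests each coefficient of
  \<open>y\<close> separately.\<close>

lemma residue_perp:
  assumes P: "lead_coeff P = 1" "P \<in> pint 0" and y: "y \<in> residue_polys P"
  shows "(\<forall>x\<in>rlattice P n. \<psi> (top_coeff P (x * y)) = 1) \<longleftrightarrow> y \<in> rlattice P (c - n)"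
proof
  assume all: "\<forall>x\<in>rlattice P n. \<psi> (top_coeff P (x * y)) = 1"
  have "coeff y j \<in> mp (c - n)" for j
  proof (cases "j < degree P")
    case True
    have "\<psi> (s * coeff y j) = 1" if s: "s \<in> mp n" for s
    proof -
      let ?x = "smult s (poly_shift (Suc j) P)"
      have "?x \<in> pint n"
        using pint_smult[OF s, of "poly_shift (Suc j) P" 0] P(2) by (simp add: pint_def coeff_poly_shift)
      moreover have "?x \<in> residue_polys P"
        by (rule residue_polysI) (use True in \<open>auto simp: coeff_poly_shift intro!: coeff_eq_0\<close>)
      ultimately have "?x \<in> rlattice P n" by (simp add: rlattice_def)
      then have "\<psi> (top_coeff P (?x * y)) = 1" using all by blast
      moreover have "top_coeff P (?x * y) = s * coeff y j"
        using top_coeff_dual[OF P(1) True, of y] mod_residue_polys[OF y] by (simp add: top_coeff_smult mult.commute)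
      ultimately show ?thesis by simp
    qed
    then show ?thesis by (rule \<psi>_perp)
  qed (use residue_polys_coeff[OF y] in simp)
  then show "y \<in> rlattice P (c - n)" using y by (simp add: rlattice_def pint_def)
next
  assume "y \<in> rlattice P (c - n)"
  then have "y \<in> pint (c - n)" by (simp add: rlattice_def)
  then show "\<forall>x\<in>rlattice P n. \<psi> (top_coeff P (x * y)) = 1"
    using pint_mult[of _ n y "c - n"] top_coeff_pint[OF P, of _ c] \<psi>_trivial by (auto simp: rlattice_def)
qed

text \<open>Multiplication by w, with inverse w', plays the role of \<tau>; the factor 1/2 makes the
  associated bilinear form exactly the pairing of x with w y.\<close>

lemma quadratic_character_residue:
  assumes P: "lead_coeff P = 1" "P \<in> pint 0" "degree P \<ge> 1" and w: "(w * w') mod P = 1"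
  shows "quadratic_character (residue_polys P) (residue_poly_topology v P) (rlattice P) (CARD('f) ^ degree P)
    (\<lambda>x y. \<psi> (top_coeff P (x * y))) c (\<lambda>y. (w * y) mod P) (\<lambda>x. \<psi> (top_coeff P (smult (1 / 2) (w * x\<^sup>2))))"
proof (rule quadratic_character.intro[OF filtered_group_residue[OF P(3)]], unfold_locales)
  let ?\<tau> = "\<lambda>y. (w * y) mod P" and ?\<tau>' = "\<lambda>y. (w' * y) mod P"
  note res = residue_polys_mod[OF P(3)]
  show "\<psi> (top_coeff P ((x + y) * z)) = \<psi> (top_coeff P (x * z)) * \<psi> (top_coeff P (y * z))" for x y z
    by (simp add: distrib_right top_coeff_add \<psi>_add)
  show "\<psi> (top_coeff P (x * y)) = \<psi> (top_coeff P (y * x))" for x y by (simp add: mult.commute)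
  show "norm (\<psi> (top_coeff P (x * y))) = 1" for x y by (rule \<psi>_norm)
  show "(\<forall>x\<in>rlattice P n. \<psi> (top_coeff P (x * y)) = 1) \<longleftrightarrow> y \<in> rlattice P (c - n)" if "y \<in> residue_polys P" for y n
    by (rule residue_perp[OF P(1,2) that])
  have inv: "?\<tau>' (?\<tau> y) = y" "?\<tau> (?\<tau>' y) = y" if "y \<in> residue_polys P" for y
  proof -
    have "w' * (w * y) = w * w' * y" by (simp add: mult_ac)
    then have "(w' * (w * y)) mod P = ((w * w') mod P * y) mod P" by (simp only: mod_mult_left_eq)
    then have e: "(w' * (w * y)) mod P = y" using w mod_residue_polys[OF that] by simp
    then show "?\<tau>' (?\<tau> y) = y" by (simp add: mod_mult_right_eq)
    from e show "?\<tau> (?\<tau>' y) = y" by (simp add: mod_mult_right_eq mult.left_commute)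
  qed
  show "bij_betw ?\<tau> (residue_polys P) (residue_polys P)"
    by (rule bij_betw_byWitness[of _ ?\<tau>']) (use inv res in auto)
  show "?\<tau> (x + y) = ?\<tau> x + ?\<tau> y" for x y by (simp add: distrib_left poly_mod_add_left)
  show "\<exists>k. \<forall>n. \<forall>x\<in>residue_polys P. (x \<in> rlattice P n \<longrightarrow> ?\<tau> x \<in> rlattice P (n - k)) \<and>
      (?\<tau> x \<in> rlattice P n \<longrightarrow> x \<in> rlattice P (n - k))"
  proof -
    obtain i j where ij: "w \<in> pint i" "w' \<in> pint j" using pint_exists by metis
    define k where "k = max (- i) (- j)"
    have "- k \<le> i" "- k \<le> j" by (simp_all add: k_def)
    then have w: "w \<in> pint (- k)" "w' \<in> pint (- k)" using ij pint_antimono by blast+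
    have m: "(u * x) mod P \<in> rlattice P (n - k)" if "u \<in> pint (- k)" "x \<in> rlattice P n" for u x n
      using pint_mod[OF P(1,2) pint_mult[OF that(1), of x n]] that(2) res by (simp add: rlattice_def)
    show ?thesis
    proof (rule exI[of _ k], intro allI ballI conjI impI)
      fix n x assume x: "x \<in> residue_polys P"
      show "?\<tau> x \<in> rlattice P (n - k)" if "x \<in> rlattice P n" by (rule m[OF w(1) that])
      show "x \<in> rlattice P (n - k)" if "?\<tau> x \<in> rlattice P n" using m[OF w(2) that] inv(1)[OF x] by simp
    qed
  qed
  show "norm (\<psi> (top_coeff P (smult (1 / 2) (w * x\<^sup>2)))) = 1" for x by (rule \<psi>_norm)
  show "\<psi> (top_coeff P (smult (1 / 2) (w * (- x)\<^sup>2))) = \<psi> (top_coeff P (smult (1 / 2) (w * x\<^sup>2)))" for x by simp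
  show "\<psi> (top_coeff P (smult (1 / 2) (w * (x + y)\<^sup>2))) =
    \<psi> (top_coeff P (smult (1 / 2) (w * x\<^sup>2))) * \<psi> (top_coeff P (smult (1 / 2) (w * y\<^sup>2))) *
      \<psi> (top_coeff P (x * ((w * y) mod P)))" for x y
  proof -
    define z where "z = x * (w * y)"
    have two: "smult (1 / 2) (z + z) = z"
      by (rule poly_eqI) (simp only: coeff_smult coeff_add, simp add: field_simps)
    have "w * (x + y)\<^sup>2 = w * x\<^sup>2 + w * y\<^sup>2 + (z + z)"
      unfolding z_def power2_eq_square by (simp add: algebra_simps)
    then have "smult (1 / 2) (w * (x + y)\<^sup>2) = smult (1 / 2) (w * x\<^sup>2) + smult (1 / 2) (w * y\<^sup>2) + x * (w * y)"
      using two by (simp only: smult_add_right z_def[symmetric])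
    then show ?thesis by (simp add: top_coeff_add \<psi>_add top_coeff_mult_mod)
  qed
  obtain k where k: "w \<in> pint k" using pint_exists by blast
  \<comment> \<open>On \<open>rlattice P n\<close> the half form lies in
    \<open>pint (k + 2 * n)\<close>, and this choice makes \<open>k + 2 * n\<close> at least
    \<open>c\<close>.\<close>
  define n where "n = \<bar>c\<bar> + \<bar>k\<bar>"
  have "\<psi> (top_coeff P (smult (1 / 2) (w * x\<^sup>2))) = 1" if x: "x \<in> rlattice P n" for x
  proof -
    have "x \<in> pint n" using x by (simp add: rlattice_def)
    then have "smult (1 / 2) (w * x\<^sup>2) \<in> pint (0 + (k + (n + n)))"
      unfolding power2_eq_square by (intro pint_smult pint_mult k half_mp)
    moreover have "c \<le> 0 + (k + (n + n))" unfolding n_def by arith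
    ultimately have "smult (1 / 2) (w * x\<^sup>2) \<in> pint c" using pint_antimono by blast
    then show ?thesis using top_coeff_pint[OF P(1,2)] \<psi>_trivial by blast
  qed
  then show "\<exists>n. \<forall>x\<in>rlattice P n. \<psi> (top_coeff P (smult (1 / 2) (w * x\<^sup>2))) = 1" by blast
qed

end

section \<open>Laurent series over the residue field\<close>

lemma fls_mult_vanish_below:
  fixes x y :: "'a::comm_ring_1 fls"
  assumes "\<forall>i<m. fls_nth x i = 0" "\<forall>i<n. fls_nth y i = 0"
  shows "\<forall>i<m + n. fls_nth (x * y) i = 0" and "fls_nth (x * y) (m + n) = fls_nth x m * fls_nth y n"
proof -
  have "(\<forall>i<m + n. fls_nth (x * y) i = 0) \<and> fls_nth (x * y) (m + n) = fls_nth x m * fls_nth y n"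
  proof (cases "x = 0 \<or> y = 0")
    case False
    then have le: "m \<le> fls_subdegree x" "n \<le> fls_subdegree y" using assms by (auto intro: fls_subdegree_geI)
    then have 1: "\<forall>i<m + n. fls_nth (x * y) i = 0" by (simp add: fls_times_nth_eq0)
    show ?thesis
    proof (cases "m = fls_subdegree x \<and> n = fls_subdegree y")
      case True
      then show ?thesis using 1 fls_times_base[of x y] by simp
    next
      case False
      then have "m + n < fls_subdegree x + fls_subdegree y" "fls_nth x m * fls_nth y n = 0" using le by auto
      then show ?thesis using 1 by (simp add: fls_times_nth_eq0)
    qed
  qed auto
  then show "\<forall>i<m + n. fls_nth (x * y) i = 0" "fls_nth (x * y) (m + n) = fls_nth x m * fls_nth y n" by auto
qed

definition fls_mono :: "'a::comm_ring_1 \<Rightarrow> int \<Rightarrow> 'a fls" where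
  "fls_mono a n = fls_shift (- n) (fls_const a)"

lemma fls_nth_mono: "fls_nth (fls_mono a n) i = (if i = n then a else 0)"
  by (simp add: fls_mono_def)

lemma fls_nth_mult_mono: "fls_nth (x * fls_mono a n) i = fls_nth x (i - n) * a"
  by (simp add: fls_mono_def fls_shifted_times_simps fls_mult_const_nth)

definition fls_filt :: "int \<Rightarrow> 'a::comm_ring_1 fls set" where
  "fls_filt n = {x. \<forall>i<n. fls_nth x i = 0}"

lemma fls_filt_group: "add_subgroup (fls_filt n)"
  by (simp add: add_subgroup_def fls_filt_def)

lemma fls_filt_antimono: "m \<le> n \<Longrightarrow> fls_filt n \<subseteq> fls_filt m"
  by (auto simp: fls_filt_def)

lemma fls_filt_mult: "x \<in> fls_filt m \<Longrightarrow> y \<in> fls_filt n \<Longrightarrow> x * y \<in> fls_filt (m + n)"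
  using fls_mult_vanish_below(1)[of m x n y] by (simp add: fls_filt_def)

text \<open>Bridges the filtration and the metric on \<open>fls\<close>, in which a series of order
  n has size 2^(-n).\<close>

lemma dist_fls_filt:
  fixes x :: "'a::comm_ring_1 fls"
  shows "b \<in> fls_filt n \<Longrightarrow> dist (x + b) x \<le> 2 powi (- n)"
    and "dist y x < 2 powi (- n) \<Longrightarrow> y - x \<in> fls_filt n"
proof -
  have d: "dist y x = (if y = x then 0 else 2 powi (- fls_subdegree (y - x)))" for y x :: "'a fls"
    by (simp add: dist_fls_def power_int_def power_inverse power_one_over inverse_eq_divide)
  show "dist (x + b) x \<le> 2 powi (- n)" if "b \<in> fls_filt n" for b
  proof (cases "b = 0")
    case False
    then have "n \<le> fls_subdegree b" using that by (auto simp: fls_filt_def intro: fls_subdegree_geI)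
    then show ?thesis using False by (simp add: d power_int_increasing)
  qed simp
  show "y - x \<in> fls_filt n" if "dist y x < 2 powi (- n)" for y
  proof (cases "y = x")
    case False
    have "n < fls_subdegree (y - x)"
    proof (rule ccontr)
      assume "\<not> ?thesis"
      then have "(2::real) powi (- n) \<le> 2 powi (- fls_subdegree (y - x))" by (intro power_int_increasing) auto
      then show False using that False by (simp add: d)
    qed
    then show ?thesis unfolding fls_filt_def using fls_eq0_below_subdegree[of _ "y - x"] by simp
  qed (simp add: fls_filt_def)
qed

lemma open_fls_iff:
  fixes U :: "'a::comm_ring_1 fls set"
  shows "open U \<longleftrightarrow> (\<forall>x\<in>U. \<exists>n. \<forall>b\<in>fls_filt n. x + b \<in> U)"
proof
  assume U: "open U"
  show "\<forall>x\<in>U. \<exists>n. \<forall>b\<in>fls_filt n. x + b \<in> U"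
  proof
    fix x assume "x \<in> U"
    then obtain e where e: "e > 0" "\<And>y. dist y x < e \<Longrightarrow> y \<in> U" using U unfolding open_dist by blast
    obtain k where k: "inverse ((2::real) ^ k) < e"
      using real_arch_pow_inv[of e "1 / 2"] e(1) by (auto simp: power_one_over inverse_eq_divide)
    have "x + b \<in> U" if "b \<in> fls_filt (int k)" for b
    proof (rule e(2))
      have "(2::real) powi (- int k) = inverse (2 ^ k)" by (simp add: power_int_minus)
      then show "dist (x + b) x < e" using dist_fls_filt(1)[OF that, of x] k by simp
    qed
    then show "\<exists>n. \<forall>b\<in>fls_filt n. x + b \<in> U" by blast
  qed
next
  assume all: "\<forall>x\<in>U. \<exists>n. \<forall>b\<in>fls_filt n. x + b \<in> U"
  show "open U"
    unfolding open_dist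
  proof
    fix x assume x: "x \<in> U"
    then obtain n where n: "\<And>b. b \<in> fls_filt n \<Longrightarrow> x + b \<in> U" using all by blast
    have "y \<in> U" if "dist y x < 2 powi (- n)" for y
      using n[OF dist_fls_filt(2)[OF that]] by simp
    then show "\<exists>e>0. \<forall>y. dist y x < e \<longrightarrow> y \<in> U" by (intro exI[of _ "2 powi (- n)"]) simp
  qed
qed

lemma transversal_fls_filt:
  assumes "finite (UNIV :: 'a::comm_ring_1 set)"
  shows "transversal (range (\<lambda>a::'a. fls_mono a n)) (fls_filt n) (fls_filt (n + 1))"
proof (rule transversalI[OF fls_filt_group])
  show "finite (range (\<lambda>a::'a. fls_mono a n))" using assms by simp
  show "range (\<lambda>a. fls_mono a n) \<subseteq> fls_filt n" by (auto simp: fls_filt_def fls_nth_mono)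
  show "\<exists>r\<in>range (\<lambda>a. fls_mono a n). x - r \<in> fls_filt (n + 1)" if "x \<in> fls_filt n" for x :: "'a fls"
    using that by (intro bexI[of _ "fls_mono (fls_nth x n) n"]) (auto simp: fls_filt_def fls_nth_mono)
  show "r = s" if "r \<in> range (\<lambda>a. fls_mono a n)" "s \<in> range (\<lambda>a. fls_mono a n)" "r - s \<in> fls_filt (n + 1)" for r s :: "'a fls"
    using that by (auto simp: fls_filt_def fls_nth_mono)
qed

lemma filtered_group_fls:
  assumes "finite (UNIV :: 'a::comm_ring_1 set)"
  shows "filtered_group (UNIV :: 'a fls set) euclidean fls_filt (CARD('a))"
proof
  show "add_subgroup (fls_filt n :: 'a fls set)" for n by (rule fls_filt_group)
  show "fls_filt n \<subseteq> (fls_filt m :: 'a fls set)" if "m \<le> n" for m n by (rule fls_filt_antimono[OF that])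
  show "(\<Union>n. fls_filt n) = (UNIV :: 'a fls set)"
  proof (intro equalityI subsetI)
    fix x :: "'a fls"
    have "x \<in> fls_filt (fls_subdegree x)" by (simp add: fls_filt_def)
    then show "x \<in> (\<Union>n. fls_filt n)" by blast
  qed simp
  show "x = 0" if "\<And>n. x \<in> fls_filt n" for x :: "'a fls"
  proof (rule fls_eqI)
    fix n show "fls_nth x n = fls_nth 0 n" using that[of "n + 1"] by (simp add: fls_filt_def)
  qed
  show "\<exists>R. transversal R (fls_filt n) (fls_filt (n + 1) :: 'a fls set) \<and> card R = CARD('a)" for n
  proof (intro exI conjI)
    show "transversal (range (\<lambda>a::'a. fls_mono a n)) (fls_filt n) (fls_filt (n + 1))"
      by (rule transversal_fls_filt[OF assms])
    have "a = b" if "fls_mono a n = fls_mono b n" for a b :: 'a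
      using arg_cong[OF that, of "\<lambda>x. fls_nth x n"] by (simp add: fls_nth_mono)
    then show "card (range (\<lambda>a::'a. fls_mono a n)) = CARD('a)" by (intro card_image inj_onI)
  qed
  show "openin euclidean U \<longleftrightarrow> U \<subseteq> UNIV \<and> (\<forall>x\<in>U. \<exists>n. \<forall>b\<in>fls_filt n. x + b \<in> U)" for U :: "'a fls set"
    by (simp add: open_fls_iff)
  fix X :: "nat \<Rightarrow> 'a fls" and m
  assume X: "\<And>i. X (Suc i) - X i \<in> fls_filt (m + int i)"
  have step: "X j - X i \<in> fls_filt (m + int i)" if "i \<le> j" for i j
    using that
  proof (induction j rule: dec_induct)
    case (step j)
    have "fls_filt (m + int j) \<subseteq> (fls_filt (m + int i) :: 'a fls set)" using step by (intro fls_filt_antimono) simp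
    then have "(X (Suc j) - X j) + (X j - X i) \<in> fls_filt (m + int i)"
      using X[of j] step.IH by (intro add_subgroup_add[OF fls_filt_group]) auto
    then show ?case by simp
  qed (simp add: fls_filt_def)
  \<comment> \<open>The coefficient of index \<open>n\<close> no longer changes from stage
    \<open>n - m + 1\<close> on.\<close>
  define f where "f n = fls_nth (X (nat (n - m + 1))) n" for n
  define y where "y = Abs_fls f"
  have "\<forall>n<min m (fls_subdegree (X 0)). f n = 0" by (auto simp: f_def)
  then have y: "fls_nth y n = f n" for n
    unfolding y_def by (rule nth_Abs_fls_lower_bound)
  have "y - X i \<in> fls_filt (m + int i)" for i
    unfolding fls_filt_def
  proof (intro CollectI allI impI)
    fix n assume n: "n < m + int i"
    have le: "nat (n - m + 1) \<le> i" using n by auto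
    have "n < m + int (nat (n - m + 1))" by simp
    then have "fls_nth (X i - X (nat (n - m + 1))) n = 0" using step[OF le] unfolding fls_filt_def by blast
    then show "fls_nth (y - X i) n = 0" by (simp add: y f_def)
  qed
  then show "\<exists>y\<in>UNIV. \<forall>i. y - X i \<in> fls_filt (m + int i)" by blast
qed

section \<open>The residue pairing on Laurent series\<close>

context local_field
begin

abbreviation \<psi>p :: "'f fls \<Rightarrow> complex" where "\<psi>p \<equiv> psi_p v res \<pi> \<psi> c"

lemma \<psi>p_eq: "\<psi>p s = \<psi>0 (- fls_nth s (- 1))"
  by (simp add: psi_p_def)

lemma \<psi>p_add: "\<psi>p (x + y) = \<psi>p x * \<psi>p y"
  using \<psi>0_add[of "- fls_nth x (- 1)" "- fls_nth y (- 1)"] by (simp add: \<psi>p_eq)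

lemma \<psi>p_trivial: "x \<in> fls_filt 0 \<Longrightarrow> \<psi>p x = 1"
  by (simp add: \<psi>p_eq fls_filt_def)

text \<open>Pairing with the monomial -b t^(-1-i) isolates the i-th coefficient of \<open>y\<close>;
  its sign cancels the one in \<open>psi_p\<close>. The exponents n and -n are complementary because
  the pairing looks at the coefficient of t^(-1).\<close>

lemma \<psi>p_perp: "(\<forall>x\<in>fls_filt n. \<psi>p (x * y) = 1) \<longleftrightarrow> y \<in> fls_filt (- n)"
proof
  assume all: "\<forall>x\<in>fls_filt n. \<psi>p (x * y) = 1"
  have "fls_nth y i = 0" if i: "i < - n" for i
  proof -
    have "\<psi>0 (fls_nth y i * b) = 1" for b
    proof -
      have "fls_mono (- b) (- 1 - i) \<in> fls_filt n" using i by (auto simp: fls_filt_def fls_nth_mono)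
      then have "\<psi>p (fls_mono (- b) (- 1 - i) * y) = 1" using all by blast
      then have "\<psi>p (y * fls_mono (- b) (- 1 - i)) = 1" by (simp only: mult.commute)
      then show ?thesis by (simp add: \<psi>p_eq fls_nth_mult_mono)
    qed
    then show ?thesis by (rule \<psi>0_nontrivial)
  qed
  then show "y \<in> fls_filt (- n)" by (simp add: fls_filt_def)
next
  assume "y \<in> fls_filt (- n)"
  then show "\<forall>x\<in>fls_filt n. \<psi>p (x * y) = 1" using fls_filt_mult[of _ n y "- n"] \<psi>p_trivial by auto
qed

lemma fls_filt_mult_iff:
  fixes w :: "'f fls"
  assumes "w \<noteq> 0" shows "w * x \<in> fls_filt n \<longleftrightarrow> x \<in> fls_filt (n - fls_subdegree w)"
proof
  assume x: "w * x \<in> fls_filt n"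
  show "x \<in> fls_filt (n - fls_subdegree w)"
  proof (cases "x = 0")
    case False
    have "n \<le> fls_subdegree (w * x)"
      by (rule fls_subdegree_geI) (use False x assms in \<open>auto simp: fls_filt_def\<close>)
    then show ?thesis using False assms by (simp add: fls_filt_def)
  qed (simp add: fls_filt_def)
next
  assume "x \<in> fls_filt (n - fls_subdegree w)"
  then show "w * x \<in> fls_filt n" using fls_filt_mult[of w "fls_subdegree w" x] by (simp add: fls_filt_def)
qed

lemma quadratic_character_fls:
  assumes w: "w \<noteq> 0"
  shows "quadratic_character UNIV euclidean fls_filt (CARD('f)) (\<lambda>x y. \<psi>p (x * y)) 0 (\<lambda>y. w * y)
    (\<lambda>x. \<psi>p (fls_const (1 / 2) * w * x\<^sup>2))"
proof (rule quadratic_character.intro[OF filtered_group_fls[OF finite_residue]], unfold_locales)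
  show "\<psi>p ((x + y) * z) = \<psi>p (x * z) * \<psi>p (y * z)" for x y z by (simp add: distrib_right \<psi>p_add)
  show "\<psi>p (x * y) = \<psi>p (y * x)" for x y by (simp add: mult.commute)
  show "norm (\<psi>p (x * y)) = 1" for x y by (simp add: \<psi>p_eq \<psi>0_norm)
  show "(\<forall>x\<in>fls_filt n. \<psi>p (x * y) = 1) \<longleftrightarrow> y \<in> fls_filt (0 - n)" for y n using \<psi>p_perp by simp
  show "bij_betw (\<lambda>y. w * y) UNIV UNIV"
    by (rule bij_betw_byWitness[of _ "\<lambda>y. inverse w * y"]) (use w in \<open>auto simp: mult.assoc[symmetric]\<close>)
  show "w * (x + y) = w * x + w * y" for x y by (rule distrib_left)
  show "\<exists>k. \<forall>n. \<forall>x\<in>UNIV. (x \<in> fls_filt n \<longrightarrow> w * x \<in> fls_filt (n - k)) \<and> (w * x \<in> fls_filt n \<longrightarrow> x \<in> fls_filt (n - k))"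
  proof (rule exI[of _ "\<bar>fls_subdegree w\<bar>"], intro allI ballI conjI impI)
    fix n x
    show "w * x \<in> fls_filt (n - \<bar>fls_subdegree w\<bar>)" if "x \<in> fls_filt n"
      using that unfolding fls_filt_mult_iff[OF w]
      by (rule subsetD[OF fls_filt_antimono, rotated]) arith
    show "x \<in> fls_filt (n - \<bar>fls_subdegree w\<bar>)" if "w * x \<in> fls_filt n"
      using that unfolding fls_filt_mult_iff[OF w]
      by (rule subsetD[OF fls_filt_antimono, rotated]) arith
  qed
  show "norm (\<psi>p (fls_const (1 / 2) * w * x\<^sup>2)) = 1" for x by (simp add: \<psi>p_eq \<psi>0_norm)
  show "\<psi>p (fls_const (1 / 2) * w * (- x)\<^sup>2) = \<psi>p (fls_const (1 / 2) * w * x\<^sup>2)" for x by simp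
  show "\<psi>p (fls_const (1 / 2) * w * (x + y)\<^sup>2) =
    \<psi>p (fls_const (1 / 2) * w * x\<^sup>2) * \<psi>p (fls_const (1 / 2) * w * y\<^sup>2) * \<psi>p (x * (w * y))" for x y
  proof -
    define z where "z = x * (w * y)"
    have h: "fls_const (1 / 2) + fls_const (1 / 2) = (1 :: 'f fls)"
      using two_residue by (simp add: fls_plus_const)
    have "fls_const (1 / 2) * z + fls_const (1 / 2) * z = z"
      using arg_cong[OF h, of "\<lambda>u. u * z"] by (simp add: distrib_right)
    moreover have "fls_const (1 / 2) * w * (x + y)\<^sup>2 = fls_const (1 / 2) * w * x\<^sup>2 + fls_const (1 / 2) * w * y\<^sup>2 +
        (fls_const (1 / 2) * z + fls_const (1 / 2) * z)"
      unfolding power2_eq_square z_def by (simp add: algebra_simps)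
    ultimately show ?thesis by (simp only: \<psi>p_add z_def)
  qed
  have "\<psi>p (fls_const (1 / 2) * w * x\<^sup>2) = 1" if x: "x \<in> fls_filt \<bar>fls_subdegree w\<bar>" for x
  proof -
    have "w * x\<^sup>2 \<in> fls_filt 0"
      unfolding fls_filt_mult_iff[OF w] power2_eq_square
      by (rule subsetD[OF fls_filt_antimono fls_filt_mult[OF x x]]) arith
    then show ?thesis
      using fls_filt_mult[of "fls_const (1 / 2)" 0 "w * x\<^sup>2" 0] by (intro \<psi>p_trivial) (simp add: fls_filt_def mult.assoc)
  qed
  then show "\<exists>n. \<forall>x\<in>fls_filt n. \<psi>p (fls_const (1 / 2) * w * x\<^sup>2) = 1" by blast
qed

text \<open>With N the order of \<open>w\<close>, the orthogonal of \<open>fls_filt (- e)\<close>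
  for the form with coefficient \<open>w\<close> is \<open>fls_filt (e - N)\<close>. For
  \<open>e = N div 2\<close> their quotient is 0 or a line spanned by t^(-e-1), and
  \<open>R0\<close> represents it.\<close>

lemma weil_index_fls:
  fixes w :: "'f fls"
  assumes w: "w \<noteq> 0" and odd: "odd (fls_subdegree w) \<Longrightarrow> R0 = range (\<lambda>a. fls_mono a (- (fls_subdegree w div 2) - 1))"
    and even: "even (fls_subdegree w) \<Longrightarrow> R0 = {0}"
  defines "h \<equiv> \<lambda>x. \<psi>p (fls_const (1 / 2) * w * x\<^sup>2)"
  shows "\<exists>\<kappa>::real. \<kappa> > 0 \<and> sum h R0 = of_real \<kappa> * weil_index (additive_group UNIV) euclidean h"
proof -
  interpret quadratic_character UNIV euclidean fls_filt "CARD('f)" "\<lambda>x y. \<psi>p (x * y)" 0 "\<lambda>y. w * y" h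
    unfolding h_def by (rule quadratic_character_fls[OF w])
  let ?N = "fls_subdegree w"
  define e where "e = ?N div 2"
  have N: "?N = 2 * e \<or> ?N = 2 * e + 1" unfolding e_def by presburger
  obtain k0 where k0: "\<And>k. k \<ge> k0 \<Longrightarrow> \<exists>n0. \<forall>n\<ge>n0. (\<forall>x\<in>fls_filt (- k). \<forall>b\<in>fls_filt n. h (x + b) = h x) \<and>
     (\<forall>R. transversal R (fls_filt (- k)) (fls_filt n) \<longrightarrow>
       (\<exists>\<kappa>::real. \<kappa> > 0 \<and> sum h R = of_real \<kappa> * weil_index (additive_group UNIV) euclidean h))"
    using weil_index_gauss_sum by blast
  \<comment> \<open>Taken so large that the two lattices of the reduction, of exponents
    \<open>e - N\<close> and \<open>- e\<close>, lie inside the one of exponent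
    \<open>- k\<close>.\<close>
  define k where "k = max k0 (\<bar>e\<bar> + 1)"
  obtain n0 where n0: "\<And>n. n \<ge> n0 \<Longrightarrow> (\<forall>x\<in>fls_filt (- k). \<forall>b\<in>fls_filt n. h (x + b) = h x) \<and>
     (\<forall>R. transversal R (fls_filt (- k)) (fls_filt n) \<longrightarrow>
       (\<exists>\<kappa>::real. \<kappa> > 0 \<and> sum h R = of_real \<kappa> * weil_index (additive_group UNIV) euclidean h))"
    using k0[of k] by (auto simp: k_def)
  define n where "n = max n0 k"
  have n: "n \<ge> n0" "n \<ge> - e" "- k \<le> e - ?N" "- k \<le> n" "e - ?N \<le> - e"
    using N unfolding n_def k_def by auto
  obtain R where R: "transversal R (fls_filt (- k)) (fls_filt n :: 'f fls set)" using transversal_B[OF n(4)] by blast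
  obtain \<kappa> where \<kappa>: "\<kappa> > 0" "sum h R = of_real \<kappa> * weil_index (additive_group UNIV) euclidean h"
    using n0[OF n(1)] R by blast
  have tR0: "transversal R0 (fls_filt (e - ?N)) (fls_filt (- e))"
  proof (cases "odd ?N")
    case True
    then have "?N = 2 * e + 1" using N by auto
    then show ?thesis using transversal_fls_filt[OF finite_residue, of "- e - 1"] odd[OF True]
      by (simp add: e_def[symmetric])
  next
    case False
    then have N': "?N = 2 * e" using N by auto
    have "transversal {0} (fls_filt (- e)) (fls_filt (- e) :: 'f fls set)"
      by (rule transversalI[OF fls_filt_group]) (auto simp: fls_filt_def)
    then show ?thesis using N' even False by simp
  qed
  have "\<exists>\<kappa>::real. \<kappa> > 0 \<and> sum h R = of_real \<kappa> * sum h R0"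
  proof (rule gauss_sum_reduce[OF fls_filt_group fls_filt_group fls_filt_group fls_filt_group _ _ _ R tR0, where \<beta> = "\<lambda>x y. \<psi>p (x * (w * y))"])
    show "fls_filt n \<subseteq> fls_filt (- e)" "fls_filt (- e) \<subseteq> fls_filt (e - ?N)" "fls_filt (e - ?N) \<subseteq> fls_filt (- k)"
      using n by (auto intro!: fls_filt_antimono)
    show "x \<in> fls_filt (e - ?N) \<longleftrightarrow> (\<forall>y\<in>fls_filt (- e). \<psi>p (y * (w * x)) = 1)" for x
      using \<psi>p_perp[of "- e" "w * x"] fls_filt_mult_iff[OF w, of x e] by simp
    show "h (x + y) = h x * h y * \<psi>p (x * (w * y))" for x y using h_add by simp
    show "h x = 1" if x: "x \<in> fls_filt (- e)" for x
    proof -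
      have "fls_filt (- e + - e) \<subseteq> (fls_filt (0 - ?N) :: 'f fls set)" using N by (intro fls_filt_antimono) auto
      then have "w * x\<^sup>2 \<in> fls_filt 0"
        unfolding fls_filt_mult_iff[OF w] power2_eq_square using fls_filt_mult[OF x x] by blast
      then show ?thesis
        unfolding h_def using fls_filt_mult[of "fls_const (1 / 2)" 0 "w * x\<^sup>2" 0]
        by (intro \<psi>p_trivial) (simp add: fls_filt_def mult.assoc)
    qed
    show "\<psi>p (x * (w * y)) = \<psi>p (y * (w * x))" for x y by (simp add: mult_ac)
    show "\<psi>p ((x + y) * (w * z)) = \<psi>p (x * (w * z)) * \<psi>p (y * (w * z))" for x y z
      by (simp add: distrib_right \<psi>p_add)
    show "h (x + b) = h x" if "x \<in> fls_filt (- k)" "b \<in> fls_filt n" for x b using n0[OF n(1)] that by blast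
  qed
  then obtain \<kappa>' where \<kappa>': "\<kappa>' > 0" "sum h R = of_real \<kappa>' * sum h R0" by blast
  have "sum h R0 = of_real (\<kappa> / \<kappa>') * weil_index (additive_group UNIV) euclidean h"
    using \<kappa> \<kappa>' by (simp add: field_simps)
  then show ?thesis using \<kappa> \<kappa>' by (intro exI[of _ "\<kappa> / \<kappa>'"]) simp
qed

lemma norm_weil_index_fls:
  "w \<noteq> 0 \<Longrightarrow> norm (weil_index (additive_group UNIV) euclidean (\<lambda>x. \<psi>p (fls_const (1 / 2) * w * x\<^sup>2))) = 1"
  by (rule quadratic_character.norm_weil_index[OF quadratic_character_fls])

text \<open>The reduced sum is the single term 1, so the index is a positive number of absolute
  value 1.\<close>

lemma weil_index_fls_even:
  assumes w: "w \<noteq> 0" and "even (fls_subdegree w)"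
  shows "weil_index (additive_group UNIV) euclidean (\<lambda>x. \<psi>p (fls_const (1 / 2) * w * x\<^sup>2)) = 1" (is "?W = 1")
proof -
  obtain \<kappa> :: real where \<kappa>: "\<kappa> > 0" "1 = of_real \<kappa> * ?W"
    using weil_index_fls[OF w, of "{0}"] assms(2) by (auto simp: \<psi>p_eq)
  then have "\<kappa> * norm ?W = 1" by (metis abs_of_pos norm_mult norm_of_real norm_one)
  then have "\<kappa> = 1" using norm_weil_index_fls[OF w] by simp
  then show ?thesis using \<kappa> by simp
qed

text \<open>At x = a t^(-e-1) the half form has as coefficient of t^(-1) the leading coefficient of
  \<open>w\<close> times a^2 / 2; the conjugation is the minus sign in \<open>psi_p\<close>.\<close>

lemma weil_index_fls_odd:
  assumes w: "w \<noteq> 0" and "odd (fls_subdegree w)"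
  shows "\<exists>\<kappa>::real. \<kappa> > 0 \<and> (\<Sum>a\<in>UNIV. cnj (\<psi>0 (fls_nth w (fls_subdegree w) * a\<^sup>2 / 2))) =
    of_real \<kappa> * weil_index (additive_group UNIV) euclidean (\<lambda>x. \<psi>p (fls_const (1 / 2) * w * x\<^sup>2))"
proof -
  define e where "e = fls_subdegree w div 2"
  have N: "fls_subdegree w = 2 * e + 1" unfolding e_def using assms(2) by presburger
  let ?h = "\<lambda>x. \<psi>p (fls_const (1 / 2) * w * x\<^sup>2)"
  have inj: "inj (\<lambda>a::'f. fls_mono a (- e - 1))"
  proof (rule injI)
    fix a b :: 'f assume "fls_mono a (- e - 1) = fls_mono b (- e - 1)"
    from arg_cong[OF this, of "\<lambda>x. fls_nth x (- e - 1)"] show "a = b" by (simp add: fls_nth_mono)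
  qed
  have "sum ?h (range (\<lambda>a. fls_mono a (- e - 1))) = (\<Sum>a\<in>UNIV. ?h (fls_mono a (- e - 1)))"
    by (subst sum.reindex[OF inj]) simp
  also have "\<dots> = (\<Sum>a\<in>UNIV. cnj (\<psi>0 (fls_nth w (fls_subdegree w) * a\<^sup>2 / 2)))"
  proof (rule sum.cong[OF refl])
    fix a :: 'f
    have "fls_nth (fls_const (1 / 2) * w * (fls_mono a (- e - 1))\<^sup>2) (- 1) = fls_nth w (2 * e + 1) * a\<^sup>2 / 2"
      unfolding power2_eq_square mult.assoc[symmetric] fls_nth_mult_mono
      by (simp add: fls_mult_const_nth mult.assoc algebra_simps)
    then show "?h (fls_mono a (- e - 1)) = cnj (\<psi>0 (fls_nth w (fls_subdegree w) * a\<^sup>2 / 2))"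
      using N by (simp only: \<psi>p_eq \<psi>0_minus)
  qed
  finally show ?thesis
    using weil_index_fls[OF w, of "range (\<lambda>a. fls_mono a (- e - 1))"] assms(2) by (simp add: e_def)
qed

end

section \<open>Factorization of polynomials over a field\<close>

text \<open>A nonzero element of least degree in the ideal of A and P divides both, by division with
  remainder; as P is irreducible and does not divide A, this element is a unit.\<close>

lemma irreducible_bezout:
  fixes P :: "'k::field poly"
  assumes P: "irreducible P" and A: "\<not> P dvd A"
  shows "\<exists>u. (A * u) mod P = 1 mod P"
proof -
  define I where "I = {d. d \<noteq> 0 \<and> (\<exists>x y. d = x * A + y * P)}"
  have "A \<noteq> 0" using A by auto
  moreover have "A = 1 * A + 0 * P" by simp
  ultimately have "A \<in> I" unfolding I_def by blast
  then obtain d where d: "d \<in> I" and min: "\<And>e. e \<in> I \<Longrightarrow> degree d \<le> degree e"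
    using arg_min_nat_lemma[of "\<lambda>d. d \<in> I" A degree] by blast
  obtain x y where xy: "d = x * A + y * P" and d0: "d \<noteq> 0" using d by (auto simp: I_def)
  have dvd: "d dvd B" if "B = u * A + w * P" for B u w
  proof (rule ccontr)
    assume "\<not> d dvd B"
    then have ne: "B mod d \<noteq> 0" by (simp add: mod_eq_0_iff_dvd)
    have "B mod d = B - (B div d) * d" by (simp add: minus_div_mult_eq_mod)
    also have "\<dots> = (u - (B div d) * x) * A + (w - (B div d) * y) * P"
      unfolding that xy by (simp add: algebra_simps)
    finally have "B mod d \<in> I" using ne unfolding I_def by blast
    then show False using min[of "B mod d"] degree_mod_less'[OF d0 ne] by simp
  qed
  have dA: "d dvd A" using dvd[of A 1 0] by simp
  have "d dvd P" using dvd[of P 0 1] by simp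
  then obtain k where k: "P = d * k" by (elim dvdE)
  have "\<not> k dvd 1"
  proof
    assume "k dvd 1"
    then have "P dvd d" unfolding k by (metis dvd_refl mult_dvd_mono mult_1_right)
    then show False using dA A dvd_trans by blast
  qed
  then have "d dvd 1" using irreducibleD[OF P k] by blast
  then obtain e where e: "1 = d * e" by (elim dvdE)
  have "1 = A * (x * e) + P * (y * e)" unfolding e xy by (simp add: algebra_simps)
  then have "(A * (x * e)) mod P = 1 mod P" by (metis mod_mult_self2)
  then show ?thesis by blast
qed

lemma irreducible_degree_pos:
  fixes P :: "'k::field poly" assumes "irreducible P" shows "degree P \<ge> 1"
proof (rule ccontr)
  assume "\<not> ?thesis"
  then have "degree P = 0" by simp
  then obtain a where a: "P = [:a:]" by (rule degree_eq_zeroE)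
  then have "P dvd 1" using assms by (cases "a = 0") (auto simp: is_unit_pCons_iff)
  then show False using assms irreducible_not_unit by blast
qed

lemma monic_dvd_eq:
  fixes P Q :: "'k::field poly"
  assumes "lead_coeff P = 1" "lead_coeff Q = 1" "irreducible P" "irreducible Q" "P dvd Q"
  shows "P = Q"
proof -
  obtain k where k: "Q = P * k" using assms(5) by (elim dvdE)
  have "k dvd 1" using irreducibleD[OF assms(4) k] assms(3) irreducible_not_unit by blast
  then obtain a where "k = [:a:]" using is_unit_polyE by metis
  moreover have "lead_coeff k = 1" using assms(1,2) k by (simp add: lead_coeff_mult)
  ultimately have "k = 1" by (simp add: one_pCons)
  then show ?thesis using k by simp
qed

text \<open>A monic nonconstant divisor of least degree is irreducible. Squarefreeness keeps it from
  recurring in the cofactor, so the factors form a set.\<close>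

lemma monic_squarefree_factorization:
  fixes R :: "'k::field poly"
  assumes "lead_coeff R = 1" and "\<And>T. T * T dvd R \<Longrightarrow> degree T = 0"
  shows "\<exists>\<P>. finite \<P> \<and> (\<forall>P\<in>\<P>. lead_coeff P = 1 \<and> irreducible P) \<and> R = \<Prod>\<P>"
  using assms
proof (induction "degree R" arbitrary: R rule: less_induct)
  case (less R)
  show ?case
  proof (cases "degree R = 0")
    case True
    then have "R = 1" using less.prems(1) by (metis coeff_pCons_0 degree_eq_zeroE one_pCons)
    then show ?thesis by (intro exI[of _ "{}"]) simp
  next
    case False
    define D where "D A \<longleftrightarrow> lead_coeff A = 1 \<and> A dvd R \<and> degree A \<ge> 1" for A
    have "D R" using False less.prems(1) by (simp add: D_def)
    then obtain P where P: "D P" and min: "\<And>A. D A \<Longrightarrow> degree P \<le> degree A"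
      using arg_min_nat_lemma[of D R degree] by blast
    obtain R' where R': "R = P * R'" using P by (auto simp: D_def elim!: dvdE)
    have "R \<noteq> 0" using less.prems(1) by auto
    then have ne: "P \<noteq> 0" "R' \<noteq> 0" using R' by auto
    have irr: "irreducible P"
    proof (rule irreducibleI)
      show "P \<noteq> 0" by (rule ne(1))
      show "\<not> P dvd 1" using P by (simp add: D_def is_unit_iff_degree[OF ne(1)])
      fix A B assume AB: "P = A * B"
      have nz: "A \<noteq> 0" "B \<noteq> 0" using AB ne by auto
      have "degree A = 0 \<or> degree B = 0"
      proof (rule ccontr)
        assume "\<not> ?thesis"
        then have deg: "degree A \<ge> 1" "degree A < degree P"
          using AB nz by (auto simp: degree_mult_eq)
        let ?A = "smult (inverse (lead_coeff A)) A"
        have "?A dvd R"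
          using nz AB R' by (metis dvd_mult2 dvd_smult_cancel dvd_triv_left inverse_zero_imp_zero leading_coeff_0_iff smult_dvd)
        then have "D ?A" using nz deg(1) by (simp add: D_def)
        then show False using min[of ?A] nz deg(2) by simp
      qed
      then show "A dvd 1 \<or> B dvd 1" using nz by (auto simp: is_unit_iff_degree)
    qed
    have "degree R = degree P + degree R'" using R' ne by (simp add: degree_mult_eq)
    then have "degree R' < degree R" using P by (simp add: D_def)
    moreover have "lead_coeff R' = 1" using less.prems(1) P R' by (simp add: D_def lead_coeff_mult)
    moreover have "degree T = 0" if "T * T dvd R'" for T using less.prems(2)[of T] that R' by simp
    ultimately obtain \<P> where \<P>: "finite \<P>" "\<forall>P\<in>\<P>. lead_coeff P = 1 \<and> irreducible P" "R' = \<Prod>\<P>"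
      using less.hyps by blast
    have "P \<notin> \<P>"
    proof
      assume "P \<in> \<P>"
      then have "P dvd R'" unfolding \<P>(3) using \<P>(1) by (intro dvd_prodI)
      then have "P * P dvd R" unfolding R' by (rule mult_dvd_mono[OF dvd_refl])
      then show False using less.prems(2) irreducible_degree_pos[OF irr] by fastforce
    qed
    then show ?thesis
      using \<P> R' irr P by (intro exI[of _ "insert P \<P>"]) (auto simp: D_def)
  qed
qed

text \<open>\<open>A\<close> is monic of greatest degree among those whose square divides
  \<open>W\<close>; a square left over in the quotient could be multiplied into it.\<close>

lemma monic_square_decomposition:
  fixes W :: "'k::field poly"
  assumes W: "lead_coeff W = 1"
  shows "\<exists>A R. W = A * A * R \<and> lead_coeff A = 1 \<and> lead_coeff R = 1 \<and> (\<forall>T. T * T dvd R \<longrightarrow> degree T = 0)"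
proof -
  define D where "D A \<longleftrightarrow> lead_coeff A = 1 \<and> A * A dvd W" for A
  have W0: "W \<noteq> 0" using W by auto
  have bound: "degree A < Suc (degree W)" if "D A" for A
  proof -
    have "degree (A * A) \<le> degree W" using that W0 by (intro dvd_imp_degree_le) (auto simp: D_def)
    moreover have "A \<noteq> 0" using that by (auto simp: D_def)
    ultimately show ?thesis by (simp add: degree_mult_eq)
  qed
  have "D 1" by (simp add: D_def)
  then obtain A where A: "D A" and max: "\<And>B. D B \<Longrightarrow> degree B \<le> degree A"
    using ex_has_greatest_nat_lemma[of D 1 degree "Suc (degree W)"] bound
      ex_has_greatest_nat[of D 1 degree "Suc (degree W)"] by (metis less_imp_le)
  obtain R where R: "W = A * A * R" using A by (auto simp: D_def elim!: dvdE)
  have A0: "A \<noteq> 0" using A by (auto simp: D_def)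
  have "degree T = 0" if T: "T * T dvd R" for T
  proof -
    have T0: "T \<noteq> 0" using T R W0 by auto
    let ?T = "smult (inverse (lead_coeff T)) T"
    have "?T * ?T dvd R" using T T0 by (simp add: smult_dvd_iff)
    then have "(A * ?T) * (A * ?T) dvd W" unfolding R using mult_dvd_mono[OF dvd_refl, of "?T * ?T" R "A * A"] by (simp add: mult_ac)
    moreover have "lead_coeff (A * ?T) = 1" using A T0 by (simp add: D_def lead_coeff_mult)
    ultimately have "degree (A * ?T) \<le> degree A" using max[of "A * ?T"] unfolding D_def by blast
    then show ?thesis using A0 T0 by (simp add: degree_mult_eq)
  qed
  moreover have "lead_coeff R = 1" using W A unfolding R by (simp add: lead_coeff_mult D_def)
  ultimately show ?thesis using R A by (auto simp: D_def)
qed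

section \<open>Power series with integral coefficients\<close>

context local_field
begin

definition fint :: "int \<Rightarrow> 'k fps set" where "fint n = {g. \<forall>i. fps_nth g i \<in> mp n}"

lemma integral_fps_fint: "integral_fps v = fint 0"
  by (simp add: integral_fps_def fint_def)

lemma fint_group: "add_subgroup (fint n)"
  by (auto simp: add_subgroup_def fint_def mp_diff)

lemmas fint_intros = add_subgroup_intros[OF fint_group]

lemma fint_antimono: "m \<le> n \<Longrightarrow> fint n \<subseteq> fint m"
  using mp_antimono[of m n] by (auto simp: fint_def)

lemma fint_mult: "g \<in> fint m \<Longrightarrow> h \<in> fint n \<Longrightarrow> g * h \<in> fint (m + n)"
  by (auto simp: fint_def fps_mult_nth intro!: mp_sum mp_mult)

lemma fint_mult0: "g \<in> fint 0 \<Longrightarrow> h \<in> fint 0 \<Longrightarrow> g * h \<in> fint 0"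
  using fint_mult[of g 0 h 0] by simp

lemma fint_one [simp]: "1 \<in> fint 0"
  by (simp add: fint_def)

lemma fint_const: "a \<in> mp n \<Longrightarrow> fps_const a \<in> fint n"
  by (simp add: fint_def)

lemma fint_X_power: "fps_X ^ s \<in> fint 0"
  by (simp add: fint_def)

lemma fint_poly: "fps_of_poly p \<in> fint n \<longleftrightarrow> p \<in> pint n"
  by (simp add: fint_def pint_def)

lemma fint_shift: "g \<in> fint n \<Longrightarrow> fps_shift s g \<in> fint n"
  by (simp add: fint_def)

lemma fint_Inter: "(\<And>i::nat. g \<in> fint (int i)) \<Longrightarrow> g = 0"
proof (rule fps_ext)
  fix j assume *: "\<And>i::nat. g \<in> fint (int i)"
  have "fps_nth g j \<in> mp n" for n
  proof -
    have "fps_nth g j \<in> mp (int (nat n))" using *[of "nat n"] unfolding fint_def by blast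
    moreover have "mp (int (nat n)) \<subseteq> mp n" by (rule mp_antimono) simp
    ultimately show ?thesis by blast
  qed
  then show "fps_nth g j = fps_nth 0 j" using mp_Inter[of "fps_nth g j"] by simp
qed

definition red :: "'k fps \<Rightarrow> 'f fps" where "red g = Abs_fps (\<lambda>i. res (fps_nth g i))"

lemma red_nth [simp]: "fps_nth (red g) i = res (fps_nth g i)"
  by (simp add: red_def)

lemma res_sum: "(\<And>i. i \<in> I \<Longrightarrow> f i \<in> mp 0) \<Longrightarrow> res (sum f I) = (\<Sum>i\<in>I. res (f i))"
  by (induction I rule: infinite_finite_induct) (simp_all add: res_add mp_sum)

lemma red_add: "g \<in> fint 0 \<Longrightarrow> h \<in> fint 0 \<Longrightarrow> red (g + h) = red g + red h"
  by (rule fps_ext) (simp add: fint_def res_add)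

lemma red_mult:
  assumes g: "g \<in> fint 0" and h: "h \<in> fint 0" shows "red (g * h) = red g * red h"
proof (rule fps_ext)
  fix n
  have "fps_nth g i * fps_nth h (n - i) \<in> mp 0" for i
    using mp_mult[of "fps_nth g i" 0 "fps_nth h (n - i)" 0] g h by (simp add: fint_def)
  then have "res (\<Sum>i=0..n. fps_nth g i * fps_nth h (n - i)) = (\<Sum>i=0..n. res (fps_nth g i * fps_nth h (n - i)))"
    by (intro res_sum)
  then show "fps_nth (red (g * h)) n = fps_nth (red g * red h) n"
    using g h by (simp add: fps_mult_nth fint_def res_mult)
qed

lemma red_eq_0_iff: "g \<in> fint 0 \<Longrightarrow> red g = 0 \<longleftrightarrow> g \<in> fint 1"
  by (simp add: fps_eq_iff fint_def res_zero_iff)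

lemma fint_scale: "fps_const (\<pi> powi m) * g \<in> fint n \<longleftrightarrow> g \<in> fint (n - m)"
  by (simp add: fint_def \<pi>_powi_mult_mp)

text \<open>A nonzero series lies outside some \<open>fint i\<close>, so the k with
  \<open>g \<in> fint (n + k)\<close> are bounded; the largest one gives the content.\<close>

lemma fint_primitive:
  assumes g: "g \<noteq> 0" "g \<in> fint n"
  shows "\<exists>m g'. m \<ge> n \<and> g = fps_const (\<pi> powi m) * g' \<and> g' \<in> fint 0 \<and> red g' \<noteq> 0"
proof -
  obtain i where i: "\<not> g \<in> fint (int i)" using fint_Inter g(1) by blast
  define A where "A = {k::nat. g \<in> fint (n + int k)}"
  have bound: "k < nat (int i - n) + 1" if "k \<in> A" for k
  proof (rule ccontr)
    assume "\<not> ?thesis"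
    then have "int i \<le> n + int k" by linarith
    then show False using that i fint_antimono by (auto simp: A_def)
  qed
  have "0 \<in> A" using g(2) by (simp add: A_def)
  moreover have "finite A" using bound by (intro finite_subset[of A "{..<nat (int i - n) + 1}"]) auto
  ultimately obtain k where k: "k \<in> A" "Suc k \<notin> A"
    by (metis Max_ge Max_in Suc_n_not_le_n empty_iff)
  let ?g = "fps_const (\<pi> powi (- (n + int k))) * g"
  have "0 - - (n + int k) = n + int k" by simp
  then have int: "?g \<in> fint 0" unfolding fint_scale using k(1) unfolding A_def by (metis mem_Collect_eq)
  moreover have "1 - - (n + int k) = n + int (Suc k)" by simp
  then have "red ?g \<noteq> 0"
    unfolding red_eq_0_iff[OF int] fint_scale using k(2) unfolding A_def by (metis mem_Collect_eq)
  moreover have "g = fps_const (\<pi> powi (n + int k)) * ?g"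
    by (rule fps_ext) (simp only: fps_mult_left_const_nth \<pi>_powi_cancel)
  ultimately show ?thesis by (intro exI[of _ "n + int k"] exI[of _ ?g]) simp
qed

text \<open>Unlike \<open>distinguished\<close> this admits degree 0, that is \<open>W = 1\<close>,
  the Weierstrass polynomial of a unit.\<close>

definition distinguished0 :: "'k poly \<Rightarrow> bool" where
  "distinguished0 W \<longleftrightarrow> lead_coeff W = 1 \<and> W \<in> pint 0 \<and> red (fps_of_poly W) = fps_X ^ degree W"

lemma distinguished0_iff:
  "distinguished0 W \<longleftrightarrow> lead_coeff W = 1 \<and> (\<forall>i<degree W. coeff W i \<in> mp 1)"
proof
  assume W: "distinguished0 W"
  have "coeff W i \<in> mp 1" if "i < degree W" for i
  proof -
    have "fps_nth (red (fps_of_poly W)) i = 0" using W that by (simp add: distinguished0_def del: red_nth)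
    then show ?thesis using W res_zero_iff[of "coeff W i"] by (simp add: distinguished0_def pint_def)
  qed
  then show "lead_coeff W = 1 \<and> (\<forall>i<degree W. coeff W i \<in> mp 1)" using W by (simp add: distinguished0_def)
next
  assume W: "lead_coeff W = 1 \<and> (\<forall>i<degree W. coeff W i \<in> mp 1)"
  have c: "coeff W i \<in> mp 0 \<and> res (coeff W i) = (if i = degree W then 1 else 0)" for i
  proof (cases i "degree W" rule: linorder_cases)
    case less
    then have "coeff W i \<in> mp 1" using W by blast
    then show ?thesis using less mp_antimono[of 0 1] res_zero_iff[of "coeff W i"] by auto
  qed (use W in \<open>simp_all add: coeff_eq_0\<close>)
  then have "red (fps_of_poly W) = fps_X ^ degree W" by (intro fps_ext) simp
  then show "distinguished0 W" using W c by (simp add: distinguished0_def pint_def)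
qed

lemma distinguished_iff: "distinguished v P \<longleftrightarrow> degree P \<ge> 1 \<and> distinguished0 P"
  by (auto simp: distinguished_def distinguished0_iff)

text \<open>Gauss's lemma: the content is multiplicative because the reduction of a product is the product
  of the reductions.\<close>

lemma distinguished0_factor:
  assumes W: "distinguished0 (A * B)" and A: "lead_coeff A = 1" and B: "lead_coeff B = 1"
  shows "distinguished0 A"
proof -
  \<comment> \<open>A monic polynomial has the coefficient 1, so the exponent of its content is at
    most 0. For two monic factors of an integral product both exponents must then be 0.\<close>
  have scale: "\<exists>m\<le>0. \<exists>g. fps_of_poly F = fps_const (\<pi> powi m) * g \<and> g \<in> fint 0 \<and> red g \<noteq> 0"
    if F: "lead_coeff F = 1" for F
  proof -
    obtain n where n: "F \<in> pint n" using pint_exists by blast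
    have "fps_of_poly F \<noteq> 0" using F by auto
    then obtain m g where mg: "fps_of_poly F = fps_const (\<pi> powi m) * g" "g \<in> fint 0" "red g \<noteq> 0"
      using fint_primitive[of "fps_of_poly F" n] n by (auto simp: fint_poly)
    have "1 = \<pi> powi m * fps_nth g (degree F)"
      using F arg_cong[OF mg(1), of "\<lambda>x. fps_nth x (degree F)"] by simp
    then have "1 \<in> mp m" using \<pi>_powi_mult_mp[of m "fps_nth g (degree F)" m] mg(2) by (simp add: fint_def)
    then show ?thesis using mg by (auto simp: mp_iff)
  qed
  obtain m g where g: "m \<le> 0" "fps_of_poly A = fps_const (\<pi> powi m) * g" "g \<in> fint 0" "red g \<noteq> 0" using scale[OF A] by blast
  obtain n h where h: "n \<le> 0" "fps_of_poly B = fps_const (\<pi> powi n) * h" "h \<in> fint 0" "red h \<noteq> 0" using scale[OF B] by blast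
  have "fps_of_poly (A * B) = fps_const (\<pi> powi (m + n)) * (g * h)"
    using \<pi>_nonzero by (simp add: fps_of_poly_mult g(2) h(2) power_int_add mult_ac flip: fps_const_mult)
  then have "g * h \<in> fint (- (m + n))"
    using W fint_scale[of "m + n" "g * h" 0] by (simp add: distinguished0_def flip: fint_poly)
  moreover have "g * h \<notin> fint 1"
    using red_eq_0_iff[OF fint_mult0[OF g(3) h(3)]] red_mult[OF g(3) h(3)] g(4) h(4) by simp
  ultimately have "\<not> 1 \<le> - (m + n)" using fint_antimono by blast
  then have "m = 0" "n = 0" using g(1) h(1) by auto
  then have int: "fps_of_poly A \<in> fint 0" "fps_of_poly B \<in> fint 0" using g h by auto
  let ?a = "red (fps_of_poly A)" and ?b = "red (fps_of_poly B)"
  have prod: "?a * ?b = fps_X ^ degree (A * B)"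
    using W red_mult[OF int] by (simp add: distinguished0_def fps_of_poly_mult)
  then have nz: "?a \<noteq> 0" "?b \<noteq> 0" by auto
  \<comment> \<open>The leading coefficient reduces to 1, which bounds each order by the degree; as
    the orders add up to the total degree, both bounds are attained.\<close>
  have le: "subdegree ?a \<le> degree A" "subdegree ?b \<le> degree B"
    using A B by (auto intro!: subdegree_leI)
  have "A \<noteq> 0" "B \<noteq> 0" using A B by auto
  then have "subdegree ?a + subdegree ?b = degree A + degree B"
    using arg_cong[OF prod, of subdegree] nz by (simp add: degree_mult_eq)
  then have sub: "subdegree ?a = degree A" using le by linarith
  have "coeff A i \<in> mp 1" if "i < degree A" for i
  proof -
    have "fps_nth ?a i = 0" using that sub by (intro nth_less_subdegree_zero) simp
    then show ?thesis using res_zero_iff[of "coeff A i"] int(1) by (simp add: fint_def)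
  qed
  then show ?thesis using A by (simp add: distinguished0_iff)
qed

text \<open>A factorization over the valuation ring is one over the field, so one factor is a
  constant; as P is monic, its inverse is the leading coefficient of the other factor, which is
  integral.\<close>

lemma monic_irreducible_distinguished:
  assumes P: "lead_coeff P = 1" "irreducible P" and W: "distinguished0 W" "P dvd W"
  shows "irreducible_distinguished v P"
proof -
  obtain B where B: "W = P * B" using W(2) by (elim dvdE)
  have "lead_coeff B = 1" using W(1) P(1) B by (simp add: distinguished0_def lead_coeff_mult)
  then have d: "distinguished0 P" using distinguished0_factor W(1) B P(1) by blast
  have "(\<exists>C\<in>integral_poly v. A * C = 1) \<or> (\<exists>C\<in>integral_poly v. A' * C = 1)"
    if A: "A \<in> integral_poly v" "A' \<in> integral_poly v" "P = A * A'" for A A'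
  proof -
    have unit: "\<exists>C\<in>integral_poly v. F * C = 1"
      if F: "F dvd 1" "P = F * G" "G \<in> integral_poly v" for F G
    proof -
      obtain a where a: "F = [:a:]" using F(1) is_unit_polyE by metis
      have "P = smult a G" using F(2) a by simp
      then have l: "a * lead_coeff G = 1" using P(1) by (simp only: lead_coeff_smult)
      have "lead_coeff G \<in> mp 0" using F(3) by (simp add: integral_poly_def)
      then have "[:lead_coeff G:] \<in> integral_poly v" by (simp add: integral_poly_def coeff_pCons split: nat.split)
      moreover have "F * [:lead_coeff G:] = 1" using l a by (simp add: one_pCons mult.commute)
      ultimately show ?thesis by blast
    qed
    have "A dvd 1 \<or> A' dvd 1" by (rule irreducibleD[OF P(2) A(3)])
    then show ?thesis using unit[of A A'] unit[of A' A] A by (auto simp: mult.commute)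
  qed
  then show ?thesis
    unfolding irreducible_distinguished_def distinguished_iff
    using d irreducible_degree_pos[OF P(2)] by blast
qed

text \<open>Factors over the field, scaled to be monic, are integral by
  \<open>distinguished0_factor\<close>; irreducibility over the valuation ring then applies to
  them.\<close>

lemma irreducible_distinguished_irreducible:
  assumes P: "irreducible_distinguished v P"
  shows "distinguished0 P" "degree P \<ge> 1" "lead_coeff P = 1" "P \<in> pint 0" "irreducible P"
proof -
  show d: "distinguished0 P" and deg: "degree P \<ge> 1"
    using P by (auto simp: irreducible_distinguished_def distinguished_iff)
  show lc: "lead_coeff P = 1" and "P \<in> pint 0" using d by (auto simp: distinguished0_def)
  show "irreducible P"
  proof (rule irreducibleI)
    show "P \<noteq> 0" using lc by auto
    have "P \<noteq> 0" using lc by auto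
    then show "\<not> P dvd 1" using deg by (simp add: is_unit_iff_degree)
    fix A B assume AB: "P = A * B"
    have nz: "A \<noteq> 0" "B \<noteq> 0" using AB lc by auto
    let ?A = "smult (inverse (lead_coeff A)) A" and ?B = "smult (inverse (lead_coeff B)) B"
    have "lead_coeff A * lead_coeff B = 1" using lc AB by (simp add: lead_coeff_mult)
    then have eq: "P = ?A * ?B" using AB nz by (simp add: field_simps)
    have l: "lead_coeff ?A = 1" "lead_coeff ?B = 1" using nz by auto
    have "distinguished0 ?A" "distinguished0 ?B"
      using distinguished0_factor[OF _ l] distinguished0_factor[OF _ l(2,1)] d eq by (simp_all only: mult.commute)
    then have "?A \<in> integral_poly v" "?B \<in> integral_poly v" by (simp_all only: integral_poly_pint distinguished0_def)
    then have "(\<exists>C. ?A * C = 1) \<or> (\<exists>C. ?B * C = 1)"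
      using P eq unfolding irreducible_distinguished_def by blast
    then have "?A dvd 1 \<or> ?B dvd 1" by (metis dvd_triv_left)
    then show "A dvd 1 \<or> B dvd 1" using nz by (simp add: is_unit_iff_degree)
  qed
qed

section \<open>Weierstrass division and preparation\<close>

lemma fint_inverse:
  assumes U: "U \<in> fint 0" and u0: "res (fps_nth U 0) \<noteq> 0"
  shows "inverse U \<in> fint 0" and "U * inverse U = 1"
proof -
  have un: "fps_nth U 0 \<noteq> 0" "v (fps_nth U 0) = 0"
    using u0 res_unit_iff[of "fps_nth U 0"] U by (auto simp: fint_def)
  show one: "U * inverse U = 1" using un by (simp add: inverse_mult_eq_1')
  define V where "V = inverse U"
  have inv0: "inverse (fps_nth U 0) \<in> mp 0" using un v_inverse[of "fps_nth U 0"] by (simp add: mp_iff)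
  have "fps_nth V n \<in> mp 0" for n
  proof (induction n rule: less_induct)
    case (less n)
    show ?case
    proof (cases "n = 0")
      case True
      then show ?thesis using inv0 by (simp add: V_def)
    next
      case False
      have "(\<Sum>i=0..n. fps_nth U i * fps_nth V (n - i)) = 0"
        using arg_cong[OF one, of "\<lambda>x. fps_nth x n"] False by (simp add: V_def fps_mult_nth)
      then have "fps_nth U 0 * fps_nth V n = - (\<Sum>i=1..n. fps_nth U i * fps_nth V (n - i))"
        by (subst (asm) sum.atLeast_Suc_atMost) (auto simp: eq_neg_iff_add_eq_0)
      moreover have "(\<Sum>i=1..n. fps_nth U i * fps_nth V (n - i)) \<in> mp 0"
      proof (rule mp_sum)
        fix i assume i: "i \<in> {1..n}"
        then have "fps_nth V (n - i) \<in> mp 0" by (intro less.IH) auto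
        then show "fps_nth U i * fps_nth V (n - i) \<in> mp 0" using U by (intro mp_mult_int) (auto simp: fint_def)
      qed
      ultimately have "inverse (fps_nth U 0) * (fps_nth U 0 * fps_nth V n) \<in> mp 0"
        using mp_mult_int[OF inv0] mp_minus by simp
      then show ?thesis using un by (simp flip: mult.assoc)
    qed
  qed
  then show "inverse U \<in> fint 0" by (simp add: V_def fint_def)
qed

text \<open>Weierstrass division by successive approximation: \<open>Z = q U\<close> is the fixed point of a contraction.\<close>

lemma weierstrass_division:
  assumes g: "g \<in> fint 0" "red g \<noteq> 0" and f: "f \<in> fint 0"
  defines "s \<equiv> subdegree (red g)"
  shows "\<exists>q r. f = g * q + fps_of_poly r \<and> q \<in> fint 0 \<and> r \<in> pint 0 \<and> (\<forall>i\<ge>s. coeff r i = 0)"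
proof -
  define U where "U = fps_shift s g"
  define low where "low = fps_cutoff s g"
  have U: "U \<in> fint 0" using g by (simp add: U_def fint_shift)
  have "fps_nth (red g) s \<noteq> 0" unfolding s_def by (rule nth_subdegree_nonzero[OF g(2)])
  then have inv: "inverse U \<in> fint 0" "U * inverse U = 1" using fint_inverse[OF U] by (simp_all add: U_def)
  have low: "low \<in> fint 1"
    unfolding fint_def
  proof (intro CollectI allI)
    fix i
    have "fps_nth (red g) i = 0" if "i < s" using that unfolding s_def by (rule nth_less_subdegree_zero)
    then show "fps_nth low i \<in> mp 1" using res_zero_iff[of "fps_nth g i"] g(1) by (auto simp: low_def fint_def)
  qed
  \<comment> \<open>With g = X^s U + low and L = U q, the coefficients of f = g q + r from degree s
    on say that L is a fixed point of \<Phi>. As \<open>low\<close> is divisible by \<pi>, the map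
    \<Phi> is contracting.\<close>
  define \<Phi> where "\<Phi> Z = fps_shift s f - fps_shift s (Z * inverse U * low)" for Z
  have diff: "\<Phi> Z - \<Phi> Z' \<in> fint (n + 1)" if "Z - Z' \<in> fint n" for Z Z' n
  proof -
    have eq: "\<Phi> Z - \<Phi> Z' = - fps_shift s ((Z - Z') * inverse U * low)"
      by (rule fps_ext) (simp add: \<Phi>_def left_diff_distrib)
    have "(Z - Z') * inverse U * low \<in> fint (n + 0 + 1)" by (intro fint_mult that inv low)
    then show ?thesis unfolding eq using fint_intros(3) fint_shift by simp
  qed
  define Z where "Z i = (\<Phi> ^^ i) 0" for i
  have Z0: "Z i \<in> fint 0" for i
  proof (induction i)
    case (Suc i)
    have "Z i * inverse U * low \<in> fint (0 + 0 + 1)" by (intro fint_mult Suc inv low)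
    then have "Z i * inverse U * low \<in> fint 0" using fint_antimono[of 0 1] by auto
    then have "\<Phi> (Z i) \<in> fint 0" unfolding \<Phi>_def using f by (intro fint_intros(2) fint_shift)
    then show ?case by (simp add: Z_def)
  qed (simp add: Z_def fint_intros(1))
  have step: "Z (Suc i) - Z i \<in> fint (int i)" for i
  proof (induction i)
    case 0
    show ?case using fint_intros(2)[OF Z0 Z0, of "Suc 0" 0] by simp
  next
    case (Suc i)
    then show ?case using diff[OF Suc] by (simp add: Z_def algebra_simps)
  qed
  have "\<exists>y. \<forall>i. y - fps_nth (Z i) j \<in> mp (0 + int i)" for j
    by (rule mp_complete) (use step in \<open>simp add: fint_def\<close>)
  then obtain y where y: "\<And>j i. y j - fps_nth (Z i) j \<in> mp (int i)" by (metis add_0)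
  define L where "L = Abs_fps y"
  have L: "L - Z i \<in> fint (int i)" for i using y by (simp add: fint_def L_def)
  have L0: "L \<in> fint 0" using fint_intros(4)[OF _ Z0, of "L - Z 0" 0] L[of 0] by simp
  have "L - \<Phi> L = 0"
  proof (rule fint_Inter)
    fix i
    have a: "\<Phi> L - \<Phi> (Z i) \<in> fint (int i)" using diff[OF L[of i]] fint_antimono[of "int i" "int i + 1"] by auto
    have b: "L - Z (Suc i) \<in> fint (int i)" using L[of "Suc i"] fint_antimono[of "int i" "int (Suc i)"] by auto
    show "L - \<Phi> L \<in> fint (int i)" using fint_intros(2)[OF b a] by (simp add: Z_def)
  qed
  then have fixed: "L + fps_shift s (L * inverse U * low) = fps_shift s f" by (simp add: \<Phi>_def algebra_simps)
  define q where "q = L * inverse U"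
  have q: "q \<in> fint 0" using fint_mult0[OF L0 inv(1)] by (simp add: q_def)
  have Uq: "U * q = L" using inv(2) by (simp add: q_def mult.left_commute)
  have "g = fps_X ^ s * U + low" by (simp add: U_def low_def fps_shift_cutoff')
  then have "g * q = (fps_X ^ s * U + low) * q" by simp
  also have "\<dots> = fps_X ^ s * (U * q) + q * low" by (simp add: algebra_simps)
  finally have gq: "g * q = fps_X ^ s * L + q * low" unfolding Uq .
  define w where "w = f - g * q"
  have w: "w \<in> fint 0" unfolding w_def using f fint_mult0[OF g(1) q] by (rule fint_intros(2))
  have wz: "fps_nth w i = 0" if "i \<ge> s" for i
  proof -
    have "fps_nth (fps_shift s w) (i - s) = 0"
    proof -
      have "fps_shift s (g * q) = L + fps_shift s (q * low)"
        unfolding gq by (rule fps_ext) (simp add: fps_X_power_mult_nth)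
      then have "fps_shift s w = fps_shift s f - (L + fps_shift s (L * inverse U * low))"
        by (rule_tac fps_ext) (simp add: w_def q_def fps_eq_iff)
      then show ?thesis using fixed by simp
    qed
    then show ?thesis using that by simp
  qed
  define r where "r = coeff_poly s (fps_nth w)"
  have "fps_of_poly r = w" by (rule fps_ext) (simp add: r_def coeff_coeff_poly wz)
  moreover have "r \<in> pint 0" using w by (simp add: \<open>fps_of_poly r = w\<close> flip: fint_poly)
  ultimately show ?thesis
    using q by (intro exI[of _ q] exI[of _ r]) (simp add: w_def r_def coeff_coeff_poly)
qed

text \<open>Division of X^s by g gives X^s = g q + r. Reduction shows that r vanishes modulo \<pi>
  and that q has a constant term with nonzero residue; so q is a unit, and W = X^s - r.\<close>

lemma weierstrass_preparation:
  assumes g: "g \<in> fint 0" "red g \<noteq> 0"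
  shows "\<exists>W u u'. distinguished0 W \<and> degree W = subdegree (red g) \<and> g = fps_of_poly W * u \<and>
    u \<in> fint 0 \<and> u' \<in> fint 0 \<and> u * u' = 1"
proof -
  define s where "s = subdegree (red g)"
  obtain q r where qr: "fps_X ^ s = g * q + fps_of_poly r" "q \<in> fint 0" "r \<in> pint 0" "\<forall>i\<ge>s. coeff r i = 0"
    using weierstrass_division[OF g fint_X_power[of s]] by (auto simp: s_def)
  have rX: "red (fps_X ^ s) = fps_X ^ s" by (rule fps_ext) simp
  have rr: "fps_of_poly r \<in> fint 0" using qr(3) by (simp add: fint_poly)
  have eq: "fps_X ^ s = red g * red q + red (fps_of_poly r)"
    using arg_cong[OF qr(1), of red] by (simp add: rX red_add red_mult fint_mult0 g(1) qr(2) rr)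
  have r1: "coeff r i \<in> mp 1" for i
  proof (cases "i < s")
    case True
    have "fps_nth (red g * red q) i = 0"
    proof (cases "red q = 0")
      case False
      then show ?thesis using g(2) True by (intro nth_less_subdegree_zero) (simp add: s_def)
    qed simp
    then have "fps_nth (red (fps_of_poly r)) i = 0"
      using arg_cong[OF eq, of "\<lambda>x. fps_nth x i"] True by simp
    then show ?thesis using res_zero_iff[of "coeff r i"] qr(3) by (simp add: pint_def)
  qed (use qr(4) in simp)
  then have "red (fps_of_poly r) = 0" using red_eq_0_iff[OF rr] by (simp add: fint_def)
  then have X: "fps_X ^ s = red g * red q" using eq by simp
  then have "red q \<noteq> 0" by auto
  then have "s = s + subdegree (red q)" using arg_cong[OF X, of subdegree] g(2) by (simp add: s_def)
  then have "fps_nth (red q) 0 \<noteq> 0" using nth_subdegree_nonzero[OF \<open>red q \<noteq> 0\<close>] by simp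
  then have q0: "res (fps_nth q 0) \<noteq> 0" by simp
  note inv = fint_inverse[OF qr(2) q0]
  define W where "W = monom 1 s - r"
  have cW: "coeff W i = (if i = s then 1 else - coeff r i)" for i using qr(4) by (simp add: W_def)
  have degW: "degree W = s"
  proof (rule antisym)
    show "degree W \<le> s" by (rule degree_le) (use qr(4) in \<open>simp add: cW\<close>)
    show "s \<le> degree W" by (rule le_degree) (simp add: cW)
  qed
  have "distinguished0 W" unfolding distinguished0_iff degW using r1 mp_minus by (simp add: cW)
  moreover have "fps_of_poly W = g * q"
    using qr(1) by (simp add: W_def fps_of_poly_diff fps_of_poly_monom)
  then have "g = fps_of_poly W * inverse q" using inv(2) by (simp add: mult.assoc)
  moreover have "inverse q * q = 1" using inv(2) by (simp add: mult.commute)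
  ultimately show ?thesis using inv qr(2) degW by (auto simp: s_def)
qed

end

section \<open>Expansions at an irreducible distinguished polynomial\<close>

text \<open>Provides the linear term of expansions in t_P. Subtracting the lowest term of
  \<open>x\<close> leaves a product whose lowest coefficient is known.\<close>

lemma fls_mult_second_coeff:
  fixes x y :: "'a::comm_ring_1 fls"
  assumes "\<forall>i<m. fls_nth x i = 0" "\<forall>i<n. fls_nth y i = 0"
  shows "fls_nth (x * y) (m + n + 1) = fls_nth x m * fls_nth y (n + 1) + fls_nth x (m + 1) * fls_nth y n"
proof -
  define x' where "x' = x - fls_mono (fls_nth x m) m"
  have x': "\<forall>i<m + 1. fls_nth x' i = 0" "fls_nth x' (m + 1) = fls_nth x (m + 1)"
    using assms(1) by (auto simp: x'_def fls_nth_mono)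
  have "x * y = y * fls_mono (fls_nth x m) m + x' * y" by (simp add: x'_def algebra_simps)
  moreover have "fls_nth (x' * y) (m + n + 1) = fls_nth x (m + 1) * fls_nth y n"
    using fls_mult_vanish_below(2)[OF x'(1) assms(2)] x'(2) by (simp add: algebra_simps)
  ultimately show ?thesis by (simp add: fls_nth_mult_mono algebra_simps)
qed

section \<open>The fraction field of the integral power series\<close>

context local_field
begin

abbreviation FF :: "'k fls set" where "FF \<equiv> frac_integral_fps v"

lemma FF_iff: "x \<in> FF \<longleftrightarrow> (\<exists>g h. x = fps_to_fls g / fps_to_fls h \<and> g \<in> fint 0 \<and> h \<in> fint 0 \<and> h \<noteq> 0)"
  by (auto simp: frac_integral_fps_def integral_fps_fint)

lemma FF_fps: "g \<in> fint 0 \<Longrightarrow> fps_to_fls g \<in> FF"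
  unfolding FF_iff by (intro exI[of _ g] exI[of _ 1]) simp

lemma FF_mult:
  assumes "x \<in> FF" "y \<in> FF" shows "x * y \<in> FF"
proof -
  obtain g h g' h' where *: "x = fps_to_fls g / fps_to_fls h" "g \<in> fint 0" "h \<in> fint 0" "h \<noteq> 0"
    "y = fps_to_fls g' / fps_to_fls h'" "g' \<in> fint 0" "h' \<in> fint 0" "h' \<noteq> 0"
    using assms unfolding FF_iff by blast
  then have "x * y = fps_to_fls (g * g') / fps_to_fls (h * h')" by (simp add: fls_times_fps_to_fls)
  then show ?thesis unfolding FF_iff using * fint_mult0 by (metis mult_eq_0_iff)
qed

lemma FF_add:
  assumes "x \<in> FF" "y \<in> FF" shows "x + y \<in> FF"
proof -
  obtain g h g' h' where *: "x = fps_to_fls g / fps_to_fls h" "g \<in> fint 0" "h \<in> fint 0" "h \<noteq> 0"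
    "y = fps_to_fls g' / fps_to_fls h'" "g' \<in> fint 0" "h' \<in> fint 0" "h' \<noteq> 0"
    using assms unfolding FF_iff by blast
  then have "x + y = fps_to_fls (g * h' + g' * h) / fps_to_fls (h * h')"
    by (simp add: fls_times_fps_to_fls fps_to_fls_plus add_frac_eq)
  moreover have "g * h' + g' * h \<in> fint 0" "h * h' \<in> fint 0" "h * h' \<noteq> 0"
    using * fint_mult0 fint_intros(4) by auto
  ultimately show ?thesis unfolding FF_iff by blast
qed

lemma FF_inverse: "x \<in> FF \<Longrightarrow> inverse x \<in> FF"
proof (cases "x = 0")
  case False
  assume "x \<in> FF"
  then obtain g h where *: "x = fps_to_fls g / fps_to_fls h" "g \<in> fint 0" "h \<in> fint 0" "h \<noteq> 0"
    unfolding FF_iff by blast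
  then have "inverse x = fps_to_fls h / fps_to_fls g" "g \<noteq> 0" using False by auto
  then show ?thesis unfolding FF_iff using * by blast
qed simp

lemma FF_const: "fls_const a \<in> FF"
proof (cases "a \<in> mp 0")
  case True
  then show ?thesis using FF_fps[of "fps_const a"] by (simp add: fint_const)
next
  case False
  then have "a \<noteq> 0" "inverse a \<in> mp 0" by (auto simp: mp_iff v_inverse)
  then have "inverse (fls_const (inverse a)) \<in> FF"
    using FF_inverse[OF FF_fps[OF fint_const[of "inverse a" 0]]] by simp
  then show ?thesis using \<open>a \<noteq> 0\<close> by (simp add: fls_inverse_const)
qed

lemma FF_X: "fls_X \<in> FF"
  using FF_fps[OF fint_X_power[of 1]] by simp

lemma poly_to_fls_pCons: "poly_to_fls (pCons a p) = fls_const a + fls_X * poly_to_fls p"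
  by (simp add: poly_to_fls_def fps_of_poly_pCons fps_to_fls_plus fls_times_fps_to_fls mult.commute)

lemma poly_to_fls_mult: "poly_to_fls (p * q) = poly_to_fls p * poly_to_fls q"
  by (simp add: poly_to_fls_def fps_of_poly_mult fls_times_fps_to_fls)

lemma FF_poly: "poly_to_fls p \<in> FF"
proof (induction p)
  case (pCons a p)
  then show ?case unfolding poly_to_fls_pCons by (intro FF_add FF_mult FF_const FF_X)
next
  case 0
  then show ?case using FF_const[of 0] by (simp add: poly_to_fls_def)
qed

end

section \<open>Orders and leading coefficients at an irreducible distinguished polynomial\<close>

locale embedding = local_field v res \<pi> \<psi> c
  for v :: "'k::field_char_0 \<Rightarrow> int" and res :: "'k \<Rightarrow> 'f::field" and \<pi> \<psi> c +
  fixes P :: "'k poly" and e :: "'k fls \<Rightarrow> 'k poly fls"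
  assumes P_irr: "irreducible_distinguished v P" and e_emb: "completion_embedding v P e"
begin

lemmas P_facts = irreducible_distinguished_irreducible[OF P_irr]

lemma e_residue: "x \<in> FF \<Longrightarrow> fls_nth (e x) n \<in> residue_polys P"
  and e_add: "x \<in> FF \<Longrightarrow> y \<in> FF \<Longrightarrow> e (x + y) = e x + e y"
  and e_mult: "x \<in> FF \<Longrightarrow> y \<in> FF \<Longrightarrow> fls_nth (e (x * y)) n = fls_nth (e x * e y) n mod P"
  and e_const: "e (fls_const a) = fls_const [:a:]"
  and e_P: "e (poly_to_fls P) = fls_X"
  and e_filtration: "x \<in> FF \<Longrightarrow>
    (\<exists>g\<in>localization_at v P. x = (poly_to_fls P) powi m * g) \<longleftrightarrow> (\<forall>i<m. fls_nth (e x) i = 0)"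
  and e_X: "fls_nth (e fls_X) 0 = [:0, 1:] mod P"
  using e_emb unfolding completion_embedding_def by auto

lemma e_mod: "x \<in> FF \<Longrightarrow> fls_nth (e x) n mod P = fls_nth (e x) n"
  by (rule mod_residue_polys[OF e_residue])

lemma one_mod_P: "1 mod P = 1"
  using P_facts(2) by (intro mod_poly_less) simp

lemma P_dvd_iff: "P dvd a \<longleftrightarrow> a mod P = 0"
  by (simp add: mod_eq_0_iff_dvd)

lemma P_prime: "P dvd a * b \<longleftrightarrow> P dvd a \<or> P dvd b"
  using field_poly_irreducible_imp_prime[OF P_facts(5)] by (rule prime_elem_dvd_mult_iff)

lemma P_inverse: "\<not> P dvd a \<Longrightarrow> \<exists>b. (a * b) mod P = 1"
  using irreducible_bezout[OF P_facts(5), of a] one_mod_P by simp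

text \<open>The denominator 1 is admissible in the localization: P does not divide 1, since its
  constant coefficient lies in the maximal ideal.\<close>

lemma e_fps:
  assumes "g \<in> fint 0" shows "\<forall>i<0. fls_nth (e (fps_to_fls g)) i = 0"
proof -
  have "\<not> (\<exists>k\<in>fint 0. 1 = fps_of_poly P * k)"
  proof
    assume "\<exists>k\<in>fint 0. 1 = fps_of_poly P * k"
    then obtain k where k: "k \<in> fint 0" "1 = fps_of_poly P * k" by blast
    have "1 = coeff P 0 * fps_nth k 0" using arg_cong[OF k(2), of "\<lambda>x. fps_nth x 0"] by simp
    moreover have "coeff P 0 \<in> mp 1" using P_facts(1,2) by (simp add: distinguished0_iff)
    ultimately have "1 \<in> mp 1" using mp_mult[of "coeff P 0" 1 "fps_nth k 0" 0] k(1) by (simp add: fint_def)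
    then show False by (simp add: mp_iff)
  qed
  then have "fps_to_fls g \<in> localization_at v P"
    unfolding localization_at_def integral_fps_fint using assms
    by (intro CollectI exI[of _ g] exI[of _ 1]) simp
  then show ?thesis using e_filtration[OF FF_fps[OF assms], of 0] by auto
qed

lemma e_zero: "e 0 = 0"
  using e_const[of 0] by simp

text \<open>\<open>n\<close> is the order at P and \<open>a\<close> the leading coefficient in
  K[t]/(P), represented by its remainder; nonvanishing there is nondivisibility by P.\<close>

definition elead :: "'k fls \<Rightarrow> int \<Rightarrow> 'k poly \<Rightarrow> bool" where
  "elead x n a \<longleftrightarrow> (\<forall>i<n. fls_nth (e x) i = 0) \<and> fls_nth (e x) n = a \<and> \<not> P dvd a"

lemma elead_nonzero: "elead x n a \<Longrightarrow> fls_nth (e x) n \<noteq> 0"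
  by (auto simp: elead_def)

lemma elead_unique:
  assumes "elead x m a" "elead x n b" shows "m = n \<and> a = b"
proof -
  have "\<not> m < n" "\<not> n < m" using assms elead_nonzero unfolding elead_def by metis+
  then have "m = n" by simp
  then show ?thesis using assms by (simp add: elead_def)
qed

lemma elead_mult:
  assumes xy: "x \<in> FF" "y \<in> FF" and x: "elead x m a" and y: "elead y n b"
  shows "elead (x * y) (m + n) ((a * b) mod P)"
proof -
  have "\<forall>i<m. fls_nth (e x) i = 0" "\<forall>i<n. fls_nth (e y) i = 0" using x y by (auto simp: elead_def)
  note van = fls_mult_vanish_below[OF this]
  have "\<not> P dvd (a * b) mod P" using x y P_prime[of a b] by (simp add: elead_def dvd_mod_iff)
  then show ?thesis
    using van x y by (simp add: elead_def e_mult[OF xy])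
qed

text \<open>A nonzero \<open>x\<close> has an inverse in the fraction field, so its image cannot be
  0.\<close>

lemma elead_exists:
  assumes x: "x \<in> FF" "x \<noteq> 0" shows "\<exists>n a. elead x n a"
proof -
  have "e x \<noteq> 0"
  proof
    assume "e x = 0"
    then have "fls_nth (e (x * inverse x)) 0 = 0" unfolding e_mult[OF x(1) FF_inverse[OF x(1)]] by simp
    moreover have "e (x * inverse x) = 1" using x(2) e_const[of 1] by (simp add: one_pCons[symmetric])
    ultimately show False by simp
  qed
  let ?n = "fls_subdegree (e x)"
  have "fls_nth (e x) ?n \<noteq> 0" using \<open>e x \<noteq> 0\<close> by simp
  then have "\<not> P dvd fls_nth (e x) ?n" using e_mod[OF x(1), of ?n] P_dvd_iff by simp
  then show ?thesis unfolding elead_def by (intro exI[of _ ?n]) auto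
qed

text \<open>The value of dt/dt_P at y_P; by \<open>pderiv_\<theta>\<close> it is the inverse of P'
  modulo P.\<close>

definition \<theta> :: "'k poly" where "\<theta> = fls_nth (e fls_X) 1"

text \<open>First-order Taylor expansion of A(t) in the parameter t_P, by induction along Horner's
  scheme; the product rule comes from \<open>fls_mult_second_coeff\<close>.\<close>

lemma e_poly:
  "(\<forall>i<0. fls_nth (e (poly_to_fls A)) i = 0) \<and> fls_nth (e (poly_to_fls A)) 0 = A mod P \<and>
   fls_nth (e (poly_to_fls A)) 1 = (pderiv A * \<theta>) mod P"
proof (induction A)
  case 0
  then show ?case by (simp add: poly_to_fls_def e_zero)
next
  case (pCons a A)
  have X: "\<forall>i<0. fls_nth (e fls_X) i = 0" using e_fps[OF fint_X_power[of 1]] by simp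
  have A: "\<forall>i<0. fls_nth (e (poly_to_fls A)) i = 0" using pCons by blast
  have eq: "e (poly_to_fls (pCons a A)) = fls_const [:a:] + e (fls_X * poly_to_fls A)"
    unfolding poly_to_fls_pCons e_add[OF FF_const FF_mult[OF FF_X FF_poly]] e_const ..
  note m = e_mult[OF FF_X FF_poly, of A]
  have "[:a:] mod P = [:a:]" using P_facts(2) by (intro mod_poly_less) simp
  moreover have "pCons a A = [:a:] + [:0, 1:] * A" by simp
  ultimately have "pCons a A mod P = [:a:] + ([:0, 1:] mod P * (A mod P)) mod P"
    by (metis mod_mult_eq poly_mod_add_left)
  then have c0: "fls_nth (e (poly_to_fls (pCons a A))) 0 = pCons a A mod P"
    using pCons fls_mult_vanish_below(2)[OF X A] unfolding eq by (simp add: m e_X)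
  have "(([:0, 1:] mod P) * ((pderiv A * \<theta>) mod P) + \<theta> * (A mod P)) mod P = ([:0, 1:] * (pderiv A * \<theta>) + \<theta> * A) mod P"
    unfolding poly_mod_add_left by (simp only: mod_mult_eq mod_mult_right_eq mod_mult_left_eq)
  also have "[:0, 1:] * (pderiv A * \<theta>) + \<theta> * A = pderiv (pCons a A) * \<theta>"
    by (simp add: pderiv_pCons algebra_simps)
  finally have "fls_nth (e (poly_to_fls (pCons a A))) 1 = (pderiv (pCons a A) * \<theta>) mod P"
    using pCons fls_mult_second_coeff[OF X A] unfolding eq by (simp add: m e_X \<theta>_def)
  then show ?case using c0 fls_mult_vanish_below(1)[OF X A] unfolding eq by (simp add: m)
qed

text \<open>The image of P is t_P itself, whose linear coefficient is 1.\<close>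

lemma pderiv_\<theta>: "(pderiv P * \<theta>) mod P = 1"
  using e_poly[of P] e_P by simp

lemma \<theta>_unit: "\<not> P dvd \<theta>"
  using pderiv_\<theta> by (metis P_dvd_iff dvd_mult one_neq_zero)

lemma elead_poly: "\<not> P dvd A \<Longrightarrow> elead (poly_to_fls A) 0 (A mod P)"
  using e_poly[of A] by (simp add: elead_def dvd_mod_iff)

lemma elead_P: "elead (poly_to_fls P) 1 1"
  using P_facts(2) P_facts(5) irreducible_not_unit by (auto simp: elead_def e_P)

lemma elead_const: "a \<noteq> 0 \<Longrightarrow> elead (fls_const a) 0 [:a:]"
proof -
  assume a: "a \<noteq> 0"
  have "\<not> P dvd [:a:]"
  proof
    assume "P dvd [:a:]"
    from dvd_imp_degree_le[OF this] show False using a P_facts(2) by simp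
  qed
  then show ?thesis by (simp add: elead_def e_const)
qed

lemma elead_unit:
  assumes u: "u \<in> fint 0" "u' \<in> fint 0" "u * u' = 1"
  shows "elead (fps_to_fls u) 0 (fls_nth (e (fps_to_fls u)) 0)"
proof -
  have "fps_to_fls u * fps_to_fls u' = 1" using u(3) by (simp add: fls_times_fps_to_fls[symmetric])
  then have "fls_nth (e 1) 0 = (fls_nth (e (fps_to_fls u)) 0 * fls_nth (e (fps_to_fls u')) 0) mod P"
    using e_mult[OF FF_fps[OF u(1)] FF_fps[OF u(2)], of 0]
      fls_mult_vanish_below(2)[OF e_fps[OF u(1)] e_fps[OF u(2)]] by simp
  moreover have "e 1 = 1" using e_const[of 1] by (simp add: one_pCons[symmetric])
  ultimately have "(fls_nth (e (fps_to_fls u)) 0 * fls_nth (e (fps_to_fls u')) 0) mod P = 1" by simp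
  then have "\<not> P dvd fls_nth (e (fps_to_fls u)) 0" by (metis P_dvd_iff dvd_mult2 one_neq_zero)
  then show ?thesis using e_fps[OF u(1)] by (simp add: elead_def)
qed

lemma e_remainder:
  assumes u: "u = fps_of_poly R * q + fps_of_poly r" and q: "q \<in> fint 0" and R: "P dvd R"
  shows "fls_nth (e (fps_to_fls u)) 0 = r mod P"
proof -
  have "fps_to_fls u = poly_to_fls R * fps_to_fls q + poly_to_fls r"
    unfolding u by (simp add: poly_to_fls_def fps_to_fls_plus fls_times_fps_to_fls)
  then have "e (fps_to_fls u) = e (poly_to_fls R * fps_to_fls q) + e (poly_to_fls r)"
    using e_add[OF FF_mult[OF FF_poly FF_fps[OF q]] FF_poly] by simp
  moreover have "fls_nth (e (poly_to_fls R * fps_to_fls q)) 0 = 0"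
    using e_mult[OF FF_poly FF_fps[OF q], of R 0] fls_mult_vanish_below(2)[OF _ e_fps[OF q], of 0 "e (poly_to_fls R)"]
      e_poly[of R] R by simp
  ultimately show ?thesis using e_poly[of r] by simp
qed

text \<open>The differential is e(f) (dt/dt_P) dt_P, with leading coefficient a \<theta> = a / P'
  modulo P. Multiplication by P', the factor that Euler's formula for the trace supplies, returns
  \<open>a\<close>.\<close>

lemma expansion_elead:
  assumes ex: "\<forall>j. fls_nth (e f * fls_deriv (e fls_X)) j mod P = (if j < n then 0 else c0 (nat (j - n)))"
    and c0: "c0 0 \<noteq> 0" and f: "elead f k a" "f \<in> FF"
  shows "n = k" and "(c0 0 * pderiv P) mod P = a"
proof -
  have X: "\<forall>i<0. fls_nth (e fls_X) i = 0" using e_fps[OF fint_X_power[of 1]] by simp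
  have d: "\<forall>i<0. fls_nth (fls_deriv (e fls_X)) i = 0"
  proof (intro allI impI)
    fix i :: int assume "i < 0"
    then have "i = -1 \<or> i + 1 < 0" by auto
    then show "fls_nth (fls_deriv (e fls_X)) i = 0" using X by auto
  qed
  have d0: "fls_nth (fls_deriv (e fls_X)) 0 = \<theta>" by (simp add: \<theta>_def)
  have fk: "\<forall>i<k. fls_nth (e f) i = 0" "fls_nth (e f) k = a" "\<not> P dvd a" using f by (auto simp: elead_def)
  note van = fls_mult_vanish_below[OF fk(1) d]
  have lead: "fls_nth (e f * fls_deriv (e fls_X)) k mod P = (a * \<theta>) mod P"
    using van(2) fk(2) d0 by simp
  have nz: "(a * \<theta>) mod P \<noteq> 0" using fk(3) \<theta>_unit P_prime[of a \<theta>] by (simp add: mod_eq_0_iff_dvd)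
  have "\<not> k < n" using ex[rule_format, of k] lead nz by auto
  moreover have "\<not> n < k"
  proof
    assume "n < k"
    then have "fls_nth (e f * fls_deriv (e fls_X)) n = 0" using van(1) by simp
    then show False using ex[rule_format, of n] c0 by simp
  qed
  ultimately show "n = k" by simp
  then have "c0 0 = (a * \<theta>) mod P" using ex[rule_format, of k] lead by simp
  then have "(c0 0 * pderiv P) mod P = (a * \<theta> * pderiv P) mod P" by (simp only: mod_mult_left_eq)
  also have "\<dots> = (a * ((pderiv P * \<theta>) mod P)) mod P" by (simp only: mod_mult_right_eq mult_ac)
  also have "\<dots> = a mod P" by (simp add: pderiv_\<theta>)
  also have "\<dots> = a" using fk(2) e_mod[OF f(2)] by metis
  finally show "(c0 0 * pderiv P) mod P = a" .
qed

end

context local_field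
begin

text \<open>Modulo squares, \<open>f\<close> is \<open>\<pi>\<^sup>m R u\<close> with \<open>R\<close> squarefree and \<open>u\<close> a unit.\<close>

lemma expansion_mod_squares:
  assumes P: "irreducible_distinguished v P" and ex: "has_expansion_at v P f n c0"
    and f: "f \<in> FF" "f \<noteq> 0" and gh: "G \<in> FF" "G \<noteq> 0" "H \<in> FF" "H \<noteq> 0"
    and eq: "f * (H * H) = (G * G) * (fls_const (\<pi> powi m) * (poly_to_fls R * fps_to_fls u))"
    and u: "u \<in> fint 0" "u' \<in> fint 0" "u * u' = 1"
  shows "\<not> P dvd R \<Longrightarrow> even n"
    and "\<lbrakk>R = P * R'; \<not> P dvd R'; u = fps_of_poly R * q + fps_of_poly r; q \<in> fint 0\<rbrakk> \<Longrightarrow>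
      odd n \<and> (\<exists>w w'. (w * w') mod P = 1 \<and>
        (c0 0 * pderiv P) mod P = (smult (\<pi> powi m) (R' * r) * (w * w)) mod P) \<and> \<not> P dvd r"
proof -
  obtain e where e: "completion_embedding v P e" and c0: "c0 0 \<noteq> 0"
    and exp: "\<forall>j. fls_nth (e f * fls_deriv (e fls_X)) j mod P = (if j < n then 0 else c0 (nat (j - n)))"
    using ex unfolding has_expansion_at_def by blast
  interpret embedding v res \<pi> \<psi> c P e by unfold_locales (rule P, rule e)
  obtain k a where a: "elead f k a" using elead_exists[OF f] by blast
  obtain kg g where g: "elead G kg g" using elead_exists[OF gh(1,2)] by blast
  obtain kh h where h: "elead H kh h" using elead_exists[OF gh(3,4)] by blast
  note nk = expansion_elead[OF exp c0 a f(1)]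
  define u0 where "u0 = fls_nth (e (fps_to_fls u)) 0"
  have uu: "elead (fps_to_fls u) 0 u0" unfolding u0_def by (rule elead_unit[OF u])
  have pc: "elead (fls_const (\<pi> powi m)) 0 [:\<pi> powi m:]" using \<pi>_nonzero by (intro elead_const) simp
  have L: "elead (f * (H * H)) (k + (kh + kh)) ((a * ((h * h) mod P)) mod P)"
    by (intro elead_mult f gh FF_mult a h)
  \<comment> \<open>Orders and leading coefficients of the two sides of \<open>eq\<close>; the
    squares contribute even orders and square factors.\<close>
  have key: "k + (kh + kh) = kg + kg + l \<and> (a * (h * h)) mod P = ((g * g) * ([:\<pi> powi m:] * (y * u0))) mod P"
    if "elead (poly_to_fls R) l y" for l y
  proof -
    have "elead ((G * G) * (fls_const (\<pi> powi m) * (poly_to_fls R * fps_to_fls u))) (kg + kg + (0 + (l + 0)))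
      ((((g * g) mod P) * (([:\<pi> powi m:] * ((y * u0) mod P)) mod P)) mod P)"
      by (intro elead_mult f gh FF_mult FF_const FF_poly FF_fps u g pc that uu)
    from elead_unique[OF L[unfolded eq] this] show ?thesis by (simp only: mod_mult_eq mod_mult_right_eq mod_mult_left_eq add_0 add_0_right)
  qed
  show "even n" if "\<not> P dvd R"
  proof -
    have "k + (kh + kh) = kg + kg + 0" using key[OF elead_poly[OF that]] by blast
    then show ?thesis using nk(1) by presburger
  qed
  show "odd n \<and> (\<exists>w w'. (w * w') mod P = 1 \<and>
        (c0 0 * pderiv P) mod P = (smult (\<pi> powi m) (R' * r) * (w * w)) mod P) \<and> \<not> P dvd r"
    if R: "R = P * R'" "\<not> P dvd R'" and q: "u = fps_of_poly R * q + fps_of_poly r" "q \<in> fint 0"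
  proof -
    have eR: "elead (poly_to_fls R) (1 + 0) ((1 * (R' mod P)) mod P)"
      unfolding R(1) poly_to_fls_mult by (intro elead_mult FF_poly elead_P elead_poly R(2))
    have u0: "u0 = r mod P" unfolding u0_def by (rule e_remainder[OF q]) (simp add: R(1))
    have "k + (kh + kh) = kg + kg + 1" using key[OF eR] by simp
    then have odd: "odd n" using nk(1) by presburger
    have ngh: "\<not> P dvd g" "\<not> P dvd h" using g h by (auto simp: elead_def)
    obtain g' where g': "(g * g') mod P = 1" using P_inverse[OF ngh(1)] by blast
    obtain h' where h': "(h * h') mod P = 1" using P_inverse[OF ngh(2)] by blast
    have "(a * (h * h)) mod P = ((g * g) * ([:\<pi> powi m:] * (((1 * (R' mod P)) mod P) * (r mod P)))) mod P"
      using key[OF eR] u0 by blast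
    also have "\<dots> = ((g * g) * ([:\<pi> powi m:] * (R' * r))) mod P"
      by (intro mod_mult_cong refl) (simp_all only: mult_1_left mod_mod_trivial)
    finally have A: "(a * (h * h)) mod P = (g * g * ([:\<pi> powi m:] * (R' * r))) mod P" .
    \<comment> \<open>Division by the square of \<open>h\<close> through its inverse
      \<open>h'\<close> modulo P; the witness for \<open>w\<close> is then \<open>g * h'\<close>,
      with inverse \<open>g' * h\<close>.\<close>
    have "a mod P = (a * ((h * h') mod P * ((h * h') mod P))) mod P" by (simp add: h')
    also have "\<dots> = (a * ((h * h') * (h * h'))) mod P" by (intro mod_mult_cong refl) (simp_all add: mod_mult_eq)
    also have "\<dots> = ((a * (h * h)) * (h' * h')) mod P" by (simp only: mult_ac)
    also have "\<dots> = ((g * g * ([:\<pi> powi m:] * (R' * r))) * (h' * h')) mod P"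
      by (rule mod_mult_cong[OF A refl])
    also have "(g * g * ([:\<pi> powi m:] * (R' * r))) * (h' * h') = smult (\<pi> powi m) (R' * r) * ((g * h') * (g * h'))"
      by (simp add: mult_ac)
    finally have fin: "a mod P = (smult (\<pi> powi m) (R' * r) * ((g * h') * (g * h'))) mod P" .
    have "(g * h' * (g' * h)) mod P = ((g * g') * (h * h')) mod P" by (simp only: mult_ac)
    also have "\<dots> = ((g * g') mod P * ((h * h') mod P)) mod P" by (simp only: mod_mult_eq)
    also have "\<dots> = 1" by (simp add: g' h' one_mod_P)
    finally have w: "(g * h' * (g' * h)) mod P = 1" .
    have "a mod P = a" using a e_mod[OF f(1)] unfolding elead_def by metis
    then have "(c0 0 * pderiv P) mod P = (smult (\<pi> powi m) (R' * r) * ((g * h') * (g * h'))) mod P"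
      using nk(2) fin by simp
    moreover have "\<not> P dvd r" using uu u0 by (simp add: elead_def dvd_mod_iff)
    ultimately show ?thesis using odd w by blast
  qed
qed

end

section \<open>Gauss sums and the Chinese remainder theorem\<close>

lemma mod_eq_iff_dvd: "x mod P = y mod P \<longleftrightarrow> P dvd x - y" for P x y :: "'k::field poly"
  by (rule mod_eq_dvd_iff)

lemma add_subgroup_sum: "add_subgroup L \<Longrightarrow> (\<And>i. i \<in> I \<Longrightarrow> f i \<in> L) \<Longrightarrow> sum f I \<in> L"
  by (induction I rule: infinite_finite_induct) (auto simp: add_subgroup_zero add_subgroup_add)

lemma coeff_mult_bounds:
  fixes p q :: "'k::comm_ring_1 poly"
  assumes "degree p \<le> m" "degree q \<le> n"
  shows "coeff (p * q) (m + n) = coeff p m * coeff q n"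
proof -
  have "coeff (p * q) (m + n) = (\<Sum>i\<le>m + n. coeff p i * coeff q (m + n - i))" by (rule coeff_mult)
  also have "\<dots> = (\<Sum>i\<le>m + n. if i = m then coeff p m * coeff q n else 0)"
  proof (rule sum.cong[OF refl])
    fix i
    show "coeff p i * coeff q (m + n - i) = (if i = m then coeff p m * coeff q n else 0)"
    proof (cases "i > m")
      case True then show ?thesis using assms by (simp add: coeff_eq_0)
    next
      case False
      then show ?thesis using assms by (cases "i = m") (auto simp: coeff_eq_0)
    qed
  qed
  also have "\<dots> = coeff p m * coeff q n" by simp
  finally show ?thesis .
qed

text \<open>The remainder of C x modulo P C is C times the remainder of x modulo P, and the monic
  factor C moves the top coefficient without changing it. So multiplication by the cofactor embeds
  K[t]/(P) compatibly with the functionals.\<close>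

lemma top_coeff_cofactor:
  fixes P C x :: "'k::field poly"
  assumes P: "lead_coeff P = 1" "degree P \<ge> 1" and C: "lead_coeff C = 1"
  shows "top_coeff (P * C) (C * x) = top_coeff P x"
proof -
  have "P \<noteq> 0" using P by auto
  then have "degree (x mod P) \<le> degree P - 1"
    using P(2) degree_mod_less[of P x] by (cases "x mod P = 0") (simp, linarith)
  then have "coeff (C * (x mod P)) (degree C + (degree P - 1)) = coeff (x mod P) (degree P - 1)"
    using coeff_mult_bounds[of C "degree C" "x mod P" "degree P - 1"] C by simp
  moreover have "degree (P * C) - 1 = degree C + (degree P - 1)"
    using P C degree_mult_eq[of P C] by force
  moreover have "(C * x) mod (P * C) = C * (x mod P)" by (simp add: mult.commute[of P C] mod_mult_mult1)
  ultimately show ?thesis by (simp add: top_coeff_def)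
qed

lemma (in local_field) \<psi>_sum: "finite I \<Longrightarrow> \<psi> (sum f I) = (\<Prod>i\<in>I. \<psi> (f i))"
  by (induction I rule: finite_induct) (auto simp: \<psi>_add)

text \<open>\<open>w\<close> is the coefficient of the form on K[t]/(R), and \<open>z P\<close> a
  free rescaling of the P-component, which takes up the squares by which the local form differs from
  the restriction of the global one. The primed data are inverses.\<close>

locale residue_product = local_field v res \<pi> \<psi> c
  for v :: "'k::field_char_0 \<Rightarrow> int" and res :: "'k \<Rightarrow> 'f::field" and \<pi> \<psi> c +
  fixes \<P> :: "'k poly set" and z z' :: "'k poly \<Rightarrow> 'k poly" and w w' :: "'k poly"
  assumes finite_primes: "finite \<P>" and nonempty: "\<P> \<noteq> {}"
    and primes: "P \<in> \<P> \<Longrightarrow> lead_coeff P = 1" "P \<in> \<P> \<Longrightarrow> irreducible P" "P \<in> \<P> \<Longrightarrow> P \<in> pint 0"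
    and z_inverse: "P \<in> \<P> \<Longrightarrow> (z P * z' P) mod P = 1"
    and w_inverse: "P \<in> \<P> \<Longrightarrow> (w * w') mod P = 1"
begin

definition R :: "'k poly" where "R = \<Prod>\<P>"
definition C :: "'k poly \<Rightarrow> 'k poly" where "C P = \<Prod>(\<P> - {P})"

lemma degree_primes: "P \<in> \<P> \<Longrightarrow> degree P \<ge> 1"
  by (rule irreducible_degree_pos[OF primes(2)])

lemma prime_dvd_mult: "P \<in> \<P> \<Longrightarrow> P dvd a * b \<longleftrightarrow> P dvd a \<or> P dvd b"
  using field_poly_irreducible_imp_prime[OF primes(2)] by (rule prime_elem_dvd_mult_iff)

lemma R_eq: "P \<in> \<P> \<Longrightarrow> R = P * C P"
  unfolding R_def C_def by (rule prod.remove[OF finite_primes])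

lemma prod_primes: "S \<subseteq> \<P> \<Longrightarrow> lead_coeff (\<Prod>S) = 1 \<and> \<Prod>S \<in> pint 0"
proof (induction S rule: infinite_finite_induct)
  case (insert P S)
  then show ?case using primes pint_mult[of P 0 "\<Prod>S" 0] by (simp add: lead_coeff_mult)
next
  case empty then show ?case using pint_monom[of 1 0 0] by (simp add: monom_0 one_pCons)
qed (use finite_primes finite_subset in blast)

lemma C_monic: "lead_coeff (C P) = 1" "C P \<in> pint 0"
  using prod_primes[of "\<P> - {P}"] by (auto simp: C_def)

lemma degree_C: "P \<in> \<P> \<Longrightarrow> degree R = degree P + degree (C P)"
  using R_eq[of P] primes(1)[of P] C_monic(1)[of P] by (metis degree_mult_eq leading_coeff_0_iff one_neq_zero)

lemma degree_R: "degree R \<ge> 1"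
proof -
  obtain P where "P \<in> \<P>" using nonempty by blast
  then show ?thesis using degree_C degree_primes by force
qed

lemma dvd_C: "P \<in> \<P> \<Longrightarrow> Q \<in> \<P> \<Longrightarrow> P \<noteq> Q \<Longrightarrow> P dvd C Q"
  unfolding C_def using finite_primes by (intro dvd_prodI) auto

lemma not_dvd_prod: "S \<subseteq> \<P> \<Longrightarrow> P \<in> \<P> \<Longrightarrow> P \<notin> S \<Longrightarrow> \<not> P dvd \<Prod>S"
proof (induction S rule: infinite_finite_induct)
  case (insert Q S)
  have "\<not> P dvd Q" using monic_dvd_eq[of P Q] primes insert.prems by auto
  then show ?case using insert prime_dvd_mult[of P Q "\<Prod>S"] by simp
next
  case empty
  then show ?case using primes(2)[of P] irreducible_not_unit by auto
qed (use finite_primes finite_subset in blast)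

lemma not_dvd_C: "P \<in> \<P> \<Longrightarrow> \<not> P dvd C P"
  unfolding C_def by (rule not_dvd_prod) auto

lemma dvd_R: assumes "\<And>P. P \<in> \<P> \<Longrightarrow> P dvd x" shows "R dvd x"
proof -
  have "S \<subseteq> \<P> \<Longrightarrow> \<Prod>S dvd x" for S
  proof (induction S rule: infinite_finite_induct)
    case (insert P S)
    then obtain k where k: "x = \<Prod>S * k" by auto
    have "P dvd \<Prod>S * k" using assms[of P] insert.prems k by simp
    then have "P dvd k" using prime_dvd_mult[of P] not_dvd_prod[of S P] insert.prems insert.hyps by blast
    then show ?case using insert.hyps by (simp add: k mult.commute mult_dvd_mono)
  qed (use finite_primes finite_subset in auto)
  then show ?thesis unfolding R_def by blast
qed

definition C' :: "'k poly \<Rightarrow> 'k poly" where "C' P = (SOME b. (C P * b) mod P = 1)"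

lemma one_mod: "P \<in> \<P> \<Longrightarrow> 1 mod P = 1"
  using degree_primes[of P] by (intro mod_poly_less) simp

lemma C_inverse: "P \<in> \<P> \<Longrightarrow> (C P * C' P) mod P = 1"
  unfolding C'_def using irreducible_bezout[OF primes(2) not_dvd_C] one_mod by (metis (mono_tags, lifting) someI_ex)

text \<open>The Chinese remainder isomorphism with cofactors instead of idempotents. Mixed products
  \<open>C P * C Q\<close> are divisible by \<open>R\<close>, and of the square of
  \<open>C P\<close> one factor is removed by \<open>top_coeff_cofactor\<close>; the other stays in
  \<open>hP\<close>.\<close>

definition \<Phi> :: "('k poly \<Rightarrow> 'k poly) \<Rightarrow> 'k poly" where
  "\<Phi> y = (\<Sum>P\<in>\<P>. ((z P * y P) mod P) * C P)"

definition \<Psi> :: "'k poly \<Rightarrow> 'k poly \<Rightarrow> 'k poly" where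
  "\<Psi> x P = (z' P * C' P * x) mod P"

lemma \<Phi>_mod: assumes P: "P \<in> \<P>" shows "P dvd \<Phi> y - ((z P * y P) mod P) * C P"
proof -
  have "\<Phi> y - ((z P * y P) mod P) * C P = (\<Sum>Q\<in>\<P> - {P}. ((z Q * y Q) mod Q) * C Q)"
    unfolding \<Phi>_def using sum.remove[OF finite_primes P, of "\<lambda>Q. ((z Q * y Q) mod Q) * C Q"] by simp
  also have "P dvd \<dots>" using dvd_C[OF P] by (intro dvd_sum dvd_mult) auto
  finally show ?thesis .
qed

lemma \<Phi>_mod': assumes P: "P \<in> \<P>" shows "\<Phi> y mod P = (z P * y P * C P) mod P"
  using \<Phi>_mod[OF P, of y] unfolding mod_eq_iff_dvd[symmetric] by (simp add: mod_mult_left_eq)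

lemma \<Phi>_residue: "\<Phi> y \<in> residue_polys R"
  unfolding \<Phi>_def
proof (rule add_subgroup_sum[OF residue_polys_group[OF degree_R]])
  fix P assume P: "P \<in> \<P>"
  have "degree ((z P * y P) mod P * C P) < degree R"
  proof (cases "(z P * y P) mod P = 0")
    case False
    then have "degree ((z P * y P) mod P) < degree P" using degree_primes[OF P] degree_mod_less[of P "z P * y P"] by fastforce
    then show ?thesis using degree_C[OF P] degree_mult_le[of "(z P * y P) mod P" "C P"] by linarith
  qed (use degree_R in simp)
  then show "(z P * y P) mod P * C P \<in> residue_polys R" by (simp add: residue_polys_def)
qed

lemma \<Psi>_add: "\<Psi> (x + y) P = \<Psi> x P + \<Psi> y P" and \<Psi>_diff: "\<Psi> (x - y) P = \<Psi> x P - \<Psi> y P"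
  by (simp_all add: \<Psi>_def algebra_simps poly_mod_add_left poly_mod_diff_left)

lemma \<Psi>_\<Phi>: assumes P: "P \<in> \<P>" and y: "y P \<in> residue_polys P" shows "\<Psi> (\<Phi> y) P = y P"
proof -
  have "\<Psi> (\<Phi> y) P = (z' P * C' P * (z P * y P * C P)) mod P"
    unfolding \<Psi>_def using \<Phi>_mod'[OF P, of y] by (metis mod_mult_right_eq)
  also have "z' P * C' P * (z P * y P * C P) = (z P * z' P) * (C P * C' P) * y P" by (simp add: mult_ac)
  also have "\<dots> mod P = ((z P * z' P) mod P * ((C P * C' P) mod P) * y P) mod P"
    by (metis mod_mult_eq mod_mult_left_eq)
  also have "\<dots> = y P mod P" by (simp add: z_inverse[OF P] C_inverse[OF P])
  finally show ?thesis using mod_residue_polys[OF y] by simp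
qed

lemma residue_polys_eqI:
  assumes "x \<in> residue_polys R" "y \<in> residue_polys R" "\<And>P. P \<in> \<P> \<Longrightarrow> P dvd x - y"
  shows "x = y"
proof -
  have "x mod R = y mod R" using dvd_R[of "x - y"] assms(3) mod_eq_iff_dvd by blast
  then show ?thesis using assms mod_residue_polys by metis
qed

lemma \<Phi>_\<Psi>: assumes x: "x \<in> residue_polys R" shows "\<Phi> (\<Psi> x) = x"
proof (rule residue_polys_eqI[OF \<Phi>_residue x])
  fix P assume P: "P \<in> \<P>"
  have "\<Phi> (\<Psi> x) mod P = (z P * C P * ((z' P * C' P * x) mod P)) mod P"
    using \<Phi>_mod'[OF P, of "\<Psi> x"] by (simp add: \<Psi>_def mult_ac)
  also have "\<dots> = ((z P * z' P) * (C P * C' P) * x) mod P" unfolding mod_mult_right_eq by (simp only: mult_ac)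
  also have "\<dots> = ((z P * z' P) mod P * ((C P * C' P) mod P) * x) mod P"
    by (metis mod_mult_eq mod_mult_left_eq)
  finally show "P dvd \<Phi> (\<Psi> x) - x" by (simp add: z_inverse[OF P] C_inverse[OF P] mod_eq_iff_dvd)
qed

text \<open>The lattices of K[t]/(R) that are products of lattices of the factors; by
  \<open>E_lattice\<close> they agree with the \<open>rlattice R\<close> up to a bounded
  shift.\<close>

definition E :: "int \<Rightarrow> 'k poly set" where
  "E n = {x \<in> residue_polys R. \<forall>P\<in>\<P>. \<Psi> x P \<in> rlattice P n}"

lemma \<Psi>_zero: "\<Psi> 0 P = 0"
  by (simp add: \<Psi>_def)

lemma E_group: "add_subgroup (E n)"
  unfolding add_subgroup_def E_def
  using add_subgroup_intros[OF residue_polys_group[OF degree_R]] add_subgroup_intros[OF rlattice_group[OF degree_primes]]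
  by (auto simp: \<Psi>_zero \<Psi>_diff)

lemma uniform_pint: "\<exists>k. \<forall>P\<in>\<P>. g P \<in> pint k"
proof -
  have "\<exists>k. \<forall>P\<in>S. g P \<in> pint k" if "finite S" for S
    using that
  proof induction
    case (insert P S)
    obtain k l where "\<forall>P\<in>S. g P \<in> pint k" "g P \<in> pint l" using insert pint_exists by metis
    then show ?case using pint_antimono[of "min k l" k] pint_antimono[of "min k l" l]
      by (intro exI[of _ "min k l"]) auto
  qed simp
  then show ?thesis using finite_primes by blast
qed

lemma E_lattice: "\<exists>s. \<forall>n. rlattice R n \<subseteq> E (n + s) \<and> E n \<subseteq> rlattice R (n + s)"
proof -
  obtain k where k: "\<forall>P\<in>\<P>. z P \<in> pint k" using uniform_pint by blast
  obtain l where l: "\<forall>P\<in>\<P>. z' P * C' P \<in> pint l" using uniform_pint[of "\<lambda>P. z' P * C' P"] by blast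
  let ?s = "min k l"
  have "rlattice R n \<subseteq> E (n + ?s)" for n
  proof
    fix x assume x: "x \<in> rlattice R n"
    have "\<Psi> x P \<in> rlattice P (n + ?s)" if P: "P \<in> \<P>" for P
    proof -
      have "z' P * C' P * x \<in> pint (l + n)" using x l P by (intro pint_mult) (auto simp: rlattice_def)
      then have "\<Psi> x P \<in> pint (l + n)" unfolding \<Psi>_def by (rule pint_mod[OF primes(1,3)[OF P]])
      then have "\<Psi> x P \<in> pint (n + ?s)" using pint_antimono[of "n + ?s" "l + n"] by auto
      then show ?thesis unfolding rlattice_def \<Psi>_def using residue_polys_mod[OF degree_primes[OF P]] by blast
    qed
    then show "x \<in> E (n + ?s)" using x by (simp add: E_def rlattice_def)
  qed
  moreover have "E n \<subseteq> rlattice R (n + ?s)" for n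
  proof
    fix x assume x: "x \<in> E n"
    have "((z P * \<Psi> x P) mod P) * C P \<in> pint (n + ?s)" if P: "P \<in> \<P>" for P
    proof -
      have "z P * \<Psi> x P \<in> pint (k + n)" using x k P by (intro pint_mult) (auto simp: E_def rlattice_def)
      then have "(z P * \<Psi> x P) mod P \<in> pint (k + n)" by (rule pint_mod[OF primes(1,3)[OF P]])
      then have "((z P * \<Psi> x P) mod P) * C P \<in> pint (k + n + 0)" by (rule pint_mult[OF _ C_monic(2)])
      then show ?thesis using pint_antimono[of "n + ?s" "k + n"] by auto
    qed
    then have "\<Phi> (\<Psi> x) \<in> pint (n + ?s)" unfolding \<Phi>_def by (intro add_subgroup_sum[OF pint_group])
    then show "x \<in> rlattice R (n + ?s)" using x \<Phi>_\<Psi>[of x] by (simp add: E_def rlattice_def)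
  qed
  ultimately show ?thesis by blast
qed

definition H :: "'k poly \<Rightarrow> complex" where "H x = \<psi> (top_coeff R (smult (1 / 2) (w * x\<^sup>2)))"

definition hP :: "'k poly \<Rightarrow> 'k poly \<Rightarrow> complex" where
  "hP P x = \<psi> (top_coeff P (smult (1 / 2) (w * C P * (z P * z P) * x\<^sup>2)))"

text \<open>Modulo P only the P-summand of \<open>\<Phi> y\<close> survives, so modulo
  \<open>R\<close> its square is the sum of the squares of the summands, and the character turns
  this sum into a product.\<close>

lemma H_\<Phi>: "H (\<Phi> y) = (\<Prod>P\<in>\<P>. hP P (y P))"
proof -
  define b where "b P = (z P * y P) mod P" for P
  have "R dvd (\<Phi> y)\<^sup>2 - (\<Sum>P\<in>\<P>. (b P * C P)\<^sup>2)"
  proof (rule dvd_R)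
    fix P assume P: "P \<in> \<P>"
    have "(\<Phi> y)\<^sup>2 - (\<Sum>Q\<in>\<P>. (b Q * C Q)\<^sup>2) =
      (\<Phi> y - b P * C P) * (\<Phi> y + b P * C P) - (\<Sum>Q\<in>\<P> - {P}. (b Q * C Q)\<^sup>2)"
      using sum.remove[OF finite_primes P, of "\<lambda>Q. (b Q * C Q)\<^sup>2"] by (simp add: algebra_simps power2_eq_square)
    moreover have "P dvd (\<Sum>Q\<in>\<P> - {P}. (b Q * C Q)\<^sup>2)"
      using dvd_C[OF P] by (intro dvd_sum) (auto simp: power2_eq_square)
    ultimately show "P dvd (\<Phi> y)\<^sup>2 - (\<Sum>Q\<in>\<P>. (b Q * C Q)\<^sup>2)"
      using \<Phi>_mod[OF P, of y] by (simp add: b_def)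
  qed
  then have "R dvd smult (1 / 2) w * ((\<Phi> y)\<^sup>2 - (\<Sum>P\<in>\<P>. (b P * C P)\<^sup>2))" by (rule dvd_mult)
  also have "\<dots> = smult (1 / 2) (w * (\<Phi> y)\<^sup>2) - (\<Sum>P\<in>\<P>. smult (1 / 2) (w * (b P * C P)\<^sup>2))"
    by (simp add: right_diff_distrib sum_distrib_left)
  finally have "top_coeff R (smult (1 / 2) (w * (\<Phi> y)\<^sup>2)) =
      top_coeff R (\<Sum>P\<in>\<P>. smult (1 / 2) (w * (b P * C P)\<^sup>2))"
    by (intro top_coeff_cong) (simp only: mod_eq_iff_dvd)
  also have "\<dots> = (\<Sum>P\<in>\<P>. top_coeff P (smult (1 / 2) (w * C P * (z P * z P) * (y P)\<^sup>2)))"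
    unfolding top_coeff_sum
  proof (rule sum.cong[OF refl])
    fix P assume P: "P \<in> \<P>"
    have "top_coeff R (smult (1 / 2) (w * (b P * C P)\<^sup>2)) = top_coeff (P * C P) (C P * smult (1 / 2) (w * C P * (b P)\<^sup>2))"
      unfolding R_eq[OF P] by (simp add: power2_eq_square mult_ac)
    also have "\<dots> = top_coeff P (smult (1 / 2) (w * C P * (b P)\<^sup>2))"
      by (rule top_coeff_cofactor[OF primes(1)[OF P] degree_primes[OF P] C_monic(1)])
    also have "\<dots> = 1 / 2 * top_coeff P (w * C P * (b P)\<^sup>2)" by (rule top_coeff_smult)
    also have "top_coeff P (w * C P * (b P)\<^sup>2) = top_coeff P (w * C P * (z P * z P) * (y P)\<^sup>2)"
    proof (rule top_coeff_cong)
      have "(w * C P * (b P)\<^sup>2) mod P = (w * C P * ((z P * y P) mod P * ((z P * y P) mod P))) mod P"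
        by (simp add: b_def power2_eq_square)
      also have "\<dots> = (w * C P * (z P * y P * (z P * y P))) mod P" by (metis mod_mult_eq mod_mult_right_eq)
      finally show "(w * C P * (b P)\<^sup>2) mod P = (w * C P * (z P * z P) * (y P)\<^sup>2) mod P"
        by (simp add: power2_eq_square mult_ac)
    qed
    finally show "top_coeff R (smult (1 / 2) (w * (b P * C P)\<^sup>2)) =
        top_coeff P (smult (1 / 2) (w * C P * (z P * z P) * (y P)\<^sup>2))"
      by (simp only: top_coeff_smult)
  qed
  finally show ?thesis unfolding H_def hP_def using finite_primes by (simp add: \<psi>_sum)
qed

lemma hP_quadratic:
  assumes P: "P \<in> \<P>"
  shows "quadratic_character (residue_polys P) (residue_poly_topology v P) (rlattice P) (CARD('f) ^ degree P)
    (\<lambda>x y. \<psi> (top_coeff P (x * y))) c (\<lambda>y. (w * C P * (z P * z P) * y) mod P) (hP P)"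
proof -
  have "(w * C P * (z P * z P)) * (w' * C' P * (z' P * z' P)) = (w * w') * (C P * C' P) * ((z P * z' P) * (z P * z' P))"
    by (simp add: mult_ac)
  also have "\<dots> mod P = (((w * w') mod P) * ((C P * C' P) mod P) * (((z P * z' P) mod P) * ((z P * z' P) mod P))) mod P"
    by (metis mod_mult_eq)
  also have "\<dots> = 1" by (simp add: w_inverse[OF P] C_inverse[OF P] z_inverse[OF P] one_mod[OF P])
  finally show ?thesis
    unfolding hP_def by (rule quadratic_character_residue[OF primes(1,3)[OF P] degree_primes[OF P]])
qed

abbreviation weilP :: "'k poly \<Rightarrow> complex" where
  "weilP P \<equiv> weil_index (additive_group (residue_polys P)) (residue_poly_topology v P) (hP P)"

lemma norm_weilP: "P \<in> \<P> \<Longrightarrow> norm (weilP P) = 1"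
  by (rule quadratic_character.norm_weil_index[OF hP_quadratic])

lemma E_antimono: "m \<le> n \<Longrightarrow> E n \<subseteq> E m"
  using pint_antimono[of m n] by (fastforce simp: E_def rlattice_def)

lemma transversal_\<Phi>:
  assumes T: "\<And>P. P \<in> \<P> \<Longrightarrow> transversal (T P) (rlattice P m) (rlattice P n)"
  shows "transversal (\<Phi> ` PiE \<P> T) (E m) (E n)" "inj_on \<Phi> (PiE \<P> T)"
proof -
  have mem: "y P \<in> T P" "y P \<in> rlattice P m" "y P \<in> residue_polys P" if "y \<in> PiE \<P> T" "P \<in> \<P>" for y P
    using that transversal_subset[OF T] by (auto simp: rlattice_def PiE_iff)
  have \<Psi>\<Phi>: "\<Psi> (\<Phi> y) P = y P" if "y \<in> PiE \<P> T" "P \<in> \<P>" for y P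
    using \<Psi>_\<Phi>[OF that(2)] mem(3)[OF that] by blast
  have eq: "x = y" if "x \<in> PiE \<P> T" "y \<in> PiE \<P> T" "\<Phi> x - \<Phi> y \<in> E n" for x y
  proof (rule PiE_ext[OF that(1,2)])
    fix P assume P: "P \<in> \<P>"
    have "x P - y P \<in> rlattice P n" using that(3) P \<Psi>\<Phi>[OF that(1) P] \<Psi>\<Phi>[OF that(2) P]
      by (auto simp: E_def \<Psi>_diff)
    then show "x P = y P"
      using transversal_eq[OF T[OF P] rlattice_group[OF degree_primes[OF P]] mem(1)[OF that(1) P] mem(1)[OF that(2) P]] by blast
  qed
  show "inj_on \<Phi> (PiE \<P> T)"
  proof (rule inj_onI)
    fix x y assume "x \<in> PiE \<P> T" "y \<in> PiE \<P> T" "\<Phi> x = \<Phi> y"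
    then show "x = y" using add_subgroup_zero[OF E_group] by (intro eq) simp_all
  qed
  show "transversal (\<Phi> ` PiE \<P> T) (E m) (E n)"
  proof (rule transversalI[OF E_group])
    show "finite (\<Phi> ` PiE \<P> T)"
      using finite_primes transversal_finite[OF T] by (intro finite_imageI finite_PiE) auto
    show "\<Phi> ` PiE \<P> T \<subseteq> E m" using \<Psi>\<Phi> mem(2) \<Phi>_residue by (auto simp: E_def)
    show "\<exists>r\<in>\<Phi> ` PiE \<P> T. x - r \<in> E n" if x: "x \<in> E m" for x
    proof -
      have "\<forall>P\<in>\<P>. \<exists>r\<in>T P. \<Psi> x P - r \<in> rlattice P n"
        using x transversal_ex[OF T] by (auto simp: E_def)
      then obtain y where y: "\<forall>P\<in>\<P>. y P \<in> T P \<and> \<Psi> x P - y P \<in> rlattice P n" by metis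
      let ?y = "restrict y \<P>"
      have Y: "?y \<in> PiE \<P> T" using y by auto
      have "\<Psi> (x - \<Phi> ?y) P \<in> rlattice P n" if P: "P \<in> \<P>" for P
        using \<Psi>\<Phi>[OF Y P] y P by (simp add: \<Psi>_diff)
      moreover have "x - \<Phi> ?y \<in> residue_polys R"
        using x \<Phi>_residue by (intro add_subgroup_diff[OF residue_polys_group[OF degree_R]]) (auto simp: E_def)
      ultimately have "x - \<Phi> ?y \<in> E n" by (simp add: E_def)
      then show ?thesis using Y by blast
    qed
    show "r = s" if "r \<in> \<Phi> ` PiE \<P> T" "s \<in> \<Phi> ` PiE \<P> T" "r - s \<in> E n" for r s
      using that eq by blast
  qed
qed

lemma bound_exists:
  assumes "\<And>P. P \<in> \<P> \<Longrightarrow> \<exists>k0::int. \<forall>k\<ge>k0. A P k" shows "\<exists>k0. \<forall>k\<ge>k0. \<forall>P\<in>\<P>. A P k"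
proof -
  obtain K where K: "\<And>P k. P \<in> \<P> \<Longrightarrow> k \<ge> K P \<Longrightarrow> A P k" using assms by metis
  have "K P \<le> Max (K ` \<P>)" if "P \<in> \<P>" for P using finite_primes that by simp
  then show ?thesis using K by (intro exI[of _ "Max (K ` \<P>)"]) (meson order_trans)
qed

text \<open>On quotients of product lattices the sum of \<open>H\<close> is the product of the local
  Gauss sums. A small and a large product lattice enclose \<open>L0\<close> and \<open>D\<close>,
  and \<open>gauss_sum_reduce\<close> passes to \<open>D / L0\<close>.\<close>

theorem prod_weil_index:
  assumes groups: "add_subgroup L0" "add_subgroup D" and incl: "rlattice R n1 \<subseteq> L0" "L0 \<subseteq> D" "D \<subseteq> rlattice R k1"
    and D: "\<And>x. x \<in> residue_polys R \<Longrightarrow> x \<in> D \<longleftrightarrow> (\<forall>y\<in>L0. \<psi> (top_coeff R (w * y * x)) = 1)"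
    and H1: "\<And>x. x \<in> L0 \<Longrightarrow> H x = 1" and R0: "transversal R0 D L0"
  shows "\<exists>\<kappa>::real. \<kappa> > 0 \<and> (\<Prod>P\<in>\<P>. weilP P) = of_real \<kappa> * sum H R0"
proof -
  obtain s where s: "\<And>n. rlattice R n \<subseteq> E (n + s)" "\<And>n. E n \<subseteq> rlattice R (n + s)" using E_lattice by blast
  have "\<exists>k0. \<forall>k\<ge>k0. \<forall>P\<in>\<P>. \<exists>n0. \<forall>n\<ge>n0. (\<forall>x\<in>rlattice P (- k). \<forall>b\<in>rlattice P n. hP P (x + b) = hP P x) \<and>
     (\<forall>R. transversal R (rlattice P (- k)) (rlattice P n) \<longrightarrow> (\<exists>\<kappa>::real. \<kappa> > 0 \<and> sum (hP P) R = of_real \<kappa> * weilP P))"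
    by (rule bound_exists) (rule quadratic_character.weil_index_gauss_sum[OF hP_quadratic])
  then obtain k0 where k0: "\<And>k P. k \<ge> k0 \<Longrightarrow> P \<in> \<P> \<Longrightarrow>
    \<exists>n0. \<forall>n\<ge>n0. (\<forall>x\<in>rlattice P (- k). \<forall>b\<in>rlattice P n. hP P (x + b) = hP P x) \<and>
     (\<forall>R. transversal R (rlattice P (- k)) (rlattice P n) \<longrightarrow> (\<exists>\<kappa>::real. \<kappa> > 0 \<and> sum (hP P) R = of_real \<kappa> * weilP P))"
    by blast
  \<comment> \<open>Large enough for all the local Gauss sums and for \<open>E (- k)\<close> to
    contain \<open>D\<close>.\<close>
  define k where "k = max k0 (- (k1 + s))"
  have "k \<ge> k0" by (simp add: k_def)
  have "\<exists>n0. \<forall>n\<ge>n0. \<forall>P\<in>\<P>. (\<forall>x\<in>rlattice P (- k). \<forall>b\<in>rlattice P n. hP P (x + b) = hP P x) \<and>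
     (\<forall>R. transversal R (rlattice P (- k)) (rlattice P n) \<longrightarrow> (\<exists>\<kappa>::real. \<kappa> > 0 \<and> sum (hP P) R = of_real \<kappa> * weilP P))"
    by (rule bound_exists) (rule k0[OF \<open>k \<ge> k0\<close>])
  then obtain n0 where n0: "\<And>n P. n \<ge> n0 \<Longrightarrow> P \<in> \<P> \<Longrightarrow>
    (\<forall>x\<in>rlattice P (- k). \<forall>b\<in>rlattice P n. hP P (x + b) = hP P x) \<and>
     (\<forall>R. transversal R (rlattice P (- k)) (rlattice P n) \<longrightarrow> (\<exists>\<kappa>::real. \<kappa> > 0 \<and> sum (hP P) R = of_real \<kappa> * weilP P))"
    by blast
  \<comment> \<open>The bound \<open>n1 - s\<close> puts \<open>E n\<close> inside
    \<open>rlattice R n1\<close>, hence inside \<open>L0\<close>.\<close>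
  define n where "n = max (max n0 (n1 - s)) (- k)"
  have n: "n \<ge> n0" "n \<ge> n1 - s" "- k \<le> n" by (simp_all add: n_def)
  have "\<exists>T. transversal T (rlattice P (- k)) (rlattice P n)" if "P \<in> \<P>" for P
    using filtered_group.transversal_B[OF filtered_group_residue[OF degree_primes[OF that]] n(3)] by blast
  then obtain T where T: "\<And>P. P \<in> \<P> \<Longrightarrow> transversal (T P) (rlattice P (- k)) (rlattice P n)" by metis
  have "\<exists>\<kappa>::real. \<kappa> > 0 \<and> sum (hP P) (T P) = of_real \<kappa> * weilP P" if "P \<in> \<P>" for P
    using n0[OF n(1) that] T[OF that] by blast
  then obtain \<kappa> where \<kappa>: "\<And>P. P \<in> \<P> \<Longrightarrow> \<kappa> P > 0" "\<And>P. P \<in> \<P> \<Longrightarrow> sum (hP P) (T P) = of_real (\<kappa> P) * weilP P"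
    by metis
  note tr = transversal_\<Phi>[OF T]
  have "sum H (\<Phi> ` PiE \<P> T) = (\<Sum>y\<in>PiE \<P> T. \<Prod>P\<in>\<P>. hP P (y P))"
    by (simp add: sum.reindex[OF tr(2)] H_\<Phi>)
  also have "\<dots> = (\<Prod>P\<in>\<P>. sum (hP P) (T P))"
    by (rule prod_sum_PiE[symmetric]) (use finite_primes transversal_finite[OF T] in auto)
  also have "\<dots> = (\<Prod>P\<in>\<P>. of_real (\<kappa> P) * weilP P)" using \<kappa>(2) by simp
  also have "\<dots> = of_real (prod \<kappa> \<P>) * (\<Prod>P\<in>\<P>. weilP P)" by (simp add: prod.distrib)
  finally have sum1: "sum H (\<Phi> ` PiE \<P> T) = of_real (prod \<kappa> \<P>) * (\<Prod>P\<in>\<P>. weilP P)" .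
  have res: "x \<in> residue_polys R" if "x \<in> E j" for x j using that by (simp add: E_def)
  have per: "H (x + b) = H x" if x: "x \<in> E (- k)" and b: "b \<in> E n" for x b
  proof -
    have "x + b \<in> residue_polys R"
      using add_subgroup_add[OF residue_polys_group[OF degree_R] res[OF x] res[OF b]] .
    then have "H (x + b) = (\<Prod>P\<in>\<P>. hP P (\<Psi> x P + \<Psi> b P))"
      using H_\<Phi>[of "\<Psi> (x + b)"] \<Phi>_\<Psi>[of "x + b"] by (simp add: \<Psi>_add)
    also have "\<dots> = (\<Prod>P\<in>\<P>. hP P (\<Psi> x P))"
      using n0[OF n(1)] x b by (intro prod.cong refl) (auto simp: E_def)
    also have "\<dots> = H x" using H_\<Phi>[of "\<Psi> x"] \<Phi>_\<Psi>[OF res[OF x]] by simp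
    finally show ?thesis .
  qed
  have add: "H (x + y) = H x * H y * \<psi> (top_coeff R (w * x * y))" for x y
  proof -
    have "smult (1 / 2) (w * (x + y)\<^sup>2) = smult (1 / 2) (w * x\<^sup>2) + smult (1 / 2) (w * y\<^sup>2) + smult (1 / 2) (2 * (w * x * y))"
      by (simp add: power2_eq_square algebra_simps smult_add_right)
    also have "smult (1 / 2) (2 * (w * x * y)) = w * x * y"
      by (simp add: numeral_poly)
    finally show ?thesis unfolding H_def by (simp add: top_coeff_add \<psi>_add)
  qed
  have incl': "E n \<subseteq> L0" "D \<subseteq> E (- k)"
  proof -
    have "E n \<subseteq> E (n1 - s)" using n(2) by (intro E_antimono)
    then show "E n \<subseteq> L0" using s(2)[of "n1 - s"] incl(1) by simp
    have "E (k1 + s) \<subseteq> E (- k)" by (intro E_antimono) (simp add: k_def)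
    then show "D \<subseteq> E (- k)" using s(1)[of k1] incl(3) by blast
  qed
  have "\<exists>\<kappa>'::real. \<kappa>' > 0 \<and> sum H (\<Phi> ` PiE \<P> T) = of_real \<kappa>' * sum H R0"
  proof (rule gauss_sum_reduce[where \<beta> = "\<lambda>x y. \<psi> (top_coeff R (w * x * y))",
        OF E_group groups E_group incl'(1) incl(2) incl'(2) tr(1) R0])
    show "x \<in> D \<longleftrightarrow> (\<forall>y\<in>L0. \<psi> (top_coeff R (w * y * x)) = 1)" if "x \<in> E (- k)" for x
      by (rule D[OF res[OF that]])
    show "H (x + y) = H x * H y * \<psi> (top_coeff R (w * x * y))" for x y by (rule add)
    show "\<psi> (top_coeff R (w * x * y)) = \<psi> (top_coeff R (w * y * x))" for x y by (simp add: mult_ac)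
    show "\<psi> (top_coeff R (w * (x + y) * u)) = \<psi> (top_coeff R (w * x * u)) * \<psi> (top_coeff R (w * y * u))" for x y u
      by (simp add: algebra_simps top_coeff_add \<psi>_add)
  qed (use H1 per in auto)
  then obtain \<kappa>' :: real where k': "\<kappa>' > 0" "sum H (\<Phi> ` PiE \<P> T) = of_real \<kappa>' * sum H R0" by blast
  have pos: "prod \<kappa> \<P> > 0" using \<kappa>(1) by (rule prod_pos)
  have "(\<Prod>P\<in>\<P>. weilP P) = of_real (\<kappa>' / prod \<kappa> \<P>) * sum H R0"
    using sum1 k'(2) pos by (simp add: field_simps del: of_real_prod)
  then show ?thesis using pos k'(1) by (intro exI[of _ "\<kappa>' / prod \<kappa> \<P>"]) simp
qed

end

section \<open>The Gauss sum of a unit modulo a distinguished polynomial\<close>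

lemma fps_mult_vanish:
  fixes a b :: "'a::comm_ring_1 fps"
  assumes "\<forall>i<m. fps_nth a i = 0" "\<forall>i<n. fps_nth b i = 0"
  shows "\<forall>i<m + n. fps_nth (a * b) i = 0"
proof (intro allI impI)
  fix i assume i: "i < m + n"
  have "fps_nth a k * fps_nth b (i - k) = 0" if "k \<le> i" for k
    using assms i that by (cases "k < m") auto
  then show "fps_nth (a * b) i = 0" by (simp add: fps_mult_nth)
qed

lemma fps_nth_mult_monom_poly:
  fixes a :: "'a::comm_ring_1 fps"
  shows "fps_nth (a * fps_of_poly (monom b j)) n = (if n < j then 0 else fps_nth a (n - j) * b)"
proof -
  have "a * fps_of_poly (monom b j) = (a * fps_const b) * fps_X ^ j" by (simp add: fps_of_poly_monom mult.assoc)
  then show ?thesis by (simp add: fps_X_power_mult_right_nth)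
qed

section \<open>Reduction modulo the maximal ideal\<close>

context local_field
begin

abbreviation rd :: "'k poly \<Rightarrow> 'f fps" where "rd q \<equiv> red (fps_of_poly q)"

lemma rd_mult: "p \<in> pint 0 \<Longrightarrow> q \<in> pint 0 \<Longrightarrow> rd (p * q) = rd p * rd q"
  by (simp add: fps_of_poly_mult red_mult fint_poly)

text \<open>R reduces to the power of t with exponent \<open>degree R\<close>, so integral multiples
  of R do not disturb the lower coefficients of the reduction.\<close>

lemma rd_mod:
  assumes R: "distinguished0 R" and q: "q \<in> pint 0" and i: "i < degree R"
  shows "res (coeff (q mod R) i) = res (coeff q i)"
proof -
  have R': "lead_coeff R = 1" "R \<in> pint 0" and redR: "rd R = fps_X ^ degree R" using R by (auto simp: distinguished0_def)
  have qR: "q div R \<in> pint 0"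
  proof -
    obtain d s where ds: "q = d * R + s" "d \<in> pint 0" "s = 0 \<or> degree s < degree R"
      using pint_division[OF R' q] by blast
    have "R \<noteq> 0" using R'(1) by auto
    then have "q div R = d" unfolding ds(1) using ds(3) div_poly_less[of s R] by (auto simp: poly_div_add_left)
    then show ?thesis using ds(2) by simp
  qed
  have "rd q = red (fps_of_poly (q div R * R) + fps_of_poly (q mod R))"
    by (simp flip: fps_of_poly_add)
  also have "\<dots> = rd (q div R) * fps_X ^ degree R + rd (q mod R)"
    using rd_mult[OF qR R'(2)] redR
    by (subst red_add) (simp_all add: fint_poly pint_mod[OF R' q] pint_mult[OF qR R'(2), simplified])
  finally have "fps_nth (rd q) i = fps_nth (rd (q mod R)) i" using i by (simp add: fps_X_power_mult_right_nth)
  then show ?thesis by simp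
qed

lemma res_top_coeff:
  assumes R: "distinguished0 R" "degree R \<ge> 1" and q: "q \<in> pint 0"
  shows "res (top_coeff R q) = fps_nth (rd q) (degree R - 1)"
  using rd_mod[OF R(1) q, of "degree R - 1"] R(2) by (simp add: top_coeff_def)

text \<open>A nonzero remainder would be R times a nonzero integral series. Once the content of that
  series is removed, the product has a nonzero reduction in some degree at least
  \<open>degree R\<close>, where the remainder has no coefficients.\<close>

lemma weierstrass_unique:
  assumes R: "distinguished0 R" and p: "p \<in> pint 0" "fps_of_poly p = fps_of_poly R * q" "q \<in> fint 0"
  shows "p mod R = 0"
proof (rule ccontr)
  assume nz: "p mod R \<noteq> 0"
  have R': "lead_coeff R = 1" "R \<in> pint 0" and redR: "rd R = fps_X ^ degree R" using R by (auto simp: distinguished0_def)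
  obtain d s where ds: "p = d * R + s" "d \<in> pint 0" "s = 0 \<or> degree s < degree R"
    using pint_division[OF R' p(1)] by blast
  have "R \<noteq> 0" using R'(1) by auto
  then have "s = p mod R" unfolding ds(1) using ds(3) mod_poly_less[of s R] by (auto simp: poly_mod_add_left)
  then have s: "s \<noteq> 0" "degree s < degree R" using nz ds(3) by auto
  define q' where "q' = q - fps_of_poly d"
  have eq: "fps_of_poly s = fps_of_poly R * q'"
    using p(2) unfolding ds(1) q'_def by (simp add: fps_of_poly_add fps_of_poly_mult algebra_simps)
  have q': "q' \<in> fint 0" using p(3) ds(2) fint_poly[of d 0] unfolding q'_def by (intro fint_intros(2)) auto
  have "q' \<noteq> 0" using eq s(1) by (metis mult_zero_right fps_of_poly_0 fps_of_poly_eq_iff)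
  then obtain m q'' where q'': "q' = fps_const (\<pi> powi m) * q''" "q'' \<in> fint 0" "red q'' \<noteq> 0"
    using fint_primitive[OF _ q'] by blast
  have "fps_of_poly (smult (\<pi> powi (- m)) s) = fps_of_poly R * q''"
  proof -
    have "fps_of_poly (smult (\<pi> powi (- m)) s) = fps_const (\<pi> powi (- m)) * (fps_of_poly R * (fps_const (\<pi> powi m) * q''))"
      using eq q''(1) by (simp add: fps_of_poly_smult)
    also have "\<dots> = fps_const (\<pi> powi (- m) * \<pi> powi m) * (fps_of_poly R * q'')" by (simp flip: fps_const_mult add: mult_ac)
    also have "\<pi> powi (- m) * \<pi> powi m = 1" using \<pi>_nonzero by (simp add: power_int_minus)
    finally show ?thesis by simp
  qed
  then have "rd (smult (\<pi> powi (- m)) s) = fps_X ^ degree R * red q''"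
    using red_mult[of "fps_of_poly R" q''] R'(2) q''(2) redR by (simp add: fint_poly)
  then have red: "fps_nth (rd (smult (\<pi> powi (- m)) s)) (degree R + i) = fps_nth (red q'') i" for i
    by (simp add: fps_X_power_mult_nth)
  have "fps_nth (red q'') i = 0" for i
  proof -
    have "coeff s (degree R + i) = 0" using s(2) by (intro coeff_eq_0) simp
    then have "res (coeff (smult (\<pi> powi (- m)) s) (degree R + i)) = 0" by simp
    then show ?thesis using red[of i] by (simp del: coeff_smult)
  qed
  then show False using q''(3) by (simp add: fps_eq_iff)
qed

text \<open>Let r and r' be the Weierstrass remainders of u and its inverse. R divides 1 - r r' as a
  power series, hence as a polynomial by \<open>weierstrass_unique\<close>.\<close>

lemma unit_remainder:
  assumes R: "distinguished0 R" "degree R \<ge> 1" and u: "u \<in> fint 0" "u' \<in> fint 0" "u * u' = 1"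
  obtains q r r' where "u = fps_of_poly R * q + fps_of_poly r" "q \<in> fint 0" "r \<in> pint 0" "r' \<in> pint 0"
    "(r * r') mod R = 1" "res (coeff r 0) = fps_nth (red u) 0" "fps_nth (red u) 0 \<noteq> 0"
proof -
  have R': "lead_coeff R = 1" "R \<in> pint 0" and redR: "rd R = fps_X ^ degree R" using R by (auto simp: distinguished0_def)
  have nz: "rd R \<noteq> 0" by (simp add: redR)
  have R0: "fps_of_poly R \<in> fint 0" using R'(2) by (simp add: fint_poly)
  obtain q r where q: "u = fps_of_poly R * q + fps_of_poly r" "q \<in> fint 0" "r \<in> pint 0"
    using weierstrass_division[OF R0 nz u(1)] by blast
  obtain q' r' where q': "u' = fps_of_poly R * q' + fps_of_poly r'" "q' \<in> fint 0" "r' \<in> pint 0"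
    using weierstrass_division[OF R0 nz u(2)] by blast
  have "fps_of_poly (1 - r * r') = u * u' - fps_of_poly r * fps_of_poly r'"
    using u(3) by (simp add: fps_of_poly_diff fps_of_poly_mult)
  also have "\<dots> = fps_of_poly R * (q * u' + fps_of_poly r * q')" unfolding q(1) q'(1) by (simp add: algebra_simps)
  finally have "fps_of_poly (1 - r * r') = fps_of_poly R * (q * u' + fps_of_poly r * q')" .
  moreover have "1 - r * r' \<in> pint 0"
    using pint_mult[OF q(3) q'(3)] pint_monom[of 1 0 0] by (intro pint_intros(2)) (auto simp: monom_0 one_pCons)
  moreover have "q * u' + fps_of_poly r * q' \<in> fint 0"
    using q q' u by (intro fint_intros(4) fint_mult0) (auto simp: fint_poly)
  ultimately have "(1 - r * r') mod R = 0" using weierstrass_unique[OF R(1)] by blast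
  moreover have "1 mod R = 1" using R(2) by (intro mod_poly_less) simp
  ultimately have mod: "(r * r') mod R = 1" by (simp add: poly_mod_diff_left)
  have "red u = fps_X ^ degree R * red q + rd r"
    unfolding q(1) using q R0 redR by (simp add: red_add red_mult fint_mult0 fint_poly)
  then have "fps_nth (red u) 0 = res (coeff r 0)" using R(2) by (simp add: fps_X_power_mult_nth)
  moreover have "fps_nth (red u) 0 * fps_nth (red u') 0 = 1"
    using red_mult[OF u(1,2)] u(3) by (metis fps_mult_nth_0 red_nth fps_one_nth res_one)
  then have "fps_nth (red u) 0 \<noteq> 0" by auto
  ultimately show ?thesis using that[OF q q'(3) mod] by simp
qed

text \<open>For distinguished R of degree d and e \<le> d this is the preimage of the ideal of t^e
  under reduction of the integral lattice to k[t]/(t^d). These lattices interpolate between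
  \<open>rlattice R 0\<close> and \<open>rlattice R 1\<close>.\<close>

definition shallow :: "'k poly \<Rightarrow> nat \<Rightarrow> 'k poly set" where
  "shallow R e = {x \<in> rlattice R 0. \<forall>i<e. coeff x i \<in> mp 1}"

lemma shallow_group: "degree R \<ge> 1 \<Longrightarrow> add_subgroup (shallow R e)"
  using add_subgroup_intros[OF rlattice_group[of R 0]] unfolding shallow_def add_subgroup_def
  by (auto intro: mp_diff)

lemma shallow_rd: "x \<in> shallow R e \<longleftrightarrow> x \<in> rlattice R 0 \<and> (\<forall>i<e. fps_nth (rd x) i = 0)"
  by (auto simp: shallow_def rlattice_def pint_def res_zero_iff)

lemma shallow_incl: "e \<le> e' \<Longrightarrow> shallow R e' \<subseteq> shallow R e" "rlattice R 1 \<subseteq> shallow R e" "shallow R e \<subseteq> rlattice R 0"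
  using pint_antimono[of 0 1] by (auto simp: shallow_def rlattice_def pint_coeff)

context
  fixes R r r' :: "'k poly"
  assumes R: "distinguished0 R" "degree R \<ge> 1" and r: "r \<in> pint 0" "r' \<in> pint 0" "(r * r') mod R = 1"
    and r0: "res (coeff r 0) \<noteq> 0"
begin

lemma R_facts: "lead_coeff R = 1" "R \<in> pint 0" using R(1) by (auto simp: distinguished0_def)

lemma pairing_residue:
  assumes "q \<in> pint 0"
  shows "\<psi> (top_coeff R (smult (\<pi> powi (c - 1)) q)) = \<psi>0 (fps_nth (rd q) (degree R - 1))"
  using psi_0_eq[OF top_coeff_pint[OF R_facts assms]] res_top_coeff[OF R assms] by (simp add: top_coeff_smult)

text \<open>Multiplication by r maps each lattice onto itself, because r and its inverse r' are
  integral; only the power of \<pi> shifts the orthogonal.\<close>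

lemma lattice_perp:
  assumes x: "x \<in> residue_polys R"
  shows "x \<in> rlattice R (c - n - k) \<longleftrightarrow> (\<forall>y\<in>rlattice R n. \<psi> (top_coeff R (smult (\<pi> powi k) r * y * x)) = 1)"
proof -
  define s where "s = (smult (\<pi> powi k) r * x) mod R"
  have "\<psi> (top_coeff R (smult (\<pi> powi k) r * y * x)) = \<psi> (top_coeff R (y * s))" for y
    unfolding s_def top_coeff_mult_mod by (simp add: mult_ac)
  then have "(\<forall>y\<in>rlattice R n. \<psi> (top_coeff R (smult (\<pi> powi k) r * y * x)) = 1) \<longleftrightarrow> s \<in> rlattice R (c - n)"
    using residue_perp[OF R_facts, of s n] residue_polys_mod[OF R(2)] unfolding s_def by simp
  also have "\<dots> \<longleftrightarrow> x \<in> rlattice R (c - n - k)"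
  proof
    assume "s \<in> rlattice R (c - n)"
    then have "smult (\<pi> powi (- k)) (r' * s) \<in> pint ((- k) + (0 + (c - n)))"
      by (intro pint_smult pint_mult r(2)) (auto simp: rlattice_def)
    then have "smult (\<pi> powi (- k)) (r' * s) mod R \<in> pint (c - n - k)" using pint_mod[OF R_facts] by simp
    also have "smult (\<pi> powi (- k)) (r' * s) mod R =
        smult (\<pi> powi (- k)) r' * (smult (\<pi> powi k) r * x) mod R"
      unfolding s_def by (metis mod_mult_right_eq mult_smult_left)
    also have "smult (\<pi> powi (- k)) r' * (smult (\<pi> powi k) r * x) = (r * r') * x"
    proof -
      have "\<pi> powi (- k) * \<pi> powi k = 1" using \<pi>_powi_cancel(2)[of k 1] by simp
      then show ?thesis by (simp add: mult_ac)
    qed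
    also have "(r * r') * x mod R = ((r * r') mod R) * x mod R" by (simp only: mod_mult_left_eq)
    also have "\<dots> = x" using mod_residue_polys[OF x] r(3) by simp
    finally show "x \<in> rlattice R (c - n - k)" using x by (simp add: rlattice_def)
  next
    assume "x \<in> rlattice R (c - n - k)"
    then have "smult (\<pi> powi k) (r * x) \<in> pint (k + (0 + (c - n - k)))"
      by (intro pint_smult pint_mult r(1)) (auto simp: rlattice_def)
    then show "s \<in> rlattice R (c - n)"
      using pint_mod[OF R_facts] residue_polys_mod[OF R(2)] by (simp add: s_def rlattice_def)
  qed
  finally show ?thesis by blast
qed

text \<open>For integral x and y the pairing is \<psi>0 of the coefficient of t^(d-1) in the product
  of the reductions in k[t]/(t^d), where the ideals of t^e and t^(d-e) are orthogonal to each
  other.\<close>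

lemma shallow_perp:
  assumes e: "e \<le> degree R" and x: "x \<in> residue_polys R"
  shows "x \<in> shallow R (degree R - e) \<longleftrightarrow>
    (\<forall>y\<in>shallow R e. \<psi> (top_coeff R (smult (\<pi> powi (c - 1)) r * y * x)) = 1)"
proof
  assume "x \<in> shallow R (degree R - e)"
  then have x: "x \<in> pint 0" "\<forall>i<degree R - e. fps_nth (rd x) i = 0" by (auto simp: shallow_rd rlattice_def)
  show "\<forall>y\<in>shallow R e. \<psi> (top_coeff R (smult (\<pi> powi (c - 1)) r * y * x)) = 1"
  proof
    fix y assume "y \<in> shallow R e"
    then have y: "y \<in> pint 0" "\<forall>i<e. fps_nth (rd y) i = 0" by (auto simp: shallow_rd rlattice_def)
    have yx: "y * x \<in> pint 0" using pint_mult[OF y(1) x(1)] by simp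
    have "\<forall>i<0 + (e + (degree R - e)). fps_nth (rd r * (rd y * rd x)) i = 0"
      by (intro fps_mult_vanish x y) simp
    then have "fps_nth (rd (r * (y * x))) (degree R - 1) = 0"
      using e R(2) rd_mult[OF r(1) yx] rd_mult[OF y(1) x(1)] by simp
    then show "\<psi> (top_coeff R (smult (\<pi> powi (c - 1)) r * y * x)) = 1"
      using pairing_residue[of "r * (y * x)"] pint_mult[OF r(1) yx] by (simp add: mult.assoc)
  qed
next
  \<comment> \<open>Pairing with \<open>rlattice R 1\<close> shows that \<open>x\<close> is
    integral. Pairing with monomials of degree at least \<open>e\<close> kills the low coefficients
    of the reduction of r x, and the reduction of r is invertible as a power series.\<close>
  assume triv: "\<forall>y\<in>shallow R e. \<psi> (top_coeff R (smult (\<pi> powi (c - 1)) r * y * x)) = 1"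
  then have "\<forall>y\<in>rlattice R 1. \<psi> (top_coeff R (smult (\<pi> powi (c - 1)) r * y * x)) = 1"
    using shallow_incl(2) by blast
  then have x0: "x \<in> pint 0" using lattice_perp[OF x, of 1 "c - 1"] by (simp add: rlattice_def)
  have rx: "r * x \<in> pint 0" using pint_mult[OF r(1) x0] by simp
  have vanish: "fps_nth (rd r * rd x) i = 0" if i: "i < degree R - e" for i
  proof (rule \<psi>0_nontrivial)
    fix b
    define j where "j = degree R - 1 - i"
    have j: "e \<le> j" "j < degree R" "degree R - 1 - j = i" using i by (auto simp: j_def)
    have y: "monom (lift b) j \<in> shallow R e"
      using j pint_monom[of "lift b" 0 j] degree_monom_le[of "lift b" j] by (auto simp: shallow_def rlattice_def residue_polys_def)
    then have y0: "monom (lift b) j \<in> pint 0" by (simp add: shallow_def rlattice_def)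
    have "1 = \<psi> (top_coeff R (smult (\<pi> powi (c - 1)) (r * x * monom (lift b) j)))"
      using triv[rule_format, OF y] by (simp add: mult_ac)
    also have "\<dots> = \<psi>0 (fps_nth (rd (r * x * monom (lift b) j)) (degree R - 1))"
      using pint_mult[OF rx y0] by (intro pairing_residue) simp
    also have "rd (r * x * monom (lift b) j) = rd (r * x) * fps_of_poly (monom b j)"
    proof -
      have "rd (monom (lift b) j) = fps_of_poly (monom b j)" by (rule fps_ext) simp
      then show ?thesis using rd_mult[OF rx y0] by simp
    qed
    also have "fps_nth (rd (r * x) * fps_of_poly (monom b j)) (degree R - 1) = fps_nth (rd r * rd x) i * b"
      unfolding fps_nth_mult_monom_poly rd_mult[OF r(1) x0] using j by simp
    finally show "\<psi>0 (fps_nth (rd r * rd x) i * b) = 1" by simp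
  qed
  have "inverse (rd r) * (rd r * rd x) = rd x"
    using r0 inverse_mult_eq_1[of "rd r"] by (simp add: mult.assoc[symmetric] del: mult_cancel_right2)
  moreover have "\<forall>i<0 + (degree R - e). fps_nth (inverse (rd r) * (rd r * rd x)) i = 0"
    using vanish by (intro fps_mult_vanish) auto
  ultimately have "\<forall>i<degree R - e. fps_nth (rd x) i = 0" by (metis add_0)
  then show "x \<in> shallow R (degree R - e)" using x x0 unfolding shallow_rd rlattice_def by blast
qed

lemma form_residue:
  assumes "x \<in> pint 0"
  shows "\<psi> (top_coeff R (smult (1 / 2) (smult (\<pi> powi (c - 1)) r * x\<^sup>2))) =
    \<psi>0 (fps_nth (rd r * (rd x * rd x)) (degree R - 1) / 2)"
proof -
  have x2: "x * x \<in> pint 0" using pint_mult[OF assms assms] by simp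
  have rx2: "r * (x * x) \<in> pint 0" using pint_mult[OF r(1) x2] by simp
  have "smult (1 / 2) (r * (x * x)) \<in> pint 0" using pint_smult[OF half_mp rx2] by simp
  note pairing_residue[OF this]
  also have "fps_nth (rd (smult (1 / 2) (r * (x * x)))) (degree R - 1) = res (1 / 2 * coeff (r * (x * x)) (degree R - 1))"
    by (simp only: red_nth fps_of_poly_nth coeff_smult)
  also have "res (1 / 2 * coeff (r * (x * x)) (degree R - 1)) = fps_nth (rd r * (rd x * rd x)) (degree R - 1) / 2" (is "_ = fps_nth _ ?i / 2")
  proof -
    have "res (1 / 2 * coeff (r * (x * x)) ?i) = 1 / 2 * res (coeff (r * (x * x)) ?i)"
      using res_mult[OF half_mp pint_coeff[OF rx2]] by (simp only: res_half)
    also have "res (coeff (r * (x * x)) ?i) = fps_nth (rd r * (rd x * rd x)) ?i"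
      using rd_mult[OF r(1) x2] rd_mult[OF assms assms] by (metis fps_of_poly_nth red_nth)
    finally show ?thesis by simp
  qed
  finally show ?thesis by (simp add: power2_eq_square mult_ac)
qed

lemma form_trivial:
  assumes x: "x \<in> shallow R e" and e: "degree R \<le> 2 * e"
  shows "\<psi> (top_coeff R (smult (1 / 2) (smult (\<pi> powi (c - 1)) r * x\<^sup>2))) = 1"
proof -
  have x': "x \<in> pint 0" "\<forall>i<e. fps_nth (rd x) i = 0" using x by (auto simp: shallow_rd rlattice_def)
  have "\<forall>i<0 + (e + e). fps_nth (rd r * (rd x * rd x)) i = 0" by (intro fps_mult_vanish x') simp
  then show ?thesis using e R(2) form_residue[OF x'(1)] by simp
qed

lemma transversal_shallow:
  assumes "j < degree R"
  shows "transversal (range (\<lambda>a. monom (lift a) j)) (shallow R j) (shallow R (Suc j))"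
proof (rule transversalI[OF shallow_group[OF R(2)]])
  show "finite (range (\<lambda>a. monom (lift a) j))" using finite_residue by simp
  show sub: "range (\<lambda>a. monom (lift a) j) \<subseteq> shallow R j"
    using assms pint_monom[of "lift _" 0 j] degree_monom_le[of _ j]
    by (fastforce simp: shallow_def rlattice_def residue_polys_def intro: le_less_trans)
  show "\<exists>y\<in>range (\<lambda>a. monom (lift a) j). x - y \<in> shallow R (Suc j)" if x: "x \<in> shallow R j" for x
  proof (rule bexI[OF _ rangeI[of _ "res (coeff x j)"]])
    let ?y = "monom (lift (res (coeff x j))) j"
    have "x - ?y \<in> shallow R j" using x sub add_subgroup_diff[OF shallow_group[OF R(2)]] by blast
    moreover have "coeff (x - ?y) j \<in> mp 1"
      using x res_eq_iff[of "coeff x j" "lift (res (coeff x j))"] by (simp add: shallow_def rlattice_def pint_coeff)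
    ultimately show "x - ?y \<in> shallow R (Suc j)" by (auto simp: shallow_def less_Suc_eq simp del: coeff_diff)
  qed
  show "x = y" if "x \<in> range (\<lambda>a. monom (lift a) j)" "y \<in> range (\<lambda>a. monom (lift a) j)" "x - y \<in> shallow R (Suc j)" for x y
  proof -
    from that(1,2) obtain a b where ab: "x = monom (lift a) j" "y = monom (lift b) j" by blast
    then have "lift a - lift b \<in> mp 1" using that(3) by (auto simp: shallow_def)
    then show ?thesis using ab res_eq_iff[of "lift a" "lift b"] by simp
  qed
qed

text \<open>In degree 2 j = \<open>degree R - 1\<close> the product of r with the square of a t^j
  reduces to the constant term of r times a^2.\<close>

lemma form_sum_odd:
  assumes j: "degree R = 2 * j + 1"
  shows "(\<Sum>x\<in>range (\<lambda>a. monom (lift a) j). \<psi> (top_coeff R (smult (1 / 2) (smult (\<pi> powi (c - 1)) r * x\<^sup>2)))) =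
    (\<Sum>a\<in>UNIV. \<psi>0 (res (coeff r 0) * a\<^sup>2 / 2))"
proof -
  have inj: "inj (\<lambda>a. monom (lift a) j)"
  proof (rule injI)
    fix a b assume "monom (lift a) j = monom (lift b) j"
    then have "lift a = lift b" by simp
    then show "a = b" by (metis res_lift)
  qed
  have "\<psi> (top_coeff R (smult (1 / 2) (smult (\<pi> powi (c - 1)) r * (monom (lift a) j)\<^sup>2))) = \<psi>0 (res (coeff r 0) * a\<^sup>2 / 2)" for a
  proof -
    have "rd (monom (lift a) j) = fps_of_poly (monom a j)" by (rule fps_ext) simp
    moreover have "fps_of_poly (monom a j) * fps_of_poly (monom a j) = fps_of_poly (monom (a * a) (2 * j))"
      by (simp only: fps_of_poly_mult[symmetric] mult_monom mult_2)
    ultimately have "\<psi> (top_coeff R (smult (1 / 2) (smult (\<pi> powi (c - 1)) r * (monom (lift a) j)\<^sup>2))) =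
        \<psi>0 (fps_nth (rd r * fps_of_poly (monom (a * a) (2 * j))) (degree R - 1) / 2)"
      using form_residue[OF pint_monom[OF lift_mp, of a j]] by (simp only:)
    then show ?thesis using j by (simp only: fps_nth_mult_monom_poly) (simp add: power2_eq_square)
  qed
  then show ?thesis by (simp add: sum.reindex[OF inj])
qed

end

end

section \<open>The completion at the prime of the constants\<close>

text \<open>Products of double series are limits of symmetric partial sums; for the Laurent series
  here these sums are exact as soon as m reaches n - l.\<close>

lemma fls_times_nth_symmetric:
  fixes x D :: "'a::comm_ring_1 fls"
  assumes x: "\<forall>i<0. fls_nth x i = 0" and D: "\<forall>i<l. fls_nth D i = 0" and m: "n - l \<le> int m"
  shows "fls_nth (x * D) n = (\<Sum>i = - int m..int m. fls_nth x i * fls_nth D (n - i))"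
  unfolding fls_times_nth(2)
proof (rule sum.mono_neutral_cong)
  fix i assume "i \<in> {- int m..int m} - {fls_subdegree x..n - fls_subdegree D}"
  then have "i < fls_subdegree x \<or> n - i < fls_subdegree D" by auto
  then show "fls_nth x i * fls_nth D (n - i) = 0" by auto
next
  fix i assume "i \<in> {fls_subdegree x..n - fls_subdegree D} - {- int m..int m}"
  then have "i < 0 \<or> n - i < l" using m by auto
  then show "fls_nth x i * fls_nth D (n - i) = 0" using x D by auto
qed auto

context local_field
begin

text \<open>Modulo \<pi> the limit is attained by a partial sum, and the \<open>d i\<close> of index
  below \<open>l\<close> vanish, so the product reduces to a product of Laurent series.\<close>

lemma res_double_product:
  assumes h: "h \<in> fint 0" and d: "\<And>i. d i \<in> mp 0" "\<And>i. i < l \<Longrightarrow> d i \<in> mp 1"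
    and lim: "limitin (valuation_topology v) (\<lambda>m. \<Sum>i = - int m..int m. fls_nth (fps_to_fls h) i * d (n - i)) y sequentially"
    and D: "\<And>i. fls_nth D i = res (d i)"
  shows "y \<in> mp 0" "res y = fls_nth (fps_to_fls (red h) * D) n"
proof -
  obtain N where N: "\<And>m. m \<ge> N \<Longrightarrow> (\<Sum>i = - int m..int m. fls_nth (fps_to_fls h) i * d (n - i)) - y \<in> mp 1"
    using lim unfolding limitin_valuation by blast
  define m where "m = max N (nat (n - l))"
  let ?S = "\<Sum>i = - int m..int m. fls_nth (fps_to_fls h) i * d (n - i)"
  have hi: "fls_nth (fps_to_fls h) i \<in> mp 0" for i using h by (simp add: fint_def)
  have t: "fls_nth (fps_to_fls h) i * d (n - i) \<in> mp 0" for i using mp_mult[OF hi d(1)] by simp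
  have S: "?S \<in> mp 0" by (intro mp_sum t)
  have y: "?S - y \<in> mp 1" by (rule N) (simp add: m_def)
  then have "?S - y \<in> mp 0" using subsetD[OF mp_antimono[of 0 1]] by simp
  then have "?S - (?S - y) \<in> mp 0" by (rule mp_diff[OF S])
  then show y0: "y \<in> mp 0" by (simp only: diff_diff_eq2 add_diff_cancel_left')
  have "res y = res ?S" using res_eq_iff[OF S y0] y by simp
  also have "\<dots> = (\<Sum>i = - int m..int m. res (fls_nth (fps_to_fls h) i * d (n - i)))" by (intro res_sum t)
  also have "\<dots> = (\<Sum>i = - int m..int m. fls_nth (fps_to_fls (red h)) i * fls_nth D (n - i))"
    using res_mult[OF hi d(1)] by (intro sum.cong) (auto simp: D)
  also have "\<dots> = fls_nth (fps_to_fls (red h) * D) n"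
    by (rule fls_times_nth_symmetric[symmetric, where l = l]) (auto simp: D res_zero_iff[OF d(1)] d(2) m_def)
  finally show "res y = fls_nth (fps_to_fls (red h) * D) n" .
qed

text \<open>Boundedness makes the minimum of the valuations attained, and convergence to 0 at minus
  infinity bounds the support of the reduction from below.\<close>

lemma double_series_normalize:
  assumes a: "a \<in> double_series v" and nz: "a i0 \<noteq> 0"
  shows "\<exists>l j. (\<forall>i. \<pi> powi (- double_series_ord v a) * a i \<in> mp 0) \<and>
    (\<forall>i<l. \<pi> powi (- double_series_ord v a) * a i \<in> mp 1) \<and> \<pi> powi (- double_series_ord v a) * a j \<notin> mp 1"
proof -
  obtain b where b: "\<And>i. a i \<in> mp b" using a by (auto simp: double_series_def)
  have lb: "b \<le> v (a i)" if "a i \<noteq> 0" for i using b[of i] that by (simp add: mp_iff)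
  define j where "j = (ARG_MIN (\<lambda>i. nat (v (a i) - b)) i. a i \<noteq> 0)"
  have j: "a j \<noteq> 0" unfolding j_def by (rule arg_min_natI[of _ i0]) (rule nz)
  have min: "v (a j) \<le> v (a i)" if i: "a i \<noteq> 0" for i
  proof -
    have "nat (v (a j) - b) \<le> nat (v (a i) - b)" unfolding j_def by (rule arg_min_nat_le) (rule i)
    then show ?thesis using lb[OF i] lb[OF j] by simp
  qed
  have ord: "double_series_ord v a = v (a j)"
    unfolding double_series_ord_def by (rule cInf_eq_minimum) (use j min in auto)
  have "limitin (valuation_topology v) (\<lambda>i. a (- int i)) 0 sequentially" using a by (simp add: double_series_def)
  then obtain N where N: "\<And>i. i \<ge> N \<Longrightarrow> a (- int i) - 0 \<in> mp (v (a j) + 1)" unfolding limitin_valuation by metis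
  have "\<forall>i < - int N. a i \<in> mp (v (a j) + 1)"
  proof (intro allI impI)
    fix i assume "i < - int N"
    then show "a i \<in> mp (v (a j) + 1)" using N[of "nat (- i)"] by simp
  qed
  then show ?thesis
    unfolding ord \<pi>_powi_mult_mp using min j
    by (intro exI[of _ "- int N"] exI[of _ j]) (auto simp: mp_iff)
qed

text \<open>Contents are removed from g, h and the double series. What remains is h' d = \<pi>^q g'
  with g', h' and d nonzero modulo \<pi>; comparing reductions forces q = 0, so \<open>m\<close> is
  the difference of the contents of g and h.\<close>

lemma image_in_double_series_normalize:
  assumes im: "image_in_double_series v f a" and f: "f \<noteq> 0"
  defines "m \<equiv> double_series_ord v a"
  shows "\<exists>g h. g \<in> fint 0 \<and> h \<in> fint 0 \<and> red g \<noteq> 0 \<and> red h \<noteq> 0 \<and>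
    f * fps_to_fls h = fls_const (\<pi> powi m) * fps_to_fls g \<and>
    double_series_bar v res \<pi> a * fps_to_fls (red h) = fps_to_fls (red g)"
proof -
  obtain g h where gh: "g \<in> fint 0" "h \<in> fint 0" "h \<noteq> 0" "f = fps_to_fls g / fps_to_fls h"
    and lim: "double_series_product v (fls_nth (fps_to_fls h)) a (fls_nth (fps_to_fls g))" and a: "a \<in> double_series v"
    using im by (auto simp: image_in_double_series_def integral_fps_fint)
  have "g \<noteq> 0" using gh(4) f by auto
  then obtain k g' where g': "g = fps_const (\<pi> powi k) * g'" "g' \<in> fint 0" "red g' \<noteq> 0"
    using fint_primitive[OF _ gh(1)] by blast
  obtain k' h' where h': "h = fps_const (\<pi> powi k') * h'" "h' \<in> fint 0" "red h' \<noteq> 0"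
    using fint_primitive[OF gh(3,2)] by blast
  have "\<exists>i. a i \<noteq> 0"
  proof (rule ccontr)
    assume "\<nexists>i. a i \<noteq> 0"
    then have "limitin (valuation_topology v) (\<lambda>m. 0) (fls_nth (fps_to_fls g) n) sequentially" for n
      using lim by (simp add: double_series_product_def)
    then have "0 - fls_nth (fps_to_fls g) n \<in> mp j" for n j unfolding limitin_valuation by (meson le_refl)
    then have "fls_nth (fps_to_fls g) n = 0" for n using mp_Inter[of "0 - fls_nth (fps_to_fls g) n"] by simp
    then have "fps_to_fls g = 0" by (intro fls_eqI) simp
    then show False using \<open>g \<noteq> 0\<close> by simp
  qed
  then obtain i0 where "a i0 \<noteq> 0" by blast
  define d where "d i = \<pi> powi (- m) * a i" for i
  obtain l j where d: "\<And>i. d i \<in> mp 0" "\<And>i. i < l \<Longrightarrow> d i \<in> mp 1" "d j \<notin> mp 1"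
    using double_series_normalize[OF a \<open>a i0 \<noteq> 0\<close>] unfolding d_def m_def by blast
  define D where "D = double_series_bar v res \<pi> a"
  have D: "fls_nth D i = res (d i)" for i
    unfolding D_def double_series_bar_def d_def[symmetric] m_def[symmetric]
    by (subst nth_Abs_fls_ex_lower_bound) (use d(2) res_zero_iff[OF d(1)] in auto)
  define q where "q = k - k' - m"
  define y where "y n = \<pi> powi q * fls_nth (fps_to_fls g') n" for n
  have lim': "limitin (valuation_topology v) (\<lambda>m. \<Sum>i = - int m..int m. fls_nth (fps_to_fls h') i * d (n - i)) (y n) sequentially" for n
    unfolding limitin_valuation
  proof
    fix r
    obtain N where N: "\<And>M. M \<ge> N \<Longrightarrow>
      (\<Sum>i = - int M..int M. fls_nth (fps_to_fls h) i * a (n - i)) - fls_nth (fps_to_fls g) n \<in> mp (r + m + k')"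
      using lim unfolding double_series_product_def limitin_valuation by metis
    have "(\<Sum>i = - int M..int M. fls_nth (fps_to_fls h') i * d (n - i)) - y n =
      \<pi> powi (- m - k') * ((\<Sum>i = - int M..int M. fls_nth (fps_to_fls h) i * a (n - i)) - fls_nth (fps_to_fls g) n)" for M
    proof -
      have "fls_nth (fps_to_fls h') i * d (n - i) = \<pi> powi (- m - k') * (fls_nth (fps_to_fls h) i * a (n - i))" for i
        using \<pi>_nonzero by (simp add: h'(1) d_def power_int_diff power_int_minus field_simps)
      moreover have "y n = \<pi> powi (- m - k') * fls_nth (fps_to_fls g) n"
        using \<pi>_nonzero by (simp add: g'(1) y_def q_def power_int_diff power_int_minus power_int_add field_simps)
      ultimately show ?thesis by (simp add: right_diff_distrib sum_distrib_left)
    qed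
    moreover have "r - (- m - k') = r + m + k'" by simp
    ultimately have "(\<Sum>i = - int M..int M. fls_nth (fps_to_fls h') i * d (n - i)) - y n \<in> mp r" if "M \<ge> N" for M
      using N[OF that] by (simp only: \<pi>_powi_mult_mp)
    then show "\<exists>N. \<forall>M\<ge>N. (\<Sum>i = - int M..int M. fls_nth (fps_to_fls h') i * d (n - i)) - y n \<in> mp r" by blast
  qed
  have y: "y n \<in> mp 0" "res (y n) = fls_nth (fps_to_fls (red h') * D) n" for n
    by (rule res_double_product[OF h'(2) d(1) _ lim' D, where l = l], erule d(2))+
  have "fls_nth D j \<noteq> 0" unfolding D using d(3) res_zero_iff[OF d(1)[of j]] by blast
  then have "D \<noteq> 0" by auto
  then have "fps_to_fls (red h') * D \<noteq> 0" using h'(3) by simp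
  then obtain n1 where n1: "fls_nth (fps_to_fls (red h') * D) n1 \<noteq> 0" by (metis fls_eqI fls_zero_nth)
  have "y n1 \<notin> mp 1" using n1 y(2)[of n1] res_zero_iff[OF y(1)[of n1]] by metis
  have g0: "fls_nth (fps_to_fls g') n \<in> mp 0" for n using g'(2) by (simp add: fint_def)
  have "\<exists>n. fls_nth (fps_to_fls g') n \<notin> mp 1"
  proof -
    obtain i where "fps_nth (red g') i \<noteq> 0" using g'(3) by (auto simp: fps_eq_iff)
    then have "fps_nth g' i \<notin> mp 1" using res_zero_iff[of "fps_nth g' i"] g'(2) by (simp add: fint_def)
    then show ?thesis by (intro exI[of _ "int i"]) simp
  qed
  then obtain n2 where n2: "fls_nth (fps_to_fls g') n2 \<notin> mp 1" by blast
  have "\<not> q > 0"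
  proof
    assume "q > 0"
    then have "y n1 \<in> mp 1" unfolding y_def \<pi>_powi_mult_mp using g0[of n1] mp_antimono[of "1 - q" 0] by auto
    then show False using \<open>y n1 \<notin> mp 1\<close> by blast
  qed
  moreover have "\<not> q < 0"
  proof
    assume "q < 0"
    then have "fls_nth (fps_to_fls g') n2 \<in> mp 1"
      using y(1)[of n2] mp_antimono[of 1 "0 - q"] unfolding y_def \<pi>_powi_mult_mp by auto
    then show False using n2 by blast
  qed
  ultimately have q: "q = 0" by simp
  have "D * fps_to_fls (red h') = fps_to_fls (red g')"
  proof (rule fls_eqI)
    fix n
    have "fls_nth (D * fps_to_fls (red h')) n = res (fls_nth (fps_to_fls g') n)"
      using y(2)[of n] by (simp add: y_def q mult.commute)
    then show "fls_nth (D * fps_to_fls (red h')) n = fls_nth (fps_to_fls (red g')) n" by auto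
  qed
  moreover have "f * fps_to_fls h' = fls_const (\<pi> powi m) * fps_to_fls g'"
  proof -
    have "f * fps_to_fls h = fps_to_fls g" using gh(3,4) by simp
    then have "fls_const (\<pi> powi k') * (f * fps_to_fls h') = fls_const (\<pi> powi k) * fps_to_fls g'"
      by (simp add: g'(1) h'(1) fls_times_fps_to_fls mult_ac)
    then have "fls_const (\<pi> powi - k' * \<pi> powi k') * (f * fps_to_fls h') = fls_const (\<pi> powi - k' * \<pi> powi k) * fps_to_fls g'"
      by (simp flip: fls_const_mult_const add: mult.assoc)
    moreover have "\<pi> powi - k' * \<pi> powi k' = 1" using \<pi>_nonzero by (simp add: power_int_minus)
    moreover have "\<pi> powi - k' * \<pi> powi k = \<pi> powi m"
      using \<pi>_nonzero q by (simp add: q_def flip: power_int_add)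
    ultimately show ?thesis by simp
  qed
  ultimately show ?thesis using g' h' unfolding D_def by blast
qed

text \<open>The square of \<eta> changes the order by an even number and the leading coefficient by
  a nonzero square.\<close>

lemma bar_leading_coefficient:
  fixes D \<eta> :: "'f fls"
  assumes eq: "D * (\<eta> * \<eta>) = fls_X ^ (2 * a + n) * fps_to_fls u" and u: "fps_nth u 0 \<noteq> 0"
  shows "D \<noteq> 0" and "even (fls_subdegree D) \<longleftrightarrow> even n"
    and "\<exists>\<alpha>. \<alpha> \<noteq> 0 \<and> fls_nth D (fls_subdegree D) * \<alpha>\<^sup>2 = fps_nth u 0"
proof -
  have "u \<noteq> 0" using u by (metis fps_zero_nth)
  then have "fps_to_fls u \<noteq> 0" by simp
  then have "fls_X ^ (2 * a + n) * fps_to_fls u \<noteq> 0" by (simp only: mult_eq_0_iff power_eq_0_iff fls_X_nonzero) simp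
  then have "D * (\<eta> * \<eta>) \<noteq> 0" by (simp only: eq not_False_eq_True)
  then have D: "D \<noteq> 0" and \<eta>: "\<eta> \<noteq> 0" by (metis mult_zero_left mult_zero_right)+
  show "D \<noteq> 0" by (rule D)
  have su: "fls_subdegree (fps_to_fls u) = 0" using u by (simp add: fls_subdegree_fls_to_fps subdegree_eq_0)
  have "fls_subdegree (D * (\<eta> * \<eta>)) = fls_subdegree D + 2 * fls_subdegree \<eta>" using D \<eta> by simp
  moreover have "fls_subdegree (fls_X ^ (2 * a + n) * fps_to_fls u) = int (2 * a + n)"
    unfolding fls_subdegree_mult[OF power_not_zero[OF fls_X_nonzero] \<open>fps_to_fls u \<noteq> 0\<close>] su by (simp add: fls_subdegree_pow)
  ultimately have sd: "fls_subdegree D + 2 * fls_subdegree \<eta> = int (2 * a + n)" using eq by simp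
  then show "even (fls_subdegree D) \<longleftrightarrow> even n" by presburger
  have v: "\<forall>i<fls_subdegree x. fls_nth x i = 0" for x :: "'f fls" by simp
  note 1 = fls_mult_vanish_below[OF v v, of \<eta> \<eta>]
  have "fls_nth (D * (\<eta> * \<eta>)) (fls_subdegree D + (fls_subdegree \<eta> + fls_subdegree \<eta>)) =
      fls_nth D (fls_subdegree D) * (fls_nth \<eta> (fls_subdegree \<eta>))\<^sup>2"
    using fls_mult_vanish_below(2)[OF v[of D] 1(1)] 1(2) by (simp add: power2_eq_square)
  moreover have "fls_subdegree D + (fls_subdegree \<eta> + fls_subdegree \<eta>) = int (2 * a + n)" using sd by simp
  moreover have "fls_nth (fls_X ^ (2 * a + n) * fps_to_fls u) (int (2 * a + n)) = fps_nth u 0"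
    by (simp add: fls_X_power_times_conv_shift)
  ultimately show "\<exists>\<alpha>. \<alpha> \<noteq> 0 \<and> fls_nth D (fls_subdegree D) * \<alpha>\<^sup>2 = fps_nth u 0"
    using eq \<eta> by (intro exI[of _ "fls_nth \<eta> (fls_subdegree \<eta>)"]) simp
qed

end

section \<open>The product formula\<close>

lemma irreducible_dvd_prod:
  fixes P :: "'k::field poly"
  assumes P: "irreducible P" and fin: "finite S" and dvd: "P dvd \<Prod>S"
  shows "\<exists>Q\<in>S. P dvd Q"
  using fin dvd
proof induction
  case empty
  then show ?case using P irreducible_not_unit by auto
next
  case (insert Q S)
  then have "P dvd Q \<or> P dvd \<Prod>S"
    using prime_elem_dvd_mult_iff[OF field_poly_irreducible_imp_prime[OF P], of Q "\<Prod>S"] by simp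
  then show ?case using insert.IH by blast
qed

lemma unit_positive_eq_one:
  fixes x :: complex
  assumes "norm x = 1" "x = of_real t" "t \<ge> 0" shows "x = 1"
  using assms by simp

context local_field
begin

text \<open>Euler's formula replaces the trace by \<open>top_coeff\<close> at the price of a factor
  P', and \<open>c0 * pderiv P\<close> enters only through its class modulo P.\<close>

lemma gamma_P_eq:
  assumes P: "lead_coeff P = 1" and n: "odd n"
    and c0: "(c0 * pderiv P) mod P = (w * C * (z * z)) mod P"
  shows "gamma_P v \<psi> P n c0 = weil_index (additive_group (residue_polys P)) (residue_poly_topology v P)
    (\<lambda>x. \<psi> (top_coeff P (smult (1 / 2) (w * C * (z * z) * x\<^sup>2))))"
proof -
  have "residue_trace P (smult (1 / 2) (c0 * x\<^sup>2)) = top_coeff P (smult (1 / 2) (w * C * (z * z) * x\<^sup>2))" for x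
  proof -
    have "residue_trace P (smult (1 / 2) (c0 * x\<^sup>2)) = top_coeff P (smult (1 / 2) ((c0 * pderiv P) * x\<^sup>2))"
      unfolding residue_trace_eq[OF P] by (simp add: mult_ac)
    also have "\<dots> = 1 / 2 * top_coeff P ((c0 * pderiv P) * x\<^sup>2)" by (rule top_coeff_smult)
    also have "top_coeff P ((c0 * pderiv P) * x\<^sup>2) = top_coeff P (w * C * (z * z) * x\<^sup>2)"
      by (rule top_coeff_cong) (rule mod_mult_cong[OF c0 refl])
    finally show ?thesis by (simp only: top_coeff_smult)
  qed
  then show ?thesis using n by (simp add: gamma_P_def)
qed

text \<open>The product of the two Gauss sums is \<open>\<bar>\<Sum>\<^sub>a \<psi>\<^sub>0 (r\<^sub>0 a\<^sup>2 / 2)\<bar>\<^sup>2\<close> up to a positive factor.\<close>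

lemma gauss_sums_cancel:
  assumes k: "\<kappa> > 0" "X = of_real \<kappa> * (\<Sum>a\<in>UNIV. \<psi>0 (r0 * a\<^sup>2 / 2))"
    and k': "\<kappa>' > 0" "(\<Sum>a\<in>UNIV. cnj (\<psi>0 (d * a\<^sup>2 / 2))) = of_real \<kappa>' * Y"
    and d: "\<alpha> \<noteq> 0" "d * \<alpha>\<^sup>2 = r0" and norm: "norm X = 1" "norm Y = 1"
  shows "Y * X = 1"
proof -
  let ?S = "\<Sum>a\<in>UNIV. \<psi>0 (r0 * a\<^sup>2 / 2)"
  \<comment> \<open>\<open>d\<close> and \<open>r0\<close> differ by the square of \<alpha>, which
    the substitution of \<alpha> a for a removes.\<close>
  have "bij (\<lambda>a. \<alpha> * a)" using d(1) by (intro bijI') (auto intro: exI[of _ "_ / \<alpha>"])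
  then have "(\<Sum>a\<in>UNIV. cnj (\<psi>0 (d * a\<^sup>2 / 2))) = (\<Sum>a\<in>UNIV. cnj (\<psi>0 (d * (\<alpha> * a)\<^sup>2 / 2)))"
    by (rule sum.reindex_bij_betw[symmetric])
  also have "\<dots> = cnj ?S" by (simp add: d(2)[symmetric] power_mult_distrib mult.assoc)
  finally have "of_real \<kappa>' * Y = cnj ?S" using k'(2) by simp
  then have Y: "Y = of_real (1 / \<kappa>') * cnj ?S" using k'(1) by (simp add: field_simps)
  have "Y * X = of_real (\<kappa> / \<kappa>') * (?S * cnj ?S)" unfolding Y k(2) by (simp add: mult_ac)
  also have "\<dots> = of_real (\<kappa> / \<kappa>' * (norm ?S)\<^sup>2)" by (simp only: complex_norm_square of_real_mult)
  finally have "Y * X = of_real (\<kappa> / \<kappa>' * (norm ?S)\<^sup>2)" .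
  then show ?thesis
    by (rule unit_positive_eq_one[rotated]) (use k(1) k'(1) norm in \<open>simp_all add: norm_mult\<close>)
qed

theorem product_formula:
  assumes f: "f \<in> FF" "f \<noteq> 0"
    and exp: "\<And>P. irreducible_distinguished v P \<Longrightarrow> has_expansion_at v P f (n P) (c0 P)"
    and im: "image_in_double_series v f a"
  defines "\<G> \<equiv> \<lambda>P. gamma_P v \<psi> P (n P) (c0 P 0)"
  shows "finite {P. irreducible_distinguished v P \<and> \<G> P \<noteq> 1} \<and>
    gamma_p v res \<pi> \<psi> c a * (\<Prod>P | irreducible_distinguished v P \<and> \<G> P \<noteq> 1. \<G> P) = 1"
proof -
  define m where "m = double_series_ord v a"
  define D where "D = double_series_bar v res \<pi> a"
  obtain g h where gh: "g \<in> fint 0" "h \<in> fint 0" "red g \<noteq> 0" "red h \<noteq> 0"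
    and fgh: "f * fps_to_fls h = fls_const (\<pi> powi m) * fps_to_fls g"
    and Dgh: "D * fps_to_fls (red h) = fps_to_fls (red g)"
    using image_in_double_series_normalize[OF im f(2)] unfolding m_def D_def by blast
  have "red (g * h) \<noteq> 0" using gh by (simp add: red_mult)
  then obtain W u u' where W: "distinguished0 W" "g * h = fps_of_poly W * u" and u: "u \<in> fint 0" "u' \<in> fint 0" "u * u' = 1"
    using weierstrass_preparation[OF fint_mult0[OF gh(1,2)]] by blast
  have "lead_coeff W = 1" using W(1) by (simp add: distinguished0_def)
  then obtain A R where AR: "W = A * A * R" "lead_coeff A = 1" "lead_coeff R = 1" "\<forall>T. T * T dvd R \<longrightarrow> degree T = 0"
    using monic_square_decomposition by blast
  have AA: "lead_coeff (A * A) = 1" using AR(2) by (simp add: lead_coeff_mult)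
  have R: "distinguished0 R"
    using distinguished0_factor[of R "A * A"] W(1) AR AA by (simp add: mult.commute)
  obtain \<P> where \<P>: "finite \<P>" "\<And>P. P \<in> \<P> \<Longrightarrow> lead_coeff P = 1" "\<And>P. P \<in> \<P> \<Longrightarrow> irreducible P" "R = \<Prod>\<P>"
    using monic_squarefree_factorization[OF AR(3)] AR(4) by blast
  have \<P>_dvd: "P dvd R" if "P \<in> \<P>" for P unfolding \<P>(4) using \<P>(1) that by (intro dvd_prodI) auto
  have \<P>_dist: "irreducible_distinguished v P" if "P \<in> \<P>" for P
    by (rule monic_irreducible_distinguished[OF \<P>(2,3)[OF that] R \<P>_dvd[OF that]])
  have not_dvd: "\<not> P dvd \<Prod>S" if P: "irreducible_distinguished v P" "P \<notin> S" "S \<subseteq> \<P>" for P S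
  proof
    note P' = irreducible_distinguished_irreducible[OF P(1)]
    assume "P dvd \<Prod>S"
    then obtain Q where "Q \<in> S" "P dvd Q" using irreducible_dvd_prod[OF P'(5)] finite_subset[OF P(3) \<P>(1)] by blast
    then have "P = Q" using monic_dvd_eq[OF P'(3) _ P'(5)] \<P>(2,3) P(3) by blast
    then show False using \<open>Q \<in> S\<close> P(2) by blast
  qed
  define G where "G = poly_to_fls A"
  define H where "H = fps_to_fls h"
  have GH: "G \<in> FF" "G \<noteq> 0" "H \<in> FF" "H \<noteq> 0"
  proof -
    show "G \<in> FF" unfolding G_def by (rule FF_poly)
    show "H \<in> FF" unfolding H_def by (rule FF_fps[OF gh(2)])
    have "A \<noteq> 0" using AR(2) by auto
    then show "G \<noteq> 0" unfolding G_def poly_to_fls_def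
      by (metis fps_of_poly_0 fps_of_poly_eq_iff fps_to_fls_eq_0_iff)
    have "h \<noteq> 0"
    proof
      assume "h = 0"
      then have "red h = 0" by (intro fps_ext) simp
      then show False using gh(4) by simp
    qed
    then show "H \<noteq> 0" by (simp add: H_def)
  qed
  have eq: "f * (H * H) = (G * G) * (fls_const (\<pi> powi m) * (poly_to_fls R * fps_to_fls u))"
  proof -
    have "f * (H * H) = fls_const (\<pi> powi m) * (fps_to_fls g * fps_to_fls h)"
      using fgh by (simp add: H_def mult.assoc[symmetric])
    also have "fps_to_fls g * fps_to_fls h = poly_to_fls W * fps_to_fls u"
      using W(2) by (simp add: poly_to_fls_def flip: fls_times_fps_to_fls)
    also have "poly_to_fls W = G * G * poly_to_fls R" unfolding AR(1) poly_to_fls_mult G_def ..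
    finally show ?thesis by (simp only: mult_ac)
  qed
  note ems = expansion_mod_squares[OF _ exp f GH eq u]
  have \<G>1: "\<G> P = 1" if "irreducible_distinguished v P" "P \<notin> \<P>" for P
    using ems(1)[OF that(1) that(1)] not_dvd[OF that] \<P>(4) by (simp add: \<G>_def gamma_P_def)
  then have sub: "{P. irreducible_distinguished v P \<and> \<G> P \<noteq> 1} \<subseteq> \<P>" by blast
  then have fin: "finite {P. irreducible_distinguished v P \<and> \<G> P \<noteq> 1}" using \<P>(1) finite_subset by blast
  have prod: "(\<Prod>P | irreducible_distinguished v P \<and> \<G> P \<noteq> 1. \<G> P) = prod \<G> \<P>"
    by (rule prod.mono_neutral_left[OF \<P>(1) sub]) (use \<P>_dist in blast)
  define \<rho> where "\<rho> = fps_nth (red u) 0"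
  have "fps_nth (red u) 0 * fps_nth (red u') 0 = 1"
    using red_mult[OF u(1,2)] u(3) by (metis fps_mult_nth_0 red_nth fps_one_nth res_one)
  then have \<rho>: "\<rho> \<noteq> 0" by (auto simp: \<rho>_def)
  \<comment> \<open>Reduction of \<open>g * h = W * u\<close>: the distinguished \<open>W\<close>
    becomes a power of the variable, and \<open>D\<close> times the square of \<open>red h\<close>
    is the same product.\<close>
  have DH: "D * (fps_to_fls (red h) * fps_to_fls (red h)) = fls_X ^ (2 * degree A + degree R) * fps_to_fls (red u)"
  proof -
    have "A \<noteq> 0" "R \<noteq> 0" using AR(2,3) by auto
    then have "degree W = 2 * degree A + degree R" unfolding AR(1) by (simp add: degree_mult_eq)
    then have "rd W = fps_X ^ (2 * degree A + degree R)" using W(1) by (simp add: distinguished0_def)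
    moreover have "fps_of_poly W \<in> fint 0" using W(1) by (simp add: distinguished0_def fint_poly)
    ultimately have red: "red g * red h = fps_X ^ (2 * degree A + degree R) * red u"
      using red_mult[OF gh(1,2)] W(2) red_mult[OF _ u(1), of "fps_of_poly W"] by simp
    have "D * (fps_to_fls (red h) * fps_to_fls (red h)) = fps_to_fls (red g * red h)"
      unfolding mult.assoc[symmetric] Dgh by (simp only: fls_times_fps_to_fls)
    then show ?thesis unfolding red by (simp add: fls_times_fps_to_fls fps_to_fls_power)
  qed
  have D: "D \<noteq> 0" "even (fls_subdegree D) \<longleftrightarrow> even (degree R)"
    "\<exists>\<alpha>. \<alpha> \<noteq> 0 \<and> fls_nth D (fls_subdegree D) * \<alpha>\<^sup>2 = \<rho>"
    using bar_leading_coefficient[OF DH] \<rho> unfolding \<rho>_def by blast+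
  define \<Gamma> where "\<Gamma> = weil_index (additive_group UNIV) euclidean (\<lambda>x. \<psi>p (fls_const (1 / 2) * D * x\<^sup>2))"
  have gp: "gamma_p v res \<pi> \<psi> c a = (if even (m - c) then 1 else \<Gamma>)"
    unfolding gamma_p_def \<Gamma>_def D_def m_def ..
  have gp_even: "gamma_p v res \<pi> \<psi> c a = 1" if "even (m - c) \<or> even (degree R)"
    using that gp weil_index_fls_even[OF D(1)] D(2) unfolding \<Gamma>_def by auto
  have "gamma_p v res \<pi> \<psi> c a * prod \<G> \<P> = 1"
  proof (cases "\<P> = {}")
    case True
    then have "degree R = 0" using \<P>(4) by simp
    then show ?thesis using gp_even True by simp
  next
    case False
    then obtain P0 where P0: "P0 \<in> \<P>" by blast
    have "R \<noteq> 0" using AR(3) by auto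
    then have degR: "degree R \<ge> 1"
      using dvd_imp_degree_le[OF \<P>_dvd[OF P0]] irreducible_degree_pos[OF \<P>(3)[OF P0]] by linarith
    obtain q r r' where q: "u = fps_of_poly R * q + fps_of_poly r" "q \<in> fint 0" and r: "r \<in> pint 0" "r' \<in> pint 0" "(r * r') mod R = 1"
      and r0: "res (coeff r 0) = \<rho>"
      using unit_remainder[OF R degR u] unfolding \<rho>_def by metis
    have r0': "res (coeff r 0) \<noteq> 0" using r0 \<rho> by simp
    have "\<exists>w w'. odd (n P) \<and> (w * w') mod P = 1 \<and>
        (c0 P 0 * pderiv P) mod P = (smult (\<pi> powi m) (\<Prod>(\<P> - {P}) * r) * (w * w)) mod P" if P: "P \<in> \<P>" for P
    proof -
      have "R = P * \<Prod>(\<P> - {P})" unfolding \<P>(4) by (rule prod.remove[OF \<P>(1) P])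
      from ems(2)[OF \<P>_dist[OF P] \<P>_dist[OF P] this not_dvd[OF \<P>_dist[OF P]] q] show ?thesis by blast
    qed
    then obtain w w' where ww: "\<And>P. P \<in> \<P> \<Longrightarrow> odd (n P)" "\<And>P. P \<in> \<P> \<Longrightarrow> (w P * w' P) mod P = 1"
      "\<And>P. P \<in> \<P> \<Longrightarrow> (c0 P 0 * pderiv P) mod P = (smult (\<pi> powi m) (\<Prod>(\<P> - {P}) * r) * (w P * w P)) mod P"
      by metis
    \<comment> \<open>m = (c - d) + 2 \<nu> with d equal to 0 or 1: the even part of the power of
      \<pi> is moved into the scalings of the components, which leaves the form with coefficient
      \<pi>^(c-d) r.\<close>
    define d where "d = (c - m) mod 2"
    define \<nu> where "\<nu> = (m - c + d) div 2"
    have d01: "d = 0 \<or> d = 1" "even (m - c) \<longleftrightarrow> d = 0" and m: "m = (c - d) + (\<nu> + \<nu>)"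
      unfolding d_def \<nu>_def by presburger+
    let ?z = "\<lambda>P. smult (\<pi> powi \<nu>) (w P)" and ?z' = "\<lambda>P. smult (\<pi> powi (- \<nu>)) (w' P)"
    let ?w = "smult (\<pi> powi (c - d)) r" and ?w' = "smult (\<pi> powi (- (c - d))) r'"
    have inv: "\<pi> powi k * \<pi> powi (- k) = 1" for k using \<pi>_powi_cancel(1)[of k 1] by simp
    interpret RP: residue_product v res \<pi> \<psi> c \<P> ?z ?z' ?w ?w'
    proof
      show "finite \<P>" "\<P> \<noteq> {}" by (fact \<P>(1), fact False)
      fix P assume P: "P \<in> \<P>"
      show "lead_coeff P = 1" "irreducible P" by (fact \<P>(2)[OF P], fact \<P>(3)[OF P])
      show "P \<in> pint 0" by (rule irreducible_distinguished_irreducible(4)[OF \<P>_dist[OF P]])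
      have "?z P * ?z' P = smult (\<pi> powi \<nu> * \<pi> powi (- \<nu>)) (w P * w' P)" by (simp add: mult_ac)
      then show "(?z P * ?z' P) mod P = 1" unfolding inv using ww(2)[OF P] by simp
      have "?w * ?w' = smult (\<pi> powi (c - d) * \<pi> powi (- (c - d))) (r * r')" by (simp add: mult_ac)
      then have "?w * ?w' = r * r'" unfolding inv by simp
      moreover have "1 mod R = 1" using degR by (intro mod_poly_less) simp
      then have "R dvd r * r' - 1" using r(3) by (simp add: mod_eq_iff_dvd[symmetric])
      then have "P dvd r * r' - 1" using \<P>_dvd[OF P] by (rule dvd_trans[rotated])
      then have "(r * r') mod P = 1 mod P" by (simp add: mod_eq_iff_dvd)
      moreover have "1 mod P = 1" using irreducible_degree_pos[OF \<P>(3)[OF P]] by (intro mod_poly_less) simp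
      ultimately show "(?w * ?w') mod P = 1" by simp
    qed
    have R_eq: "RP.R = R" unfolding RP.R_def \<P>(4) ..
    have \<G>: "\<G> P = RP.weilP P" if P: "P \<in> \<P>" for P
    proof -
      have "\<pi> powi m = \<pi> powi (c - d) * (\<pi> powi \<nu> * \<pi> powi \<nu>)"
        unfolding m by (simp only: power_int_add[OF disjI1[OF \<pi>_nonzero]])
      then have "smult (\<pi> powi m) (\<Prod>(\<P> - {P}) * r) * (w P * w P) = ?w * RP.C P * (?z P * ?z P)"
        by (simp add: RP.C_def mult_ac)
      then show ?thesis
        unfolding \<G>_def RP.hP_def using ww(3)[OF P] by (intro gamma_P_eq[OF \<P>(2)[OF P] ww(1)[OF P]]) simp
    qed
    then have pr: "prod \<G> \<P> = prod RP.weilP \<P>" by (intro prod.cong) auto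
    have norm: "norm (prod \<G> \<P>) = 1"
      unfolding pr using RP.norm_weilP by (simp add: prod_norm[symmetric])
    have pw: "\<exists>\<kappa>::real. \<kappa> > 0 \<and> prod \<G> \<P> = of_real \<kappa> * sum RP.H R0"
      if "add_subgroup L0" "add_subgroup L" "rlattice R k \<subseteq> L0" "L0 \<subseteq> L" "L \<subseteq> rlattice R 0"
        "\<And>x. x \<in> residue_polys R \<Longrightarrow> x \<in> L \<longleftrightarrow> (\<forall>y\<in>L0. \<psi> (top_coeff R (?w * y * x)) = 1)"
        "\<And>x. x \<in> L0 \<Longrightarrow> RP.H x = 1" "transversal R0 L L0" for L0 L k R0
      unfolding pr by (rule RP.prod_weil_index[unfolded R_eq, OF that])
    have formal: "RP.H x = \<psi> (top_coeff R (smult (1 / 2) (smult (\<pi> powi (c - d)) r * x\<^sup>2)))" for x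
      unfolding RP.H_def R_eq ..
    have zero: "transversal {0} L L" if "add_subgroup L" for L :: "'k poly set"
      using that by (intro transversalI) (auto simp: add_subgroup_zero)
    have H0: "sum RP.H {0} = 1" by (simp add: RP.H_def)
    have one: "prod \<G> \<P> = 1" if ex: "\<exists>\<kappa>::real. \<kappa> > 0 \<and> prod \<G> \<P> = of_real \<kappa> * sum RP.H {0}"
    proof -
      obtain \<kappa> :: real where "\<kappa> > 0" "prod \<G> \<P> = of_real \<kappa>" using ex unfolding H0 by auto
      then show ?thesis using unit_positive_eq_one[OF norm] by simp
    qed
    consider "d = 0" | "d = 1" "even (degree R)" | "d = 1" "odd (degree R)" using d01 by blast
    then show ?thesis
    proof cases
      \<comment> \<open>For the coefficient \<pi>^c r the integral lattice is its own orthogonal and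
        the form is trivial on it.\<close>
      case 1
      have "prod \<G> \<P> = 1"
      proof (rule one, rule pw[of "rlattice R 0" "rlattice R 0" 0])
        show "add_subgroup (rlattice R 0)" by (rule rlattice_group[OF degR])
        show "add_subgroup (rlattice R 0)" by (rule rlattice_group[OF degR])
        show "x \<in> rlattice R 0 \<longleftrightarrow> (\<forall>y\<in>rlattice R 0. \<psi> (top_coeff R (?w * y * x)) = 1)" if "x \<in> residue_polys R" for x
          using lattice_perp[OF R degR r r0' that, of 0 c] 1 by simp
        show "RP.H x = 1" if "x \<in> rlattice R 0" for x
        proof -
          have "smult (1 / 2) (r * x\<^sup>2) \<in> pint (0 + (0 + (0 + 0)))"
            unfolding power2_eq_square using that by (intro pint_smult pint_mult half_mp r(1)) (auto simp: rlattice_def)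
          then have "smult (\<pi> powi c) (smult (1 / 2) (r * x\<^sup>2)) \<in> pint (c + 0)" by (intro pint_smult) auto
          then have "top_coeff R (smult (\<pi> powi c) (smult (1 / 2) (r * x\<^sup>2))) \<in> mp c"
            using R by (intro top_coeff_pint) (auto simp: distinguished0_def)
          then show ?thesis unfolding formal using 1 \<psi>_trivial by (simp add: mult.commute)
        qed
        show "transversal {0} (rlattice R 0) (rlattice R 0)" by (rule zero[OF rlattice_group[OF degR]])
      qed auto
      then show ?thesis using gp_even 1 d01(2) by simp
    next
      \<comment> \<open>\<open>shallow R e\<close> is its own orthogonal, because \<open>e\<close>
        is half the degree.\<close>
      case 2
      then obtain e where e: "degree R = 2 * e" by (elim evenE)
      have "prod \<G> \<P> = 1"
      proof (rule one, rule pw[of "shallow R e" "shallow R e" 1])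
        show "add_subgroup (shallow R e)" by (rule shallow_group[OF degR])
        show "add_subgroup (shallow R e)" by (rule shallow_group[OF degR])
        show "rlattice R 1 \<subseteq> shallow R e" "shallow R e \<subseteq> rlattice R 0" by (fact shallow_incl(2), fact shallow_incl(3))
        show "x \<in> shallow R e \<longleftrightarrow> (\<forall>y\<in>shallow R e. \<psi> (top_coeff R (?w * y * x)) = 1)" if "x \<in> residue_polys R" for x
          using shallow_perp[OF R degR r r0' _ that, of e] 2(1) e by simp
        show "RP.H x = 1" if "x \<in> shallow R e" for x
          unfolding formal using form_trivial[OF R degR r r0' that] 2(1) e by simp
        show "transversal {0} (shallow R e) (shallow R e)" by (rule zero[OF shallow_group[OF degR]])
      qed auto
      then show ?thesis using gp_even 2 by simp
    next
      \<comment> \<open>The orthogonal of \<open>shallow R (Suc e)\<close> is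
        \<open>shallow R e\<close>, and the quotient is a line over the residue field. This is the
        one case that leaves a genuine Gauss sum, to be cancelled by that of the Laurent series
        side.\<close>
      case 3
      then obtain e where e: "degree R = 2 * e + 1" by (elim oddE)
      have "\<exists>\<kappa>::real. \<kappa> > 0 \<and> prod \<G> \<P> = of_real \<kappa> * sum RP.H (range (\<lambda>a. monom (lift a) e))"
      proof (rule pw[of "shallow R (Suc e)" "shallow R e" 1])
        show "add_subgroup (shallow R (Suc e))" "add_subgroup (shallow R e)" by (rule shallow_group[OF degR])+
        show "rlattice R 1 \<subseteq> shallow R (Suc e)" "shallow R (Suc e) \<subseteq> shallow R e" "shallow R e \<subseteq> rlattice R 0"
          by (fact shallow_incl(2), rule shallow_incl(1), simp, fact shallow_incl(3))
        show "x \<in> shallow R e \<longleftrightarrow> (\<forall>y\<in>shallow R (Suc e). \<psi> (top_coeff R (?w * y * x)) = 1)" if "x \<in> residue_polys R" for x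
          using shallow_perp[OF R degR r r0' _ that, of "Suc e"] 3(1) e by simp
        show "RP.H x = 1" if "x \<in> shallow R (Suc e)" for x
          unfolding formal using form_trivial[OF R degR r r0' that] 3(1) e by simp
        show "transversal (range (\<lambda>a. monom (lift a) e)) (shallow R e) (shallow R (Suc e))"
          by (rule transversal_shallow[OF R degR r r0']) (simp add: e)
      qed
      then obtain \<kappa> :: real where k: "\<kappa> > 0" "prod \<G> \<P> = of_real \<kappa> * (\<Sum>a\<in>UNIV. \<psi>0 (\<rho> * a\<^sup>2 / 2))"
        unfolding formal using form_sum_odd[OF R degR r r0' e] 3(1) r0 by auto
      have "odd (fls_subdegree D)" using D(2) 3(2) by simp
      from weil_index_fls_odd[OF D(1) this] obtain \<kappa>' :: real where
        k': "\<kappa>' > 0" "(\<Sum>a\<in>UNIV. cnj (\<psi>0 (fls_nth D (fls_subdegree D) * a\<^sup>2 / 2))) = of_real \<kappa>' * \<Gamma>"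
        unfolding \<Gamma>_def by blast
      obtain \<alpha> where \<alpha>: "\<alpha> \<noteq> 0" "fls_nth D (fls_subdegree D) * \<alpha>\<^sup>2 = \<rho>" using D(3) by blast
      have "norm \<Gamma> = 1" unfolding \<Gamma>_def by (rule norm_weil_index_fls[OF D(1)])
      then have "\<Gamma> * prod \<G> \<P> = 1" by (rule gauss_sums_cancel[OF k k' \<alpha> norm])
      then show ?thesis using gp 3(1) d01(2) by simp
    qed
  qed
  then show ?thesis using fin prod by simp
qed

end

text \<open>The finiteness of the residue field is the point with content: by density every residue
  is attained on the Dedekind domain, and the residue of \<open>\<iota> a\<close> depends only on
  \<open>a\<close> modulo \<open>p\<close>.\<close>

lemma completion_local_field:
  fixes p :: "'o::idom set" and v :: "'k::field_char_0 \<Rightarrow> int" and res :: "'k \<Rightarrow> 'f::field"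
  assumes fin: "finite (residue_classes p)" and p: "is_prime_ideal p" and comp: "is_completion_at p \<iota> v"
    and res: "is_residue_map v res" and odd: "odd CHAR('f)" and \<pi>: "\<pi> \<noteq> 0" "v \<pi> = 1"
    and \<psi>: "additive_character v \<psi>" and cond: "has_conductor v \<psi> c"
  shows "local_field v res \<pi> \<psi> c"
proof
  show "discrete_valuation v" using comp by (simp add: is_completion_at_def)
  show "\<exists>L. limitin (valuation_topology v) X L sequentially"
    if "\<forall>n. \<exists>N::nat. \<forall>i\<ge>N. \<forall>j\<ge>N. X i - X j \<in> max_power v n" for X
    using comp that by (simp add: is_completion_at_def)
  have hom: "\<psi> \<in> hom (additive_group UNIV) circle_group"
    using \<psi> by (simp add: additive_character_def dual_group_def)
  show "\<psi> (x + y) = \<psi> x * \<psi> y" "norm (\<psi> x) = 1" for x y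
    using hom by (auto simp: hom_def additive_group_def circle_group_def)
  have \<iota>: "\<iota> (a + b) = \<iota> a + \<iota> b" "a \<in> ideal_power p n \<longleftrightarrow> \<iota> a \<in> max_power v (int n)"
    "x \<in> max_power v 0 \<Longrightarrow> \<exists>a. x - \<iota> a \<in> max_power v k" for a b n x k
    using comp by (auto simp: is_completion_at_def)
  have \<iota>_diff: "\<iota> (a - b) = \<iota> a - \<iota> b" for a b using \<iota>(1)[of "a - b" b] by simp
  have \<iota>_int: "\<iota> a \<in> max_power v 0" for a using \<iota>(2)[of a 0] by simp
  have res_eq: "res x = res y" if xy: "x \<in> max_power v 0" "y \<in> max_power v 0" "x - y \<in> max_power v 1" for x y
  proof -
    have "x - y \<in> max_power v 0" using xy(3) by (auto simp: max_power_def)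
    then have "res (x - y + y) = res (x - y) + res y" using res xy(2) unfolding is_residue_map_def by blast
    moreover have "res (x - y) = 0" using res xy(3) \<open>x - y \<in> max_power v 0\<close> unfolding is_residue_map_def by blast
    ultimately show ?thesis by simp
  qed
  define cl where "cl a = {b. a - b \<in> p}" for a
  interpret module "(*) :: 'o \<Rightarrow> 'o \<Rightarrow> 'o" by unfold_locales (simp_all add: algebra_simps)
  have sub: "subspace p" using p by (simp add: is_prime_ideal_def is_ideal_def)
  \<comment> \<open>\<open>ideal_power p 1\<close> is the span of the products with the unit ideal,
    hence \<open>p\<close> itself; so the valuation detects membership in \<open>p\<close>.\<close>
  have "{a * b | a b. a \<in> p \<and> b \<in> ideal_power p 0} = p"
    using subspace_scale[OF sub] by (auto simp: mult.commute) (metis mult.right_neutral)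
  then have "ideal_power p 1 = span p" by (simp only: One_nat_def ideal_power.simps(2))
  also have "span p = p" using sub by (rule span_eq_iff[THEN iffD2])
  finally have p1: "p = ideal_power p 1" by (rule sym)
  have cl: "res (\<iota> a) = res (\<iota> b)" if "cl a = cl b" for a b
  proof -
    have "0 \<in> p" by (rule subspace_0[OF sub])
    then have "b \<in> cl a" using that by (auto simp: cl_def)
    then have "\<iota> (a - b) \<in> max_power v 1" using \<iota>(2)[of "a - b" 1] p1 by (simp add: cl_def)
    then show ?thesis using res_eq[OF \<iota>_int \<iota>_int] by (simp add: \<iota>_diff)
  qed
  have "range cl = residue_classes p" by (auto simp: residue_classes_def quotient_def cl_def)
  then have "finite (range cl)" using fin by simp
  moreover have "UNIV \<subseteq> (\<lambda>X. res (\<iota> (SOME a. cl a = X))) ` range cl"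
  proof
    fix y :: 'f
    have "y \<in> res ` max_power v 0" using res unfolding is_residue_map_def by blast
    then obtain x where x: "x \<in> max_power v 0" "res x = y" by blast
    obtain a where a: "x - \<iota> a \<in> max_power v 1" using \<iota>(3)[OF x(1)] by blast
    have "cl (SOME b. cl b = cl a) = cl a" by (rule someI[of _ a]) simp
    then have "res (\<iota> (SOME b. cl b = cl a)) = y" using cl res_eq[OF x(1) \<iota>_int a] x(2) by metis
    then show "y \<in> (\<lambda>X. res (\<iota> (SOME a. cl a = X))) ` range cl" by blast
  qed
  ultimately show "finite (UNIV :: 'f set)" using finite_surj by blast
qed (use res odd \<pi> cond in auto)

theorem corollary5p5:
  fixes p :: "'o::{idom, ring_char_0} set"
    and \<iota> :: "'o \<Rightarrow> 'k::field_char_0"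
    and v :: "'k \<Rightarrow> int"
    and res :: "'k \<Rightarrow> 'f::field"
    and \<pi> :: 'k
    and \<psi> :: "'k \<Rightarrow> complex"
    and c\<^sub>\<psi> :: int
    and f :: "'k fls"
    and ord\<^sub>P :: "'k poly \<Rightarrow> int"
    and c\<^sub>P :: "'k poly \<Rightarrow> nat \<Rightarrow> 'k poly"
    and c\<^sub>p :: "int \<Rightarrow> 'k"
  assumes "dedekind_domain TYPE('o)"
    and "\<And>q :: 'o set. is_prime_ideal q \<Longrightarrow> q \<noteq> {0} \<Longrightarrow> finite (residue_classes q)"
    and "is_prime_ideal p" and "p \<noteq> {0}"
    and "is_completion_at p \<iota> v"
    and "is_residue_map v res" and "odd CHAR('f)"
    and "\<pi> \<noteq> 0" and "v \<pi> = 1"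
    and "additive_character v \<psi>" and "\<exists>x. \<psi> x \<noteq> 1" and "has_conductor v \<psi> c\<^sub>\<psi>"
    and "f \<in> frac_integral_fps v" and "f \<noteq> 0"
    and "\<And>P. irreducible_distinguished v P \<Longrightarrow> has_expansion_at v P f (ord\<^sub>P P) (c\<^sub>P P)"
    and "image_in_double_series v f c\<^sub>p"
  shows "finite {P. irreducible_distinguished v P \<and> gamma_P v \<psi> P (ord\<^sub>P P) (c\<^sub>P P 0) \<noteq> 1} \<and>
    gamma_p v res \<pi> \<psi> c\<^sub>\<psi> c\<^sub>p *
      (\<Prod>P | irreducible_distinguished v P \<and> gamma_P v \<psi> P (ord\<^sub>P P) (c\<^sub>P P 0) \<noteq> 1.
         gamma_P v \<psi> P (ord\<^sub>P P) (c\<^sub>P P 0)) = 1"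
proof -
  interpret local_field v res \<pi> \<psi> c\<^sub>\<psi>
    by (rule completion_local_field[OF assms(2)[OF assms(3,4)] assms(3,5,6,7,8,9,10,12)])
  show ?thesis by (rule product_formula[OF assms(13,14,15,16)])
qed

end
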